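(* Let $\sharp\in\{cy,ra\}$ and assume (ER$\sharp$) and (NE). 1) The maps $\boldsymbol\zeta\mapsto\rho^\sharp_{+,\boldsymbol\zeta}$, $\boldsymbol\zeta\mapsto\Phi_{j,\boldsymbol\zeta}$ and $\boldsymbol\zeta\mapsto\Phi^{cy}_{j,\boldsymbol\zeta}$ are infinitely differentiable on $\mathbb R^M$; define the kinetic coefficients $L^\sharp_{jk}:=\partial_{\zeta_k}\,\mathrm{Tr}\big(\rho^\sharp_{+,\boldsymbol\zeta}\,\Phi^\sharp_{j,\boldsymbol\zeta}\big)\big|_{\boldsymbol\zeta=0}$, where $\Phi^{ra}_j:=\Phi_j$. 2) With all quantities on the right-hand sides evaluated at $\boldsymbol\zeta=0$ and $\rho_+:=\rho_{+,0}$, $$L^{cy}_{jk}=T\sum_{n=0}^{\infty}\rho_+\Big(\mathcal L_{k+1}^*\circ\cdots\circ\mathcal L_M^*\circ(\mathcal L_{cy}^* )^{n}\circ\mathcal L_1^*\circ\cdots\circ\mathcal L_{j-1}^*(\Phi_j)\,\Phi_{k,\mathrm{rev}}\Big)+\delta_{j>k}\,T\,\rho_+\Big(\mathcal L_{k+1}^*\circ\cdots\circ\mathcal L_{j-1}^*(\Phi_j)\,\Phi_{k,\mathrm{rev}}\Big)+\tfrac12\delta_{jk}\,\rho_+\big(\mathcal D_j(H'_{\mathcal S},H'_{\mathcal S})\big),$$ $$L^{ra}_{jk}=\frac TM\sum_{n=0}^{\infty}\rho_+\big((\mathcal L_{ra}^* )^{n}(\Phi_j)\,\Phi_{k,\mathrm{rev}}\big)+\tfrac12\delta_{jk}\,\rho_+\big(\mathcal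 D_j(H'_{\mathcal S},H'_{\mathcal S})\big),$$ where $\rho_+(X):=\mathrm{Tr}(\rho_+X)$ (the case $\sharp=cy$ under (ER cy), the case $\sharp=ra$ under (ER ra)). 3) If moreover (TRI) holds, then $L^{cy}_{jk}=L^{rcy}_{kj}$ and $L^{ra}_{jk}=L^{ra}_{kj}$ for all $j,k$. In the specific case $M=2$ one has $L^{cy}_{jk}=L^{cy}_{kj}$.
   Context: Setting: $\mathcal H_{\mathcal S}$ and $\mathcal H_{\mathcal E_j}$, $j=1,\dots,M$ ($M\ge2$), are finite-dimensional Hilbert spaces with self-adjoint Hamiltonians $H_{\mathcal S}$, $H_{\mathcal E_j}$; $V_j$ is a self-adjoint operator on $\mathcal H_{\mathcal S}\otimes\mathcal H_{\mathcal E_j}$, $\tau_j>0$, $T=\tau_1+\dots+\tau_M$, $H_j=H_{\mathcal S}\otimes\mathrm{Id}+\mathrm{Id}\otimes H_{\mathcal E_j}+V_j$, $U_j=e^{-i\tau_jH_j}$. Fix $\beta_{\rm ref}>0$. For thermal forces $\boldsymbol\zeta\in\mathbb R^M$ set $\beta_j=\beta_{\rm ref}-\zeta_j$ and $\rho_{\mathcal E_j}=e^{-\beta_jH_{\mathcal E_j}}/\mathrm{Tr}(e^{-\beta_jH_{\mathcal E_j}})$. Reduced dynamics on operators of $\mathcal H_{\mathcal S}$: $\mathcal L_j(\rho)=\mathrm{Tr}_{\mathcal H_{\mathcal E_j}}(U_j(\rho\otimes\rho_{\mathcal E_j})U_j^* )$, dual $\mathcal L_j^*(X)=\mathrm{Tr}_{\mathcal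 H_{\mathcal E_j}}((\mathrm{Id}\otimes\rho_{\mathcal E_j})U_j^*(X\otimes\mathrm{Id})U_j)$; $\mathcal L_{cy}=\mathcal L_M\circ\cdots\circ\mathcal L_1$, $\mathcal L_{ra}=\frac1M\sum_j\mathcal L_j$; the reversed-order cyclic map is $\mathcal L_{rcy}=\mathcal L_1\circ\cdots\circ\mathcal L_M$. Dependence on $\boldsymbol\zeta$ is indicated by a subscript ($\mathcal L_j$ depends only on $\zeta_j$); a scalar subscript $\zeta$ means all $\zeta_j=\zeta$. A completely positive map with Kraus form $\sum_iV_i\cdot V_i^*$ is primitive if for some $n$ the products $V_{i_1}\cdots V_{i_n}$ span all operators on the space. (ER$\sharp$): there exists $\boldsymbol\zeta$ such that $\mathcal L_{\sharp,\boldsymbol\zeta}$ is primitive; then $\rho^\sharp_{+,\boldsymbol\zeta}$ denotes the unique invariant state of $\mathcal L_{\sharp,\boldsymbol\zeta}$ (and $\rho^{rcy}_{+,\boldsymbol\zeta}$ that of $\mathcal L_{rcy,\boldsymbol\zeta}$). (NE): there is a map $\zeta\mapsto\rho_{+,\zeta}$ into states on $\mathcal H_{\mathcal S}$ such that for every $j$ and $\zeta\in\mathbb R$, $U_j(\rho_{+,\zeta}\otimes\rho_{\mathcal E_j,\zeta})U_j^*=\rho_{+,\zeta}\otimes\rho_{\mathcal E_j,\zeta}$, where $\rho_{\mathcal E_j,\zeta}$ is the Gibbs state of $H_{\mathcal E_j}$ at inverse temperature $\beta_{\rm ref}-\zeta$. Effective Hamiltonian: $H'_{\mathcal S}=-\beta_{\rm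 ref}^{-1}\log\rho_{+,0}$. (TRI): there exist antiunitary involutions $\theta$ on $\mathcal H_{\mathcal S}$ and $\theta_{\mathcal E_j}$ on $\mathcal H_{\mathcal E_j}$ with $\theta H_{\mathcal S}=H_{\mathcal S}\theta$, $\theta_{\mathcal E_j}H_{\mathcal E_j}=H_{\mathcal E_j}\theta_{\mathcal E_j}$, $(\theta\otimes\theta_{\mathcal E_j})V_j=V_j(\theta\otimes\theta_{\mathcal E_j})$. Fluxes: $\Phi_j=-\frac1T\mathrm{Tr}_{\mathcal H_{\mathcal E_j}}\big((\mathrm{Id}\otimes\rho_{\mathcal E_j})(U_j^*(\mathrm{Id}\otimes H_{\mathcal E_j})U_j-\mathrm{Id}\otimes H_{\mathcal E_j})\big)$, $\Phi_{j,\mathrm{rev}}=\frac1T\mathrm{Tr}_{\mathcal H_{\mathcal E_j}}\big((\mathrm{Id}\otimes\rho_{\mathcal E_j})(U_j(\mathrm{Id}\otimes H_{\mathcal E_j})U_j^*-\mathrm{Id}\otimes H_{\mathcal E_j})\big)$, $\Phi^{cy}_j=\mathcal L_1^*\circ\cdots\circ\mathcal L_{j-1}^*(\Phi_j)$, and for the reversed-order cycle $\Phi^{rcy}_j=\mathcal L_M^*\circ\cdots\circ\mathcal L_{j+1}^*(\Phi_j)$, with $L^{rcy}_{jk}=\partial_{\zeta_k}\mathrm{Tr}(\rho^{rcy}_{+,\boldsymbol\zeta}\Phi^{rcy}_{j,\boldsymbol\zeta})|_{\boldsymbol\zeta=0}$. Dissipation function: $\mathcal D_j(X,Y)=\frac1T\big(\mathcal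 L_j^*(X^*Y)-\mathcal L_j^*(X^* )Y-X^*\mathcal L_j^*(Y)+X^*Y\big)$. $\delta_{j>k}$ is $1$ if $j>k$ and $0$ otherwise. *)

theory Defs
  imports "Jordan_Normal_Form.Matrix" "HOL-Analysis.Analysis"
begin

definition mtrace :: "complex mat \<Rightarrow> complex" where
  "mtrace A = (\<Sum>i<dim_row A. A $$ (i,i))"

definition adj :: "complex mat \<Rightarrow> complex mat" where
  "adj A = Matrix.mat (dim_col A) (dim_row A) (\<lambda>(i,j). cnj (A $$ (j,i)))"

definition cconj :: "complex mat \<Rightarrow> complex mat" where
  "cconj A = map_mat cnj A"

definition herm :: "nat \<Rightarrow> complex mat \<Rightarrow> bool" where
  "herm d A \<longleftrightarrow> A \<in> carrier_mat d d \<and> adj A = A"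

definition unitary :: "nat \<Rightarrow> complex mat \<Rightarrow> bool" where
  "unitary d U \<longleftrightarrow> U \<in> carrier_mat d d \<and> adj U * U = 1\<^sub>m d \<and> U * adj U = 1\<^sub>m d"

definition psd :: "nat \<Rightarrow> complex mat \<Rightarrow> bool" where
  "psd d A \<longleftrightarrow> herm d A \<and>
     (\<forall>v \<in> carrier_vec d. 0 \<le> Re (\<Sum>i<d. cnj (vec_index v i) * vec_index (A *\<^sub>v v) i))"

definition state :: "nat \<Rightarrow> complex mat \<Rightarrow> bool" where
  "state d \<rho> \<longleftrightarrow> psd d \<rho> \<and> mtrace \<rho> = 1"

definition mexp :: "complex mat \<Rightarrow> complex mat" where
  "mexp A = Matrix.mat (dim_row A) (dim_col A)
      (\<lambda>(i,j). \<Sum>k. (A ^\<^sub>m k) $$ (i,j) / of_nat (fact k))"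

definition mlog :: "nat \<Rightarrow> complex mat \<Rightarrow> complex mat" where
  "mlog d A = (THE X. herm d X \<and> mexp X = A)"

text \<open>Kronecker (tensor) product; basis of C^a (x) C^b indexed by i*b + k\<close>
definition kron :: "complex mat \<Rightarrow> complex mat \<Rightarrow> complex mat" where
  "kron A B = Matrix.mat (dim_row A * dim_row B) (dim_col A * dim_col B)
     (\<lambda>(i,j). A $$ (i div dim_row B, j div dim_col B) * B $$ (i mod dim_row B, j mod dim_col B))"

definition ptr2 :: "nat \<Rightarrow> nat \<Rightarrow> complex mat \<Rightarrow> complex mat" where
  "ptr2 d e X = Matrix.mat d d (\<lambda>(i,j). \<Sum>k<e. X $$ (i*e + k, j*e + k))"

definition gibbs :: "real \<Rightarrow> complex mat \<Rightarrow> complex mat" where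
  "gibbs \<beta> H = (1 / mtrace (mexp (complex_of_real (-\<beta>) \<cdot>\<^sub>m H))) \<cdot>\<^sub>m
                 mexp (complex_of_real (-\<beta>) \<cdot>\<^sub>m H)"

definition msum :: "nat \<Rightarrow> ('a \<Rightarrow> complex mat) \<Rightarrow> 'a list \<Rightarrow> complex mat" where
  "msum d f xs = fold (\<lambda>x acc. acc + f x) xs (0\<^sub>m d d)"

definition primitive :: "nat \<Rightarrow> (complex mat \<Rightarrow> complex mat) \<Rightarrow> bool" where
  "primitive d L \<longleftrightarrow> (\<exists>Ks :: complex mat list.
      (\<forall>K \<in> set Ks. K \<in> carrier_mat d d) \<and>
      (\<forall>\<rho> \<in> carrier_mat d d. L \<rho> = msum d (\<lambda>K. K * \<rho> * adj K) Ks) \<and>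
      (\<exists>n \<ge> 1. \<forall>X \<in> carrier_mat d d. \<exists>c :: nat list \<Rightarrow> complex.
          X = msum d (\<lambda>w. c w \<cdot>\<^sub>m foldr (\<lambda>i A. Ks ! i * A) w (1\<^sub>m d))
                     (List.n_lists n [0..<length Ks])))"

definition inv_state :: "nat \<Rightarrow> (complex mat \<Rightarrow> complex mat) \<Rightarrow> complex mat" where
  "inv_state d L = (THE \<rho>. state d \<rho> \<and> L \<rho> = \<rho>)"

text \<open>antiunitary involution theta on C^d, represented as theta v = Theta * conj(v)\<close>
definition antiunitary_involution :: "nat \<Rightarrow> complex mat \<Rightarrow> bool" where
  "antiunitary_involution d \<Theta> \<longleftrightarrow> unitary d \<Theta> \<and> \<Theta> * cconj \<Theta> = 1\<^sub>m d"

text \<open>theta A = A theta, for theta v = Theta * conj(v)\<close>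
definition anti_commutes :: "complex mat \<Rightarrow> complex mat \<Rightarrow> bool" where
  "anti_commutes \<Theta> A \<longleftrightarrow> \<Theta> * cconj A = A * \<Theta>"

type_synonym 'm rvec = "(real, 'm) Finite_Cartesian_Product.vec"

definition pd :: "'m::{finite,linorder} \<Rightarrow> ('m rvec \<Rightarrow> complex) \<Rightarrow> 'm rvec \<Rightarrow> complex" where
  "pd k g x = vector_derivative (\<lambda>t. g (x + t *\<^sub>R axis k 1)) (at 0)"

fun iter_pd :: "'m::{finite,linorder} list \<Rightarrow> ('m rvec \<Rightarrow> complex) \<Rightarrow> 'm rvec \<Rightarrow> complex" where
  "iter_pd [] g = g"
| "iter_pd (k # ks) g = pd k (iter_pd ks g)"

definition C_inf :: "('m::{finite,linorder} rvec \<Rightarrow> complex) \<Rightarrow> bool" where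
  "C_inf g \<longleftrightarrow> (\<forall>ks. continuous_on UNIV (iter_pd ks g) \<and>
      (\<forall>k x. (\<lambda>t. iter_pd ks g (x + t *\<^sub>R axis k 1)) differentiable (at 0)))"

definition smooth_mat :: "nat \<Rightarrow> ('m::{finite,linorder} rvec \<Rightarrow> complex mat) \<Rightarrow> bool" where
  "smooth_mat d F \<longleftrightarrow> (\<forall>a<d. \<forall>b<d. C_inf (\<lambda>\<zeta>. F \<zeta> $$ (a,b)))"

text \<open>Environments indexed by a finite linearly ordered type 'm (order = 1 < ... < M).\<close>

record 'm qsys =
  dS :: nat
  dE :: "'m \<Rightarrow> nat"
  HS :: "complex mat"
  HE :: "'m \<Rightarrow> complex mat"
  Vint :: "'m \<Rightarrow> complex mat"
  tau :: "'m \<Rightarrow> real"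
  bref :: real

definition wf_sys :: "('m::{finite,linorder}) qsys \<Rightarrow> bool" where
  "wf_sys S \<longleftrightarrow> CARD('m) \<ge> 2 \<and> dS S \<ge> 1 \<and> herm (dS S) (HS S) \<and> bref S > 0 \<and>
     (\<forall>j. dE S j \<ge> 1 \<and> herm (dE S j) (HE S j) \<and> herm (dS S * dE S j) (Vint S j) \<and> tau S j > 0)"

definition idx :: "'m::{finite,linorder} list" where
  "idx = sorted_list_of_set UNIV"

definition Ttot :: "'m::{finite,linorder} qsys \<Rightarrow> real" where
  "Ttot S = (\<Sum>j\<in>UNIV. tau S j)"

definition Hj :: "'m::{finite,linorder} qsys \<Rightarrow> 'm \<Rightarrow> complex mat" where
  "Hj S j = kron (HS S) (1\<^sub>m (dE S j)) + kron (1\<^sub>m (dS S)) (HE S j) + Vint S j"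

definition Uj :: "'m::{finite,linorder} qsys \<Rightarrow> 'm \<Rightarrow> complex mat" where
  "Uj S j = mexp ((- \<i> * complex_of_real (tau S j)) \<cdot>\<^sub>m Hj S j)"

text \<open>Gibbs state of environment j at thermal force z, i.e. inverse temperature bref - z\<close>
definition rhoE :: "'m::{finite,linorder} qsys \<Rightarrow> 'm \<Rightarrow> real \<Rightarrow> complex mat" where
  "rhoE S j z = gibbs (bref S - z) (HE S j)"

definition Lch :: "'m::{finite,linorder} qsys \<Rightarrow> 'm \<Rightarrow> real \<Rightarrow> complex mat \<Rightarrow> complex mat" where
  "Lch S j z \<rho> = ptr2 (dS S) (dE S j) (Uj S j * kron \<rho> (rhoE S j z) * adj (Uj S j))"

definition Ldual :: "'m::{finite,linorder} qsys \<Rightarrow> 'm \<Rightarrow> real \<Rightarrow> complex mat \<Rightarrow> complex mat" where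
  "Ldual S j z X = ptr2 (dS S) (dE S j)
      (kron (1\<^sub>m (dS S)) (rhoE S j z) * adj (Uj S j) * kron X (1\<^sub>m (dE S j)) * Uj S j)"

definition Lcy :: "'m::{finite,linorder} qsys \<Rightarrow> 'm rvec \<Rightarrow> complex mat \<Rightarrow> complex mat" where
  "Lcy S \<zeta> \<rho> = fold (\<lambda>j. Lch S j (vec_nth \<zeta> j)) idx \<rho>"

definition Lrcy :: "'m::{finite,linorder} qsys \<Rightarrow> 'm rvec \<Rightarrow> complex mat \<Rightarrow> complex mat" where
  "Lrcy S \<zeta> \<rho> = fold (\<lambda>j. Lch S j (vec_nth \<zeta> j)) (rev idx) \<rho>"

definition Lra :: "'m::{finite,linorder} qsys \<Rightarrow> 'm rvec \<Rightarrow> complex mat \<Rightarrow> complex mat" where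
  "Lra S \<zeta> \<rho> = complex_of_real (1 / real CARD('m)) \<cdot>\<^sub>m
      msum (dS S) (\<lambda>j. Lch S j (vec_nth \<zeta> j) \<rho>) idx"

definition Lcy_dual :: "'m::{finite,linorder} qsys \<Rightarrow> 'm rvec \<Rightarrow> complex mat \<Rightarrow> complex mat" where
  "Lcy_dual S \<zeta> X = foldr (\<lambda>j. Ldual S j (vec_nth \<zeta> j)) idx X"

definition Lra_dual :: "'m::{finite,linorder} qsys \<Rightarrow> 'm rvec \<Rightarrow> complex mat \<Rightarrow> complex mat" where
  "Lra_dual S \<zeta> X = complex_of_real (1 / real CARD('m)) \<cdot>\<^sub>m
      msum (dS S) (\<lambda>j. Ldual S j (vec_nth \<zeta> j) X) idx"

datatype scheme = Cy | Ra

definition Lsh :: "scheme \<Rightarrow> 'm::{finite,linorder} qsys \<Rightarrow> 'm rvec \<Rightarrow> complex mat \<Rightarrow> complex mat" where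
  "Lsh sh = (case sh of Cy \<Rightarrow> Lcy | Ra \<Rightarrow> Lra)"

definition Phi :: "'m::{finite,linorder} qsys \<Rightarrow> 'm \<Rightarrow> real \<Rightarrow> complex mat" where
  "Phi S j z = complex_of_real (- 1 / Ttot S) \<cdot>\<^sub>m ptr2 (dS S) (dE S j)
     (kron (1\<^sub>m (dS S)) (rhoE S j z) *
       (adj (Uj S j) * kron (1\<^sub>m (dS S)) (HE S j) * Uj S j - kron (1\<^sub>m (dS S)) (HE S j)))"

definition Phirev :: "'m::{finite,linorder} qsys \<Rightarrow> 'm \<Rightarrow> real \<Rightarrow> complex mat" where
  "Phirev S j z = complex_of_real (1 / Ttot S) \<cdot>\<^sub>m ptr2 (dS S) (dE S j)
     (kron (1\<^sub>m (dS S)) (rhoE S j z) *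
       (Uj S j * kron (1\<^sub>m (dS S)) (HE S j) * adj (Uj S j) - kron (1\<^sub>m (dS S)) (HE S j)))"

definition Phicy :: "'m::{finite,linorder} qsys \<Rightarrow> 'm rvec \<Rightarrow> 'm \<Rightarrow> complex mat" where
  "Phicy S \<zeta> j = foldr (\<lambda>i. Ldual S i (vec_nth \<zeta> i)) (filter (\<lambda>i. i < j) idx)
                        (Phi S j (vec_nth \<zeta> j))"

definition Phircy :: "'m::{finite,linorder} qsys \<Rightarrow> 'm rvec \<Rightarrow> 'm \<Rightarrow> complex mat" where
  "Phircy S \<zeta> j = foldr (\<lambda>i. Ldual S i (vec_nth \<zeta> i)) (rev (filter (\<lambda>i. j < i) idx))
                        (Phi S j (vec_nth \<zeta> j))"

definition Phish :: "scheme \<Rightarrow> 'm::{finite,linorder} qsys \<Rightarrow> 'm rvec \<Rightarrow> 'm \<Rightarrow> complex mat" where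
  "Phish sh S \<zeta> j = (case sh of Cy \<Rightarrow> Phicy S \<zeta> j | Ra \<Rightarrow> Phi S j (vec_nth \<zeta> j))"

definition rho_sh :: "scheme \<Rightarrow> 'm::{finite,linorder} qsys \<Rightarrow> 'm rvec \<Rightarrow> complex mat" where
  "rho_sh sh S \<zeta> = inv_state (dS S) (Lsh sh S \<zeta>)"

definition rho_rcy :: "'m::{finite,linorder} qsys \<Rightarrow> 'm rvec \<Rightarrow> complex mat" where
  "rho_rcy S \<zeta> = inv_state (dS S) (Lrcy S \<zeta>)"

definition Lkin :: "scheme \<Rightarrow> 'm::{finite,linorder} qsys \<Rightarrow> 'm \<Rightarrow> 'm \<Rightarrow> complex" where
  "Lkin sh S j k = pd k (\<lambda>\<zeta>. mtrace (rho_sh sh S \<zeta> * Phish sh S \<zeta> j)) 0"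

definition Lkin_rcy :: "'m::{finite,linorder} qsys \<Rightarrow> 'm \<Rightarrow> 'm \<Rightarrow> complex" where
  "Lkin_rcy S j k = pd k (\<lambda>\<zeta>. mtrace (rho_rcy S \<zeta> * Phircy S \<zeta> j)) 0"

definition Dissip :: "'m::{finite,linorder} qsys \<Rightarrow> 'm \<Rightarrow> real \<Rightarrow> complex mat \<Rightarrow> complex mat \<Rightarrow> complex mat" where
  "Dissip S j z X Y = complex_of_real (1 / Ttot S) \<cdot>\<^sub>m
     (Ldual S j z (adj X * Y) - Ldual S j z (adj X) * Y - adj X * Ldual S j z Y + adj X * Y)"

definition ER :: "scheme \<Rightarrow> 'm::{finite,linorder} qsys \<Rightarrow> bool" where
  "ER sh S \<longleftrightarrow> (\<exists>\<zeta>. primitive (dS S) (Lsh sh S \<zeta>))"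

text \<open>(NE) witnessed by the map rp : zeta |-> rho_{+,zeta}\<close>
definition NE_map :: "'m::{finite,linorder} qsys \<Rightarrow> (real \<Rightarrow> complex mat) \<Rightarrow> bool" where
  "NE_map S rp \<longleftrightarrow> (\<forall>z. state (dS S) (rp z)) \<and>
     (\<forall>j z. Uj S j * kron (rp z) (rhoE S j z) * adj (Uj S j) = kron (rp z) (rhoE S j z))"

definition TRI :: "'m::{finite,linorder} qsys \<Rightarrow> bool" where
  "TRI S \<longleftrightarrow> (\<exists>\<Theta> \<Theta>E. antiunitary_involution (dS S) \<Theta> \<and> anti_commutes \<Theta> (HS S) \<and>
     (\<forall>j. antiunitary_involution (dE S j) (\<Theta>E j) \<and> anti_commutes (\<Theta>E j) (HE S j) \<and>
          anti_commutes (kron \<Theta> (\<Theta>E j)) (Vint S j)))"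

end

(* Positivity: Gibbs states at different temperatures are comparable, so a power of the reduced
   dynamics that improves positivity for one value of the thermal forces does so for all of them.
   Doeblin's contraction then makes X - L(X) + tr(X)/d invertible; Cramer's rule gives the
   invariant state as a rational expression in exponentials of the thermal forces, and the inverse
   on traceless matrices is the sum of the powers of L.

   Response: in equilibrium every U_j commutes with rho (x) rho_Ej, so differentiating L_k with
   respect to its temperature at rho produces T Phirev_k rho. This accounts for the series and for
   the delta_{j>k} term; the diagonal term is the static derivative of Phi_j, rewritten with the
   conservation of H' (x) 1 + 1 (x) H_Ej that follows by taking the logarithm of rho (x) rho_Ej.

   Reciprocity: time reversal exchanges U_j with its adjoint, hence Phi_j with -Phirev_j, and
   reverses words in the L_j^* under the trace with rho, so the formulas match term by term. For
   M = 2 rows and columns of the kinetic matrix sum to zero, which already forces symmetry. *)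
theory Submission
  imports Defs "Jordan_Normal_Form.Spectral_Radius"
begin

text \<open>Primitivity is assumed at one value of the thermal forces and for one order of the
  steps, whereas the statement speaks of invariant states at all values and of the reversed cycle.
  This is why primitivity is replaced at once by the lower bound L^n(A) \<ge> eps tr(A) 1, which
  mentions no Kraus operators and survives both a change of temperature and time reversal. For the
  reversed cycle the bridge is infinite temperature, reached when every thermal force equals
  \<open>bref S\<close>: there the environment states are multiples of the identity, and the dual of
  a step is the time reversal of that step. The same bound supplies two facts that (NE) and (TRI) do
  not state: rho_+ is faithful, so that its logarithm exists, and it is the only invariant state at
  equilibrium, so that time reversal fixes it. Smoothness means that all iterated partial
  derivatives exist and are continuous. It is therefore proved for a class of functions that is
  closed under differentiation, and the explicit inverse by Cramer's rule is what places the
  invariant state in that class.\<close>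

section \<open>Matrices entrywise\<close>

lemma mult_index:
  assumes "A \<in> carrier_mat n m" "B \<in> carrier_mat m p" "i < n" "j < p"
  shows "(A * B) $$ (i,j) = (\<Sum>k<m. A $$ (i,k) * B $$ (k,j))"
  using assms by (auto simp: scalar_prod_def atLeast0LessThan)

lemma mult_carrier_sq [simp]:
  "A \<in> carrier_mat n n \<Longrightarrow> B \<in> carrier_mat n n \<Longrightarrow> A * B \<in> carrier_mat n n"
  by (rule mult_carrier_mat)

lemma mult_one_sq [simp]:
  fixes A :: "complex mat"
  shows "A \<in> carrier_mat n n \<Longrightarrow> A * 1\<^sub>m n = A"
  by (rule right_mult_one_mat)

lemma adj_carrier [simp]: "A \<in> carrier_mat n m \<Longrightarrow> adj A \<in> carrier_mat m n"
  by (auto simp: adj_def)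

lemma adj_index: "A \<in> carrier_mat n m \<Longrightarrow> i < m \<Longrightarrow> j < n \<Longrightarrow> adj A $$ (i,j) = cnj (A $$ (j,i))"
  by (auto simp: adj_def)

lemma cconj_carrier [simp]: "A \<in> carrier_mat n m \<Longrightarrow> cconj A \<in> carrier_mat n m"
  by (auto simp: cconj_def)

lemma cconj_index: "A \<in> carrier_mat n m \<Longrightarrow> i < n \<Longrightarrow> j < m \<Longrightarrow> cconj A $$ (i,j) = cnj (A $$ (i,j))"
  by (auto simp: cconj_def)

lemma matI:
  assumes "A \<in> carrier_mat n m" "B \<in> carrier_mat n m"
    "\<And>i j. i < n \<Longrightarrow> j < m \<Longrightarrow> A $$ (i,j) = B $$ (i,j)"
  shows "A = B"
  using assms by (intro eq_matI) auto

lemma mat_op_index: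
  assumes "A \<in> carrier_mat n m" "B \<in> carrier_mat n m" "i < n" "j < m"
  shows "(A + B) $$ (i,j) = A $$ (i,j) + B $$ (i,j)" "(A - B) $$ (i,j) = A $$ (i,j) - B $$ (i,j)"
  using assms by auto

lemma smult_index: "A \<in> carrier_mat n m \<Longrightarrow> i < n \<Longrightarrow> j < m \<Longrightarrow> (c \<cdot>\<^sub>m A) $$ (i,j) = c * A $$ (i,j)"
  by auto

lemma minus_carrier [simp]:
  fixes A :: "complex mat"
  shows "A \<in> carrier_mat n m \<Longrightarrow> B \<in> carrier_mat n m \<Longrightarrow> A - B \<in> carrier_mat n m"
  by auto

lemma adj_adj [simp]: "A \<in> carrier_mat n m \<Longrightarrow> adj (adj A) = A"
  by (rule matI[of _ n m]) (auto simp: adj_def)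

lemma adj_mult: "A \<in> carrier_mat n m \<Longrightarrow> B \<in> carrier_mat m p \<Longrightarrow> adj (A * B) = adj B * adj A"
  by (rule matI[of _ p n]) (auto simp: adj_def scalar_prod_def cnj_sum mult.commute)

lemma adj_add: "A \<in> carrier_mat n m \<Longrightarrow> B \<in> carrier_mat n m \<Longrightarrow> adj (A + B) = adj A + adj B"
  by (rule matI[of _ m n]) (auto simp: adj_def)

lemma adj_minus: "A \<in> carrier_mat n m \<Longrightarrow> B \<in> carrier_mat n m \<Longrightarrow> adj (A - B) = adj A - adj B"
  by (rule matI[of _ m n]) (auto simp: adj_def)

lemma adj_smult: "A \<in> carrier_mat n m \<Longrightarrow> adj (c \<cdot>\<^sub>m A) = cnj c \<cdot>\<^sub>m adj A"
  by (rule matI[of _ m n]) (auto simp: adj_def)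

lemma adj_one [simp]: "adj (1\<^sub>m n) = 1\<^sub>m n"
  by (rule matI[of _ n n]) (auto simp: adj_def)

lemma adj_zero [simp]: "adj (0\<^sub>m n m) = 0\<^sub>m m n"
  by (rule matI[of _ m n]) (auto simp: adj_def)

lemma cconj_mult: "A \<in> carrier_mat n m \<Longrightarrow> B \<in> carrier_mat m p \<Longrightarrow> cconj (A * B) = cconj A * cconj B"
  by (rule matI[of _ n p]) (auto simp: cconj_def scalar_prod_def cnj_sum)

lemma cconj_add: "A \<in> carrier_mat n m \<Longrightarrow> B \<in> carrier_mat n m \<Longrightarrow> cconj (A + B) = cconj A + cconj B"
  by (rule matI[of _ n m]) (auto simp: cconj_def)

lemma cconj_minus: "A \<in> carrier_mat n m \<Longrightarrow> B \<in> carrier_mat n m \<Longrightarrow> cconj (A - B) = cconj A - cconj B"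
  by (rule matI[of _ n m]) (auto simp: cconj_def)

lemma cconj_smult: "A \<in> carrier_mat n m \<Longrightarrow> cconj (c \<cdot>\<^sub>m A) = cnj c \<cdot>\<^sub>m cconj A"
  by (rule matI[of _ n m]) (auto simp: cconj_def)

lemma cconj_one [simp]: "cconj (1\<^sub>m n) = 1\<^sub>m n"
  by (rule matI[of _ n n]) (auto simp: cconj_def)

lemma cconj_cconj [simp]: "A \<in> carrier_mat n m \<Longrightarrow> cconj (cconj A) = A"
  by (rule matI[of _ n m]) (auto simp: cconj_def)

lemma cconj_adj: "A \<in> carrier_mat n m \<Longrightarrow> cconj (adj A) = adj (cconj A)"
  by (rule matI[of _ m n]) (auto simp: cconj_def adj_def)

text \<open>The library rule turns an entry of a product into a scalar product of a row and a
  column; from here on entries of products are expanded by \<open>mult_index\<close> into plain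
  sums.\<close>

declare index_mult_mat(1) [simp del]

lemma mtrace_eq: "A \<in> carrier_mat n n \<Longrightarrow> mtrace A = (\<Sum>i<n. A $$ (i,i))"
  by (auto simp: mtrace_def)

lemma mtrace_add: "A \<in> carrier_mat n n \<Longrightarrow> B \<in> carrier_mat n n \<Longrightarrow> mtrace (A + B) = mtrace A + mtrace B"
  by (subst (1 2 3) mtrace_eq[of _ n]) (auto simp: sum.distrib)

lemma mtrace_minus: "A \<in> carrier_mat n n \<Longrightarrow> B \<in> carrier_mat n n \<Longrightarrow> mtrace (A - B) = mtrace A - mtrace B"
  by (subst (1 2 3) mtrace_eq[of _ n]) (auto simp: sum_subtractf)

lemma mtrace_smult: "A \<in> carrier_mat n n \<Longrightarrow> mtrace (c \<cdot>\<^sub>m A) = c * mtrace A"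
  by (subst (1 2) mtrace_eq[of _ n]) (auto simp: sum_distrib_left)

lemma mtrace_one: "mtrace (1\<^sub>m n) = of_nat n"
  by (auto simp: mtrace_def)

lemma mtrace_adj: "A \<in> carrier_mat n n \<Longrightarrow> mtrace (adj A) = cnj (mtrace A)"
  by (subst (1 2) mtrace_eq[of _ n]) (auto simp: adj_index cnj_sum)

lemma mtrace_cconj: "A \<in> carrier_mat n n \<Longrightarrow> mtrace (cconj A) = cnj (mtrace A)"
  by (subst (1 2) mtrace_eq[of _ n]) (auto simp: cconj_index cnj_sum)

lemma mtrace_mult:
  assumes "A \<in> carrier_mat n m" "B \<in> carrier_mat m n"
  shows "mtrace (A * B) = (\<Sum>i<n. \<Sum>k<m. A $$ (i,k) * B $$ (k,i))"
proof -
  have "mtrace (A * B) = (\<Sum>i<n. (A * B) $$ (i,i))" using assms by (intro mtrace_eq) auto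
  also have "\<dots> = (\<Sum>i<n. \<Sum>k<m. A $$ (i,k) * B $$ (k,i))"
    using assms by (intro sum.cong refl mult_index) auto
  finally show ?thesis .
qed

lemma mtrace_comm:
  assumes "A \<in> carrier_mat n m" "B \<in> carrier_mat m n"
  shows "mtrace (A * B) = mtrace (B * A)"
  unfolding mtrace_mult[OF assms] mtrace_mult[OF assms(2,1)]
  by (subst sum.swap) (simp add: mult.commute)

lemma mtrace_cyc:
  assumes "A \<in> carrier_mat n n" "B \<in> carrier_mat n n" "C \<in> carrier_mat n n"
  shows "mtrace (A * B * C) = mtrace (B * C * A)"
  using assms mtrace_comm[of A n n "B * C"] by (simp add: assoc_mult_mat[of _ n n _ n _ n])

section \<open>Hermitian and unitary matrices\<close>

lemma hermD: "herm n A \<Longrightarrow> A \<in> carrier_mat n n" "herm n A \<Longrightarrow> adj A = A"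
  by (auto simp: herm_def)

lemma herm_index: "herm n A \<Longrightarrow> i < n \<Longrightarrow> j < n \<Longrightarrow> cnj (A $$ (j,i)) = A $$ (i,j)"
  using hermD[of n A] adj_index[of A n n i j] by simp

lemma unitaryD:
  "unitary n U \<Longrightarrow> U \<in> carrier_mat n n" "unitary n U \<Longrightarrow> adj U * U = 1\<^sub>m n"
  "unitary n U \<Longrightarrow> U * adj U = 1\<^sub>m n"
  by (auto simp: unitary_def)

text \<open>For square matrices a left inverse is also a right inverse, so one of the two equations
  is enough.\<close>

lemma unitaryI: "U \<in> carrier_mat n n \<Longrightarrow> adj U * U = 1\<^sub>m n \<Longrightarrow> unitary n U"
  unfolding unitary_def using mat_mult_left_right_inverse[of "adj U" n U] by auto

lemma unitary_mult:
  assumes "unitary n U" "unitary n V" shows "unitary n (U * V)"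
proof (rule unitaryI)
  note u = unitaryD[OF assms(1)] note v = unitaryD[OF assms(2)]
  show "U * V \<in> carrier_mat n n" using u v by auto
  have "adj (U * V) * (U * V) = adj V * (adj U * U) * V"
    using u(1) v(1) by (simp add: adj_mult assoc_mult_mat[of _ n n _ n _ n])
  then show "adj (U * V) * (U * V) = 1\<^sub>m n" using u v by simp
qed

lemma unitary_adj: "unitary n U \<Longrightarrow> unitary n (adj U)"
  by (auto simp: unitary_def)

lemma unitary_cconj:
  assumes "unitary n U" shows "unitary n (cconj U)"
proof (rule unitaryI)
  note u = unitaryD[OF assms]
  show "cconj U \<in> carrier_mat n n" using u by auto
  show "adj (cconj U) * cconj U = 1\<^sub>m n" using u(1,2)
    by (metis cconj_adj cconj_mult cconj_one adj_carrier)
qed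

section \<open>The spectral theorem\<close>

text \<open>Describing the diagonal by a function makes functional calculus pointwise: matrices
  \<open>P * dg n f * adj P\<close> with a common unitary \<open>P\<close> are multiplied and
  exponentiated through \<open>f\<close>.\<close>

definition dg :: "nat \<Rightarrow> (nat \<Rightarrow> complex) \<Rightarrow> complex mat" where
  "dg n f = Matrix.mat n n (\<lambda>(i,j). if i = j then f i else 0)"

lemma dg_carrier [simp]: "dg n f \<in> carrier_mat n n"
  by (simp add: dg_def)

lemma dg_index: "i < n \<Longrightarrow> j < n \<Longrightarrow> dg n f $$ (i,j) = (if i = j then f i else 0)"
  by (simp add: dg_def)

lemma dg_one: "dg n (\<lambda>_. 1) = 1\<^sub>m n"
  by (rule matI[of _ n n]) (auto simp: dg_def)

lemma mult_dg_index:
  assumes "A \<in> carrier_mat m n" "i < m" "j < n"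
  shows "(A * dg n f) $$ (i,j) = A $$ (i,j) * f j"
proof -
  have "(A * dg n f) $$ (i,j) = (\<Sum>k<n. A $$ (i,k) * (if k = j then f k else 0))"
    using assms by (simp add: mult_index[OF assms(1) dg_carrier assms(2,3)] dg_index)
  also have "\<dots> = (\<Sum>k<n. if k = j then A $$ (i,k) * f k else 0)"
    by (intro sum.cong) auto
  finally show ?thesis using assms by (simp add: sum.delta)
qed

lemma dg_mult_index:
  assumes "A \<in> carrier_mat n m" "i < n" "j < m"
  shows "(dg n f * A) $$ (i,j) = f i * A $$ (i,j)"
proof -
  have "(dg n f * A) $$ (i,j) = (\<Sum>k<n. (if i = k then f i else 0) * A $$ (k,j))"
    using assms by (simp add: mult_index[OF dg_carrier assms(1,2,3)] dg_index)
  also have "\<dots> = (\<Sum>k<n. if i = k then f k * A $$ (k,j) else 0)"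
    by (intro sum.cong) auto
  finally show ?thesis using assms by (simp add: sum.delta')
qed

lemma dg_mult: "dg n f * dg n g = dg n (\<lambda>i. f i * g i)"
  by (rule matI[of _ n n]) (simp_all add: dg_mult_index[of _ n n] dg_index)

lemma adj_dg: "adj (dg n f) = dg n (\<lambda>i. cnj (f i))"
  by (rule matI[of _ n n]) (auto simp: dg_def adj_def)

lemma smult_dg: "c \<cdot>\<^sub>m dg n f = dg n (\<lambda>i. c * f i)"
  by (rule matI[of _ n n]) (auto simp: dg_def)

lemma sandwich_dg_index:
  assumes "P \<in> carrier_mat m n" "i < m" "j < m"
  shows "(P * dg n f * adj P) $$ (i,j) = (\<Sum>a<n. P $$ (i,a) * f a * cnj (P $$ (j,a)))"
proof -
  have "P * dg n f \<in> carrier_mat m n" using assms by (intro mult_carrier_mat) auto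
  moreover have "adj P \<in> carrier_mat n m" using assms by auto
  ultimately show ?thesis
    using assms by (simp add: mult_index[of _ m n _ m] mult_dg_index[of _ m n] adj_index[of _ m n])
qed

lemma herm_conj:
  assumes "herm n A" "P \<in> carrier_mat n n"
  shows "herm n (P * A * adj P)"
proof -
  note a = hermD[OF assms(1)]
  have "adj (P * A * adj P) = P * A * adj P"
    using a assms(2) by (simp add: adj_mult[of _ n n _ n] assoc_mult_mat[of _ n n _ n _ n])
  then show ?thesis using a assms unfolding herm_def by (auto intro!: mult_carrier_mat)
qed

text \<open>Gram-Schmidt on a basis that begins with \<open>v\<close> keeps \<open>v\<close> in
  front but yields orthogonal columns of arbitrary length. Dividing by the norms \<open>nn\<close>
  gives a unitary, and \<open>c\<close> is the inverse norm of \<open>v\<close>. This is the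
  deflation step of the spectral theorem.\<close>

lemma unitary_first_column:
  assumes v: "v \<in> carrier_vec n" "v \<noteq> 0\<^sub>v n" and n: "n > 0"
  obtains W c where "unitary n W" "\<And>i. i < n \<Longrightarrow> W $$ (i,0) = c * vec_index v i" "c \<noteq> 0"
proof -
  define b where "b = basis_completion v"
  define ws where "ws = gram_schmidt n b"
  interpret cof_vec_space n "TYPE(complex)" .
  note bc = basis_completion[OF v, folded b_def]
  obtain vs where bv: "b = v # vs" using bc(6,7) n by (cases b) auto
  have ws: "set ws \<subseteq> carrier_vec n" "corthogonal ws" "length ws = n"
    using gram_schmidt_result[OF bc(2,4,5) refl, folded ws_def] bc(6) by auto
  have hd: "ws ! 0 = v"
    using gram_schmidt_hd[OF v(1), of vs, folded bv] ws(3) n hd_conv_nth[of ws] unfolding ws_def[symmetric] by fastforce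
  have wsc: "i < n \<Longrightarrow> ws ! i \<in> carrier_vec n" for i using ws by auto
  define nn where "nn i = sqrt (\<Sum>k<n. (cmod (vec_index (ws ! i) k))^2)" for i
  have ip: "(ws ! i) \<bullet>c (ws ! j) = (\<Sum>k<n. vec_index (ws ! i) k * cnj (vec_index (ws ! j) k))"
    if "i < n" "j < n" for i j
    using wsc[OF that(2)] by (auto simp: scalar_prod_def atLeast0LessThan)
  have ii: "(\<Sum>k<n. vec_index (ws ! i) k * cnj (vec_index (ws ! i) k)) = complex_of_real ((nn i)^2)" for i
    unfolding nn_def by (simp add: sum_nonneg complex_norm_square[symmetric])
  have nz: "nn i \<noteq> 0" if "i < n" for i
  proof
    assume "nn i = 0"
    then have "(ws ! i) \<bullet>c (ws ! i) = 0" using ip[OF that that] ii[of i] by simp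
    then show False using corthogonalD[OF ws(2)] that ws(3) by auto
  qed
  define W where "W = Matrix.mat n n (\<lambda>(k,i). vec_index (ws ! i) k / complex_of_real (nn i))"
  have W: "W \<in> carrier_mat n n" by (simp add: W_def)
  have "adj W * W = 1\<^sub>m n"
  proof (rule matI[of _ n n])
    fix i j assume ij: "i < n" "j < n"
    have "(adj W * W) $$ (i,j) = (\<Sum>k<n. adj W $$ (i,k) * W $$ (k,j))"
      using W ij by (intro mult_index) auto
    also have "\<dots> = (\<Sum>k<n. vec_index (ws ! j) k * cnj (vec_index (ws ! i) k)) / (complex_of_real (nn i) * complex_of_real (nn j))"
      using ij by (simp add: adj_index[OF W]) (simp add: W_def sum_divide_distrib mult_ac)
    also have "\<dots> = (1\<^sub>m n) $$ (i,j)"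
    proof (cases "i = j")
      case True
      then show ?thesis using nz[OF ij(1)] ij unfolding True ii by (simp add: power2_eq_square)
    next
      case False
      then have "(ws ! j) \<bullet>c (ws ! i) = 0" using corthogonalD[OF ws(2)] ij ws(3) by auto
      then show ?thesis using ip ij False by simp
    qed
    finally show "(adj W * W) $$ (i,j) = (1\<^sub>m n) $$ (i,j)" .
  qed (use W in auto)
  then have "unitary n W" using W by (intro unitaryI)
  moreover have "W $$ (i,0) = (1 / complex_of_real (nn 0)) * vec_index v i" if "i < n" for i
    using that n hd by (simp add: W_def)
  moreover have "1 / complex_of_real (nn 0) \<noteq> 0" using nz[OF n] by simp
  ultimately show ?thesis by (rule that)
qed

text \<open>The block matrix with 1 in the corner and \<open>A\<close> below it; it lifts a
  diagonalisation to the next dimension.\<close>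

definition corner_ext :: "nat \<Rightarrow> complex mat \<Rightarrow> complex mat" where
  "corner_ext m A = Matrix.mat (Suc m) (Suc m) (\<lambda>(i,j). case i of 0 \<Rightarrow> (case j of 0 \<Rightarrow> 1 | Suc _ \<Rightarrow> 0)
      | Suc i' \<Rightarrow> (case j of 0 \<Rightarrow> 0 | Suc j' \<Rightarrow> A $$ (i',j')))"

text \<open>Induction on the dimension. An eigenvector is made the first column of a unitary
  \<open>W\<close>; then the first column of \<open>adj W * H * W\<close> vanishes off the corner,
  and the remaining block is a Hermitian matrix of smaller size.\<close>

lemma spectral_theorem_ex:
  "herm n H \<Longrightarrow> \<exists>P lam. unitary n P \<and> H = P * dg n (\<lambda>i. complex_of_real (lam i)) * adj P"
proof (induction n arbitrary: H)
  case 0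
  then show ?case
    by (intro exI[of _ "1\<^sub>m 0"] exI[of _ "\<lambda>_. 0"] conjI)
      (auto simp: unitary_def herm_def dg_def intro!: eq_matI)
next
  case (Suc m)
  let ?n = "Suc m"
  note H = hermD[OF Suc.prems]
  obtain e v where ev: "eigenvector H v e"
    using spectrum_non_empty[OF H(1)] by (auto simp: spectrum_def eigenvalue_def)
  have v: "v \<in> carrier_vec ?n" "v \<noteq> 0\<^sub>v ?n" "H *\<^sub>v v = e \<cdot>\<^sub>v v"
    using ev H(1) unfolding eigenvector_def by auto
  obtain W c where W: "unitary ?n W" and Wv: "\<And>i. i < ?n \<Longrightarrow> W $$ (i,0) = c * vec_index v i"
    using unitary_first_column[OF v(1,2) zero_less_Suc] by metis
  note w = unitaryD[OF W]
  define A where "A = adj W * H * W"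
  have hA: "herm ?n A" using herm_conj[OF Suc.prems adj_carrier[OF w(1)]] w unfolding A_def by simp
  note a = hermD[OF hA]
  have HW: "(H * W) $$ (i,0) = e * W $$ (i,0)" if i: "i < ?n" for i
  proof -
    have "(H * W) $$ (i,0) = (\<Sum>k<?n. H $$ (i,k) * (c * vec_index v k))"
      using mult_index[OF H(1) w(1) i, of 0] Wv by simp
    also have "\<dots> = c * (\<Sum>k<?n. H $$ (i,k) * vec_index v k)"
      by (simp add: sum_distrib_left mult_ac del: sum.lessThan_Suc)
    also have "(\<Sum>k<?n. H $$ (i,k) * vec_index v k) = vec_index (H *\<^sub>v v) i"
      using H(1) v(1) i by (auto simp: scalar_prod_def atLeast0LessThan)
    also have "\<dots> = e * vec_index v i" using v i by simp
    finally show ?thesis using Wv[OF i] by simp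
  qed
  have A0: "A $$ (i,0) = (if i = 0 then e else 0)" if i: "i < ?n" for i
  proof -
    have HWc: "H * W \<in> carrier_mat ?n ?n" using H(1) w(1) by auto
    have "A = adj W * (H * W)" unfolding A_def using H(1) w(1) by (intro assoc_mult_mat[of _ ?n ?n _ ?n _ ?n]) auto
    then have "A $$ (i,0) = (\<Sum>k<?n. adj W $$ (i,k) * (H * W) $$ (k,0))"
      using mult_index[of "adj W" ?n ?n "H * W" ?n i 0] HWc w(1) i by simp
    also have "\<dots> = (\<Sum>k<?n. adj W $$ (i,k) * (e * W $$ (k,0)))"
      by (intro sum.cong refl) (simp add: HW)
    also have "\<dots> = e * (\<Sum>k<?n. adj W $$ (i,k) * W $$ (k,0))"
      by (simp add: sum_distrib_left mult_ac del: sum.lessThan_Suc)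
    also have "(\<Sum>k<?n. adj W $$ (i,k) * W $$ (k,0)) = (adj W * W) $$ (i,0)"
      using w(1) i by (intro mult_index[symmetric]) auto
    finally show ?thesis using w(2) i by simp
  qed
  \<comment> \<open>Hermiticity carries the zeros of the first column over to the first row and
    makes the eigenvalue real.\<close>
  have A0': "A $$ (0,j) = (if j = 0 then e else 0)" "cnj e = e" if "j < ?n" for j
  proof -
    have "cnj (A $$ (0,0)) = A $$ (0,0)" by (rule herm_index[OF hA]) auto
    then show "cnj e = e" using A0[of 0] by simp
    then show "A $$ (0,j) = (if j = 0 then e else 0)"
      using herm_index[OF hA, of 0 j] A0[OF that] that by (auto split: if_splits)
  qed
  define B where "B = Matrix.mat m m (\<lambda>(i,j). A $$ (Suc i, Suc j))"
  have "herm m B" unfolding herm_def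
  proof
    show B: "B \<in> carrier_mat m m" by (simp add: B_def)
    have Bi: "B $$ (i,j) = A $$ (Suc i, Suc j)" if "i < m" "j < m" for i j using that by (simp add: B_def)
    show "adj B = B"
      by (rule matI[of _ m m]) (use B in \<open>auto simp: adj_index[OF B] Bi herm_index[OF hA]\<close>)
  qed
  from Suc.IH[OF this] obtain P lam where P: "unitary m P"
    and BP: "B = P * dg m (\<lambda>i. complex_of_real (lam i)) * adj P" by blast
  note p = unitaryD[OF P]
  define Q where "Q = corner_ext m P"
  have Q: "Q \<in> carrier_mat ?n ?n" by (simp add: Q_def corner_ext_def)
  have Qi: "Q $$ (0,0) = 1" "\<And>i. i < m \<Longrightarrow> Q $$ (Suc i,0) = 0" "\<And>i. i < m \<Longrightarrow> Q $$ (0,Suc i) = 0"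
    "\<And>i j. i < m \<Longrightarrow> j < m \<Longrightarrow> Q $$ (Suc i, Suc j) = P $$ (i,j)"
    by (auto simp: Q_def corner_ext_def)
  have PP: "(\<Sum>k<m. cnj (P $$ (k,i)) * P $$ (k,j)) = (if i = j then 1 else 0)" if "i < m" "j < m" for i j
  proof -
    have "(adj P * P) $$ (i,j) = (\<Sum>k<m. adj P $$ (i,k) * P $$ (k,j))"
      using p(1) that by (intro mult_index) auto
    then show ?thesis using p(2) that by (simp add: adj_index[OF p(1)])
  qed
  have uQ: "unitary ?n Q"
  proof (rule unitaryI[OF Q], rule matI[of _ ?n ?n])
    fix i j assume ij: "i < ?n" "j < ?n"
    have "(adj Q * Q) $$ (i,j) = (\<Sum>k<?n. adj Q $$ (i,k) * Q $$ (k,j))"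
      using Q ij by (intro mult_index) auto
    also have "\<dots> = (\<Sum>k<?n. cnj (Q $$ (k,i)) * Q $$ (k,j))"
      using ij by (simp add: adj_index[OF Q])
    also have "\<dots> = (1\<^sub>m ?n) $$ (i,j)"
      using ij by (cases i; cases j) (auto simp: sum.lessThan_Suc_shift Qi PP simp del: sum.lessThan_Suc)
    finally show "(adj Q * Q) $$ (i,j) = (1\<^sub>m ?n) $$ (i,j)" .
  qed (use Q in auto)
  define l where "l i = (case i of 0 \<Rightarrow> Re e | Suc i' \<Rightarrow> lam i')" for i
  have AQ: "A = Q * dg ?n (\<lambda>i. complex_of_real (l i)) * adj Q"
  proof (rule matI[OF a(1)])
    show "Q * dg ?n (\<lambda>i. complex_of_real (l i)) * adj Q \<in> carrier_mat ?n ?n"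
      using Q by auto
    fix i j assume ij: "i < ?n" "j < ?n"
    have e: "complex_of_real (Re e) = e" using A0'(2)[of 0] by (simp add: complex_eq_iff)
    have Bi: "A $$ (Suc i', Suc j') = (\<Sum>a<m. P $$ (i',a) * complex_of_real (lam a) * cnj (P $$ (j',a)))"
      if "i' < m" "j' < m" for i' j'
      using arg_cong[OF BP, of "\<lambda>M. M $$ (i',j')"] that by (simp add: sandwich_dg_index[OF p(1)] B_def)
    show "A $$ (i,j) = (Q * dg ?n (\<lambda>i. complex_of_real (l i)) * adj Q) $$ (i,j)"
      unfolding sandwich_dg_index[OF Q ij] using ij
      by (cases i; cases j)
        (auto simp: sum.lessThan_Suc_shift Qi A0 A0' l_def Bi e simp del: sum.lessThan_Suc)
  qed
  have "H = W * A * adj W"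
  proof -
    have "W * A * adj W = (W * adj W) * H * (W * adj W)"
      unfolding A_def using w(1) H(1) by (simp add: assoc_mult_mat[of _ ?n ?n _ ?n _ ?n] mult_carrier_mat[of _ ?n ?n _ ?n])
    then show ?thesis using w H by simp
  qed
  also have "\<dots> = (W * Q) * dg ?n (\<lambda>i. complex_of_real (l i)) * adj (W * Q)"
    unfolding AQ using w(1) Q
    by (simp add: assoc_mult_mat[of _ ?n ?n _ ?n _ ?n] mult_carrier_mat[of _ ?n ?n _ ?n] adj_mult[of _ ?n ?n _ ?n])
  finally show ?case using unitary_mult[OF W uQ] by blast
qed

lemma spectral_theorem:
  assumes "herm n H"
  obtains P lam where "unitary n P" "H = P * dg n (\<lambda>i. complex_of_real (lam i)) * adj P"
  using spectral_theorem_ex[OF assms] by blast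

section \<open>Positive semidefinite matrices\<close>

text \<open>Vectors are plain functions here, so test vectors need no carrier condition; only their
  values below \<open>d\<close> enter.\<close>

definition qf :: "nat \<Rightarrow> complex mat \<Rightarrow> (nat \<Rightarrow> complex) \<Rightarrow> complex" where
  "qf d A f = (\<Sum>i<d. \<Sum>j<d. cnj (f i) * A $$ (i,j) * f j)"

lemma psd_iff: "psd d A \<longleftrightarrow> herm d A \<and> (\<forall>f. 0 \<le> Re (qf d A f))"
proof (cases "herm d A")
  case True
  note a = hermD[OF True]
  have eq: "(\<Sum>i<d. cnj (vec_index v i) * vec_index (A *\<^sub>v v) i) = qf d A (vec_index v)"
    if "v \<in> carrier_vec d" for v
    unfolding qf_def using that a(1)
    by (intro sum.cong refl) (auto simp: scalar_prod_def atLeast0LessThan sum_distrib_left mult_ac)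
  have "qf d A f = qf d A (vec_index (Matrix.vec d f))" for f
    unfolding qf_def by (intro sum.cong refl) auto
  then have "(\<forall>f. 0 \<le> Re (qf d A f)) \<longleftrightarrow> (\<forall>v\<in>carrier_vec d. 0 \<le> Re (qf d A (vec_index v)))"
    by (metis vec_carrier)
  then show ?thesis using True eq unfolding psd_def by auto
qed (auto simp: psd_def)

lemma psdD: "psd d A \<Longrightarrow> herm d A" "psd d A \<Longrightarrow> A \<in> carrier_mat d d" "psd d A \<Longrightarrow> 0 \<le> Re (qf d A f)"
  by (auto simp: psd_iff herm_def)

lemma psdI: "herm d A \<Longrightarrow> (\<And>f. 0 \<le> Re (qf d A f)) \<Longrightarrow> psd d A"
  by (auto simp: psd_iff)

lemma herm_add: "herm n A \<Longrightarrow> herm n B \<Longrightarrow> herm n (A + B)"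
  by (auto simp: herm_def adj_add[of _ n n])

lemma herm_minus: "herm n A \<Longrightarrow> herm n B \<Longrightarrow> herm n (A - B)"
  by (auto simp: herm_def adj_minus[of _ n n])

lemma herm_smult: "herm n A \<Longrightarrow> herm n (complex_of_real c \<cdot>\<^sub>m A)"
  by (auto simp: herm_def adj_smult[of _ n n])

lemma herm_one [simp]: "herm n (1\<^sub>m n)"
  by (auto simp: herm_def)

lemma qf_add: "A \<in> carrier_mat d d \<Longrightarrow> B \<in> carrier_mat d d \<Longrightarrow> qf d (A + B) f = qf d A f + qf d B f"
  by (auto simp: qf_def algebra_simps sum.distrib)

lemma qf_minus: "A \<in> carrier_mat d d \<Longrightarrow> B \<in> carrier_mat d d \<Longrightarrow> qf d (A - B) f = qf d A f - qf d B f"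
  by (auto simp: qf_def algebra_simps sum_subtractf)

lemma qf_smult: "A \<in> carrier_mat d d \<Longrightarrow> qf d (c \<cdot>\<^sub>m A) f = c * qf d A f"
  by (auto simp: qf_def sum_distrib_left mult_ac)

lemma psd_add: "psd d A \<Longrightarrow> psd d B \<Longrightarrow> psd d (A + B)"
  by (rule psdI) (auto simp: psdD herm_add qf_add)

lemma psd_smult: "psd d A \<Longrightarrow> c \<ge> 0 \<Longrightarrow> psd d (complex_of_real c \<cdot>\<^sub>m A)"
  by (rule psdI) (auto simp: psdD herm_smult qf_smult)

lemma qf_conj:
  assumes "A \<in> carrier_mat d d" "W \<in> carrier_mat d d"
  shows "qf d (W * A * adj W) f = qf d A (\<lambda>i. \<Sum>k<d. cnj (W $$ (k,i)) * f k)"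
proof -
  have "(W * A * adj W) $$ (i,j) = (\<Sum>l<d. \<Sum>k<d. W $$ (i,k) * A $$ (k,l) * cnj (W $$ (j,l)))"
    if "i < d" "j < d" for i j
    using that assms mult_index[of "W * A" d d "adj W" d i j]
    by (simp add: mult_index[of W d d A d] adj_index[of _ d d] sum_distrib_right)
  then have "qf d (W * A * adj W) f = (\<Sum>i<d. \<Sum>j<d. \<Sum>l<d. \<Sum>k<d.
      cnj (f i) * (W $$ (i,k) * A $$ (k,l) * cnj (W $$ (j,l))) * f j)"
    unfolding qf_def by (simp add: sum_distrib_left sum_distrib_right)
  also have "\<dots> = (\<Sum>k<d. \<Sum>l<d. \<Sum>i<d. \<Sum>j<d.
      cnj (f i) * (W $$ (i,k) * A $$ (k,l) * cnj (W $$ (j,l))) * f j)"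
    unfolding sum.cartesian_product
    by (rule sum.reindex_bij_witness[of _ "\<lambda>(k,l,i,j). (i,j,l,k)" "\<lambda>(i,j,l,k). (k,l,i,j)"]) auto
  also have "\<dots> = qf d A (\<lambda>i. \<Sum>k<d. cnj (W $$ (k,i)) * f k)"
    unfolding qf_def by (simp add: cnj_sum sum_distrib_left sum_distrib_right mult_ac)
  finally show ?thesis .
qed

lemma psd_conj: "psd d A \<Longrightarrow> W \<in> carrier_mat d d \<Longrightarrow> psd d (W * A * adj W)"
  by (rule psdI) (auto simp: psdD herm_conj qf_conj)

lemma psd_dg:
  assumes "\<And>i. i < d \<Longrightarrow> 0 \<le> lam i"
  shows "psd d (dg d (\<lambda>i. complex_of_real (lam i)))"
proof (rule psdI)
  show "herm d (dg d (\<lambda>i. complex_of_real (lam i)))" by (simp add: herm_def adj_dg)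
  fix f
  have "qf d (dg d (\<lambda>i. complex_of_real (lam i))) f = (\<Sum>i<d. \<Sum>j<d. if i = j then cnj (f i) * lam i * f i else 0)"
    unfolding qf_def by (intro sum.cong refl) (auto simp: dg_index)
  also have "\<dots> = (\<Sum>i<d. complex_of_real (lam i * (cmod (f i))\<^sup>2))"
    by (intro sum.cong refl) (simp add: sum.delta' complex_norm_square[symmetric] mult.assoc mult.commute[of "cnj _"])
  finally show "0 \<le> Re (qf d (dg d (\<lambda>i. complex_of_real (lam i))) f)"
    using assms by (auto intro!: sum_nonneg)
qed

lemma psd_one [simp]: "psd d (1\<^sub>m d)"
  using psd_dg[of d "\<lambda>_. 1"] by (simp add: dg_one)

text \<open>The form is evaluated at a basis vector.\<close>

lemma psd_diag:
  assumes "psd d A" "i < d"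
  shows "0 \<le> Re (A $$ (i,i))" "Im (A $$ (i,i)) = 0"
proof -
  have "qf d A (\<lambda>k. if k = i then 1 else 0) = (\<Sum>k<d. \<Sum>j<d. if k = i then (if j = i then A $$ (i,i) else 0) else 0)"
    unfolding qf_def by (intro sum.cong refl) auto
  also have "\<dots> = (\<Sum>k<d. if k = i then (\<Sum>j<d. if j = i then A $$ (i,i) else 0) else 0)"
    by (intro sum.cong refl) auto
  also have "\<dots> = A $$ (i,i)" using assms by (simp add: sum.delta)
  finally show "0 \<le> Re (A $$ (i,i))" using psdD(3)[OF assms(1)] by metis
  show "Im (A $$ (i,i)) = 0"
    using herm_index[OF psdD(1)[OF assms(1)] assms(2) assms(2)] by (metis cnj.simps(2) neg_equal_zero)
qed

lemma psd_trace_nonneg: "psd d A \<Longrightarrow> 0 \<le> Re (mtrace A)" "psd d A \<Longrightarrow> Im (mtrace A) = 0"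
  using psd_diag[of d A] mtrace_eq[OF psdD(2)[of d A]] by (auto intro!: sum_nonneg)

text \<open>The eigenvalues are the diagonal entries of \<open>adj P * A * P\<close>, which is again
  positive semidefinite.\<close>

lemma psd_spectral:
  assumes "psd d A"
  obtains P lam where "unitary d P" "A = P * dg d (\<lambda>i. complex_of_real (lam i)) * adj P"
    "\<And>i. i < d \<Longrightarrow> 0 \<le> lam i"
proof -
  obtain P lam where P: "unitary d P" "A = P * dg d (\<lambda>i. complex_of_real (lam i)) * adj P"
    using spectral_theorem[OF psdD(1)[OF assms]] by blast
  note p = unitaryD[OF P(1)]
  let ?D = "dg d (\<lambda>i. complex_of_real (lam i))"
  have "adj P * A * adj (adj P) = (adj P * P) * ?D * (adj P * P)"
    using p(1) unfolding P(2) by (simp add: assoc_mult_mat[of _ d d _ d _ d])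
  then have "psd d ?D" using psd_conj[OF assms, of "adj P"] p by (simp add: left_mult_one_mat[of _ d d])
  from psd_diag(1)[OF this] have "0 \<le> lam i" if "i < d" for i using that by (auto simp: dg_index)
  then show ?thesis using that P by blast
qed

lemma unitary_row_norm:
  assumes "unitary d P" "i < d"
  shows "(\<Sum>a<d. (cmod (P $$ (i,a)))\<^sup>2) = 1"
proof -
  note p = unitaryD[OF assms(1)]
  have "(P * adj P) $$ (i,i) = (\<Sum>a<d. P $$ (i,a) * adj P $$ (a,i))"
    using p(1) assms by (intro mult_index) auto
  also have "\<dots> = complex_of_real (\<Sum>a<d. (cmod (P $$ (i,a)))\<^sup>2)"
    using assms(2) by (simp add: adj_index[OF p(1)] complex_norm_square[symmetric])
  finally show ?thesis using p(3) assms(2) by (metis index_one_mat(1) of_real_eq_1_iff)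
qed

lemma unitary_entry_le:
  assumes "unitary d P" "i < d" "a < d" shows "cmod (P $$ (i,a)) \<le> 1"
proof -
  have "(cmod (P $$ (i,a)))\<^sup>2 \<le> (\<Sum>a<d. (cmod (P $$ (i,a)))\<^sup>2)"
    using assms by (intro member_le_sum) auto
  then show ?thesis using unitary_row_norm[OF assms(1,2)] by (simp add: power_le_one_iff abs_square_le_1)
qed

lemma unitary_cancel:
  assumes "unitary d P" "X \<in> carrier_mat d d"
  shows "adj P * (P * X) = X" "P * (adj P * X) = X"
  using unitaryD[OF assms(1)] assms(2)
  by (simp_all add: assoc_mult_mat[of _ d d _ d _ d, symmetric] left_mult_one_mat[of _ d d])

lemma mtrace_unitary_conj:
  assumes "unitary d P" "X \<in> carrier_mat d d"
  shows "mtrace (P * X * adj P) = mtrace X"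
proof -
  note p = unitaryD[OF assms(1)]
  have "mtrace (P * X * adj P) = mtrace (adj P * (P * X))"
    using p(1) assms(2) by (intro mtrace_comm) auto
  then show ?thesis using unitary_cancel[OF assms] by simp
qed

text \<open>Entries of a unitary have modulus at most 1, so an entry of \<open>A\<close> is bounded
  by the sum of the eigenvalues. This turns the decay of traces in the contraction argument into
  entrywise convergence.\<close>

lemma psd_entry_le:
  assumes A: "psd d A" and ij: "i < d" "j < d"
  shows "cmod (A $$ (i,j)) \<le> Re (mtrace A)"
proof -
  obtain P lam where P: "unitary d P" "A = P * dg d (\<lambda>i. complex_of_real (lam i)) * adj P"
    and l: "\<And>i. i < d \<Longrightarrow> 0 \<le> lam i"
    using psd_spectral[OF A] by blast
  note p = unitaryD[OF P(1)]
  have "cmod (A $$ (i,j)) \<le> (\<Sum>a<d. cmod (P $$ (i,a) * complex_of_real (lam a) * cnj (P $$ (j,a))))"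
    unfolding P(2) sandwich_dg_index[OF p(1) ij] by (rule norm_sum)
  also have "\<dots> \<le> (\<Sum>a<d. lam a)"
  proof (rule sum_mono)
    fix a assume a: "a \<in> {..<d}"
    have "cmod (P $$ (i,a)) * cmod (P $$ (j,a)) \<le> 1 * 1"
      using a ij by (intro mult_mono unitary_entry_le[OF P(1)]) auto
    then have "lam a * (cmod (P $$ (i,a)) * cmod (P $$ (j,a))) \<le> lam a * 1"
      using l a by (intro mult_left_mono) auto
    then show "cmod (P $$ (i,a) * complex_of_real (lam a) * cnj (P $$ (j,a))) \<le> lam a"
      using l a by (simp add: norm_mult mult_ac)
  qed
  also have "\<dots> = Re (mtrace A)"
    unfolding P(2) mtrace_unitary_conj[OF P(1) dg_carrier] by (simp add: mtrace_eq[OF dg_carrier] dg_index)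
  finally show ?thesis .
qed

text \<open>In an eigenbasis of \<open>B\<close> the trace is a combination of diagonal entries of
  \<open>adj P * A * P\<close> weighted by the eigenvalues of \<open>B\<close>.\<close>

lemma psd_mtrace_mult_nonneg:
  assumes "psd d A" "psd d B" shows "0 \<le> Re (mtrace (A * B))"
proof -
  obtain P lam where P: "unitary d P" "B = P * dg d (\<lambda>i. complex_of_real (lam i)) * adj P"
    and l: "\<And>i. i < d \<Longrightarrow> 0 \<le> lam i"
    using psd_spectral[OF assms(2)] by blast
  note p = unitaryD[OF P(1)]
  let ?D = "dg d (\<lambda>i. complex_of_real (lam i))"
  have A: "A \<in> carrier_mat d d" using assms psdD by auto
  have C: "psd d (adj P * A * P)" using psd_conj[OF assms(1), of "adj P"] p by simp
  have "mtrace (A * B) = mtrace ((A * P * ?D) * adj P)"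
    unfolding P(2) using p A by (simp add: assoc_mult_mat[of _ d d _ d _ d])
  also have "\<dots> = mtrace (adj P * (A * P * ?D))"
    using p A by (intro mtrace_comm[of _ d d]) auto
  also have "\<dots> = mtrace (adj P * A * P * ?D)"
    using p A by (simp add: assoc_mult_mat[of _ d d _ d _ d])
  also have "\<dots> = (\<Sum>i<d. (adj P * A * P) $$ (i,i) * lam i)"
    using psdD(2)[OF C] mult_dg_index[OF psdD(2)[OF C]] by (simp add: mtrace_eq[of _ d])
  finally show ?thesis using psd_diag[OF C] l by (auto intro!: sum_nonneg)
qed

text \<open>Shifting by the sum of the moduli of the eigenvalues makes all of them nonnegative. The
  decay of traceless Hermitian matrices is reduced to differences of positive ones in this
  way.\<close>

lemma herm_plus_scalar_psd:
  assumes "herm d Y"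
  obtains c where "c \<ge> 0" "psd d (Y + complex_of_real c \<cdot>\<^sub>m 1\<^sub>m d)"
proof -
  obtain P lam where P: "unitary d P" "Y = P * dg d (\<lambda>i. complex_of_real (lam i)) * adj P"
    using spectral_theorem[OF assms] by blast
  note p = unitaryD[OF P(1)]
  define c where "c = (\<Sum>a<d. \<bar>lam a\<bar>)"
  have "0 \<le> lam i + c" if "i < d" for i
  proof -
    have "\<bar>lam i\<bar> \<le> c" unfolding c_def using that by (intro member_le_sum) auto
    then show ?thesis by linarith
  qed
  then have "psd d (P * dg d (\<lambda>i. complex_of_real (lam i + c)) * adj P)"
    using p by (intro psd_conj psd_dg) auto
  moreover have "P * dg d (\<lambda>i. complex_of_real (lam i + c)) * adj P = Y + complex_of_real c \<cdot>\<^sub>m 1\<^sub>m d"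
  proof -
    have "dg d (\<lambda>i. complex_of_real (lam i + c)) = dg d (\<lambda>i. complex_of_real (lam i)) + complex_of_real c \<cdot>\<^sub>m 1\<^sub>m d"
      by (rule matI[of _ d d]) (auto simp: dg_def)
    moreover have "P * (dg d (\<lambda>i. complex_of_real (lam i)) + complex_of_real c \<cdot>\<^sub>m 1\<^sub>m d) * adj P
      = Y + complex_of_real c \<cdot>\<^sub>m (P * adj P)"
      unfolding P(2) using p(1)
      by (simp add: mult_add_distrib_mat[of _ d d _ d] add_mult_distrib_mat[of _ d d _ _ d]
          mult_smult_distrib[of _ d d _ d] mult_smult_assoc_mat[of _ d d _ d])
    ultimately show ?thesis using p(3) by simp
  qed
  moreover have "c \<ge> 0" by (simp add: c_def sum_nonneg)
  ultimately show ?thesis using that by metis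
qed

section \<open>Tensor products and partial traces\<close>

text \<open>The basis of a tensor product is numbered by \<open>i * b + k\<close>, so traces and
  products there become double sums.\<close>

lemma sum_prod_index:
  fixes g :: "nat \<Rightarrow> 'a::comm_monoid_add"
  shows "(\<Sum>n<a*b. g n) = (\<Sum>i<a. \<Sum>k<b. g (i*b+k))"
proof (induction a)
  case (Suc a)
  have "(\<Sum>n<Suc a * b. g n) = (\<Sum>n<a*b. g n) + (\<Sum>n=a*b..<a*b+b. g n)"
    by (simp add: lessThan_atLeast0 sum.atLeastLessThan_concat add.commute)
  also have "(\<Sum>n=a*b..<a*b+b. g n) = (\<Sum>k<b. g (a*b+k))"
    using sum.shift_bounds_nat_ivl[of g 0 "a*b" b] by (simp add: lessThan_atLeast0 add.commute)
  finally show ?case using Suc by simp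
qed simp

lemma prod_index_less: "i < a \<Longrightarrow> k < b \<Longrightarrow> i * b + k < a * (b::nat)"
proof -
  assume "i < a" "k < b"
  then have "i * b + k < Suc i * b" "Suc i * b \<le> a * b" by (simp, intro mult_right_mono) auto
  then show ?thesis by linarith
qed

lemma prod_matI:
  assumes "A \<in> carrier_mat (a*b) (a*b)" "B \<in> carrier_mat (a*b) (a*b)"
    "\<And>i j k l. i < a \<Longrightarrow> j < a \<Longrightarrow> k < b \<Longrightarrow> l < b \<Longrightarrow> A $$ (i*b+k, j*b+l) = B $$ (i*b+k, j*b+l)"
  shows "A = B"
proof (rule matI[OF assms(1,2)])
  fix m n assume mn: "m < a * b" "n < a * b"
  then have "b > 0" by (cases b) auto
  then have "m div b < a" "n div b < a" "m mod b < b" "n mod b < b"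
    using mn by (auto simp: less_mult_imp_div_less)
  from assms(3)[OF this] show "A $$ (m,n) = B $$ (m,n)" by simp
qed

lemma kron_carrier [simp]:
  "A \<in> carrier_mat a a \<Longrightarrow> B \<in> carrier_mat b b \<Longrightarrow> kron A B \<in> carrier_mat (a*b) (a*b)"
  by (auto simp: kron_def)

lemma kron_index:
  assumes "A \<in> carrier_mat a a" "B \<in> carrier_mat b b" "i < a" "j < a" "k < b" "l < b"
  shows "kron A B $$ (i*b+k, j*b+l) = A $$ (i,j) * B $$ (k,l)"
  using assms prod_index_less[of i a k b] prod_index_less[of j a l b] by (auto simp: kron_def)

lemma kron_mult:
  assumes "A \<in> carrier_mat a a" "B \<in> carrier_mat b b" "C \<in> carrier_mat a a" "D \<in> carrier_mat b b"
  shows "kron A B * kron C D = kron (A * C) (B * D)"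
proof (rule prod_matI[of _ a b])
  fix i j k l assume *: "i < a" "j < a" "k < b" "l < b"
  have "(kron A B * kron C D) $$ (i*b+k, j*b+l) = (\<Sum>n<a*b. kron A B $$ (i*b+k, n) * kron C D $$ (n, j*b+l))"
    using assms * by (intro mult_index[of _ "a*b" "a*b" _ "a*b"]) (auto simp: prod_index_less)
  also have "\<dots> = (\<Sum>m<a. \<Sum>n<b. (A $$ (i,m) * B $$ (k,n)) * (C $$ (m,j) * D $$ (n,l)))"
    unfolding sum_prod_index using assms * by (intro sum.cong refl) (simp add: kron_index)
  also have "\<dots> = (A * C) $$ (i,j) * (B * D) $$ (k,l)"
    using assms * by (simp add: mult_index[of _ a a _ a] mult_index[of _ b b _ b] sum_product mult_ac)
  also have "\<dots> = kron (A * C) (B * D) $$ (i*b+k, j*b+l)"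
    using assms * by (intro kron_index[symmetric]) auto
  finally show "(kron A B * kron C D) $$ (i*b+k, j*b+l) = kron (A * C) (B * D) $$ (i*b+k, j*b+l)" .
qed (use assms in auto)

lemma adj_kron:
  assumes "A \<in> carrier_mat a a" "B \<in> carrier_mat b b"
  shows "adj (kron A B) = kron (adj A) (adj B)"
  by (rule prod_matI[of _ a b])
    (use assms in \<open>auto simp: adj_index[of _ "a*b" "a*b"] adj_index[of _ a a] adj_index[of _ b b] kron_index[of _ a _ b] prod_index_less\<close>)

lemma cconj_kron:
  assumes "A \<in> carrier_mat a a" "B \<in> carrier_mat b b"
  shows "cconj (kron A B) = kron (cconj A) (cconj B)"
  by (rule prod_matI[of _ a b])
    (use assms in \<open>auto simp: cconj_index[of _ "a*b" "a*b"] cconj_index[of _ a a] cconj_index[of _ b b] kron_index[of _ a _ b] prod_index_less\<close>)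

lemma prod_index_eq_iff: "k < b \<Longrightarrow> l < b \<Longrightarrow> i * b + k = j * b + l \<longleftrightarrow> i = j \<and> k = (l::nat)"
  by (metis add.commute add_right_imp_eq div_mult_self3 div_less add_0_right mult.commute not_less_zero)

lemma kron_dg: "kron (dg a f) (dg b g) = dg (a*b) (\<lambda>n. f (n div b) * g (n mod b))"
  by (rule prod_matI[of _ a b]) (auto simp: mat_op_index[of _ "a*b" "a*b"] kron_index[of _ a _ b] dg_index prod_index_less prod_index_eq_iff)

lemma kron_one: "kron (1\<^sub>m a) (1\<^sub>m b) = 1\<^sub>m (a*b)"
  using kron_dg[of a "\<lambda>_. 1" b "\<lambda>_. 1"] by (simp add: dg_one)

lemma kron_sum_dg:
  "kron (dg a f) (1\<^sub>m b) + kron (1\<^sub>m a) (dg b g) = dg (a*b) (\<lambda>n. f (n div b) + g (n mod b))"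
  by (rule prod_matI[of _ a b]) (auto simp: mat_op_index[of _ "a*b" "a*b"] kron_index[of _ a _ b] dg_index prod_index_less prod_index_eq_iff)

lemma kron_add_left:
  "A \<in> carrier_mat a a \<Longrightarrow> A' \<in> carrier_mat a a \<Longrightarrow> B \<in> carrier_mat b b \<Longrightarrow> kron (A + A') B = kron A B + kron A' B"
  by (rule prod_matI[of _ a b]) (auto simp: kron_index[of _ a _ b] mat_op_index[of _ "a*b" "a*b"] prod_index_less mat_op_index[of _ a a] mat_op_index[of _ b b] smult_index[of _ a a] smult_index[of _ b b] smult_index[of _ "a*b" "a*b"] distrib_left distrib_right left_diff_distrib right_diff_distrib)

lemma kron_minus_right:
  "A \<in> carrier_mat a a \<Longrightarrow> B' \<in> carrier_mat b b \<Longrightarrow> B \<in> carrier_mat b b \<Longrightarrow> kron A (B - B') = kron A B - kron A B'"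
  by (rule prod_matI[of _ a b]) (auto simp: kron_index[of _ a _ b] mat_op_index[of _ "a*b" "a*b"] prod_index_less mat_op_index[of _ a a] mat_op_index[of _ b b] smult_index[of _ a a] smult_index[of _ b b] smult_index[of _ "a*b" "a*b"] distrib_left distrib_right left_diff_distrib right_diff_distrib)

lemma kron_smult_left:
  "A \<in> carrier_mat a a \<Longrightarrow> B \<in> carrier_mat b b \<Longrightarrow> kron (c \<cdot>\<^sub>m A) B = c \<cdot>\<^sub>m kron A B"
  by (rule prod_matI[of _ a b]) (auto simp: kron_index[of _ a _ b] mat_op_index[of _ "a*b" "a*b"] prod_index_less mat_op_index[of _ a a] mat_op_index[of _ b b] smult_index[of _ a a] smult_index[of _ b b] smult_index[of _ "a*b" "a*b"] distrib_left distrib_right left_diff_distrib right_diff_distrib)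

lemma kron_smult_right:
  "A \<in> carrier_mat a a \<Longrightarrow> B \<in> carrier_mat b b \<Longrightarrow> kron A (c \<cdot>\<^sub>m B) = c \<cdot>\<^sub>m kron A B"
  by (rule prod_matI[of _ a b]) (auto simp: kron_index[of _ a _ b] mat_op_index[of _ "a*b" "a*b"] prod_index_less mat_op_index[of _ a a] mat_op_index[of _ b b] smult_index[of _ a a] smult_index[of _ b b] smult_index[of _ "a*b" "a*b"] distrib_left distrib_right left_diff_distrib right_diff_distrib)

lemma unitary_kron:
  assumes "unitary a A" "unitary b B" shows "unitary (a*b) (kron A B)"
  using unitaryD[OF assms(1)] unitaryD[OF assms(2)]
  by (intro unitaryI) (auto simp: adj_kron[of _ a _ b] kron_mult[of _ a _ b] kron_one)

lemma herm_kron: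
  assumes "herm a A" "herm b B" shows "herm (a*b) (kron A B)"
  using hermD[OF assms(1)] hermD[OF assms(2)] by (auto simp: herm_def adj_kron[of _ a _ b])

lemma ptr2_carrier [simp]: "ptr2 d e X \<in> carrier_mat d d"
  by (simp add: ptr2_def)

lemma ptr2_index: "i < d \<Longrightarrow> j < d \<Longrightarrow> ptr2 d e X $$ (i,j) = (\<Sum>k<e. X $$ (i*e+k, j*e+k))"
  by (simp add: ptr2_def)

lemma ptr2_add:
  "X \<in> carrier_mat (d*e) (d*e) \<Longrightarrow> Y \<in> carrier_mat (d*e) (d*e) \<Longrightarrow> ptr2 d e (X + Y) = ptr2 d e X + ptr2 d e Y"
  by (rule matI[of _ d d]) (auto simp: ptr2_index mat_op_index[of _ d d] smult_index[of _ d d] mat_op_index[of _ "d*e" "d*e"] smult_index[of _ "d*e" "d*e"] prod_index_less sum.distrib)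

lemma ptr2_minus:
  "X \<in> carrier_mat (d*e) (d*e) \<Longrightarrow> Y \<in> carrier_mat (d*e) (d*e) \<Longrightarrow> ptr2 d e (X - Y) = ptr2 d e X - ptr2 d e Y"
  by (rule matI[of _ d d]) (auto simp: ptr2_index mat_op_index[of _ d d] smult_index[of _ d d] mat_op_index[of _ "d*e" "d*e"] smult_index[of _ "d*e" "d*e"] prod_index_less sum_subtractf)

lemma ptr2_smult:
  "X \<in> carrier_mat (d*e) (d*e) \<Longrightarrow> ptr2 d e (c \<cdot>\<^sub>m X) = c \<cdot>\<^sub>m ptr2 d e X"
  by (rule matI[of _ d d]) (auto simp: ptr2_index mat_op_index[of _ d d] smult_index[of _ d d] mat_op_index[of _ "d*e" "d*e"] smult_index[of _ "d*e" "d*e"] prod_index_less sum_distrib_left)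

lemma adj_ptr2:
  "X \<in> carrier_mat (d*e) (d*e) \<Longrightarrow> adj (ptr2 d e X) = ptr2 d e (adj X)"
  by (rule matI[of _ d d]) (auto simp: ptr2_index adj_index[of _ d d] adj_index[of _ "d*e" "d*e"] prod_index_less cnj_sum)

lemma cconj_ptr2:
  "X \<in> carrier_mat (d*e) (d*e) \<Longrightarrow> cconj (ptr2 d e X) = ptr2 d e (cconj X)"
  by (rule matI[of _ d d]) (auto simp: ptr2_index cconj_index[of _ d d] cconj_index[of _ "d*e" "d*e"] prod_index_less cnj_sum)

lemma mtrace_ptr2: "X \<in> carrier_mat (d*e) (d*e) \<Longrightarrow> mtrace (ptr2 d e X) = mtrace X"
  by (simp add: mtrace_eq[of _ d] mtrace_eq[of _ "d*e"] ptr2_index sum_prod_index)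

lemma ptr2_kron: "A \<in> carrier_mat d d \<Longrightarrow> B \<in> carrier_mat e e \<Longrightarrow> ptr2 d e (kron A B) = mtrace B \<cdot>\<^sub>m A"
  by (rule matI[of _ d d]) (auto simp: ptr2_index kron_index[of _ d _ e] mtrace_eq[of _ e] sum_distrib_left mult_ac)

lemma kron_one_right_mult_index:
  assumes "A \<in> carrier_mat d d" "X \<in> carrier_mat (d*e) (d*e)" "i < d" "j < d" "k < e" "l < e"
  shows "(kron A (1\<^sub>m e) * X) $$ (i*e+k, j*e+l) = (\<Sum>m<d. A $$ (i,m) * X $$ (m*e+k, j*e+l))"
    "(X * kron A (1\<^sub>m e)) $$ (i*e+k, j*e+l) = (\<Sum>m<d. X $$ (i*e+k, m*e+l) * A $$ (m,j))"
proof -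
  have "(kron A (1\<^sub>m e) * X) $$ (i*e+k, j*e+l) = (\<Sum>m<d. \<Sum>n<e. kron A (1\<^sub>m e) $$ (i*e+k, m*e+n) * X $$ (m*e+n, j*e+l))"
    using assms by (simp add: mult_index[of _ "d*e" "d*e" _ "d*e"] prod_index_less sum_prod_index)
  also have "\<dots> = (\<Sum>m<d. \<Sum>n<e. if n = k then A $$ (i,m) * X $$ (m*e+n, j*e+l) else 0)"
    using assms by (intro sum.cong refl) (auto simp: kron_index[of _ d _ e])
  finally show "(kron A (1\<^sub>m e) * X) $$ (i*e+k, j*e+l) = (\<Sum>m<d. A $$ (i,m) * X $$ (m*e+k, j*e+l))"
    using assms by (simp add: sum.delta)
  have "(X * kron A (1\<^sub>m e)) $$ (i*e+k, j*e+l) = (\<Sum>m<d. \<Sum>n<e. X $$ (i*e+k, m*e+n) * kron A (1\<^sub>m e) $$ (m*e+n, j*e+l))"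
    using assms by (simp add: mult_index[of _ "d*e" "d*e" _ "d*e"] prod_index_less sum_prod_index)
  also have "\<dots> = (\<Sum>m<d. \<Sum>n<e. if n = l then X $$ (i*e+k, m*e+n) * A $$ (m,j) else 0)"
    using assms by (intro sum.cong refl) (auto simp: kron_index[of _ d _ e])
  finally show "(X * kron A (1\<^sub>m e)) $$ (i*e+k, j*e+l) = (\<Sum>m<d. X $$ (i*e+k, m*e+l) * A $$ (m,j))"
    using assms by (simp add: sum.delta)
qed

lemma kron_one_left_mult_index:
  assumes "B \<in> carrier_mat e e" "X \<in> carrier_mat (d*e) (d*e)" "i < d" "j < d" "k < e" "l < e"
  shows "(kron (1\<^sub>m d) B * X) $$ (i*e+k, j*e+l) = (\<Sum>n<e. B $$ (k,n) * X $$ (i*e+n, j*e+l))"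
    "(X * kron (1\<^sub>m d) B) $$ (i*e+k, j*e+l) = (\<Sum>n<e. X $$ (i*e+k, j*e+n) * B $$ (n,l))"
proof -
  have "(kron (1\<^sub>m d) B * X) $$ (i*e+k, j*e+l) = (\<Sum>m<d. \<Sum>n<e. kron (1\<^sub>m d) B $$ (i*e+k, m*e+n) * X $$ (m*e+n, j*e+l))"
    using assms by (simp add: mult_index[of _ "d*e" "d*e" _ "d*e"] prod_index_less sum_prod_index)
  also have "\<dots> = (\<Sum>m<d. if m = i then \<Sum>n<e. B $$ (k,n) * X $$ (m*e+n, j*e+l) else 0)"
    using assms by (intro sum.cong refl) (auto simp: kron_index[of _ d _ e] intro!: sum.cong)
  finally show "(kron (1\<^sub>m d) B * X) $$ (i*e+k, j*e+l) = (\<Sum>n<e. B $$ (k,n) * X $$ (i*e+n, j*e+l))"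
    using assms by (simp add: sum.delta)
  have "(X * kron (1\<^sub>m d) B) $$ (i*e+k, j*e+l) = (\<Sum>m<d. \<Sum>n<e. X $$ (i*e+k, m*e+n) * kron (1\<^sub>m d) B $$ (m*e+n, j*e+l))"
    using assms by (simp add: mult_index[of _ "d*e" "d*e" _ "d*e"] prod_index_less sum_prod_index)
  also have "\<dots> = (\<Sum>m<d. if m = j then \<Sum>n<e. X $$ (i*e+k, m*e+n) * B $$ (n,l) else 0)"
    using assms by (intro sum.cong refl) (auto simp: kron_index[of _ d _ e] intro!: sum.cong)
  finally show "(X * kron (1\<^sub>m d) B) $$ (i*e+k, j*e+l) = (\<Sum>n<e. X $$ (i*e+k, j*e+n) * B $$ (n,l))"
    using assms by (simp add: sum.delta)
qed

text \<open>An operator on the first factor does not touch the index that is summed, so it leaves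
  the partial trace on its own side.\<close>

lemma ptr2_kron_one:
  assumes "A \<in> carrier_mat d d" "X \<in> carrier_mat (d*e) (d*e)"
  shows "ptr2 d e (kron A (1\<^sub>m e) * X) = A * ptr2 d e X" "ptr2 d e (X * kron A (1\<^sub>m e)) = ptr2 d e X * A"
proof -
  show "ptr2 d e (kron A (1\<^sub>m e) * X) = A * ptr2 d e X"
  proof (rule matI[of _ d d])
    fix i j assume ij: "i < d" "j < d"
    show "ptr2 d e (kron A (1\<^sub>m e) * X) $$ (i,j) = (A * ptr2 d e X) $$ (i,j)"
      using ij assms by (simp add: ptr2_index kron_one_right_mult_index mult_index[of _ d d _ d] sum_distrib_left)
        (rule sum.swap)
  qed (use assms in auto)
  show "ptr2 d e (X * kron A (1\<^sub>m e)) = ptr2 d e X * A"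
  proof (rule matI[of _ d d])
    fix i j assume ij: "i < d" "j < d"
    show "ptr2 d e (X * kron A (1\<^sub>m e)) $$ (i,j) = (ptr2 d e X * A) $$ (i,j)"
      using ij assms by (simp add: ptr2_index kron_one_right_mult_index mult_index[of _ d d _ d] sum_distrib_right)
        (rule sum.swap)
  qed (use assms in auto)
qed

text \<open>Partial cyclicity: an operator on the factor traced out may be moved around.\<close>

lemma ptr2_comm:
  assumes "B \<in> carrier_mat e e" "X \<in> carrier_mat (d*e) (d*e)"
  shows "ptr2 d e (kron (1\<^sub>m d) B * X) = ptr2 d e (X * kron (1\<^sub>m d) B)"
proof (rule matI[of _ d d])
  fix i j assume ij: "i < d" "j < d"
  have "(\<Sum>k<e. \<Sum>n<e. B $$ (k,n) * X $$ (i*e+n, j*e+k)) = (\<Sum>n<e. \<Sum>k<e. X $$ (i*e+n, j*e+k) * B $$ (k,n))"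
    by (subst sum.swap) (simp add: mult.commute)
  then show "ptr2 d e (kron (1\<^sub>m d) B * X) $$ (i,j) = ptr2 d e (X * kron (1\<^sub>m d) B) $$ (i,j)"
    using ij assms by (simp add: ptr2_index kron_one_left_mult_index)
qed auto

section \<open>Functional calculus\<close>

lemma pow_sandwich_dg:
  assumes "unitary n P"
  shows "(P * dg n f * adj P) ^\<^sub>m k = P * dg n (\<lambda>i. f i ^ k) * adj P"
proof (induction k)
  case 0
  have "dim_row P = n" using unitaryD[OF assms] by auto
  then show ?case using unitaryD[OF assms] by (simp add: dg_one)
next
  case (Suc k)
  note p = unitaryD[OF assms]
  have "(P * dg n f * adj P) ^\<^sub>m Suc k = P * (dg n (\<lambda>i. f i ^ k) * dg n f) * adj P"
    using Suc p(1) by (simp add: assoc_mult_mat[of _ n n _ n _ n] unitary_cancel[OF assms])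
  then show ?case by (simp add: dg_mult mult.commute)
qed

lemma mexp_carrier [simp]: "A \<in> carrier_mat n n \<Longrightarrow> mexp A \<in> carrier_mat n n"
  by (auto simp: mexp_def)

text \<open>The exponential is an entrywise series. Each entry of a power is a fixed combination of
  powers of the diagonal values, so the series is a finite combination of scalar exponential
  series.\<close>

lemma mexp_sandwich:
  assumes "unitary n P"
  shows "mexp (P * dg n f * adj P) = P * dg n (\<lambda>i. exp (f i)) * adj P"
proof (rule matI[of _ n n])
  note p = unitaryD[OF assms]
  have c: "P * dg n f * adj P \<in> carrier_mat n n" using p by auto
  then show "mexp (P * dg n f * adj P) \<in> carrier_mat n n" using c by simp
  show "P * dg n (\<lambda>i. exp (f i)) * adj P \<in> carrier_mat n n" using p by auto
  fix i j assume ij: "i < n" "j < n"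
  have "(\<lambda>k. (\<Sum>a<n. P $$ (i,a) * (f a ^ k /\<^sub>R fact k) * cnj (P $$ (j,a))))
      sums (\<Sum>a<n. P $$ (i,a) * exp (f a) * cnj (P $$ (j,a)))"
    by (intro sums_sum sums_mult sums_mult2 exp_converges)
  moreover have "(\<Sum>a<n. P $$ (i,a) * (f a ^ k /\<^sub>R fact k) * cnj (P $$ (j,a)))
      = ((P * dg n f * adj P) ^\<^sub>m k) $$ (i,j) / of_nat (fact k)" for k
    unfolding pow_sandwich_dg[OF assms] sandwich_dg_index[OF p(1) ij]
    by (simp add: sum_divide_distrib scaleR_conv_of_real divide_simps mult_ac)
  moreover have "dim_row P = n" "dim_col (adj P) = n" using p(1) adj_carrier[OF p(1)] by blast+
  ultimately show "mexp (P * dg n f * adj P) $$ (i,j) = (P * dg n (\<lambda>i. exp (f i)) * adj P) $$ (i,j)"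
    using ij c unfolding sandwich_dg_index[OF p(1) ij] by (simp add: mexp_def sums_iff)
qed

lemma smult_sandwich_dg:
  assumes "P \<in> carrier_mat n n"
  shows "c \<cdot>\<^sub>m (P * dg n f * adj P) = P * dg n (\<lambda>i. c * f i) * adj P"
  unfolding smult_dg[symmetric] using assms
  by (simp add: mult_smult_distrib[of _ n n _ n] mult_smult_assoc_mat[of _ n n _ n])

lemma mexp_smult_sandwich:
  assumes "unitary n P"
  shows "mexp (c \<cdot>\<^sub>m (P * dg n f * adj P)) = P * dg n (\<lambda>i. exp (c * f i)) * adj P"
  using unitaryD(1)[OF assms] by (simp add: smult_sandwich_dg mexp_sandwich[OF assms])

lemma adj_sandwich_dg:
  assumes "P \<in> carrier_mat n n"
  shows "adj (P * dg n f * adj P) = P * dg n (\<lambda>i. cnj (f i)) * adj P"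
  using assms by (simp add: adj_mult[of _ n n _ n] assoc_mult_mat[of _ n n _ n _ n] adj_dg)

lemma cconj_dg: "cconj (dg n f) = dg n (\<lambda>i. cnj (f i))"
  by (rule matI[of _ n n]) (auto simp: dg_def cconj_def)

lemma mult_sandwich_dg:
  assumes "unitary n P"
  shows "(P * dg n f * adj P) * (P * dg n g * adj P) = P * dg n (\<lambda>i. f i * g i) * adj P"
  using unitaryD(1)[OF assms] unfolding dg_mult[symmetric]
  by (simp add: assoc_mult_mat[of _ n n _ n _ n] unitary_cancel[OF assms])

lemma mexp_adj:
  assumes "herm n H" shows "adj (mexp (c \<cdot>\<^sub>m H)) = mexp (cnj c \<cdot>\<^sub>m H)"
proof -
  obtain P l where P: "unitary n P" and H: "H = P * dg n (\<lambda>i. complex_of_real (l i)) * adj P"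
    using spectral_theorem[OF assms] by blast
  show ?thesis unfolding H mexp_smult_sandwich[OF P] adj_sandwich_dg[OF unitaryD(1)[OF P]]
    by (simp add: exp_cnj)
qed

lemma mexp_unitary:
  assumes "herm n H" shows "unitary n (mexp ((- \<i> * complex_of_real t) \<cdot>\<^sub>m H))"
proof -
  obtain P l where P: "unitary n P" and H: "H = P * dg n (\<lambda>i. complex_of_real (l i)) * adj P"
    using spectral_theorem[OF assms] by blast
  note p = unitaryD[OF P]
  have "adj (mexp ((- \<i> * complex_of_real t) \<cdot>\<^sub>m H)) * mexp ((- \<i> * complex_of_real t) \<cdot>\<^sub>m H)
     = P * dg n (\<lambda>i. 1) * adj P"
    unfolding mexp_adj[OF assms] unfolding H mexp_smult_sandwich[OF P] mult_sandwich_dg[OF P]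
    by (simp flip: exp_add)
  then show ?thesis using p hermD(1)[OF assms] by (intro unitaryI) (auto simp: dg_one)
qed

text \<open>Antilinearity conjugates the scalar \<open>c\<close>, which is how a propagator becomes
  its adjoint under time reversal. The unitary \<open>\<Theta> * cconj P\<close> diagonalises the
  transformed matrix.\<close>

lemma mexp_antiunitary:
  assumes "unitary n \<Theta>" "herm n H"
  shows "\<Theta> * cconj (mexp (c \<cdot>\<^sub>m H)) * adj \<Theta> = mexp (cnj c \<cdot>\<^sub>m (\<Theta> * cconj H * adj \<Theta>))"
proof -
  obtain P l where P: "unitary n P" and H: "H = P * dg n (\<lambda>i. complex_of_real (l i)) * adj P"
    using spectral_theorem[OF assms(2)] by blast
  note p = unitaryD[OF P] note t = unitaryD[OF assms(1)]
  define Q where "Q = \<Theta> * cconj P"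
  have Q: "unitary n Q" unfolding Q_def by (intro unitary_mult assms unitary_cconj P)
  have *: "\<Theta> * cconj (P * dg n f * adj P) * adj \<Theta> = Q * dg n (\<lambda>i. cnj (f i)) * adj Q" for f
    unfolding Q_def using p t
    by (simp add: cconj_mult[of _ n n _ n] adj_mult[of _ n n _ n] cconj_adj[of _ n n] cconj_dg assoc_mult_mat[of _ n n _ n _ n])
  show ?thesis unfolding H mexp_smult_sandwich[OF P] * mexp_smult_sandwich[OF Q]
    by (simp add: exp_cnj)
qed

text \<open>In the two eigenbases the hypothesis reads
  \<open>W $$ (i,j) * g j = h i * W $$ (i,j)\<close>, so an entry of \<open>W\<close> is nonzero
  only where the eigenvalues agree. Functions \<open>l\<close> and \<open>m\<close> that agree there
  are intertwined too.\<close>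

lemma intertwine_sandwich:
  assumes P: "unitary n P" and Q: "unitary n Q" and U: "U \<in> carrier_mat n n"
    and inj: "\<And>i j. i < n \<Longrightarrow> j < n \<Longrightarrow> g i = h j \<Longrightarrow> l i = m j"
    and eq: "U * (P * dg n g * adj P) = (Q * dg n h * adj Q) * U"
  shows "U * (P * dg n l * adj P) = (Q * dg n m * adj Q) * U"
proof -
  note p = unitaryD[OF P] note q = unitaryD[OF Q]
  define W where "W = adj Q * U * P"
  have W: "W \<in> carrier_mat n n" using p q U by (simp add: W_def)
  have UW: "U * (P * D * adj P) = Q * (W * D) * adj P" "(Q * D * adj Q) * U = Q * (D * W) * adj P"
    if "D \<in> carrier_mat n n" for D
    unfolding W_def using p q U that
    by (simp_all add: assoc_mult_mat[of _ n n _ n _ n] unitary_cancel[OF Q])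
  have "adj Q * (Q * (W * dg n g) * adj P) * P = adj Q * (Q * (dg n h * W) * adj P) * P"
    using eq UW by simp
  then have "W * dg n g = dg n h * W"
    using p q W by (simp add: assoc_mult_mat[of _ n n _ n _ n] unitary_cancel[OF Q])
  then have e: "W $$ (i,j) * g j = h i * W $$ (i,j)" if "i < n" "j < n" for i j
    using mult_dg_index[OF W that, of g] dg_mult_index[OF W that, of h] by metis
  have "W * dg n l = dg n m * W"
  proof (rule matI[of _ n n])
    fix i j assume ij: "i < n" "j < n"
    have "W $$ (i,j) * l j = m i * W $$ (i,j)"
    proof (cases "W $$ (i,j) = 0")
      case False
      have "W $$ (i,j) * g j = W $$ (i,j) * h i" using e[OF ij] by (simp only: mult.commute)
      then have "g j = h i" using False by (simp only: mult_cancel_left) simp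
      then show ?thesis using inj[OF ij(2,1)] by (simp only: mult.commute)
    qed simp
    then show "(W * dg n l) $$ (i,j) = (dg n m * W) $$ (i,j)"
      using ij W by (simp add: mult_dg_index[of _ n n] dg_mult_index[of _ n n])
  qed (use W in auto)
  then show ?thesis by (simp add: UW)
qed

text \<open>The real exponential is injective, so intertwining passes to logarithms. Uniqueness of
  the matrix logarithm and conservation of energy both rest on this.\<close>

lemma mexp_intertwine:
  assumes "herm n X" "herm n Y" "U \<in> carrier_mat n n" "U * mexp X = mexp Y * U"
  shows "U * X = Y * U"
proof -
  obtain P l where P: "unitary n P" and X: "X = P * dg n (\<lambda>i. complex_of_real (l i)) * adj P"
    using spectral_theorem[OF assms(1)] by blast
  obtain Q m where Q: "unitary n Q" and Y: "Y = Q * dg n (\<lambda>i. complex_of_real (m i)) * adj Q"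
    using spectral_theorem[OF assms(2)] by blast
  show ?thesis unfolding X Y
  proof (rule intertwine_sandwich[OF P Q assms(3)])
    show "U * (P * dg n (\<lambda>i. exp (complex_of_real (l i))) * adj P) = Q * dg n (\<lambda>i. exp (complex_of_real (m i))) * adj Q * U"
      using assms(4) unfolding X Y mexp_sandwich[OF P] mexp_sandwich[OF Q] .
    show "complex_of_real (l i) = complex_of_real (m j)"
      if "exp (complex_of_real (l i)) = exp (complex_of_real (m j))" for i j
      using that unfolding exp_of_real by simp
  qed
qed

text \<open>Two Hermitian logarithms of one matrix are intertwined by the identity, hence equal;
  this makes the definite description in \<open>mlog\<close> proper.\<close>

lemma mlog_mexp:
  assumes "herm n X" shows "mlog n (mexp X) = X"
  unfolding mlog_def
proof (rule the_equality)
  fix Y assume Y: "herm n Y \<and> mexp Y = mexp X"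
  note c = hermD(1)[OF assms] hermD(1)[OF conjunct1[OF Y]]
  have "1\<^sub>m n * mexp Y = mexp X * 1\<^sub>m n"
    using left_mult_one_mat[OF mexp_carrier[OF c(1)]] mult_one_sq[OF mexp_carrier[OF c(1)]] conjunct2[OF Y]
    by simp
  then have "1\<^sub>m n * Y = X * 1\<^sub>m n"
    by (intro mexp_intertwine[OF conjunct1[OF Y] assms one_carrier_mat])
  then show "Y = X" using left_mult_one_mat[OF c(2)] mult_one_sq[OF c(1)] by simp
qed (use assms in auto)

text \<open>The lower bound makes every eigenvalue positive, so the scalar logarithm applies to the
  spectrum.\<close>

lemma positive_definite_log:
  assumes "herm n A" "psd n (A - complex_of_real \<epsilon> \<cdot>\<^sub>m 1\<^sub>m n)" "\<epsilon> > 0"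
  obtains X where "herm n X" "mexp X = A"
proof -
  obtain P l where P: "unitary n P" and A: "A = P * dg n (\<lambda>i. complex_of_real (l i)) * adj P"
    using spectral_theorem[OF assms(1)] by blast
  note p = unitaryD[OF P]
  have "A - complex_of_real \<epsilon> \<cdot>\<^sub>m 1\<^sub>m n = P * dg n (\<lambda>i. complex_of_real (l i) - complex_of_real \<epsilon>) * adj P"
  proof (rule matI[of _ n n])
    fix i j assume ij: "i < n" "j < n"
    have "(A - complex_of_real \<epsilon> \<cdot>\<^sub>m 1\<^sub>m n) $$ (i,j) = A $$ (i,j) - \<epsilon> * (P * dg n (\<lambda>_. 1) * adj P) $$ (i,j)"
      using p ij A by (simp add: dg_one)
    then show "(A - complex_of_real \<epsilon> \<cdot>\<^sub>m 1\<^sub>m n) $$ (i,j) = (P * dg n (\<lambda>i. complex_of_real (l i) - complex_of_real \<epsilon>) * adj P) $$ (i,j)"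
      unfolding A sandwich_dg_index[OF p(1) ij]
      by (simp add: sum_distrib_left sum_subtractf algebra_simps)
  qed (use p A in auto)
  then have "psd n (adj P * (P * dg n (\<lambda>i. complex_of_real (l i) - complex_of_real \<epsilon>) * adj P) * adj (adj P))"
    by - (rule psd_conj; use assms(2) p in auto)
  moreover have eq: "adj P * (P * D * adj P) * adj (adj P) = D" if "D \<in> carrier_mat n n" for D
    using p that by (simp add: assoc_mult_mat[of _ n n _ n _ n] unitary_cancel[OF P])
  ultimately have "psd n (dg n (\<lambda>i. complex_of_real (l i) - complex_of_real \<epsilon>))"
    by (simp only: eq[OF dg_carrier])
  from psd_diag(1)[OF this] assms(3) have pos: "l i > 0" if "i < n" for i
    using that by (force simp: dg_index)
  define X where "X = P * dg n (\<lambda>i. complex_of_real (ln (l i))) * adj P"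
  have "herm n X" unfolding X_def by (rule herm_conj) (use p in \<open>auto simp: herm_def adj_dg\<close>)
  moreover have "mexp X = A"
  proof -
    have "dg n (\<lambda>i. exp (complex_of_real (ln (l i)))) = dg n (\<lambda>i. complex_of_real (l i))"
      by (rule matI[of _ n n]) (auto simp: dg_index exp_of_real pos)
    then show ?thesis unfolding X_def mexp_sandwich[OF P] A by simp
  qed
  ultimately show ?thesis using that by blast
qed

text \<open>The matrix \<open>kron P Q\<close> diagonalises the sum, its eigenvalues are sums of the
  two kinds of eigenvalues, and the exponential of a sum is a product.\<close>

lemma mexp_kron_sum:
  assumes "herm a A" "herm b B"
  shows "mexp (c \<cdot>\<^sub>m (kron A (1\<^sub>m b) + kron (1\<^sub>m a) B)) = kron (mexp (c \<cdot>\<^sub>m A)) (mexp (c \<cdot>\<^sub>m B))"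
proof -
  obtain P l where P: "unitary a P" and A: "A = P * dg a (\<lambda>i. complex_of_real (l i)) * adj P"
    using spectral_theorem[OF assms(1)] by blast
  obtain Q m where Q: "unitary b Q" and B: "B = Q * dg b (\<lambda>i. complex_of_real (m i)) * adj Q"
    using spectral_theorem[OF assms(2)] by blast
  note p = unitaryD[OF P] note q = unitaryD[OF Q]
  let ?R = "kron P Q"
  have R: "unitary (a*b) ?R" by (rule unitary_kron[OF P Q])
  have *: "kron (P * D * adj P) (Q * E * adj Q) = ?R * kron D E * adj ?R"
    if "D \<in> carrier_mat a a" "E \<in> carrier_mat b b" for D E
    using p q that by (simp add: adj_kron[of _ a _ b] kron_mult[of _ a _ b])
  have "kron A (1\<^sub>m b) + kron (1\<^sub>m a) B = ?R * kron (dg a (\<lambda>i. complex_of_real (l i))) (1\<^sub>m b) * adj ?R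
      + ?R * kron (1\<^sub>m a) (dg b (\<lambda>i. complex_of_real (m i))) * adj ?R"
    using *[of "dg a (\<lambda>i. complex_of_real (l i))" "1\<^sub>m b"] *[of "1\<^sub>m a" "dg b (\<lambda>i. complex_of_real (m i))"] p q
    unfolding A B by simp
  also have "\<dots> = ?R * dg (a*b) (\<lambda>n. complex_of_real (l (n div b)) + complex_of_real (m (n mod b))) * adj ?R"
    using unitaryD(1)[OF R] kron_sum_dg[of a "\<lambda>i. complex_of_real (l i)" b "\<lambda>i. complex_of_real (m i)", symmetric]
    by (simp add: mult_add_distrib_mat[of _ "a*b" "a*b" _ "a*b"] add_mult_distrib_mat[of _ "a*b" "a*b" _ _ "a*b"])
  finally show ?thesis
    unfolding A B mexp_smult_sandwich[OF P] mexp_smult_sandwich[OF Q]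
    by (simp add: * kron_dg mexp_smult_sandwich[OF R] distrib_left exp_add)
qed

section \<open>Gibbs states\<close>

lemma gibbs_sandwich:
  assumes "unitary n P" "H = P * dg n (\<lambda>i. complex_of_real (l i)) * adj P"
  shows "gibbs \<beta> H = P * dg n (\<lambda>i. complex_of_real (exp (- \<beta> * l i) / (\<Sum>k<n. exp (- \<beta> * l k)))) * adj P"
proof -
  have e: "mexp (complex_of_real (-\<beta>) \<cdot>\<^sub>m H) = P * dg n (\<lambda>i. complex_of_real (exp (- \<beta> * l i))) * adj P"
    unfolding assms(2) mexp_smult_sandwich[OF assms(1)] by (simp flip: exp_of_real)
  have t: "mtrace (mexp (complex_of_real (-\<beta>) \<cdot>\<^sub>m H)) = complex_of_real (\<Sum>k<n. exp (- \<beta> * l k))"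
    unfolding e mtrace_unitary_conj[OF assms(1) dg_carrier] by (simp add: mtrace_eq[OF dg_carrier] dg_index)
  show ?thesis unfolding gibbs_def t unfolding e smult_sandwich_dg[OF unitaryD(1)[OF assms(1)]]
    by (simp add: divide_simps)
qed

lemma gibbs_partition_pos: "n > 0 \<Longrightarrow> 0 < (\<Sum>k<(n::nat). exp (- \<beta> * l k :: real))"
  by (intro sum_pos) auto

lemma gibbs_state:
  assumes "herm n H" "n > 0"
  shows "psd n (gibbs \<beta> H)" "mtrace (gibbs \<beta> H) = 1" "gibbs \<beta> H * H = H * gibbs \<beta> H"
proof -
  obtain P l where P: "unitary n P" and H: "H = P * dg n (\<lambda>i. complex_of_real (l i)) * adj P"
    using spectral_theorem[OF assms(1)] by blast
  note p = unitaryD[OF P] note g = gibbs_sandwich[OF P H, of \<beta>]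
  note Z = gibbs_partition_pos[OF assms(2), of \<beta> l]
  show "psd n (gibbs \<beta> H)" unfolding g
    by (intro psd_conj psd_dg p divide_nonneg_pos Z) auto
  show "mtrace (gibbs \<beta> H) = 1" unfolding g mtrace_unitary_conj[OF P dg_carrier]
    using Z by (simp add: mtrace_eq[OF dg_carrier] dg_index flip: sum_divide_distrib of_real_sum)
  show "gibbs \<beta> H * H = H * gibbs \<beta> H" unfolding g unfolding H
    by (simp add: mult_sandwich_dg[OF P] mult.commute)
qed

lemma gibbs_carrier [simp]: "H \<in> carrier_mat n n \<Longrightarrow> gibbs \<beta> H \<in> carrier_mat n n"
  by (simp add: gibbs_def)

text \<open>Infinite temperature, reached at the thermal force \<open>bref S\<close>. It is the
  point at which the cycle is compared with its reversal.\<close>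

lemma gibbs_zero:
  assumes "herm n H" shows "gibbs 0 H = complex_of_real (1 / real n) \<cdot>\<^sub>m 1\<^sub>m n"
proof -
  obtain P l where P: "unitary n P" and H: "H = P * dg n (\<lambda>i. complex_of_real (l i)) * adj P"
    using spectral_theorem[OF assms(1)] by blast
  note p = unitaryD[OF P]
  have "gibbs 0 H = P * dg n (\<lambda>i. complex_of_real (1 / real n) * 1) * adj P"
    unfolding gibbs_sandwich[OF P H] by simp
  also have "\<dots> = complex_of_real (1 / real n) \<cdot>\<^sub>m (P * dg n (\<lambda>i. 1) * adj P)"
    by (rule smult_sandwich_dg[symmetric, OF p(1)])
  finally show ?thesis using p by (simp add: dg_one)
qed

lemma gibbs_antiunitary:
  assumes "unitary n \<Theta>" "herm n H" "\<Theta> * cconj H * adj \<Theta> = H"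
  shows "\<Theta> * cconj (gibbs \<beta> H) * adj \<Theta> = gibbs \<beta> H"
proof -
  note t = unitaryD[OF assms(1)] note h = hermD[OF assms(2)]
  let ?E = "mexp (complex_of_real (-\<beta>) \<cdot>\<^sub>m H)"
  have E: "?E \<in> carrier_mat n n" using h by simp
  have e: "\<Theta> * cconj ?E * adj \<Theta> = ?E"
    using mexp_antiunitary[OF assms(1,2), of "complex_of_real (-\<beta>)"] assms(3) by simp
  have "cnj (mtrace ?E) = mtrace ?E"
    using mexp_adj[OF assms(2), of "complex_of_real (-\<beta>)"] mtrace_adj[OF E] by simp
  then have "cconj (gibbs \<beta> H) = (1 / mtrace ?E) \<cdot>\<^sub>m cconj ?E"
    unfolding gibbs_def cconj_smult[OF E] by simp
  then show ?thesis using e t E unfolding gibbs_def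
    by (simp add: mult_smult_distrib[of _ n n _ n] mult_smult_assoc_mat[of _ n n _ n])
qed

lemma smult_cancel:
  fixes c :: complex
  assumes "c \<cdot>\<^sub>m A = c \<cdot>\<^sub>m B" "c \<noteq> 0" "A \<in> carrier_mat n n" "B \<in> carrier_mat n n"
  shows "A = B"
proof (rule matI[OF assms(3,4)])
  fix i j assume "i < n" "j < n"
  then have "c * A $$ (i,j) = c * B $$ (i,j)"
    using smult_index[OF assms(3), of i j c] smult_index[OF assms(4), of i j c] assms(1) by (simp only:)
  then show "A $$ (i,j) = B $$ (i,j)" using assms(2) by simp
qed

text \<open>The logarithm of a product state is additive, so a unitary that fixes the state conserves
  the corresponding total energy.\<close>
lemma gibbs_product_commute:
  assumes "herm a A" "herm b H" "b > 0" "\<beta> \<noteq> 0" "U \<in> carrier_mat (a*b) (a*b)"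
    and "U * kron (mexp (complex_of_real (-\<beta>) \<cdot>\<^sub>m A)) (gibbs \<beta> H)
       = kron (mexp (complex_of_real (-\<beta>) \<cdot>\<^sub>m A)) (gibbs \<beta> H) * U"
  shows "U * (kron A (1\<^sub>m b) + kron (1\<^sub>m a) H) = (kron A (1\<^sub>m b) + kron (1\<^sub>m a) H) * U"
proof -
  let ?n = "a * b" let ?c = "complex_of_real (-\<beta>)"
  let ?X = "kron A (1\<^sub>m b) + kron (1\<^sub>m a) H"
  let ?E = "mexp (?c \<cdot>\<^sub>m H)"
  have X: "herm ?n ?X" using assms(1,2) by (intro herm_add herm_kron) auto
  note x = hermD[OF X] note h = hermD[OF assms(2)] note aa = hermD[OF assms(1)]
  \<comment> \<open>With total division, a vanishing partition function would give a Gibbs matrix of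
    trace 0 instead of 1.\<close>
  have nz: "mtrace ?E \<noteq> 0"
  proof
    assume "mtrace ?E = 0"
    then have "mtrace (gibbs \<beta> H) = 0" using h by (simp add: gibbs_def mtrace_smult[of _ b])
    then show False using gibbs_state(2)[OF assms(2,3)] by simp
  qed
  have k: "kron (mexp (?c \<cdot>\<^sub>m A)) (gibbs \<beta> H) = (1 / mtrace ?E) \<cdot>\<^sub>m mexp (?c \<cdot>\<^sub>m ?X)"
    unfolding mexp_kron_sum[OF assms(1,2)] gibbs_def using aa h by (intro kron_smult_right[of _ a _ b]) auto
  have m: "mexp (?c \<cdot>\<^sub>m ?X) \<in> carrier_mat ?n ?n" using x by simp
  have eq: "(1 / mtrace ?E) \<cdot>\<^sub>m (U * mexp (?c \<cdot>\<^sub>m ?X)) = (1 / mtrace ?E) \<cdot>\<^sub>m (mexp (?c \<cdot>\<^sub>m ?X) * U)"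
    using assms(6) unfolding k mult_smult_distrib[OF assms(5) m] mult_smult_assoc_mat[OF m assms(5)] .
  have "1 / mtrace ?E \<noteq> 0" using nz by simp
  note comm = smult_cancel[OF eq this mult_carrier_sq[OF assms(5) m] mult_carrier_sq[OF m assms(5)]]
  have "U * (?c \<cdot>\<^sub>m ?X) = (?c \<cdot>\<^sub>m ?X) * U"
    by (intro mexp_intertwine[OF herm_smult[OF X] herm_smult[OF X] assms(5)] comm)
  then have eq': "?c \<cdot>\<^sub>m (U * ?X) = ?c \<cdot>\<^sub>m (?X * U)"
    unfolding mult_smult_distrib[OF assms(5) x(1)] mult_smult_assoc_mat[OF x(1) assms(5)] .
  have "?c \<noteq> 0" using assms(4) by simp
  from smult_cancel[OF eq' this mult_carrier_sq[OF assms(5) x(1)] mult_carrier_sq[OF x(1) assms(5)]]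
  show ?thesis .
qed

section \<open>Linear maps on matrices\<close>

definition linop :: "nat \<Rightarrow> (complex mat \<Rightarrow> complex mat) \<Rightarrow> bool" where
  "linop d L \<longleftrightarrow> (\<forall>A\<in>carrier_mat d d. L A \<in> carrier_mat d d) \<and>
     (\<forall>A\<in>carrier_mat d d. \<forall>B\<in>carrier_mat d d. L (A + B) = L A + L B) \<and>
     (\<forall>A\<in>carrier_mat d d. \<forall>c. L (c \<cdot>\<^sub>m A) = c \<cdot>\<^sub>m L A)"

lemma linop_carrier: "linop d L \<Longrightarrow> A \<in> carrier_mat d d \<Longrightarrow> L A \<in> carrier_mat d d"
  and linop_add: "linop d L \<Longrightarrow> A \<in> carrier_mat d d \<Longrightarrow> B \<in> carrier_mat d d \<Longrightarrow> L (A + B) = L A + L B"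
  and linop_smult: "linop d L \<Longrightarrow> A \<in> carrier_mat d d \<Longrightarrow> L (c \<cdot>\<^sub>m A) = c \<cdot>\<^sub>m L A"
  by (auto simp: linop_def)

lemma minus_eq_add_smult:
  fixes A :: "complex mat"
  shows "A \<in> carrier_mat n n \<Longrightarrow> B \<in> carrier_mat n n \<Longrightarrow> A - B = A + (-1) \<cdot>\<^sub>m B"
  by (rule matI[of _ n n]) auto

lemma linop_minus: "linop d L \<Longrightarrow> A \<in> carrier_mat d d \<Longrightarrow> B \<in> carrier_mat d d \<Longrightarrow> L (A - B) = L A - L B"
  by (simp add: minus_eq_add_smult[of _ d] linop_add linop_smult linop_carrier)

lemma linop_id: "linop d (\<lambda>X. X)"
  by (simp add: linop_def)

lemma linop_comp: "linop d L \<Longrightarrow> linop d K \<Longrightarrow> linop d (\<lambda>A. L (K A))"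
  by (simp add: linop_def)

lemma linop_funpow: "linop d L \<Longrightarrow> linop d (L ^^ n)"
  by (induction n) (auto intro: linop_comp simp: linop_def)

lemma linop_fold: "(\<And>x. x \<in> set xs \<Longrightarrow> linop d (f x)) \<Longrightarrow> linop d (fold f xs)"
  by (induction xs) (auto simp: linop_def)

lemma linop_foldr: "(\<And>x. x \<in> set xs \<Longrightarrow> linop d (f x)) \<Longrightarrow> linop d (foldr f xs)"
  by (induction xs) (auto simp: linop_def)

lemma linop_plus: "linop d L \<Longrightarrow> linop d K \<Longrightarrow> linop d (\<lambda>A. L A + K A)"
  unfolding linop_def
  apply (intro conjI ballI allI)
    apply simp
  subgoal for A B by (rule matI[of _ d d]) (auto simp: mat_op_index[of _ d d])
  subgoal for A c by (rule matI[of _ d d]) (auto simp: mat_op_index[of _ d d] smult_index[of _ d d] algebra_simps)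
  done

lemma linop_scale:
  assumes "linop d L" shows "linop d (\<lambda>A. c \<cdot>\<^sub>m L A)"
  unfolding linop_def
proof (intro conjI ballI allI)
  fix A B :: "complex mat" and b assume A: "A \<in> carrier_mat d d" "B \<in> carrier_mat d d"
  show "c \<cdot>\<^sub>m L A \<in> carrier_mat d d" using linop_carrier[OF assms A(1)] by simp
  show "c \<cdot>\<^sub>m L (A + B) = c \<cdot>\<^sub>m L A + c \<cdot>\<^sub>m L B"
    using linop_carrier[OF assms A(1)] linop_carrier[OF assms A(2)] linop_add[OF assms A]
    by (intro matI[of _ d d]) (auto simp: algebra_simps)
  show "c \<cdot>\<^sub>m L (b \<cdot>\<^sub>m A) = b \<cdot>\<^sub>m (c \<cdot>\<^sub>m L A)"
    using linop_carrier[OF assms A(1)] linop_smult[OF assms A(1)]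
    by (intro matI[of _ d d]) (auto simp: algebra_simps)
qed

lemma msum_snoc: "msum d f (xs @ [x]) = msum d f xs + f x"
  by (simp add: msum_def)

lemma msum_Nil [simp]: "msum d f [] = 0\<^sub>m d d"
  by (simp add: msum_def)

lemma msum_carrier: "(\<And>x. x \<in> set xs \<Longrightarrow> f x \<in> carrier_mat d d) \<Longrightarrow> msum d f xs \<in> carrier_mat d d"
  by (induction xs rule: rev_induct) (auto simp: msum_snoc)

lemma msum_index:
  "(\<And>x. x \<in> set xs \<Longrightarrow> f x \<in> carrier_mat d d) \<Longrightarrow> i < d \<Longrightarrow> j < d \<Longrightarrow>
    msum d f xs $$ (i,j) = (\<Sum>x\<leftarrow>xs. f x $$ (i,j))"
proof (induction xs rule: rev_induct)
  case (snoc x xs)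
  have "msum d f xs \<in> carrier_mat d d" "f x \<in> carrier_mat d d" using snoc(2) by (auto intro: msum_carrier)
  then show ?case using snoc by (simp add: msum_snoc mat_op_index[of _ d d])
qed simp

lemma linop_msum:
  "(\<And>x. x \<in> set xs \<Longrightarrow> linop d (f x)) \<Longrightarrow> linop d (\<lambda>A. msum d (\<lambda>x. f x A) xs)"
proof (induction xs rule: rev_induct)
  case Nil
  show ?case by (auto simp: linop_def intro!: matI[of _ d d])
qed (simp add: msum_snoc linop_plus)

text \<open>Positive trace-preserving maps. Compositions, powers and averages of steps stay in this
  class, and the contraction argument takes place in it.\<close>

definition channel :: "nat \<Rightarrow> (complex mat \<Rightarrow> complex mat) \<Rightarrow> bool" where
  "channel d L \<longleftrightarrow> linop d L \<and> (\<forall>A. psd d A \<longrightarrow> psd d (L A)) \<and>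
     (\<forall>A\<in>carrier_mat d d. mtrace (L A) = mtrace A)"

lemma channelD:
  "channel d L \<Longrightarrow> linop d L"
  "channel d L \<Longrightarrow> psd d A \<Longrightarrow> psd d (L A)"
  "channel d L \<Longrightarrow> A \<in> carrier_mat d d \<Longrightarrow> mtrace (L A) = mtrace A"
  by (auto simp: channel_def)

lemma channel_id: "channel d (\<lambda>X. X)"
  by (simp add: channel_def linop_id)

lemma channel_comp:
  assumes "channel d L" "channel d K" shows "channel d (\<lambda>A. L (K A))"
  unfolding channel_def
proof (intro conjI allI impI ballI)
  show "linop d (\<lambda>A. L (K A))" by (rule linop_comp[OF channelD(1)[OF assms(1)] channelD(1)[OF assms(2)]])
  show "psd d (L (K A))" if "psd d A" for A
    by (rule channelD(2)[OF assms(1) channelD(2)[OF assms(2) that]])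
  show "mtrace (L (K A)) = mtrace A" if "A \<in> carrier_mat d d" for A
    using channelD(3)[OF assms(1) linop_carrier[OF channelD(1)[OF assms(2)] that]] channelD(3)[OF assms(2) that]
    by simp
qed

lemma channel_fold: "(\<And>x. x \<in> set xs \<Longrightarrow> channel d (f x)) \<Longrightarrow> channel d (fold f xs)"
proof (induction xs)
  case Nil
  show ?case unfolding fold.simps id_def by (rule channel_id)
next
  case (Cons x xs)
  have "channel d (\<lambda>A. fold f xs (f x A))"
    by (rule channel_comp[OF Cons.IH Cons.prems]) (use Cons.prems in auto)
  then show ?case unfolding fold.simps comp_def .
qed

lemma channel_funpow: "channel d L \<Longrightarrow> channel d (L ^^ n)"
proof (induction n)
  case 0
  show ?case unfolding funpow.simps id_def by (rule channel_id)
next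
  case (Suc n)
  have "channel d (\<lambda>A. L ((L ^^ n) A))"
    by (rule channel_comp[OF Suc.prems Suc.IH[OF Suc.prems]])
  then show ?case unfolding funpow.simps comp_def .
qed

lemma psd_zero [simp]: "psd d (0\<^sub>m d d)"
proof -
  have "complex_of_real 0 \<cdot>\<^sub>m 1\<^sub>m d = (0\<^sub>m d d :: complex mat)"
    by (intro matI[of _ d d]) auto
  then show ?thesis using psd_smult[OF psd_one[of d], of 0] by (simp del: of_real_0)
qed

lemma psd_msum: "(\<And>x. x \<in> set xs \<Longrightarrow> psd d (f x)) \<Longrightarrow> psd d (msum d f xs)"
  by (induction xs rule: rev_induct) (auto simp: msum_snoc intro: psd_add)

lemma channel_average:
  assumes "\<And>x. x \<in> set xs \<Longrightarrow> channel d (f x)" "xs \<noteq> []"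
  shows "channel d (\<lambda>A. complex_of_real (1 / real (length xs)) \<cdot>\<^sub>m msum d (\<lambda>x. f x A) xs)"
  unfolding channel_def
proof (intro conjI allI impI ballI)
  have lin: "linop d (\<lambda>A. msum d (\<lambda>x. f x A) xs)"
    using assms(1) by (intro linop_msum channelD(1))
  then show "linop d (\<lambda>A. complex_of_real (1 / real (length xs)) \<cdot>\<^sub>m msum d (\<lambda>x. f x A) xs)"
    by (rule linop_scale)
  show "psd d (complex_of_real (1 / real (length xs)) \<cdot>\<^sub>m msum d (\<lambda>x. f x A) xs)" if "psd d A" for A
    by (rule psd_smult, rule psd_msum, rule channelD(2)[OF assms(1) that]) auto
  fix A :: "complex mat" assume A: "A \<in> carrier_mat d d"
  have "mtrace (msum d (\<lambda>x. f x A) ys) = of_nat (length ys) * mtrace A" if "set ys \<subseteq> set xs" for ys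
    using that
  proof (induction ys rule: rev_induct)
    case (snoc y ys)
    have "msum d (\<lambda>x. f x A) ys \<in> carrier_mat d d" "f y A \<in> carrier_mat d d"
      using snoc.prems linop_carrier[OF channelD(1)[OF assms(1)] A] by (auto intro!: msum_carrier)
    then show ?case using snoc channelD(3)[OF assms(1) A]
      by (simp add: msum_snoc mtrace_add[of _ d] algebra_simps)
  qed (simp add: mtrace_def)
  then show "mtrace (complex_of_real (1 / real (length xs)) \<cdot>\<^sub>m msum d (\<lambda>x. f x A) xs) = mtrace A"
    using assms(2) linop_carrier[OF lin A] by (simp add: mtrace_smult[of _ d])
qed

section \<open>Mixing\<close>

text \<open>A Doeblin minorisation: some power raises every positive \<open>A\<close> above a fixed
  multiple of its trace times the identity. It is phrased in the order of matrices alone, so it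
  passes to every channel that dominates.\<close>

definition mixing :: "nat \<Rightarrow> (complex mat \<Rightarrow> complex mat) \<Rightarrow> bool" where
  "mixing d L \<longleftrightarrow> (\<exists>n\<ge>1. \<exists>\<epsilon>>0. \<forall>A. psd d A \<longrightarrow>
     psd d ((L ^^ n) A - complex_of_real (\<epsilon> * Re (mtrace A)) \<cdot>\<^sub>m 1\<^sub>m d))"

text \<open>Doeblin's argument in the base norm: subtracting the common part from both terms of
  \<open>A - B\<close> with equal traces contracts the traces.\<close>
lemma mixing_step:
  assumes L: "channel d L" and d: "d > 0" and "mixing d L"
  obtains n r where "n \<ge> 1" "0 \<le> r" "r < 1"
    "\<And>A B t. psd d A \<Longrightarrow> psd d B \<Longrightarrow> mtrace A = complex_of_real t \<Longrightarrow> mtrace B = complex_of_real t \<Longrightarrow>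
      \<exists>A' B'. psd d A' \<and> psd d B' \<and> mtrace A' = complex_of_real (r * t) \<and> mtrace B' = complex_of_real (r * t) \<and>
        (L ^^ n) (A - B) = A' - B'"
proof -
  obtain n \<epsilon> where n: "n \<ge> 1" and e: "\<epsilon> > 0" and
    E: "\<And>A. psd d A \<Longrightarrow> psd d ((L ^^ n) A - complex_of_real (\<epsilon> * Re (mtrace A)) \<cdot>\<^sub>m 1\<^sub>m d)"
    using assms(3) unfolding mixing_def by blast
  note Ln = channel_funpow[OF L, of n]
  \<comment> \<open>The subtraction takes \<open>\<epsilon>\<close> times the trace of the identity,
    that is \<open>\<epsilon> * d\<close>, from each unit of trace.\<close>
  define r where "r = 1 - \<epsilon> * real d"
  have T: "mtrace ((L ^^ n) A - complex_of_real (\<epsilon> * Re (mtrace A)) \<cdot>\<^sub>m 1\<^sub>m d) = complex_of_real (r * t)"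
    if "psd d A" "mtrace A = complex_of_real t" for A t
    using that linop_carrier[OF channelD(1)[OF Ln] psdD(2)[OF that(1)]]
    by (simp add: mtrace_minus[of _ d] mtrace_smult[of _ d] mtrace_one channelD(3)[OF Ln psdD(2)[OF that(1)]] r_def algebra_simps)
  \<comment> \<open>Tested on the maximally mixed state: what remains after the subtraction is
    positive and has trace \<open>r\<close>.\<close>
  have "r \<ge> 0"
  proof -
    define A where "A = complex_of_real (1 / real d) \<cdot>\<^sub>m 1\<^sub>m d"
    have A: "psd d A" unfolding A_def by (intro psd_smult) auto
    have "mtrace A = complex_of_real 1" using d by (simp add: A_def mtrace_smult[of _ d] mtrace_one)
    from T[OF A this] psd_trace_nonneg(1)[OF E[OF A]] show ?thesis by simp
  qed
  moreover have "r < 1" using d e by (simp add: r_def)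
  moreover have "\<exists>A' B'. psd d A' \<and> psd d B' \<and> mtrace A' = complex_of_real (r * t) \<and> mtrace B' = complex_of_real (r * t) \<and>
        (L ^^ n) (A - B) = A' - B'"
    if AB: "psd d A" "psd d B" and t: "mtrace A = complex_of_real t" "mtrace B = complex_of_real t" for A B t
  proof (intro exI conjI)
    show "psd d ((L ^^ n) A - complex_of_real (\<epsilon> * Re (mtrace A)) \<cdot>\<^sub>m 1\<^sub>m d)"
      "psd d ((L ^^ n) B - complex_of_real (\<epsilon> * Re (mtrace B)) \<cdot>\<^sub>m 1\<^sub>m d)"
      using E AB by auto
    show "mtrace ((L ^^ n) A - complex_of_real (\<epsilon> * Re (mtrace A)) \<cdot>\<^sub>m 1\<^sub>m d) = complex_of_real (r * t)"
      "mtrace ((L ^^ n) B - complex_of_real (\<epsilon> * Re (mtrace B)) \<cdot>\<^sub>m 1\<^sub>m d) = complex_of_real (r * t)"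
      using T AB t by auto
    note c = linop_carrier[OF channelD(1)[OF Ln] psdD(2)[OF AB(1)]] linop_carrier[OF channelD(1)[OF Ln] psdD(2)[OF AB(2)]]
    show "(L ^^ n) (A - B) = (L ^^ n) A - complex_of_real (\<epsilon> * Re (mtrace A)) \<cdot>\<^sub>m 1\<^sub>m d -
        ((L ^^ n) B - complex_of_real (\<epsilon> * Re (mtrace B)) \<cdot>\<^sub>m 1\<^sub>m d)"
      using c unfolding linop_minus[OF channelD(1)[OF Ln] psdD(2)[OF AB(1)] psdD(2)[OF AB(2)]] t
      by (intro matI[of _ d d]) auto
  qed
  ultimately show ?thesis using that n by blast
qed

text \<open>Write \<open>N\<close> as \<open>n * (N div n)\<close> plus a remainder. Each full block
  multiplies the traces by \<open>r\<close>, the remainder preserves them, and traces bound entries,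
  so the decay is geometric in \<open>N div n\<close>.\<close>

lemma mixing_decay_psd:
  assumes L: "channel d L" and d: "d > 0" and mix: "mixing d L"
    and AB: "psd d A" "psd d B" "mtrace A = mtrace B" and ij: "i < d" "j < d"
  shows "(\<lambda>N. (L ^^ N) (A - B) $$ (i,j)) \<longlonglongrightarrow> 0"
proof -
  obtain n r where n: "n \<ge> 1" and r: "0 \<le> r" "r < 1" and
    step: "\<And>A B t. psd d A \<Longrightarrow> psd d B \<Longrightarrow> mtrace A = complex_of_real t \<Longrightarrow> mtrace B = complex_of_real t \<Longrightarrow>
      \<exists>A' B'. psd d A' \<and> psd d B' \<and> mtrace A' = complex_of_real (r * t) \<and> mtrace B' = complex_of_real (r * t) \<and>
        (L ^^ n) (A - B) = A' - B'"
    using mixing_step[OF L d mix] by metis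
  define t where "t = Re (mtrace A)"
  have tA: "mtrace A = complex_of_real t" "mtrace B = complex_of_real t"
    using psd_trace_nonneg(2)[OF AB(1)] AB(3) by (auto simp: t_def complex_eq_iff)
  have iter: "\<exists>A' B'. psd d A' \<and> psd d B' \<and> mtrace A' = complex_of_real (r ^ k * t) \<and> mtrace B' = complex_of_real (r ^ k * t) \<and>
        (L ^^ (n * k)) (A - B) = A' - B'" for k
  proof (induction k)
    case 0
    show ?case using AB tA by (intro exI[of _ A] exI[of _ B]) auto
  next
    case (Suc k)
    then obtain A' B' where *: "psd d A'" "psd d B'" "mtrace A' = complex_of_real (r ^ k * t)" "mtrace B' = complex_of_real (r ^ k * t)"
      "(L ^^ (n * k)) (A - B) = A' - B'" by blast
    have "(L ^^ (n * Suc k)) (A - B) = (L ^^ n) ((L ^^ (n * k)) (A - B))"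
      by (simp add: funpow_add)
    then show ?case using step[OF *(1-4)] *(5) by (simp add: mult.assoc)
  qed
  have bound: "cmod ((L ^^ N) (A - B) $$ (i,j)) \<le> 2 * t * r ^ (N div n)" for N
  proof -
    obtain A' B' where *: "psd d A'" "psd d B'" "mtrace A' = complex_of_real (r ^ (N div n) * t)" "mtrace B' = complex_of_real (r ^ (N div n) * t)"
      "(L ^^ (n * (N div n))) (A - B) = A' - B'" using iter by blast
    define K where "K = L ^^ (N mod n)"
    have K: "channel d K" unfolding K_def by (rule channel_funpow[OF L])
    have "(L ^^ N) (A - B) = K ((L ^^ (n * (N div n))) (A - B))"
      unfolding K_def by (metis funpow_add comp_apply mod_mult_div_eq)
    also have "\<dots> = K A' - K B'" unfolding *(5) by (rule linop_minus[OF channelD(1)[OF K] psdD(2)[OF *(1)] psdD(2)[OF *(2)]])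
    finally have eq: "(L ^^ N) (A - B) = K A' - K B'" .
    have psd: "psd d (K A')" "psd d (K B')" using K * channelD(2) by auto
    have "cmod ((L ^^ N) (A - B) $$ (i,j)) \<le> cmod (K A' $$ (i,j)) + cmod (K B' $$ (i,j))"
      unfolding eq using psdD(2)[OF psd(1)] psdD(2)[OF psd(2)] ij
      by (simp add: mat_op_index[of _ d d] norm_triangle_ineq4)
    also have "\<dots> \<le> Re (mtrace (K A')) + Re (mtrace (K B'))"
      using psd_entry_le[OF psd(1) ij] psd_entry_le[OF psd(2) ij] by simp
    also have "\<dots> = 2 * t * r ^ (N div n)"
      using channelD(3)[OF K psdD(2)[OF *(1)]] channelD(3)[OF K psdD(2)[OF *(2)]] *(3,4) by simp
    finally show ?thesis .
  qed
  have "filterlim (\<lambda>N. N div n) sequentially sequentially"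
    unfolding filterlim_at_top
  proof
    fix Z
    show "\<forall>\<^sub>F N in sequentially. Z \<le> N div n"
      using n by (intro eventually_sequentiallyI[of "Z * n"]) (simp add: less_eq_div_iff_mult_less_eq)
  qed
  then have "(\<lambda>N. r ^ (N div n)) \<longlonglongrightarrow> 0"
    using filterlim_compose[OF LIMSEQ_power_zero[of r]] r by simp
  then have "(\<lambda>N. 2 * t * r ^ (N div n)) \<longlonglongrightarrow> 0"
    by (rule tendsto_mult_right_zero)
  with always_eventually[OF allI[OF bound]] show ?thesis by (rule Lim_null_comparison)
qed

text \<open>The Hermitian parts (X + adj X)/2 and (X - adj X)/(2i); the factors
  \<open>- \<i>\<close> and \<open>\<i>\<close> in the second avoid a division by
  \<open>\<i>\<close>.\<close>

lemma complex_mat_decomp: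
  assumes "X \<in> carrier_mat d d"
  shows "X = (complex_of_real (1/2) \<cdot>\<^sub>m (X + adj X)) + \<i> \<cdot>\<^sub>m (complex_of_real (1/2) \<cdot>\<^sub>m ((- \<i>) \<cdot>\<^sub>m X + \<i> \<cdot>\<^sub>m adj X))"
    "herm d (complex_of_real (1/2) \<cdot>\<^sub>m (X + adj X))"
    "herm d (complex_of_real (1/2) \<cdot>\<^sub>m ((- \<i>) \<cdot>\<^sub>m X + \<i> \<cdot>\<^sub>m adj X))"
proof -
  have a: "adj X \<in> carrier_mat d d" using assms by simp
  show "X = (complex_of_real (1/2) \<cdot>\<^sub>m (X + adj X)) + \<i> \<cdot>\<^sub>m (complex_of_real (1/2) \<cdot>\<^sub>m ((- \<i>) \<cdot>\<^sub>m X + \<i> \<cdot>\<^sub>m adj X))"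
    by (rule matI[of _ d d]) (use assms a in \<open>auto simp: mat_op_index[of _ d d] smult_index[of _ d d] field_simps\<close>)
  show "herm d (complex_of_real (1/2) \<cdot>\<^sub>m (X + adj X))"
    using assms a by (intro herm_smult) (auto simp: herm_def adj_add[of _ d d] comm_add_mat[of _ d d])
  show "herm d (complex_of_real (1/2) \<cdot>\<^sub>m ((- \<i>) \<cdot>\<^sub>m X + \<i> \<cdot>\<^sub>m adj X))"
    using assms a by (intro herm_smult) (auto simp: herm_def adj_add[of _ d d] adj_smult[of _ d d] comm_add_mat[of _ d d])
qed

text \<open>Since \<open>Y\<close> is traceless, its shift by a multiple of the identity has the
  same trace as that multiple, and their difference falls under the positive case.\<close>

lemma mixing_decay_herm:
  assumes L: "channel d L" and d: "d > 0" and mix: "mixing d L"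
    and Y: "herm d Y" "mtrace Y = 0" and ij: "i < d" "j < d"
  shows "(\<lambda>N. (L ^^ N) Y $$ (i,j)) \<longlonglongrightarrow> 0"
proof -
  obtain c where c: "c \<ge> 0" "psd d (Y + complex_of_real c \<cdot>\<^sub>m 1\<^sub>m d)"
    using herm_plus_scalar_psd[OF Y(1)] by blast
  have eq: "Y = (Y + complex_of_real c \<cdot>\<^sub>m 1\<^sub>m d) - complex_of_real c \<cdot>\<^sub>m 1\<^sub>m d"
    by (rule matI[of _ d d]) (use hermD(1)[OF Y(1)] in auto)
  have p: "psd d (complex_of_real c \<cdot>\<^sub>m 1\<^sub>m d)" by (intro psd_smult c) simp
  have "mtrace (Y + complex_of_real c \<cdot>\<^sub>m 1\<^sub>m d) = mtrace (complex_of_real c \<cdot>\<^sub>m 1\<^sub>m d)"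
    using hermD(1)[OF Y(1)] Y(2) by (simp add: mtrace_add[of _ d])
  from mixing_decay_psd[OF L d mix c(2) p this ij] show ?thesis unfolding eq[symmetric] .
qed

lemma mixing_decay:
  assumes L: "channel d L" and d: "d > 0" and mix: "mixing d L"
    and X: "X \<in> carrier_mat d d" "mtrace X = 0" and ij: "i < d" "j < d"
  shows "(\<lambda>N. (L ^^ N) X $$ (i,j)) \<longlonglongrightarrow> 0"
proof -
  define Y where "Y = complex_of_real (1/2) \<cdot>\<^sub>m (X + adj X)"
  define Z where "Z = complex_of_real (1/2) \<cdot>\<^sub>m ((- \<i>) \<cdot>\<^sub>m X + \<i> \<cdot>\<^sub>m adj X)"
  note D = complex_mat_decomp[OF X(1), folded Y_def Z_def]
  note c = hermD(1)[OF D(2)] hermD(1)[OF D(3)]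
  have a: "adj X \<in> carrier_mat d d" "mtrace (adj X) = 0" using X by (auto simp: mtrace_adj[of _ d])
  have t: "mtrace Y = 0" "mtrace Z = 0"
    unfolding Y_def Z_def using X a by (simp_all add: mtrace_smult[of _ d] mtrace_add[of _ d])
  have eq: "(L ^^ N) X $$ (i,j) = (L ^^ N) Y $$ (i,j) + \<i> * (L ^^ N) Z $$ (i,j)" for N
  proof -
    note l = channelD(1)[OF channel_funpow[OF L, of N]]
    have "(L ^^ N) X = (L ^^ N) Y + \<i> \<cdot>\<^sub>m (L ^^ N) Z"
      by (subst D(1)) (simp add: linop_add[OF l] linop_smult[OF l] c)
    then show ?thesis using linop_carrier[OF l c(1)] linop_carrier[OF l c(2)] ij by simp
  qed
  have "(\<lambda>N. (L ^^ N) Y $$ (i,j) + \<i> * (L ^^ N) Z $$ (i,j)) \<longlonglongrightarrow> 0 + \<i> * 0"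
    using mixing_decay_herm[OF L d mix D(2) t(1) ij] mixing_decay_herm[OF L d mix D(3) t(2) ij]
    by (intro tendsto_intros)
  then show ?thesis unfolding eq by simp
qed

section \<open>Inverting linear maps on matrices\<close>

text \<open>Matrix units numbered by the single index \<open>i * d + j\<close>, the flattening in
  which a map on matrices becomes an ordinary matrix.\<close>

definition unit_mat :: "nat \<Rightarrow> nat \<Rightarrow> complex mat" where
  "unit_mat d n = Matrix.mat d d (\<lambda>(i,j). if i * d + j = n then 1 else 0)"

lemma unit_mat_carrier [simp]: "unit_mat d n \<in> carrier_mat d d"
  by (simp add: unit_mat_def)

text \<open>Additivity is given for two summands, so the entries of \<open>X\<close> are switched on
  one at a time: \<open>Y k\<close> keeps the first \<open>k\<close> of them.\<close>

lemma linop_expand: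
  assumes N: "linop d N" and X: "X \<in> carrier_mat d d" and ij: "i < d" "j < d"
  shows "N X $$ (i,j) = (\<Sum>n<d*d. N (unit_mat d n) $$ (i,j) * X $$ (n div d, n mod d))"
proof -
  define Y where "Y k = Matrix.mat d d (\<lambda>(i,j). if i * d + j < k then X $$ (i,j) else 0)" for k
  have Yc: "Y k \<in> carrier_mat d d" for k by (simp add: Y_def)
  have "N (Y k) $$ (i,j) = (\<Sum>n<k. N (unit_mat d n) $$ (i,j) * X $$ (n div d, n mod d))" if "k \<le> d * d" for k
    using that
  proof (induction k)
    case 0
    have "Y 0 = 0 \<cdot>\<^sub>m Y 0" by (rule matI[of _ d d]) (auto simp: Y_def)
    then have "N (Y 0) = 0 \<cdot>\<^sub>m N (Y 0)" using linop_smult[OF N Yc] by metis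
    then have "N (Y 0) $$ (i,j) = (0 \<cdot>\<^sub>m N (Y 0)) $$ (i,j)" by simp
    also have "\<dots> = 0" using smult_index[OF linop_carrier[OF N Yc] ij, of 0 0] by simp
    finally show ?case by simp
  next
    case (Suc k)
    have "Y (Suc k) = Y k + X $$ (k div d, k mod d) \<cdot>\<^sub>m unit_mat d k"
      by (rule matI[of _ d d]) (auto simp: Y_def unit_mat_def less_Suc_eq)
    then have "N (Y (Suc k)) = N (Y k) + X $$ (k div d, k mod d) \<cdot>\<^sub>m N (unit_mat d k)"
      by (simp add: linop_add[OF N] linop_smult[OF N] Yc)
    then show ?case using Suc linop_carrier[OF N Yc[of k]] linop_carrier[OF N unit_mat_carrier[of d k]] ij
      by (simp add: mat_op_index[of _ d d] smult_index[of _ d d] mult.commute)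
  qed
  moreover have "Y (d * d) = X"
    by (rule matI[of _ d d]) (use X in \<open>auto simp: Y_def prod_index_less\<close>)
  ultimately show ?thesis by force
qed

definition super_mat :: "nat \<Rightarrow> (complex mat \<Rightarrow> complex mat) \<Rightarrow> complex mat" where
  "super_mat d N = Matrix.mat (d*d) (d*d) (\<lambda>(m,n). N (unit_mat d n) $$ (m div d, m mod d))"

lemma super_mat_carrier [simp]: "super_mat d N \<in> carrier_mat (d*d) (d*d)"
  by (simp add: super_mat_def)

text \<open>The inverse of a linear map by Cramer's rule.\<close>
definition linop_inv :: "nat \<Rightarrow> (complex mat \<Rightarrow> complex mat) \<Rightarrow> complex mat \<Rightarrow> complex mat" where
  "linop_inv d N B = Matrix.mat d d (\<lambda>(i,j).
     (\<Sum>n<d*d. adj_mat (super_mat d N) $$ (i * d + j, n) * B $$ (n div d, n mod d)) * inverse (det (super_mat d N)))"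

lemma linop_inv_carrier [simp]: "linop_inv d N B \<in> carrier_mat d d"
  by (simp add: linop_inv_def)

lemma div_mod_less: "n < d * d \<Longrightarrow> n div d < d \<and> n mod d < (d::nat)"
  by (cases "d = 0") (auto simp: less_mult_imp_div_less)

text \<open>A kernel vector of the flattened map, folded back into a \<open>d\<close> by
  \<open>d\<close> matrix, lies in the kernel of \<open>N\<close>.\<close>

lemma super_mat_det:
  assumes N: "linop d N" and inj: "\<And>X. X \<in> carrier_mat d d \<Longrightarrow> N X = 0\<^sub>m d d \<Longrightarrow> X = 0\<^sub>m d d"
  shows "det (super_mat d N) \<noteq> 0"
proof
  assume "det (super_mat d N) = 0"
  then obtain v where v: "v \<in> carrier_vec (d*d)" "v \<noteq> 0\<^sub>v (d*d)" "super_mat d N *\<^sub>v v = 0\<^sub>v (d*d)"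
    using det_0_iff_vec_prod_zero[OF super_mat_carrier] by blast
  define X where "X = Matrix.mat d d (\<lambda>(i,j). vec_index v (i * d + j))"
  have X: "X \<in> carrier_mat d d" by (simp add: X_def)
  have Xn: "X $$ (n div d, n mod d) = vec_index v n" if "n < d * d" for n
    using div_mod_less[OF that] by (simp add: X_def)
  have "N X = 0\<^sub>m d d"
  proof (rule matI[of _ d d])
    fix i j assume ij: "i < d" "j < d"
    have "N X $$ (i,j) = (\<Sum>n<d*d. super_mat d N $$ (i*d+j,n) * vec_index v n)"
      unfolding linop_expand[OF N X ij]
      using ij by (intro sum.cong refl) (simp add: super_mat_def prod_index_less Xn)
    also have "\<dots> = vec_index (super_mat d N *\<^sub>v v) (i*d+j)"
      using v(1) carrier_matD[OF super_mat_carrier[of d N]] prod_index_less[OF ij]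
      by (simp add: scalar_prod_def atLeast0LessThan)
    finally show "N X $$ (i,j) = 0\<^sub>m d d $$ (i,j)" using ij v(3) by (simp add: prod_index_less)
  qed (use linop_carrier[OF N X] in auto)
  from inj[OF X this] have "vec_index v n = 0" if "n < d * d" for n
    using Xn[OF that] div_mod_less[OF that] by simp
  then have "v = 0\<^sub>v (d*d)" using v(1) by auto
  then show False using v(2) by simp
qed

text \<open>A matrix times its adjugate is its determinant times the identity.\<close>

lemma linop_inv_right:
  assumes N: "linop d N" and inj: "\<And>X. X \<in> carrier_mat d d \<Longrightarrow> N X = 0\<^sub>m d d \<Longrightarrow> X = 0\<^sub>m d d"
    and B: "B \<in> carrier_mat d d"
  shows "N (linop_inv d N B) = B"
proof (rule matI[of _ d d])
  let ?S = "super_mat d N"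
  fix i j assume ij: "i < d" "j < d"
  note adjm = adj_mat[OF super_mat_carrier[of d N]]
  have "N (linop_inv d N B) $$ (i,j) = (\<Sum>m<d*d. ?S $$ (i*d+j,m) *
      ((\<Sum>n<d*d. adj_mat ?S $$ (m,n) * B $$ (n div d, n mod d)) * inverse (det ?S)))"
    unfolding linop_expand[OF N linop_inv_carrier ij]
    using ij div_mod_less by (intro sum.cong refl) (simp add: super_mat_def linop_inv_def prod_index_less)
  also have "\<dots> = (\<Sum>n<d*d. (\<Sum>m<d*d. ?S $$ (i*d+j,m) * adj_mat ?S $$ (m,n)) * B $$ (n div d, n mod d)) * inverse (det ?S)"
    by (simp add: sum_distrib_left sum_distrib_right mult_ac) (rule sum.swap)
  also have "\<dots> = (\<Sum>n<d*d. (det ?S \<cdot>\<^sub>m 1\<^sub>m (d*d)) $$ (i*d+j,n) * B $$ (n div d, n mod d)) * inverse (det ?S)"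
    unfolding adjm(2)[symmetric] using ij
    by (intro arg_cong2[where f="(*)"] sum.cong refl)
       (auto simp: mult_index[OF super_mat_carrier adjm(1)] prod_index_less)
  also have "\<dots> = (\<Sum>n<d*d. if n = i*d+j then det ?S * B $$ (n div d, n mod d) else 0) * inverse (det ?S)"
    using ij by (intro arg_cong2[where f="(*)"] sum.cong refl) (auto simp: prod_index_less)
  also have "\<dots> = B $$ (i,j)"
    using super_mat_det[OF N inj] ij by (simp add: sum.delta prod_index_less)
  finally show "N (linop_inv d N B) $$ (i,j) = B $$ (i,j)" .
qed (use N B linop_carrier in auto)

text \<open>The right inverse shows that \<open>N\<close> takes equal values at the two matrices,
  and injectivity removes \<open>N\<close>.\<close>

lemma linop_inv_left:
  assumes N: "linop d N" and inj: "\<And>X. X \<in> carrier_mat d d \<Longrightarrow> N X = 0\<^sub>m d d \<Longrightarrow> X = 0\<^sub>m d d"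
    and X: "X \<in> carrier_mat d d"
  shows "linop_inv d N (N X) = X"
proof -
  let ?Y = "linop_inv d N (N X)"
  have NX: "N X \<in> carrier_mat d d" using linop_carrier[OF N X] .
  have "N ?Y = N X" by (rule linop_inv_right[OF N inj NX])
  then have "N (?Y - X) = 0\<^sub>m d d"
    unfolding linop_minus[OF N linop_inv_carrier X] by (simp only: minus_r_inv_mat[OF NX])
  with minus_carrier[OF linop_inv_carrier X] have "?Y - X = 0\<^sub>m d d" by (rule inj)
  then have "(?Y - X) $$ (i,j) = 0" if "i < d" "j < d" for i j using that by simp
  then show ?thesis using X by (intro matI[of _ d d]) (auto simp: mat_op_index[of _ d d])
qed

text \<open>With \<open>N\<close> fixed, the entries of the inverse are finite linear combinations
  of the entries of the argument. This continuity carries the partial sums of the response series to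
  their limit.\<close>

lemma linop_inv_tendsto:
  assumes "\<And>i j. i < d \<Longrightarrow> j < d \<Longrightarrow> (\<lambda>k. B k $$ (i,j)) \<longlonglongrightarrow> C $$ (i,j)" "i < d" "j < d"
  shows "(\<lambda>k. linop_inv d N (B k) $$ (i,j)) \<longlonglongrightarrow> linop_inv d N C $$ (i,j)"
  using assms(2,3) div_mod_less
  by (simp add: linop_inv_def) (intro tendsto_intros assms(1); auto)

section \<open>Invariant states of mixing channels\<close>

text \<open>For a trace-preserving \<open>L\<close> the map \<open>1 - L\<close> has traceless
  values and is singular. The added multiple of the identity has trace \<open>mtrace X\<close> and
  repairs this; on traceless matrices nothing is added, and the map is \<open>1 - L\<close>.\<close>

definition resolvent_map :: "nat \<Rightarrow> (complex mat \<Rightarrow> complex mat) \<Rightarrow> complex mat \<Rightarrow> complex mat" where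
  "resolvent_map d L X = X - L X + (mtrace X / of_nat d) \<cdot>\<^sub>m 1\<^sub>m d"

definition max_mixed :: "nat \<Rightarrow> complex mat" where
  "max_mixed d = complex_of_real (1 / real d) \<cdot>\<^sub>m 1\<^sub>m d"

lemma max_mixed: "d > 0 \<Longrightarrow> psd d (max_mixed d)" "d > 0 \<Longrightarrow> mtrace (max_mixed d) = 1" "max_mixed d \<in> carrier_mat d d"
proof -
  show "psd d (max_mixed d)" unfolding max_mixed_def by (rule psd_smult) auto
  show "d > 0 \<Longrightarrow> mtrace (max_mixed d) = 1" by (simp add: max_mixed_def mtrace_smult[of _ d] mtrace_one)
qed (simp add: max_mixed_def)

lemma linop_resolvent: assumes "linop d L" shows "linop d (resolvent_map d L)"
  unfolding linop_def
proof (intro conjI ballI allI)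
  fix A B :: "complex mat" and c assume A: "A \<in> carrier_mat d d" and B: "B \<in> carrier_mat d d"
  note l = linop_carrier[OF assms A] linop_carrier[OF assms B]
  show "resolvent_map d L A \<in> carrier_mat d d" using A l by (simp add: resolvent_map_def)
  show "resolvent_map d L (A + B) = resolvent_map d L A + resolvent_map d L B"
    unfolding resolvent_map_def linop_add[OF assms A B] mtrace_add[OF A B]
    using A B l by (intro matI[of _ d d]) (auto simp: add_divide_distrib)
  show "resolvent_map d L (c \<cdot>\<^sub>m A) = c \<cdot>\<^sub>m resolvent_map d L A"
    unfolding resolvent_map_def linop_smult[OF assms A] mtrace_smult[OF A]
    using A l by (intro matI[of _ d d]) (auto simp: algebra_simps)
qed

text \<open>A fixed point equals its images under all powers of \<open>L\<close>, and for a
  traceless matrix these tend to 0.\<close>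

lemma mixing_fixed_traceless:
  assumes L: "channel d L" and d: "d > 0" and mix: "mixing d L"
    and X: "X \<in> carrier_mat d d" "mtrace X = 0" "L X = X"
  shows "X = 0\<^sub>m d d"
proof (rule matI[OF X(1)])
  fix i j assume ij: "i < d" "j < d"
  have "(L ^^ N) X = X" for N by (induction N) (auto simp: X)
  then have "(\<lambda>N. X $$ (i,j)) \<longlonglongrightarrow> 0" using mixing_decay[OF L d mix X(1,2) ij] by simp
  then show "X $$ (i,j) = 0\<^sub>m d d $$ (i,j)" using ij by (simp add: LIMSEQ_const_iff)
qed simp

lemma mtrace_resolvent:
  assumes L: "channel d L" and "d > 0" "X \<in> carrier_mat d d"
  shows "mtrace (resolvent_map d L X) = mtrace X"
  using assms(2,3) channelD(3)[OF L assms(3)] linop_carrier[OF channelD(1)[OF L] assms(3)]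
  by (simp add: resolvent_map_def mtrace_add[of _ d] mtrace_minus[of _ d] mtrace_smult[of _ d] mtrace_one)

text \<open>Taking traces first gives \<open>mtrace X = 0\<close>; then the correction vanishes and
  \<open>X\<close> is a traceless fixed point.\<close>

lemma resolvent_inj:
  assumes L: "channel d L" and d: "d > 0" and mix: "mixing d L"
    and X: "X \<in> carrier_mat d d" "resolvent_map d L X = 0\<^sub>m d d"
  shows "X = 0\<^sub>m d d"
proof (rule mixing_fixed_traceless[OF L d mix X(1)])
  show t: "mtrace X = 0" using mtrace_resolvent[OF L d X(1)] X(2) by (simp add: mtrace_def)
  have l: "L X \<in> carrier_mat d d" using linop_carrier[OF channelD(1)[OF L] X(1)] .
  have "(X - L X + 0 \<cdot>\<^sub>m 1\<^sub>m d) $$ (i,j) = 0" if "i < d" "j < d" for i j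
    using X(2) that t by (simp add: resolvent_map_def)
  then show "L X = X" using X(1) l by (intro matI[of _ d d]) auto
qed

context
  fixes d :: nat and L :: "complex mat \<Rightarrow> complex mat"
  assumes L: "channel d L" and d: "d > 0" and mix: "mixing d L"
begin

abbreviation (input) "resinv \<equiv> linop_inv d (resolvent_map d L)"

lemmas lin_resolvent = linop_resolvent[OF channelD(1)[OF L]]

lemma resolvent_right: "B \<in> carrier_mat d d \<Longrightarrow> resolvent_map d L (resinv B) = B"
  by (rule linop_inv_right[OF lin_resolvent resolvent_inj[OF L d mix]])

lemma resolvent_left: "X \<in> carrier_mat d d \<Longrightarrow> resinv (resolvent_map d L X) = X"
  by (rule linop_inv_left[OF lin_resolvent resolvent_inj[OF L d mix]])

text \<open>The form in which linear response uses the inverse: differentiating the fixed-point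
  equation of a curve of states leads to \<open>X = D + L X\<close> with traceless
  \<open>X\<close>.\<close>

lemma resolvent_eqI:
  assumes "X \<in> carrier_mat d d" "D \<in> carrier_mat d d" "mtrace X = 0" "X = D + L X"
  shows "X = resinv D"
proof -
  have "L X \<in> carrier_mat d d" using linop_carrier[OF channelD(1)[OF L] assms(1)] .
  moreover have "resolvent_map d L X = (D + L X) - L X + (mtrace X / of_nat d) \<cdot>\<^sub>m 1\<^sub>m d"
    unfolding resolvent_map_def using assms(4) by simp
  ultimately have "resolvent_map d L X = D"
    using assms(2,3) by (intro matI[of _ d d]) auto
  then show ?thesis using resolvent_left[OF assms(1)] by simp
qed

text \<open>The preimage of the maximally mixed state has trace 1, so the correction term equals the
  right-hand side and the rest of the equation says that the preimage is fixed.\<close>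

lemma invariant_fixed: "L (resinv (max_mixed d)) = resinv (max_mixed d)" "mtrace (resinv (max_mixed d)) = 1"
proof -
  let ?r = "resinv (max_mixed d)"
  have rr: "resolvent_map d L ?r = max_mixed d" by (rule resolvent_right[OF max_mixed(3)])
  show t: "mtrace ?r = 1" using mtrace_resolvent[OF L d, of ?r] rr max_mixed(2)[OF d] by simp
  have l: "L ?r \<in> carrier_mat d d" using linop_carrier[OF channelD(1)[OF L]] by simp
  have "(?r - L ?r + (1 / of_nat d) \<cdot>\<^sub>m 1\<^sub>m d) $$ (i,j) = max_mixed d $$ (i,j)" if "i < d" "j < d" for i j
    using rr t unfolding resolvent_map_def by simp
  then show "L ?r = ?r"
    using l linop_inv_carrier[of d "resolvent_map d L" "max_mixed d"]
    by (intro matI[of _ d d]) (auto simp: max_mixed_def)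
qed

text \<open>Cramer's rule says nothing about signs. Positivity comes from a limit:
  \<open>max_mixed d\<close> minus the fixed point is traceless and decays, so the fixed point is
  the limit of the positive matrices \<open>(L ^^ N) (max_mixed d)\<close>.\<close>

lemma invariant_psd: "psd d (resinv (max_mixed d))"
proof -
  let ?r = "resinv (max_mixed d)"
  have Lr: "(L ^^ N) ?r = ?r" for N by (induction N) (auto simp: invariant_fixed)
  have lim: "(\<lambda>N. (L ^^ N) (max_mixed d) $$ (i,j)) \<longlonglongrightarrow> ?r $$ (i,j)" if ij: "i < d" "j < d" for i j
  proof -
    have "(\<lambda>N. (L ^^ N) (max_mixed d - ?r) $$ (i,j)) \<longlonglongrightarrow> 0"
      using max_mixed d by (intro mixing_decay[OF L d mix _ _ ij]) (auto simp: mtrace_minus[of _ d] invariant_fixed)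
    moreover have "(L ^^ N) (max_mixed d - ?r) $$ (i,j) = (L ^^ N) (max_mixed d) $$ (i,j) - ?r $$ (i,j)" for N
      using linop_minus[OF channelD(1)[OF channel_funpow[OF L, of N]] max_mixed(3), of ?r] Lr[of N]
        linop_carrier[OF channelD(1)[OF channel_funpow[OF L, of N]] max_mixed(3)] ij
      by (simp add: mat_op_index[of _ d d])
    ultimately show ?thesis by (simp add: LIM_zero_iff)
  qed
  have P: "psd d ((L ^^ N) (max_mixed d))" for N
    by (rule channelD(2)[OF channel_funpow[OF L] max_mixed(1)[OF d]])
  show ?thesis
  proof (rule psdI)
    have "adj ?r = ?r"
    proof (rule matI[of _ d d])
      fix i j assume ij: "i < d" "j < d"
      have "(\<lambda>N. cnj ((L ^^ N) (max_mixed d) $$ (j,i))) \<longlonglongrightarrow> cnj (?r $$ (j,i))"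
        by (intro tendsto_cnj lim ij)
      moreover have "cnj ((L ^^ N) (max_mixed d) $$ (j,i)) = (L ^^ N) (max_mixed d) $$ (i,j)" for N
        by (rule herm_index[OF psdD(1)[OF P] ij])
      ultimately have "cnj (?r $$ (j,i)) = ?r $$ (i,j)"
        using LIMSEQ_unique[OF _ lim[OF ij]] by simp
      then show "adj ?r $$ (i,j) = ?r $$ (i,j)" using ij by (simp add: adj_index[of _ d d])
    qed auto
    then show "herm d ?r" by (simp add: herm_def)
    fix f
    have "(\<lambda>N. Re (qf d ((L ^^ N) (max_mixed d)) f)) \<longlonglongrightarrow> Re (qf d ?r f)"
      unfolding qf_def by (intro tendsto_intros lim) auto
    then show "0 \<le> Re (qf d ?r f)"
      by (rule LIMSEQ_le_const) (use psdD(3)[OF P] in auto)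
  qed
qed

lemma invariant_state: "state d (resinv (max_mixed d))"
  using invariant_psd invariant_fixed by (simp add: state_def)

lemma invariant_unique:
  assumes "\<rho> \<in> carrier_mat d d" "mtrace \<rho> = 1" "L \<rho> = \<rho>"
  shows "\<rho> = resinv (max_mixed d)"
proof -
  let ?r = "resinv (max_mixed d)"
  have "\<rho> - ?r = 0\<^sub>m d d"
  proof (rule mixing_fixed_traceless[OF L d mix])
    show "mtrace (\<rho> - ?r) = 0" using assms invariant_fixed by (simp add: mtrace_minus[of _ d])
    show "L (\<rho> - ?r) = \<rho> - ?r" using assms invariant_fixed by (simp add: linop_minus[OF channelD(1)[OF L]])
  qed (use assms in auto)
  then have "(\<rho> - ?r) $$ (i,j) = 0" if "i < d" "j < d" for i j using that by simp
  then show ?thesis using assms by (intro matI[of _ d d]) (auto simp: mat_op_index[of _ d d])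
qed

lemma invariant_ex1: "\<exists>!\<rho>. state d \<rho> \<and> L \<rho> = \<rho>"
  using invariant_state invariant_fixed(1) invariant_unique psdD(2) by (metis state_def)

lemma inv_state_eq: "inv_state d L = resinv (max_mixed d)"
  unfolding inv_state_def
  using invariant_state invariant_fixed(1) invariant_unique psdD(2)
  by (intro the_equality) (auto simp: state_def)

text \<open>Telescoping gives \<open>S N = X - (L ^^ N) X + L (S N)\<close>, so each partial sum is
  the inverse applied to \<open>X - (L ^^ N) X\<close>. The limit follows from the decay of
  \<open>(L ^^ N) X\<close> and the continuity of the inverse.\<close>

lemma resolvent_series:
  assumes X: "X \<in> carrier_mat d d" "mtrace X = 0" and Z: "Z \<in> carrier_mat d d"
  shows "(\<lambda>n. mtrace ((L ^^ n) X * Z)) sums mtrace (resinv X * Z)"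
proof -
  define S where "S N = msum d (\<lambda>n. (L ^^ n) X) [0..<N]" for N
  have Ln: "(L ^^ n) X \<in> carrier_mat d d" "mtrace ((L ^^ n) X) = 0" for n
    using linop_carrier[OF channelD(1)[OF channel_funpow[OF L]] X(1)] channelD(3)[OF channel_funpow[OF L] X(1)] X(2)
    by auto
  have S: "S N \<in> carrier_mat d d" for N unfolding S_def by (intro msum_carrier Ln)
  have SS: "S (Suc N) = S N + (L ^^ N) X" for N by (simp add: S_def msum_snoc)
  have T: "mtrace (S N) = 0" for N
    by (induction N) (auto simp: SS mtrace_add[of _ d] S Ln, auto simp: S_def mtrace_def)
  have partial: "mtrace (S N * Z) = (\<Sum>n<N. mtrace ((L ^^ n) X * Z))" for N
  proof (induction N)
    case 0
    have "S 0 * Z = 0\<^sub>m d d" using Z by (simp add: S_def)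
    then show ?case by (simp add: mtrace_def)
  next
    case (Suc N)
    have "S (Suc N) * Z = S N * Z + (L ^^ N) X * Z"
      unfolding SS by (rule add_mult_distrib_mat[OF S Ln(1) Z])
    then show ?case using Suc S[of N] Ln(1)[of N] Z by (simp add: mtrace_add[of _ d])
  qed
  have "S N = X - (L ^^ N) X + L (S N)" for N
  proof (induction N)
    case 0
    have "L (0\<^sub>m d d) = 0\<^sub>m d d"
      using linop_minus[OF channelD(1)[OF L] X(1) X(1)] X(1) linop_carrier[OF channelD(1)[OF L] X(1)] by simp
    then show ?case using X by (simp add: S_def)
  next
    case (Suc N)
    have "L (S (Suc N)) = L (S N) + (L ^^ Suc N) X"
      unfolding SS using linop_add[OF channelD(1)[OF L] S Ln(1)] by simp
    then have "X - (L ^^ Suc N) X + L (S (Suc N)) = (X - (L ^^ N) X + L (S N)) + (L ^^ N) X"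
      using X(1) Ln(1)[of N] Ln(1)[of "Suc N"] linop_carrier[OF channelD(1)[OF L] S[of N]]
      by (intro matI[of _ d d]) (auto simp: mat_op_index[of _ d d])
    then show ?case using Suc SS by simp
  qed
  then have SN: "S N = resinv (X - (L ^^ N) X)" for N
    using X(1) Ln(1) by (intro resolvent_eqI S T) auto
  have "(\<lambda>N. (X - (L ^^ N) X) $$ (i,j)) \<longlonglongrightarrow> X $$ (i,j)" if ij: "i < d" "j < d" for i j
  proof -
    have "(\<lambda>N. X $$ (i,j) - (L ^^ N) X $$ (i,j)) \<longlonglongrightarrow> X $$ (i,j) - 0"
      using mixing_decay[OF L d mix X ij] by (intro tendsto_intros)
    then show ?thesis using X(1) Ln(1) ij by (simp add: mat_op_index[of _ d d])
  qed
  then have lim: "(\<lambda>N. S N $$ (i,j)) \<longlonglongrightarrow> resinv X $$ (i,j)" if "i < d" "j < d" for i j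
    unfolding SN using that by (rule linop_inv_tendsto)
  have "(\<lambda>N. mtrace (S N * Z)) \<longlonglongrightarrow> mtrace (resinv X * Z)"
    unfolding mtrace_mult[OF S Z] mtrace_mult[OF linop_inv_carrier Z]
    by (intro tendsto_intros lim) auto
  then show ?thesis unfolding sums_def partial .
qed

end

section \<open>Smooth functions of the thermal forces\<close>

text \<open>Every quantity of the model is a rational expression in exponentials of the thermal forces.\<close>
inductive exp_rational :: "('m::{finite,linorder} rvec \<Rightarrow> complex) \<Rightarrow> bool" where
  const: "exp_rational (\<lambda>_. c)"
| exp: "exp_rational (\<lambda>\<zeta>. complex_of_real (exp (a * vec_nth \<zeta> i)))"
| add: "exp_rational f \<Longrightarrow> exp_rational g \<Longrightarrow> exp_rational (\<lambda>\<zeta>. f \<zeta> + g \<zeta>)"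
| mult: "exp_rational f \<Longrightarrow> exp_rational g \<Longrightarrow> exp_rational (\<lambda>\<zeta>. f \<zeta> * g \<zeta>)"
| inv: "exp_rational f \<Longrightarrow> (\<And>\<zeta>. f \<zeta> \<noteq> 0) \<Longrightarrow> exp_rational (\<lambda>\<zeta>. inverse (f \<zeta>))"

lemma exp_rational_sum: "(\<And>x. x \<in> A \<Longrightarrow> exp_rational (f x)) \<Longrightarrow> exp_rational (\<lambda>\<zeta>. \<Sum>x\<in>A. f x \<zeta>)"
  by (induction A rule: infinite_finite_induct) (auto intro: exp_rational.intros)

lemma exp_rational_prod: "(\<And>x. x \<in> A \<Longrightarrow> exp_rational (f x)) \<Longrightarrow> exp_rational (\<lambda>\<zeta>. \<Prod>x\<in>A. f x \<zeta>)"
  by (induction A rule: infinite_finite_induct) (auto intro: exp_rational.intros)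

lemma exp_rational_minus: "exp_rational f \<Longrightarrow> exp_rational g \<Longrightarrow> exp_rational (\<lambda>\<zeta>. f \<zeta> - g \<zeta>)"
  using exp_rational.add[OF _ exp_rational.mult[OF exp_rational.const[of "-1"]]] by fastforce

text \<open>The induction runs over total derivatives rather than partial ones: they supply
  continuity and the chain rule, and their values in the coordinate directions stay in the
  class.\<close>

lemma exp_rational_derivative:
  fixes f :: "'m::{finite,linorder} rvec \<Rightarrow> complex"
  assumes "exp_rational f"
  shows "\<exists>D. (\<forall>x. (f has_derivative D x) (at x)) \<and> (\<forall>k. exp_rational (\<lambda>x. D x (axis k 1)))"
  using assms
proof induction
  case (const c)
  show ?case by (intro exI[of _ "\<lambda>_ _. 0"]) (auto intro: exp_rational.intros)
next
  case (exp a i)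
  let ?D = "\<lambda>x h. complex_of_real (exp (a * vec_nth x i) * (a * vec_nth h i))"
  have "((\<lambda>\<zeta>::'m rvec. complex_of_real (exp (a * vec_nth \<zeta> i))) has_derivative ?D x) (at x)" for x
    by (rule has_derivative_of_real) (auto intro!: derivative_eq_intros simp: bounded_linear_vec_nth bounded_linear_imp_has_derivative)
  moreover have "exp_rational (\<lambda>x. ?D x (axis k 1))" for k
  proof -
    have "(\<lambda>x. ?D x (axis k 1)) = (\<lambda>x. complex_of_real (exp (a * vec_nth x i)) * complex_of_real (a * vec_nth (axis k 1) i))"
      by auto
    then show ?thesis by (simp only:) (intro exp_rational.intros)
  qed
  ultimately show ?case by (intro exI[of _ ?D] conjI allI)
next
  case (add f g)
  then obtain D E where "\<forall>x. (f has_derivative D x) (at x)" "\<forall>x. (g has_derivative E x) (at x)"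
    "\<forall>k. exp_rational (\<lambda>x. D x (axis k 1))" "\<forall>k. exp_rational (\<lambda>x. E x (axis k 1))" by blast
  then show ?case by (intro exI[of _ "\<lambda>x h. D x h + E x h"]) (auto intro!: has_derivative_add exp_rational.intros)
next
  case (mult f g)
  then obtain D E where "\<forall>x. (f has_derivative D x) (at x)" "\<forall>x. (g has_derivative E x) (at x)"
    "\<forall>k. exp_rational (\<lambda>x. D x (axis k 1))" "\<forall>k. exp_rational (\<lambda>x. E x (axis k 1))" by blast
  with mult.hyps show ?case by (intro exI[of _ "\<lambda>x h. f x * E x h + D x h * g x"]) (auto intro!: has_derivative_mult exp_rational.intros)
next
  case (inv f)
  then obtain D where D: "\<forall>x. (f has_derivative D x) (at x)" "\<forall>k. exp_rational (\<lambda>x. D x (axis k 1))" by blast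
  have "((\<lambda>x. inverse (f x)) has_derivative (\<lambda>h. (-1) * (inverse (f x) * D x h * inverse (f x)))) (at x)" for x
    using Deriv.has_derivative_inverse[OF inv.hyps(2) spec[OF D(1)], of x] by simp
  moreover have "exp_rational (\<lambda>x. (-1) * (inverse (f x) * D x (axis k 1) * inverse (f x)))" for k
    using inv.hyps D(2) by (intro exp_rational.intros) auto
  ultimately show ?case by (intro exI[of _ "\<lambda>x h. (-1) * (inverse (f x) * D x h * inverse (f x))"]) blast
qed

text \<open>The bridge from total derivatives to the one-variable \<open>vector_derivative\<close>
  in the definition of \<open>pd\<close>.\<close>

lemma has_derivative_along_line:
  fixes f :: "'m::{finite,linorder} rvec \<Rightarrow> complex"
  assumes "(f has_derivative D) (at x)"
  shows "((\<lambda>t. f (x + t *\<^sub>R v)) has_vector_derivative D v) (at 0)"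
proof -
  have g: "((\<lambda>t. x + t *\<^sub>R v) has_derivative (\<lambda>t. t *\<^sub>R v)) (at 0)"
    by (auto intro!: derivative_eq_intros)
  have "(f has_derivative D) (at (x + 0 *\<^sub>R v))" using assms by simp
  from has_derivative_compose[OF g this]
  have "((\<lambda>t. f (x + t *\<^sub>R v)) has_derivative (\<lambda>t. D (t *\<^sub>R v))) (at 0)" .
  moreover have "D (t *\<^sub>R v) = t *\<^sub>R D v" for t
    using linear_scale[OF has_derivative_linear[OF assms]] .
  ultimately show ?thesis by (simp add: has_vector_derivative_def)
qed

lemma pd_eq:
  assumes "(f has_derivative D) (at x)"
  shows "pd k f x = D (axis k 1)"
  unfolding pd_def by (rule vector_derivative_at[OF has_derivative_along_line[OF assms]])

lemma exp_rational_pd: assumes "exp_rational f" shows "exp_rational (pd k f)"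
proof -
  obtain D where D: "\<And>x. (f has_derivative D x) (at x)" "exp_rational (\<lambda>x. D x (axis k 1))"
    using exp_rational_derivative[OF assms] by blast
  have "pd k f = (\<lambda>x. D x (axis k 1))" using pd_eq[OF D(1)] by auto
  then show ?thesis using D(2) by simp
qed

lemma exp_rational_iter_pd: "exp_rational f \<Longrightarrow> exp_rational (iter_pd ks f)"
  by (induction ks) (auto intro: exp_rational_pd)

lemma exp_rational_C_inf:
  assumes "exp_rational f" shows "C_inf f"
  unfolding C_inf_def
proof (intro allI conjI)
  fix ks
  obtain D where D: "\<And>x. (iter_pd ks f has_derivative D x) (at x)"
    using exp_rational_derivative[OF exp_rational_iter_pd[OF assms]] by blast
  show "continuous_on UNIV (iter_pd ks f)"
    by (intro continuous_at_imp_continuous_on ballI has_derivative_continuous[OF D])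
  show "(\<lambda>t. iter_pd ks f (x + t *\<^sub>R axis k 1)) differentiable (at 0)" for k x
    using has_derivative_along_line[OF D] by (rule differentiableI_vector)
qed

lemma exp_rational_line_derivative:
  fixes f :: "'m::{finite,linorder} rvec \<Rightarrow> complex"
  assumes "exp_rational f"
  shows "((\<lambda>t. f (t *\<^sub>R axis k 1)) has_vector_derivative pd k f 0) (at 0)"
proof -
  obtain D where D: "(f has_derivative D) (at 0)"
    using exp_rational_derivative[OF assms] by blast
  show ?thesis using has_derivative_along_line[OF D, of "axis k 1"] pd_eq[OF D, of k] by simp
qed

text \<open>The all-ones vector is the sum of the coordinate directions, so the derivative along
  equal thermal forces is the sum of the partial ones. Row sums of the kinetic matrix are such
  derivatives.\<close>

lemma exp_rational_diagonal_derivative: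
  fixes f :: "'m::{finite,linorder} rvec \<Rightarrow> complex"
  assumes "exp_rational f"
  shows "((\<lambda>t. f (\<chi> i. t)) has_vector_derivative (\<Sum>k\<in>UNIV. pd k f 0)) (at 0)"
proof -
  obtain D where D: "(f has_derivative D) (at 0)"
    using exp_rational_derivative[OF assms] by blast
  have "(\<chi> i. (1::real)) = (\<Sum>k\<in>UNIV. axis k 1 :: 'm rvec)"
    by (auto simp: Finite_Cartesian_Product.vec_eq_iff axis_def sum.delta)
  then have D1: "D (\<chi> i. 1) = (\<Sum>k\<in>UNIV. pd k f 0)"
    using pd_eq[OF D] linear_sum[OF has_derivative_linear[OF D]] by simp
  have eq: "(\<chi> i. t) = (0::'m rvec) + t *\<^sub>R (\<chi> i. 1)" for t :: real
    by (simp add: Finite_Cartesian_Product.vec_eq_iff)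
  show ?thesis using has_derivative_along_line[OF D, of "\<chi> i. 1"] unfolding D1 eq[symmetric] .
qed

definition smat :: "nat \<Rightarrow> ('m::{finite,linorder} rvec \<Rightarrow> complex mat) \<Rightarrow> bool" where
  "smat n F \<longleftrightarrow> (\<forall>\<zeta>. F \<zeta> \<in> carrier_mat n n) \<and> (\<forall>a<n. \<forall>b<n. exp_rational (\<lambda>\<zeta>. F \<zeta> $$ (a,b)))"

lemma smatD: "smat n F \<Longrightarrow> F \<zeta> \<in> carrier_mat n n" "smat n F \<Longrightarrow> a < n \<Longrightarrow> b < n \<Longrightarrow> exp_rational (\<lambda>\<zeta>. F \<zeta> $$ (a,b))"
  by (auto simp: smat_def)

lemma smatI:
  assumes "\<And>\<zeta>. F \<zeta> \<in> carrier_mat n n" "\<And>a b. a < n \<Longrightarrow> b < n \<Longrightarrow> exp_rational (f a b)"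
    "\<And>a b \<zeta>. a < n \<Longrightarrow> b < n \<Longrightarrow> F \<zeta> $$ (a,b) = f a b \<zeta>"
  shows "smat n F"
  unfolding smat_def
proof (intro conjI allI impI)
  fix a b assume ab: "a < n" "b < n"
  then have "(\<lambda>\<zeta>. F \<zeta> $$ (a,b)) = f a b" using assms(3) by auto
  then show "exp_rational (\<lambda>\<zeta>. F \<zeta> $$ (a,b))" using assms(2)[OF ab] by simp
qed (rule assms(1))

lemma smat_smooth: "smat n F \<Longrightarrow> smooth_mat n F"
  by (auto simp: smat_def smooth_mat_def intro: exp_rational_C_inf)

lemma smat_const: "A \<in> carrier_mat n n \<Longrightarrow> smat n (\<lambda>_. A)"
  by (auto simp: smat_def intro: exp_rational.const)

lemma smat_add: "smat n F \<Longrightarrow> smat n G \<Longrightarrow> smat n (\<lambda>\<zeta>. F \<zeta> + G \<zeta>)"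
  by (rule smatI[of _ _ "\<lambda>a b \<zeta>. F \<zeta> $$ (a,b) + G \<zeta> $$ (a,b)"])
    (simp_all add: smatD exp_rational.add mat_op_index[of _ n n])

lemma smat_minus: "smat n F \<Longrightarrow> smat n G \<Longrightarrow> smat n (\<lambda>\<zeta>. F \<zeta> - G \<zeta>)"
  by (rule smatI[of _ _ "\<lambda>a b \<zeta>. F \<zeta> $$ (a,b) - G \<zeta> $$ (a,b)"])
    (simp_all add: smatD exp_rational_minus mat_op_index[of _ n n])

lemma smat_smult: "exp_rational c \<Longrightarrow> smat n F \<Longrightarrow> smat n (\<lambda>\<zeta>. c \<zeta> \<cdot>\<^sub>m F \<zeta>)"
  by (rule smatI[of _ _ "\<lambda>a b \<zeta>. c \<zeta> * F \<zeta> $$ (a,b)"])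
    (simp_all add: smatD exp_rational.mult smult_index[of _ n n])

lemma smat_mult: "smat n F \<Longrightarrow> smat n G \<Longrightarrow> smat n (\<lambda>\<zeta>. F \<zeta> * G \<zeta>)"
  by (rule smatI[of _ _ "\<lambda>a b \<zeta>. \<Sum>k<n. F \<zeta> $$ (a,k) * G \<zeta> $$ (k,b)"])
    (auto simp: smatD mult_index[of _ n n _ n] intro!: exp_rational.mult exp_rational_sum)

lemma smat_kron: "smat d F \<Longrightarrow> smat e G \<Longrightarrow> smat (d*e) (\<lambda>\<zeta>. kron (F \<zeta>) (G \<zeta>))"
proof (rule smatI[of _ _ "\<lambda>a b \<zeta>. F \<zeta> $$ (a div e, b div e) * G \<zeta> $$ (a mod e, b mod e)"])
  assume F: "smat d F" and G: "smat e G"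
  show "kron (F \<zeta>) (G \<zeta>) \<in> carrier_mat (d*e) (d*e)" for \<zeta> using smatD(1)[OF F] smatD(1)[OF G] by simp
  fix a b assume ab: "a < d * e" "b < d * e"
  then have "e > 0" by (cases e) auto
  with ab have l: "a div e < d" "b div e < d" "a mod e < e" "b mod e < e"
    by (auto simp: less_mult_imp_div_less)
  then show "exp_rational (\<lambda>\<zeta>. F \<zeta> $$ (a div e, b div e) * G \<zeta> $$ (a mod e, b mod e))"
    using F G by (intro exp_rational.mult smatD(2))
  show "kron (F \<zeta>) (G \<zeta>) $$ (a,b) = F \<zeta> $$ (a div e, b div e) * G \<zeta> $$ (a mod e, b mod e)" for \<zeta>
    using kron_index[OF smatD(1)[OF F] smatD(1)[OF G] l, of \<zeta> \<zeta>] by simp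
qed

lemma smat_ptr2: "smat (d*e) F \<Longrightarrow> smat d (\<lambda>\<zeta>. ptr2 d e (F \<zeta>))"
  by (rule smatI[of _ _ "\<lambda>a b \<zeta>. \<Sum>k<e. F \<zeta> $$ (a*e+k, b*e+k)"])
    (auto simp: ptr2_index prod_index_less intro!: exp_rational_sum smatD)

lemma exp_rational_mtrace: "smat n F \<Longrightarrow> exp_rational (\<lambda>\<zeta>. mtrace (F \<zeta>))"
  using smatD(1)[of n F] by (simp add: mtrace_eq[of _ n]) (intro exp_rational_sum smatD, auto)

lemma smat_msum: "(\<And>x. x \<in> set xs \<Longrightarrow> smat n (f x)) \<Longrightarrow> smat n (\<lambda>\<zeta>. msum n (\<lambda>x. f x \<zeta>) xs)"
  by (induction xs rule: rev_induct) (auto simp: msum_snoc intro: smat_const smat_add)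

text \<open>The Leibniz expansions of the determinant and of the cofactors are polynomial in the
  entries, and the reciprocal stays in the class because the determinant vanishes nowhere.\<close>

lemma smat_linop_inv:
  assumes N: "\<And>n. smat d (\<lambda>\<zeta>. N \<zeta> (unit_mat d n))" and nz: "\<And>\<zeta>. det (super_mat d (N \<zeta>)) \<noteq> 0"
    and B: "smat d B"
  shows "smat d (\<lambda>\<zeta>. linop_inv d (N \<zeta>) (B \<zeta>))"
proof -
  let ?S = "\<lambda>\<zeta>. super_mat d (N \<zeta>)"
  have S: "exp_rational (\<lambda>\<zeta>. ?S \<zeta> $$ (m,n))" if "m < d*d" "n < d*d" for m n
    using that smatD(2)[OF N] div_mod_less by (simp add: super_mat_def)
  have det: "exp_rational (\<lambda>\<zeta>. det (A \<zeta>))"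
    if "\<And>\<zeta>. A \<zeta> \<in> carrier_mat n n" "\<And>i j. i < n \<Longrightarrow> j < n \<Longrightarrow> exp_rational (\<lambda>\<zeta>. A \<zeta> $$ (i,j))"
    for n and A :: "'a rvec \<Rightarrow> complex mat"
    unfolding det_def'[OF that(1)]
  proof (intro exp_rational_sum exp_rational.mult exp_rational.const exp_rational_prod that(2))
    fix p x assume "p \<in> {p. p permutes {0..<n}}" "x \<in> {0..<n}"
    then show "x < n" "p x < n" using permutes_in_image[of p "{0..<n}" x] by auto
  qed
  \<comment> \<open>A cofactor is a signed determinant of size \<open>d*d-1\<close>, and the entries
    of \<open>mat_delete\<close> are entries of \<open>?S\<close> at shifted indices.\<close>
  have minor: "exp_rational (\<lambda>\<zeta>. cofactor (?S \<zeta>) i j)" for i j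
    unfolding cofactor_def
  proof (intro exp_rational.mult exp_rational.const det[of _ "d*d-1"])
    show "mat_delete (?S \<zeta>) i j \<in> carrier_mat (d*d-1) (d*d-1)" for \<zeta>
      using carrier_matD[OF super_mat_carrier[of d "N \<zeta>"]] by (auto simp: mat_delete_def)
    fix k l assume kl: "k < d*d-1" "l < d*d-1"
    have dims: "dim_row (?S \<zeta>) = d*d" "dim_col (?S \<zeta>) = d*d" for \<zeta>
      using carrier_matD[OF super_mat_carrier[of d "N \<zeta>"]] by auto
    show "exp_rational (\<lambda>\<zeta>. mat_delete (?S \<zeta>) i j $$ (k,l))"
      using kl by (auto simp: mat_delete_def dims intro!: S)
  qed
  show ?thesis
  proof (rule smatI[of _ _ "\<lambda>i j \<zeta>. (\<Sum>n<d*d. cofactor (?S \<zeta>) n (i*d+j) * B \<zeta> $$ (n div d, n mod d)) * inverse (det (?S \<zeta>))"])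
    fix i j assume ij: "i < d" "j < d"
    show "exp_rational (\<lambda>\<zeta>. (\<Sum>n<d*d. cofactor (?S \<zeta>) n (i*d+j) * B \<zeta> $$ (n div d, n mod d)) * inverse (det (?S \<zeta>)))"
      using div_mod_less S nz
      by (intro exp_rational.mult exp_rational.inv exp_rational_sum minor smatD(2)[OF B] det[of _ "d*d"]) auto
    fix \<zeta>
    have dims: "dim_row (?S \<zeta>) = d*d" "dim_col (?S \<zeta>) = d*d"
      using carrier_matD[OF super_mat_carrier[of d "N \<zeta>"]] by auto
    show "linop_inv d (N \<zeta>) (B \<zeta>) $$ (i,j) = (\<Sum>n<d*d. cofactor (?S \<zeta>) n (i*d+j) * B \<zeta> $$ (n div d, n mod d)) * inverse (det (?S \<zeta>))"
      using ij by (simp add: linop_inv_def adj_mat_def dims prod_index_less)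
  qed simp
qed

section \<open>Derivatives of matrix curves\<close>

text \<open>Only derivatives at 0 are taken, because the kinetic coefficients are derivatives at
  equilibrium.\<close>

definition mder :: "nat \<Rightarrow> (real \<Rightarrow> complex mat) \<Rightarrow> complex mat \<Rightarrow> bool" where
  "mder n F F' \<longleftrightarrow> (\<forall>t. F t \<in> carrier_mat n n) \<and> F' \<in> carrier_mat n n \<and>
     (\<forall>a<n. \<forall>b<n. ((\<lambda>t. F t $$ (a,b)) has_vector_derivative F' $$ (a,b)) (at 0))"

lemma mderD:
  "mder n F F' \<Longrightarrow> F t \<in> carrier_mat n n" "mder n F F' \<Longrightarrow> F' \<in> carrier_mat n n"
  "mder n F F' \<Longrightarrow> a < n \<Longrightarrow> b < n \<Longrightarrow> ((\<lambda>t. F t $$ (a,b)) has_vector_derivative F' $$ (a,b)) (at 0)"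
  by (auto simp: mder_def)

lemma mderI:
  assumes "\<And>t. F t \<in> carrier_mat n n" "F' \<in> carrier_mat n n"
    "\<And>a b. a < n \<Longrightarrow> b < n \<Longrightarrow> (f a b has_vector_derivative f' a b) (at 0)"
    "\<And>a b t. a < n \<Longrightarrow> b < n \<Longrightarrow> F t $$ (a,b) = f a b t" "\<And>a b. a < n \<Longrightarrow> b < n \<Longrightarrow> F' $$ (a,b) = f' a b"
  shows "mder n F F'"
  unfolding mder_def
proof (intro conjI allI impI)
  fix a b assume ab: "a < n" "b < n"
  then have "(\<lambda>t. F t $$ (a,b)) = f a b" using assms(4) by auto
  then show "((\<lambda>t. F t $$ (a,b)) has_vector_derivative F' $$ (a,b)) (at 0)" using assms(3,5)[OF ab] by simp
qed (use assms in auto)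

lemma mder_unique: assumes "mder n F A" "mder n F B" shows "A = B"
proof (rule matI[of _ n n])
  fix a b assume ab: "a < n" "b < n"
  show "A $$ (a,b) = B $$ (a,b)"
    by (rule vector_derivative_unique_at[OF mderD(3)[OF assms(1) ab] mderD(3)[OF assms(2) ab]])
qed (use assms in \<open>auto simp: mder_def\<close>)

lemma mder_const: "A \<in> carrier_mat n n \<Longrightarrow> mder n (\<lambda>_. A) (0\<^sub>m n n)"
  by (auto simp: mder_def)

lemma mder_add: "mder n F F' \<Longrightarrow> mder n G G' \<Longrightarrow> mder n (\<lambda>t. F t + G t) (F' + G')"
  by (rule mderI[of _ _ _ "\<lambda>a b t. F t $$ (a,b) + G t $$ (a,b)" "\<lambda>a b. F' $$ (a,b) + G' $$ (a,b)"])
    (simp_all add: mderD mat_op_index[of _ n n] has_vector_derivative_add)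

lemma mder_mult:
  assumes "mder n F F'" "mder n G G'"
  shows "mder n (\<lambda>t. F t * G t) (F 0 * G' + F' * G 0)"
proof (rule mderI[of _ _ _ "\<lambda>a b t. \<Sum>k<n. F t $$ (a,k) * G t $$ (k,b)"
      "\<lambda>a b. \<Sum>k<n. F 0 $$ (a,k) * G' $$ (k,b) + F' $$ (a,k) * G 0 $$ (k,b)"])
  note c = mderD(1,2)[OF assms(1)] mderD(1,2)[OF assms(2)]
  show "F t * G t \<in> carrier_mat n n" for t using c by simp
  show "F 0 * G' + F' * G 0 \<in> carrier_mat n n" using c by simp
  fix a b assume ab: "a < n" "b < n"
  show "((\<lambda>t. \<Sum>k<n. F t $$ (a,k) * G t $$ (k,b)) has_vector_derivative
      (\<Sum>k<n. F 0 $$ (a,k) * G' $$ (k,b) + F' $$ (a,k) * G 0 $$ (k,b))) (at 0)"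
    using ab by (intro has_vector_derivative_sum has_vector_derivative_mult mderD(3)[OF assms(1)] mderD(3)[OF assms(2)]) auto
  show "(F t * G t) $$ (a,b) = (\<Sum>k<n. F t $$ (a,k) * G t $$ (k,b))" for t
    using c ab by (simp add: mult_index[of _ n n _ n])
  show "(F 0 * G' + F' * G 0) $$ (a,b) = (\<Sum>k<n. F 0 $$ (a,k) * G' $$ (k,b) + F' $$ (a,k) * G 0 $$ (k,b))"
    using c ab by (simp add: mat_op_index[of _ n n] mult_index[of _ n n _ n] sum.distrib)
qed

lemma mder_linop:
  assumes "linop d L" "mder d F F'" shows "mder d (\<lambda>t. L (F t)) (L F')"
proof (rule mderI[of _ _ _ "\<lambda>i j t. \<Sum>n<d*d. L (unit_mat d n) $$ (i,j) * F t $$ (n div d, n mod d)"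
      "\<lambda>i j. \<Sum>n<d*d. L (unit_mat d n) $$ (i,j) * F' $$ (n div d, n mod d)"])
  fix i j assume ij: "i < d" "j < d"
  show "((\<lambda>t. \<Sum>n<d*d. L (unit_mat d n) $$ (i,j) * F t $$ (n div d, n mod d)) has_vector_derivative
      (\<Sum>n<d*d. L (unit_mat d n) $$ (i,j) * F' $$ (n div d, n mod d))) (at 0)"
    using div_mod_less by (intro has_vector_derivative_sum has_vector_derivative_mult_right mderD(3)[OF assms(2)]) auto
  show "L (F t) $$ (i,j) = (\<Sum>n<d*d. L (unit_mat d n) $$ (i,j) * F t $$ (n div d, n mod d))" for t
    by (rule linop_expand[OF assms(1) mderD(1)[OF assms(2)] ij])
  show "L F' $$ (i,j) = (\<Sum>n<d*d. L (unit_mat d n) $$ (i,j) * F' $$ (n div d, n mod d))"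
    by (rule linop_expand[OF assms(1) mderD(2)[OF assms(2)] ij])
qed (use linop_carrier[OF assms(1)] mderD(1,2)[OF assms(2)] in auto)

lemma mder_mtrace:
  assumes "mder n F F'" shows "((\<lambda>t. mtrace (F t)) has_vector_derivative mtrace F') (at 0)"
  unfolding mtrace_eq[OF mderD(1)[OF assms]] mtrace_eq[OF mderD(2)[OF assms]]
  by (intro has_vector_derivative_sum mderD(3)[OF assms]) auto

lemma smat_mder:
  assumes "smat n F"
  shows "mder n (\<lambda>t. F (t *\<^sub>R axis k 1)) (Matrix.mat n n (\<lambda>(a,b). pd k (\<lambda>\<zeta>. F \<zeta> $$ (a,b)) 0))"
proof (rule mderI[of _ _ _ "\<lambda>a b t. F (t *\<^sub>R axis k 1) $$ (a,b)" "\<lambda>a b. pd k (\<lambda>\<zeta>. F \<zeta> $$ (a,b)) 0"])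
  fix a b assume "a < n" "b < n"
  from exp_rational_line_derivative[OF smatD(2)[OF assms this]]
  show "((\<lambda>t. F (t *\<^sub>R axis k 1) $$ (a,b)) has_vector_derivative pd k (\<lambda>\<zeta>. F \<zeta> $$ (a,b)) 0) (at 0)" .
qed (simp_all add: smatD(1)[OF assms])

section \<open>Gibbs states as functions of the temperature\<close>

lemma gibbs_smat:
  fixes j :: "'m::{finite,linorder}"
  assumes "herm n H" "n > 0"
  shows "smat n (\<lambda>\<zeta>. gibbs (b - vec_nth \<zeta> j) H)"
proof -
  obtain P l where P: "unitary n P" and H: "H = P * dg n (\<lambda>i. complex_of_real (l i)) * adj P"
    using spectral_theorem[OF assms(1)] by blast
  note p = unitaryD[OF P]
  \<comment> \<open>The inverse temperature is \<open>b - vec_nth \<zeta> j\<close>, so an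
    unnormalised weight is a constant times an exponential of the thermal force.\<close>
  let ?w = "\<lambda>a (\<zeta>::'m rvec). complex_of_real (exp (- b * l a)) * complex_of_real (exp (l a * vec_nth \<zeta> j))"
  let ?Z = "\<lambda>\<zeta>. \<Sum>k<n. ?w k \<zeta>"
  have w: "complex_of_real (exp (- (b - vec_nth \<zeta> j) * l a)) = ?w a \<zeta>" for a \<zeta>
  proof -
    have "exp (- (b - vec_nth \<zeta> j) * l a) = exp (- b * l a) * exp (l a * vec_nth \<zeta> j)"
      unfolding exp_add[symmetric] by (simp add: algebra_simps)
    then show ?thesis by simp
  qed
  have Z: "?Z \<zeta> = complex_of_real (\<Sum>k<n. exp (- (b - vec_nth \<zeta> j) * l k))" for \<zeta>
    using w by simp
  have we: "exp_rational (?w a)" for a by (intro exp_rational.intros)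
  show ?thesis
  proof (rule smatI[of _ _ "\<lambda>i k \<zeta>. \<Sum>a<n. P $$ (i,a) * (?w a \<zeta> * inverse (?Z \<zeta>)) * cnj (P $$ (k,a))"])
    show "gibbs (b - vec_nth \<zeta> j) H \<in> carrier_mat n n" for \<zeta> using hermD(1)[OF assms(1)] by simp
    fix i k assume ik: "i < n" "k < n"
    have "?Z \<zeta> \<noteq> 0" for \<zeta>
      using gibbs_partition_pos[OF assms(2), of "b - vec_nth \<zeta> j" l] unfolding Z of_real_eq_0_iff by simp
    then show "exp_rational (\<lambda>\<zeta>. \<Sum>a<n. P $$ (i,a) * (?w a \<zeta> * inverse (?Z \<zeta>)) * cnj (P $$ (k,a)))"
      by (intro exp_rational_sum exp_rational.mult exp_rational.inv exp_rational.const we)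
    show "gibbs (b - vec_nth \<zeta> j) H $$ (i,k) = (\<Sum>a<n. P $$ (i,a) * (?w a \<zeta> * inverse (?Z \<zeta>)) * cnj (P $$ (k,a)))" for \<zeta>
      unfolding gibbs_sandwich[OF P H] sandwich_dg_index[OF p(1) ik] of_real_divide w Z[symmetric]
      by (simp add: divide_inverse)
  qed
qed

text \<open>Raising the thermal force lowers the inverse temperature, hence the positive sign of
  \<open>H\<close>; the mean energy is subtracted by the derivative of the partition
  function.\<close>

lemma gibbs_mder:
  assumes "herm n H" "n > 0"
  shows "mder n (\<lambda>t. gibbs (b - t) H) (gibbs b H * (H - mtrace (gibbs b H * H) \<cdot>\<^sub>m 1\<^sub>m n))"
proof -
  obtain P l where P: "unitary n P" and H: "H = P * dg n (\<lambda>i. complex_of_real (l i)) * adj P"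
    using spectral_theorem[OF assms(1)] by blast
  note p = unitaryD[OF P]
  define Z where "Z t = (\<Sum>k<n. exp (- (b - t) * l k))" for t
  define w where "w a t = exp (- (b - t) * l a) / Z t" for a t
  define h where "h = (\<Sum>a<n. w a 0 * l a)"
  have Zp: "Z t > 0" for t unfolding Z_def by (rule gibbs_partition_pos[OF assms(2)])
  have g: "gibbs (b - t) H = P * dg n (\<lambda>i. complex_of_real (w i t)) * adj P" for t
    unfolding gibbs_sandwich[OF P H] w_def Z_def ..
  have g0: "gibbs b H = P * dg n (\<lambda>i. complex_of_real (w i 0)) * adj P" using g[of 0] by simp
  have h: "mtrace (gibbs b H * H) = complex_of_real h"
    unfolding g0 unfolding H mult_sandwich_dg[OF P] mtrace_unitary_conj[OF P dg_carrier]
    by (simp add: mtrace_eq[OF dg_carrier] dg_index h_def)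
  have one: "1\<^sub>m n = P * dg n (\<lambda>_. 1) * adj P" using p by (simp add: dg_one)
  have "H - complex_of_real h \<cdot>\<^sub>m 1\<^sub>m n = P * dg n (\<lambda>i. complex_of_real (l i - h)) * adj P"
  proof (rule matI[of _ n n])
    fix i j assume ij: "i < n" "j < n"
    have "(H - complex_of_real h \<cdot>\<^sub>m 1\<^sub>m n) $$ (i,j) = H $$ (i,j) - h * (P * dg n (\<lambda>_. 1) * adj P) $$ (i,j)"
      unfolding one[symmetric] using ij by simp
    then show "(H - complex_of_real h \<cdot>\<^sub>m 1\<^sub>m n) $$ (i,j) = (P * dg n (\<lambda>i. complex_of_real (l i - h)) * adj P) $$ (i,j)"
      unfolding H sandwich_dg_index[OF p(1) ij]
      by (simp add: sum_distrib_left sum_subtractf algebra_simps)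
  qed (use p H in auto)
  then have der: "gibbs b H * (H - mtrace (gibbs b H * H) \<cdot>\<^sub>m 1\<^sub>m n)
     = P * dg n (\<lambda>i. complex_of_real (w i 0 * (l i - h))) * adj P"
    unfolding h unfolding g0 by (simp only: mult_sandwich_dg[OF P] of_real_mult)
  have wd: "((\<lambda>t. w a t) has_real_derivative (w a 0 * (l a - h))) (at 0)" for a
  proof -
    have Zd: "(Z has_real_derivative (\<Sum>k<n. l k * exp (- b * l k))) (at 0)"
      unfolding Z_def by (auto intro!: derivative_eq_intros simp: algebra_simps)
    have "((\<lambda>t. w a t) has_real_derivative
        (l a * exp (- b * l a) * Z 0 - exp (- b * l a) * (\<Sum>k<n. l k * exp (- b * l k))) / (Z 0 * Z 0)) (at 0)"
      unfolding w_def using Zp[of 0]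
      by (auto intro!: derivative_eq_intros Zd simp: algebra_simps)
    also have "(l a * exp (- b * l a) * Z 0 - exp (- b * l a) * (\<Sum>k<n. l k * exp (- b * l k))) / (Z 0 * Z 0) = w a 0 * (l a - h)"
    proof -
      have "h = (\<Sum>k<n. l k * exp (- b * l k)) / Z 0"
        unfolding h_def w_def by (simp add: sum_divide_distrib mult.commute)
      then show ?thesis using Zp[of 0] by (simp add: w_def field_simps)
    qed
    finally show ?thesis .
  qed
  show ?thesis unfolding der
  proof (rule mderI[of _ _ _ "\<lambda>i j t. \<Sum>a<n. P $$ (i,a) * complex_of_real (w a t) * cnj (P $$ (j,a))"
      "\<lambda>i j. \<Sum>a<n. P $$ (i,a) * complex_of_real (w a 0 * (l a - h)) * cnj (P $$ (j,a))"])
    show "gibbs (b - t) H \<in> carrier_mat n n" for t using hermD(1)[OF assms(1)] by simp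
    show "P * dg n (\<lambda>i. complex_of_real (w i 0 * (l i - h))) * adj P \<in> carrier_mat n n" using p by simp
    fix i j assume ij: "i < n" "j < n"
    show "((\<lambda>t. \<Sum>a<n. P $$ (i,a) * complex_of_real (w a t) * cnj (P $$ (j,a))) has_vector_derivative
      (\<Sum>a<n. P $$ (i,a) * complex_of_real (w a 0 * (l a - h)) * cnj (P $$ (j,a)))) (at 0)"
      by (intro has_vector_derivative_sum has_vector_derivative_mult_left has_vector_derivative_mult_right
          has_vector_derivative_of_real) (use wd in \<open>simp add: has_real_derivative_iff_has_vector_derivative\<close>)
    show "gibbs (b - t) H $$ (i,j) = (\<Sum>a<n. P $$ (i,a) * complex_of_real (w a t) * cnj (P $$ (j,a)))" for t
      unfolding g by (rule sandwich_dg_index[OF p(1) ij])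
    show "(P * dg n (\<lambda>i. complex_of_real (w i 0 * (l i - h))) * adj P) $$ (i,j)
      = (\<Sum>a<n. P $$ (i,a) * complex_of_real (w a 0 * (l a - h)) * cnj (P $$ (j,a)))"
      by (rule sandwich_dg_index[OF p(1) ij])
  qed
qed

section \<open>A single interaction\<close>

lemma psd_kron:
  assumes "psd a A" "psd b B" shows "psd (a*b) (kron A B)"
proof -
  obtain P l where P: "unitary a P" and A: "A = P * dg a (\<lambda>i. complex_of_real (l i)) * adj P"
    and l: "\<And>i. i < a \<Longrightarrow> 0 \<le> l i" using psd_spectral[OF assms(1)] by blast
  obtain Q m where Q: "unitary b Q" and B: "B = Q * dg b (\<lambda>i. complex_of_real (m i)) * adj Q"
    and m: "\<And>i. i < b \<Longrightarrow> 0 \<le> m i" using psd_spectral[OF assms(2)] by blast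
  note p = unitaryD(1)[OF P] and q = unitaryD(1)[OF Q]
  have "kron A B = kron P Q * dg (a*b) (\<lambda>n. complex_of_real (l (n div b) * m (n mod b))) * adj (kron P Q)"
    unfolding A B of_real_mult kron_dg[of a "\<lambda>i. complex_of_real (l i)" b "\<lambda>i. complex_of_real (m i)", symmetric]
    using p q by (simp add: adj_kron[of _ a _ b] kron_mult[of _ a _ b])
  moreover have "0 \<le> l (n div b) * m (n mod b)" if "n < a * b" for n
  proof -
    have "b > 0" using that by (cases b) auto
    then show ?thesis using that by (intro mult_nonneg_nonneg l m) (auto simp: less_mult_imp_div_less)
  qed
  ultimately show ?thesis using p q by (simp only:) (rule psd_conj[OF psd_dg], auto)
qed

text \<open>The form of the partial trace at \<open>f\<close> is the sum over \<open>k\<close> of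
  the form of \<open>X\<close> at \<open>f\<close> tensored with the \<open>k\<close>-th basis
  vector.\<close>

lemma psd_ptr2:
  assumes "psd (d*e) X" shows "psd d (ptr2 d e X)"
proof (rule psdI)
  note x = psdD(2)[OF assms]
  show "herm d (ptr2 d e X)" using adj_ptr2[OF x] hermD(2)[OF psdD(1)[OF assms]] by (simp add: herm_def)
  fix f :: "nat \<Rightarrow> complex"
  have "qf d (ptr2 d e X) f = (\<Sum>i<d. \<Sum>j<d. \<Sum>k<e. cnj (f i) * X $$ (i*e+k, j*e+k) * f j)"
    unfolding qf_def by (intro sum.cong refl) (simp add: ptr2_index sum_distrib_left sum_distrib_right)
  also have "\<dots> = (\<Sum>i<d. \<Sum>k<e. \<Sum>j<d. cnj (f i) * X $$ (i*e+k, j*e+k) * f j)"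
    by (intro sum.cong refl sum.swap)
  also have "\<dots> = (\<Sum>k<e. \<Sum>i<d. \<Sum>j<d. cnj (f i) * X $$ (i*e+k, j*e+k) * f j)"
    by (rule sum.swap)
  also have "\<dots> = (\<Sum>k<e. qf (d*e) X (\<lambda>n. if n mod e = k then f (n div e) else 0))"
  proof (intro sum.cong refl)
    fix k assume k: "k \<in> {..<e}"
    have "qf (d*e) X (\<lambda>n. if n mod e = k then f (n div e) else 0)
      = (\<Sum>i<d. \<Sum>k'<e. \<Sum>j<d. \<Sum>l<e. if k' = k then if l = k then cnj (f i) * X $$ (i*e+k', j*e+l) * f j else 0 else 0)"
      unfolding qf_def sum_prod_index by (intro sum.cong refl) auto
    also have "\<dots> = (\<Sum>i<d. \<Sum>k'<e. if k' = k then (\<Sum>j<d. \<Sum>l<e. if l = k then cnj (f i) * X $$ (i*e+k', j*e+l) * f j else 0) else 0)"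
      by (intro sum.cong refl) auto
    also have "\<dots> = (\<Sum>i<d. \<Sum>j<d. cnj (f i) * X $$ (i*e+k, j*e+k) * f j)"
      using k by (simp add: sum.delta)
    finally show "(\<Sum>i<d. \<Sum>j<d. cnj (f i) * X $$ (i*e+k, j*e+k) * f j)
      = qf (d*e) X (\<lambda>n. if n mod e = k then f (n div e) else 0)" by simp
  qed
  finally have "qf d (ptr2 d e X) f = (\<Sum>k<e. qf (d*e) X (\<lambda>n. if n mod e = k then f (n div e) else 0))" .
  then show "0 \<le> Re (qf d (ptr2 d e X) f)" by (simp only: Re_sum) (intro sum_nonneg psdD(3)[OF assms])
qed

text \<open>For the antiunitary \<open>\<theta>\<close> given by \<open>\<Theta>\<close> after
  complex conjugation this is \<theta> X \<theta>^{-1}; unitarity of \<open>\<Theta>\<close> turns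
  the inverse into \<open>adj \<Theta>\<close>.\<close>

definition time_rev :: "complex mat \<Rightarrow> complex mat \<Rightarrow> complex mat" where
  "time_rev \<Theta> X = \<Theta> * cconj X * adj \<Theta>"

lemma time_rev_carrier [simp]: "\<Theta> \<in> carrier_mat n n \<Longrightarrow> X \<in> carrier_mat n n \<Longrightarrow> time_rev \<Theta> X \<in> carrier_mat n n"
  by (simp add: time_rev_def)

lemma time_rev_mult:
  assumes "unitary n \<Theta>" "X \<in> carrier_mat n n" "Y \<in> carrier_mat n n"
  shows "time_rev \<Theta> (X * Y) = time_rev \<Theta> X * time_rev \<Theta> Y"
  using unitaryD(1)[OF assms(1)] assms(2,3) unfolding time_rev_def
  by (simp add: cconj_mult[of _ n n _ n] assoc_mult_mat[of _ n n _ n _ n] unitary_cancel[OF assms(1)])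

lemma time_rev_adj:
  assumes "\<Theta> \<in> carrier_mat n n" "X \<in> carrier_mat n n"
  shows "time_rev \<Theta> (adj X) = adj (time_rev \<Theta> X)"
  using assms unfolding time_rev_def
  by (simp add: cconj_adj[of _ n n] adj_mult[of _ n n _ n] assoc_mult_mat[of _ n n _ n _ n])

lemma time_rev_add:
  assumes "\<Theta> \<in> carrier_mat n n" "X \<in> carrier_mat n n" "Y \<in> carrier_mat n n"
  shows "time_rev \<Theta> (X + Y) = time_rev \<Theta> X + time_rev \<Theta> Y"
  using assms unfolding time_rev_def
  by (simp add: cconj_add[of _ n n] mult_add_distrib_mat[of _ n n _ n] add_mult_distrib_mat[of _ n n _ _ n])

lemma time_rev_minus:
  assumes "\<Theta> \<in> carrier_mat n n" "X \<in> carrier_mat n n" "Y \<in> carrier_mat n n"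
  shows "time_rev \<Theta> (X - Y) = time_rev \<Theta> X - time_rev \<Theta> Y"
  using assms unfolding time_rev_def
  by (simp add: cconj_minus[of _ n n] mult_minus_distrib_mat[of _ n n _ n] minus_mult_distrib_mat[of _ n n _ _ n])

lemma time_rev_smult:
  assumes "\<Theta> \<in> carrier_mat n n" "X \<in> carrier_mat n n"
  shows "time_rev \<Theta> (c \<cdot>\<^sub>m X) = cnj c \<cdot>\<^sub>m time_rev \<Theta> X"
  using assms unfolding time_rev_def
  by (simp add: cconj_smult[of _ n n] mult_smult_distrib[of _ n n _ n] mult_smult_assoc_mat[of _ n n _ n])

lemma time_rev_one: "unitary n \<Theta> \<Longrightarrow> time_rev \<Theta> (1\<^sub>m n) = 1\<^sub>m n"
  using unitaryD[of n \<Theta>] by (simp add: time_rev_def)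

lemma time_rev_mtrace:
  assumes "unitary n \<Theta>" "X \<in> carrier_mat n n"
  shows "mtrace (time_rev \<Theta> X) = cnj (mtrace X)"
  unfolding time_rev_def mtrace_unitary_conj[OF assms(1) cconj_carrier[OF assms(2)]]
  by (rule mtrace_cconj[OF assms(2)])

text \<open>Being an involution says that \<open>cconj \<Theta>\<close> is the inverse of
  \<open>\<Theta>\<close>, and the inverse of a unitary is its adjoint.\<close>

lemma antiunitary_involution_cconj:
  assumes "antiunitary_involution n \<Theta>"
  shows "cconj \<Theta> = adj \<Theta>"
proof -
  have u: "unitary n \<Theta>" and i: "\<Theta> * cconj \<Theta> = 1\<^sub>m n" using assms by (auto simp: antiunitary_involution_def)
  note t = unitaryD[OF u]
  have "adj \<Theta> * (\<Theta> * cconj \<Theta>) = adj \<Theta>" unfolding i using t(1) by simp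
  then show ?thesis using unitary_cancel(1)[OF u cconj_carrier[OF t(1)]] by simp
qed

lemma time_rev_involution:
  assumes "antiunitary_involution n \<Theta>" "X \<in> carrier_mat n n"
  shows "time_rev \<Theta> (time_rev \<Theta> X) = X"
proof -
  have u: "unitary n \<Theta>" using assms by (auto simp: antiunitary_involution_def)
  note t = unitaryD[OF u]
  have "cconj (time_rev \<Theta> X) = adj \<Theta> * X * \<Theta>"
    unfolding time_rev_def using t(1) assms(2)
    by (simp add: cconj_mult[of _ n n _ n] cconj_adj[of _ n n] antiunitary_involution_cconj[OF assms(1)] assoc_mult_mat[of _ n n _ n _ n])
  then have "time_rev \<Theta> (time_rev \<Theta> X) = \<Theta> * (adj \<Theta> * X * \<Theta>) * adj \<Theta>" by (simp add: time_rev_def)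
  then show ?thesis using t assms(2) by (simp add: assoc_mult_mat[of _ n n _ n _ n] unitary_cancel[OF u])
qed

lemma time_rev_psd:
  assumes "unitary n \<Theta>" "psd n X" shows "psd n (time_rev \<Theta> X)"
proof -
  have "psd n (cconj X)"
  proof (rule psdI)
    note x = psdD(2)[OF assms(2)]
    show "herm n (cconj X)" using x cconj_adj[OF x] hermD(2)[OF psdD(1)[OF assms(2)]] by (simp add: herm_def)
    fix f
    have "qf n (cconj X) f = cnj (qf n X (\<lambda>i. cnj (f i)))"
      unfolding qf_def by (simp add: cnj_sum cconj_index[OF x])
    then show "0 \<le> Re (qf n (cconj X) f)" using psdD(3)[OF assms(2)] by simp
  qed
  then show ?thesis unfolding time_rev_def by (rule psd_conj[OF _ unitaryD(1)[OF assms(1)]])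
qed

lemma one_smult [simp]: "1 \<cdot>\<^sub>m (A :: complex mat) = A"
  by (rule eq_matI) auto

lemma kron_split:
  assumes "A \<in> carrier_mat d d" "B \<in> carrier_mat e e"
  shows "kron A B = kron A (1\<^sub>m e) * kron (1\<^sub>m d) B" "kron A B = kron (1\<^sub>m d) B * kron A (1\<^sub>m e)"
  using assms by (simp_all add: kron_mult[of _ d _ e] left_mult_one_mat[of _ d d] left_mult_one_mat[of _ e e])

lemma time_rev_kron:
  assumes "\<Theta> \<in> carrier_mat d d" "\<Theta>E \<in> carrier_mat e e" "A \<in> carrier_mat d d" "B \<in> carrier_mat e e"
  shows "time_rev (kron \<Theta> \<Theta>E) (kron A B) = kron (time_rev \<Theta> A) (time_rev \<Theta>E B)"
  using assms by (simp add: time_rev_def cconj_kron[of _ d _ e] adj_kron[of _ d _ e] kron_mult[of _ d _ e])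

text \<open>The part of the conjugation that acts on the environment cancels by partial cyclicity;
  only the part on the system remains.\<close>

lemma time_rev_ptr2:
  assumes "\<Theta> \<in> carrier_mat d d" "unitary e \<Theta>E" "X \<in> carrier_mat (d*e) (d*e)"
  shows "time_rev \<Theta> (ptr2 d e X) = ptr2 d e (time_rev (kron \<Theta> \<Theta>E) X)"
proof -
  note t = unitaryD[OF assms(2)]
  let ?n = "d * e"
  let ?A = "kron \<Theta> (1\<^sub>m e)" and ?B = "kron (1\<^sub>m d) \<Theta>E"
  have c: "?A \<in> carrier_mat ?n ?n" "?B \<in> carrier_mat ?n ?n" "cconj X \<in> carrier_mat ?n ?n" "adj \<Theta> \<in> carrier_mat d d"
    "kron (adj \<Theta>) (1\<^sub>m e) \<in> carrier_mat ?n ?n" "kron (1\<^sub>m d) (adj \<Theta>E) \<in> carrier_mat ?n ?n" using assms t(1) by auto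
  have "time_rev (kron \<Theta> \<Theta>E) X = ?A * (?B * (cconj X * kron (1\<^sub>m d) (adj \<Theta>E))) * kron (adj \<Theta>) (1\<^sub>m e)"
    unfolding time_rev_def adj_kron[OF assms(1) t(1)] kron_split(2)[OF c(4) adj_carrier[OF t(1)]]
    unfolding kron_split(1)[OF assms(1) t(1)]
    using c by (simp add: assoc_mult_mat[of _ ?n ?n _ ?n _ ?n])
  then have "ptr2 d e (time_rev (kron \<Theta> \<Theta>E) X)
      = \<Theta> * ptr2 d e (?B * (cconj X * kron (1\<^sub>m d) (adj \<Theta>E))) * adj \<Theta>"
    using c assms(1) by (simp add: ptr2_kron_one[of _ d _ e])
  also have "ptr2 d e (?B * (cconj X * kron (1\<^sub>m d) (adj \<Theta>E)))
      = ptr2 d e ((cconj X * kron (1\<^sub>m d) (adj \<Theta>E)) * ?B)"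
    using c t(1) by (intro ptr2_comm) auto
  also have "(cconj X * kron (1\<^sub>m d) (adj \<Theta>E)) * ?B = cconj X * (kron (1\<^sub>m d) (adj \<Theta>E) * ?B)"
    by (rule assoc_mult_mat[OF c(3,6,2)])
  also have "kron (1\<^sub>m d) (adj \<Theta>E) * ?B = 1\<^sub>m ?n"
    using t by (simp add: kron_mult[of _ d _ e] kron_one)
  finally show ?thesis using c(3) assms(3) by (simp add: time_rev_def cconj_ptr2)
qed

section \<open>One collision step: channel, dual and exchanged energy\<close>

definition chan :: "nat \<Rightarrow> nat \<Rightarrow> complex mat \<Rightarrow> complex mat \<Rightarrow> complex mat \<Rightarrow> complex mat" where
  "chan d e U \<sigma> \<rho> = ptr2 d e (U * kron \<rho> \<sigma> * adj U)"

definition dchan :: "nat \<Rightarrow> nat \<Rightarrow> complex mat \<Rightarrow> complex mat \<Rightarrow> complex mat \<Rightarrow> complex mat" where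
  "dchan d e U \<sigma> X = ptr2 d e (kron (1\<^sub>m d) \<sigma> * adj U * kron X (1\<^sub>m e) * U)"

text \<open>The energy gained by an environment in state \<open>\<sigma>\<close>, as an observable
  of the system. For the unitary \<open>U\<close> of a step it is -T times \<open>Phi\<close>, and
  for \<open>adj U\<close> it is T times \<open>Phirev\<close>.\<close>

definition energy_gain :: "nat \<Rightarrow> nat \<Rightarrow> complex mat \<Rightarrow> complex mat \<Rightarrow> complex mat \<Rightarrow> complex mat" where
  "energy_gain d e U \<sigma> H = ptr2 d e (kron (1\<^sub>m d) \<sigma> * (adj U * kron (1\<^sub>m d) H * U - kron (1\<^sub>m d) H))"

context
  fixes d e :: nat and U :: "complex mat"
  assumes U: "unitary (d*e) U"
begin

private lemma Uc [simp]: "U \<in> carrier_mat (d*e) (d*e)"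
  using unitaryD(1)[OF U] .

private lemma Uaa [simp]: "adj (adj U) = U"
  by (rule adj_adj[OF Uc])

private lemmas ac = assoc_mult_mat[of _ "d*e" "d*e" _ "d*e" _ "d*e"]
private lemmas dist = mult_add_distrib_mat[of _ "d*e" "d*e" _ "d*e"] add_mult_distrib_mat[of _ "d*e" "d*e" _ _ "d*e"]
   mult_minus_distrib_mat[of _ "d*e" "d*e" _ "d*e"] minus_mult_distrib_mat[of _ "d*e" "d*e" _ _ "d*e"]
   mult_smult_distrib[of _ "d*e" "d*e" _ "d*e"] mult_smult_assoc_mat[of _ "d*e" "d*e" _ "d*e"]

lemma chan_carrier [simp]: "chan d e U \<sigma> \<rho> \<in> carrier_mat d d"
  by (simp add: chan_def)

lemma dchan_carrier [simp]: "dchan d e U \<sigma> \<rho> \<in> carrier_mat d d"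
  by (simp add: dchan_def)

lemma energy_gain_carrier [simp]: "energy_gain d e U \<sigma> \<rho> \<in> carrier_mat d d"
  by (simp add: energy_gain_def)

lemma linop_chan: assumes "\<sigma> \<in> carrier_mat e e" shows "linop d (chan d e U \<sigma>)"
  unfolding linop_def chan_def using assms
  by (simp add: kron_add_left[of _ d _ _ e] kron_smult_left[of _ d _ e] dist ptr2_add ptr2_smult)

lemma linop_dchan: assumes "\<sigma> \<in> carrier_mat e e" shows "linop d (dchan d e U \<sigma>)"
  unfolding linop_def dchan_def using assms
  by (simp add: kron_add_left[of _ d _ _ e] kron_smult_left[of _ d _ e] dist ptr2_add ptr2_smult)

lemma chan_minus_smult:
  assumes "\<sigma> \<in> carrier_mat e e" "\<tau> \<in> carrier_mat e e" "\<rho> \<in> carrier_mat d d"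
  shows "chan d e U (\<sigma> - c \<cdot>\<^sub>m \<tau>) \<rho> = chan d e U \<sigma> \<rho> - c \<cdot>\<^sub>m chan d e U \<tau> \<rho>"
  unfolding chan_def using assms
  by (simp add: kron_minus_right[of _ d _ e] kron_smult_right[of _ d _ e] dist ptr2_minus ptr2_smult)

lemma mtrace_chan:
  assumes "\<sigma> \<in> carrier_mat e e" "\<rho> \<in> carrier_mat d d"
  shows "mtrace (chan d e U \<sigma> \<rho>) = mtrace \<rho> * mtrace \<sigma>"
proof -
  have k: "kron \<rho> \<sigma> \<in> carrier_mat (d*e) (d*e)" using assms by simp
  have "mtrace (chan d e U \<sigma> \<rho>) = mtrace (kron \<rho> \<sigma>)"
    unfolding chan_def using k by (simp add: mtrace_ptr2 mtrace_unitary_conj[OF U])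
  also have "\<dots> = mtrace (ptr2 d e (kron \<rho> \<sigma>))" by (rule mtrace_ptr2[symmetric, OF k])
  finally show ?thesis using assms by (simp add: ptr2_kron mtrace_smult[of _ d] mult.commute)
qed

lemma psd_chan: "psd e \<sigma> \<Longrightarrow> psd d \<rho> \<Longrightarrow> psd d (chan d e U \<sigma> \<rho>)"
  unfolding chan_def by (intro psd_ptr2 psd_conj[OF psd_kron Uc])

lemma channel_chan: "psd e \<sigma> \<Longrightarrow> mtrace \<sigma> = 1 \<Longrightarrow> channel d (chan d e U \<sigma>)"
  unfolding channel_def by (simp add: linop_chan psdD(2) psd_chan mtrace_chan)

lemma mtrace_mult_ptr2:
  assumes "A \<in> carrier_mat d d" "X \<in> carrier_mat (d*e) (d*e)"
  shows "mtrace (A * ptr2 d e X) = mtrace (kron A (1\<^sub>m e) * X)"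
  using assms mtrace_ptr2[of "kron A (1\<^sub>m e) * X" d e] by (simp add: ptr2_kron_one)

text \<open>Cyclicity of the full trace moves \<open>U\<close> around, and
  \<open>kron \<rho> \<sigma>\<close> splits so that \<open>\<rho>\<close> leaves the partial
  trace.\<close>

lemma chan_duality:
  assumes "\<sigma> \<in> carrier_mat e e" "\<rho> \<in> carrier_mat d d" "X \<in> carrier_mat d d"
  shows "mtrace (chan d e U \<sigma> \<rho> * X) = mtrace (\<rho> * dchan d e U \<sigma> X)"
proof -
  let ?n = "d*e" let ?X = "kron X (1\<^sub>m e)"
  have c: "?X \<in> carrier_mat ?n ?n" "kron \<rho> \<sigma> \<in> carrier_mat ?n ?n" "kron \<rho> (1\<^sub>m e) \<in> carrier_mat ?n ?n"
    "kron (1\<^sub>m d) \<sigma> \<in> carrier_mat ?n ?n" using assms by auto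
  have "chan d e U \<sigma> \<rho> * X = ptr2 d e (U * kron \<rho> \<sigma> * adj U * ?X)"
    unfolding chan_def using c assms by (simp add: ptr2_kron_one)
  then have "mtrace (chan d e U \<sigma> \<rho> * X) = mtrace (U * (kron \<rho> \<sigma> * (adj U * ?X)))"
    using c by (simp add: mtrace_ptr2 ac)
  also have "\<dots> = mtrace ((kron \<rho> \<sigma> * (adj U * ?X)) * U)"
    using c by (intro mtrace_comm[of _ "d*e" "d*e"]) auto
  also have "\<dots> = mtrace (kron \<rho> (1\<^sub>m e) * (kron (1\<^sub>m d) \<sigma> * adj U * ?X * U))"
    unfolding kron_split(1)[OF assms(2,1)] using c by (simp add: ac)
  also have "\<dots> = mtrace (\<rho> * dchan d e U \<sigma> X)"
    unfolding dchan_def using c assms by (simp add: mtrace_mult_ptr2)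
  finally show ?thesis .
qed

text \<open>After the partial trace the term subtracted in \<open>energy_gain\<close> is a scalar,
  the mean energy in \<open>\<sigma>\<close>. Centring \<open>H\<close> by this mean gives the same
  matrix, and the centred energy is what differentiating a Gibbs state produces.\<close>

lemma energy_gain_centered:
  assumes "\<sigma> \<in> carrier_mat e e" "H \<in> carrier_mat e e" "mtrace \<sigma> = 1" "V = U \<or> V = adj U"
  shows "ptr2 d e (kron (1\<^sub>m d) \<sigma> * (adj V * kron (1\<^sub>m d) (H - mtrace (\<sigma> * H) \<cdot>\<^sub>m 1\<^sub>m e) * V)) = energy_gain d e V \<sigma> H"
proof -
  let ?n = "d*e" let ?h = "mtrace (\<sigma> * H)"
  have V: "unitary ?n V" using assms(4) U unitary_adj by auto
  note v = unitaryD[OF V]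
  have c: "kron (1\<^sub>m d) \<sigma> \<in> carrier_mat ?n ?n" "kron (1\<^sub>m d) H \<in> carrier_mat ?n ?n" using assms by auto
  have "adj V * kron (1\<^sub>m d) (H - ?h \<cdot>\<^sub>m 1\<^sub>m e) * V = adj V * kron (1\<^sub>m d) H * V - ?h \<cdot>\<^sub>m 1\<^sub>m ?n"
    using assms c v by (simp add: kron_minus_right[of _ d _ e] kron_smult_right[of _ d _ e] dist kron_one)
  then have "ptr2 d e (kron (1\<^sub>m d) \<sigma> * (adj V * kron (1\<^sub>m d) (H - ?h \<cdot>\<^sub>m 1\<^sub>m e) * V))
      = ptr2 d e (kron (1\<^sub>m d) \<sigma> * (adj V * kron (1\<^sub>m d) H * V)) - ?h \<cdot>\<^sub>m ptr2 d e (kron (1\<^sub>m d) \<sigma>)"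
    using c v by (simp add: dist ptr2_minus ptr2_smult)
  also have "?h \<cdot>\<^sub>m ptr2 d e (kron (1\<^sub>m d) \<sigma>) = ptr2 d e (kron (1\<^sub>m d) \<sigma> * kron (1\<^sub>m d) H)"
    using assms by (simp add: ptr2_kron kron_mult[of _ d _ e] left_mult_one_mat[of _ d d])
  also have "ptr2 d e (kron (1\<^sub>m d) \<sigma> * (adj V * kron (1\<^sub>m d) H * V)) - ptr2 d e (kron (1\<^sub>m d) \<sigma> * kron (1\<^sub>m d) H)
     = energy_gain d e V \<sigma> H"
    unfolding energy_gain_def using c v by (simp add: dist ptr2_minus)
  finally show ?thesis .
qed

section \<open>Identities at an invariant product state\<close>

context
  fixes \<sigma> \<rho> H :: "complex mat"
  assumes s: "\<sigma> \<in> carrier_mat e e" "mtrace \<sigma> = 1" and r: "\<rho> \<in> carrier_mat d d"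
    and H: "H \<in> carrier_mat e e" "\<sigma> * H = H * \<sigma>"
    and inv: "U * kron \<rho> \<sigma> * adj U = kron \<rho> \<sigma>"
begin

private lemma omega_c: "kron \<rho> \<sigma> \<in> carrier_mat (d*e) (d*e)" using s r by simp

lemma invariant_commute: "U * kron \<rho> \<sigma> = kron \<rho> \<sigma> * U" "adj U * kron \<rho> \<sigma> = kron \<rho> \<sigma> * adj U"
proof -
  have "kron \<rho> \<sigma> * U = U * kron \<rho> \<sigma> * adj U * U" unfolding inv ..
  also have "\<dots> = U * kron \<rho> \<sigma>" using omega_c unitaryD[OF U] by (simp add: ac)
  finally show "U * kron \<rho> \<sigma> = kron \<rho> \<sigma> * U" ..
  have "adj U * kron \<rho> \<sigma> = adj U * (U * kron \<rho> \<sigma> * adj U)" unfolding inv ..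
  also have "\<dots> = kron \<rho> \<sigma> * adj U" using omega_c by (simp add: ac unitary_cancel[OF U])
  finally show "adj U * kron \<rho> \<sigma> = kron \<rho> \<sigma> * adj U" .
qed

lemma chan_invariant: "chan d e U \<sigma> \<rho> = \<rho>"
  unfolding chan_def inv using s r by (simp add: ptr2_kron)

text \<open>The derivative of a Gibbs state is \<open>\<sigma>\<close> times the centred energy.
  Since \<open>kron \<rho> \<sigma>\<close> commutes with \<open>adj U\<close>, it can be moved to
  the far right, where \<open>\<rho>\<close> leaves the partial trace and the energy gain of the
  reversed step is left.\<close>

lemma chan_derivative:
  "chan d e U (\<sigma> * (H - mtrace (\<sigma> * H) \<cdot>\<^sub>m 1\<^sub>m e)) \<rho> = energy_gain d e (adj U) \<sigma> H * \<rho>"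
proof -
  let ?n = "d*e" let ?h = "mtrace (\<sigma> * H)" let ?K = "H - ?h \<cdot>\<^sub>m 1\<^sub>m e" let ?S = "kron (1\<^sub>m d) \<sigma>"
  let ?B = "kron (1\<^sub>m d) ?K" let ?R = "kron \<rho> (1\<^sub>m e)"
  have K: "?K \<in> carrier_mat e e" using H by simp
  have comm: "\<sigma> * ?K = ?K * \<sigma>"
    using s H by (simp add: mult_minus_distrib_mat[of _ e e _ e] minus_mult_distrib_mat[of _ e e _ _ e]
        mult_smult_distrib[of _ e e _ e] mult_smult_assoc_mat[of _ e e _ e] left_mult_one_mat[of _ e e])
  have c: "?B \<in> carrier_mat ?n ?n" "?S \<in> carrier_mat ?n ?n" "?R \<in> carrier_mat ?n ?n" using K s r by auto
  have "kron \<rho> (\<sigma> * ?K) = ?B * kron \<rho> \<sigma>"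
    unfolding comm using K s r by (simp add: kron_mult[of _ d _ e] left_mult_one_mat[of _ d d])
  then have "U * kron \<rho> (\<sigma> * ?K) * adj U = U * ?B * (kron \<rho> \<sigma> * adj U)"
    using c omega_c by (simp add: ac)
  also have "\<dots> = U * ?B * (adj U * (?S * ?R))"
    unfolding invariant_commute(2)[symmetric] kron_split(2)[OF r s(1), symmetric] ..
  also have "\<dots> = (U * ?B * adj U * ?S) * ?R"
    using c by (simp add: ac)
  finally have "chan d e U (\<sigma> * ?K) \<rho> = ptr2 d e (U * ?B * adj U * ?S) * \<rho>"
    unfolding chan_def using c r by (simp add: ptr2_kron_one)
  also have "ptr2 d e (U * ?B * adj U * ?S) = ptr2 d e (?S * (U * ?B * adj U))"
    using c s by (intro ptr2_comm[symmetric]) auto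
  also have "\<dots> = energy_gain d e (adj U) \<sigma> H"
    using energy_gain_centered[OF s(1) H(1) s(2), of "adj U"] by simp
  finally show ?thesis .
qed

text \<open>In the invariant product state the environment has the same mean energy before and after
  the step.\<close>

lemma mtrace_energy_gain: "mtrace (\<rho> * energy_gain d e U \<sigma> H) = 0"
proof -
  let ?n = "d*e" let ?B = "kron (1\<^sub>m d) H" let ?w = "kron \<rho> \<sigma>"
  have c: "?B \<in> carrier_mat ?n ?n" "kron \<rho> (1\<^sub>m e) \<in> carrier_mat ?n ?n" "kron (1\<^sub>m d) \<sigma> \<in> carrier_mat ?n ?n" using H s r by auto
  have "mtrace (\<rho> * energy_gain d e U \<sigma> H) = mtrace (kron \<rho> (1\<^sub>m e) * (kron (1\<^sub>m d) \<sigma> * (adj U * ?B * U - ?B)))"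
    unfolding energy_gain_def using c r by (simp add: mtrace_mult_ptr2)
  also have "kron \<rho> (1\<^sub>m e) * (kron (1\<^sub>m d) \<sigma> * (adj U * ?B * U - ?B)) = ?w * adj U * (?B * U) - ?w * ?B"
    unfolding kron_split(1)[OF r s(1)] using c by (simp add: ac dist)
  also have "mtrace (?w * adj U * (?B * U) - ?w * ?B) = mtrace (adj U * (?w * ?B * U)) - mtrace (?w * ?B)"
    unfolding invariant_commute(2)[symmetric] using c omega_c by (simp add: ac mtrace_minus[of _ ?n])
  also have "mtrace (adj U * (?w * ?B * U)) = mtrace (?w * ?B * U * adj U)"
    using c omega_c by (intro mtrace_comm[of _ "d*e" "d*e"]) auto
  also have "?w * ?B * U * adj U = ?w * ?B" using c omega_c unitaryD[OF U] by (simp add: ac)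
  finally show ?thesis by simp
qed

text \<open>What the environment gains, the system loses in \<open>A\<close>. Through this balance
  the fluxes become functions of the effective Hamiltonian.\<close>

lemma energy_gain_first_law:
  assumes A: "A \<in> carrier_mat d d"
    and cons: "U * (kron A (1\<^sub>m e) + kron (1\<^sub>m d) H) = (kron A (1\<^sub>m e) + kron (1\<^sub>m d) H) * U"
  shows "adj U * kron (1\<^sub>m d) H * U - kron (1\<^sub>m d) H = kron A (1\<^sub>m e) - adj U * kron A (1\<^sub>m e) * U"
    "energy_gain d e U \<sigma> H = A - dchan d e U \<sigma> A"
proof -
  let ?n = "d*e" let ?A = "kron A (1\<^sub>m e)" let ?B = "kron (1\<^sub>m d) H"
  have c: "?A \<in> carrier_mat ?n ?n" "?B \<in> carrier_mat ?n ?n" "kron (1\<^sub>m d) \<sigma> \<in> carrier_mat ?n ?n" using A H s by auto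
  have "adj U * (U * (?A + ?B)) = adj U * ((?A + ?B) * U)" unfolding cons ..
  then have "?A + ?B = adj U * ?A * U + adj U * ?B * U"
    using c by (simp add: unitary_cancel[OF U] dist ac)
  then have "(?A + ?B) $$ (i,j) = (adj U * ?A * U + adj U * ?B * U) $$ (i,j)" for i j by simp
  then have e: "?A $$ (i,j) + ?B $$ (i,j) = (adj U * ?A * U) $$ (i,j) + (adj U * ?B * U) $$ (i,j)" if "i < ?n" "j < ?n" for i j
    using mat_op_index(1)[OF c(1,2) that] mat_op_index(1)[of "adj U * ?A * U" ?n ?n "adj U * ?B * U" i j] c that
    by (metis Uc adj_carrier mult_carrier_sq)
  show eq: "adj U * ?B * U - ?B = ?A - adj U * ?A * U"
  proof (rule matI[of _ ?n ?n])
    fix i j assume ij: "i < ?n" "j < ?n"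
    have m: "adj U * ?A * U \<in> carrier_mat ?n ?n" "adj U * ?B * U \<in> carrier_mat ?n ?n" using c by auto
    show "(adj U * ?B * U - ?B) $$ (i,j) = (?A - adj U * ?A * U) $$ (i,j)"
      using e[OF ij] unfolding mat_op_index(2)[OF m(2) c(2) ij] mat_op_index(2)[OF c(1) m(1) ij]
      by (simp add: algebra_simps)
  qed (use c in auto)
  have "energy_gain d e U \<sigma> H = ptr2 d e (kron (1\<^sub>m d) \<sigma> * (?A - adj U * ?A * U))"
    unfolding energy_gain_def eq ..
  also have "\<dots> = ptr2 d e (kron (1\<^sub>m d) \<sigma> * ?A) - dchan d e U \<sigma> A"
    unfolding dchan_def using c by (simp add: dist ac ptr2_minus)
  also have "kron (1\<^sub>m d) \<sigma> * ?A = kron A \<sigma>" by (rule kron_split(2)[symmetric, OF A s(1)])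
  also have "ptr2 d e (kron A \<sigma>) = A" using A s by (simp add: ptr2_kron)
  finally show "energy_gain d e U \<sigma> H = A - dchan d e U \<sigma> A" .
qed

lemma mtrace_omega_ptr2:
  assumes "X \<in> carrier_mat (d*e) (d*e)"
  shows "mtrace (\<rho> * ptr2 d e (kron (1\<^sub>m d) \<sigma> * X)) = mtrace (kron \<rho> \<sigma> * X)"
  using assms s r mtrace_mult_ptr2[OF r, of "kron (1\<^sub>m d) \<sigma> * X"] unfolding kron_split(1)[OF r s(1)]
  by (simp add: ac)

text \<open>With \<open>\<Delta> = U\<^sup>* B U - B\<close> and \<open>\<omega>\<close> commuting with \<open>U\<close> and \<open>B\<close>, both sides are \<open>- Tr(\<omega> \<Delta>\<^sup>2)\<close>;
  energy conservation rewrites \<open>\<Delta>\<close> in terms of \<open>A\<close>.\<close>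
lemma fluctuation_dissipation:
  assumes A: "A \<in> carrier_mat d d"
    and cons: "U * (kron A (1\<^sub>m e) + kron (1\<^sub>m d) H) = (kron A (1\<^sub>m e) + kron (1\<^sub>m d) H) * U"
  shows "2 * mtrace (\<rho> * energy_gain d e U (\<sigma> * (H - mtrace (\<sigma> * H) \<cdot>\<^sub>m 1\<^sub>m e)) H)
    = - mtrace (\<rho> * (dchan d e U \<sigma> (A * A) - dchan d e U \<sigma> A * A - A * dchan d e U \<sigma> A + A * A))"
proof -
  let ?n = "d*e" let ?A = "kron A (1\<^sub>m e)" let ?B = "kron (1\<^sub>m d) H" let ?S = "kron (1\<^sub>m d) \<sigma>"
  let ?w = "kron \<rho> \<sigma>" let ?h = "mtrace (\<sigma> * H)"
  define V where "V = adj U * ?B * U"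
  define W where "W = adj U * ?A * U"
  define D where "D = V - ?B"
  have c: "?A \<in> carrier_mat ?n ?n" "?B \<in> carrier_mat ?n ?n" "?S \<in> carrier_mat ?n ?n" "?w \<in> carrier_mat ?n ?n" using A H s r by auto
  have vc: "V \<in> carrier_mat ?n ?n" "W \<in> carrier_mat ?n ?n" "D \<in> carrier_mat ?n ?n" using c by (auto simp: V_def W_def D_def)
  have DA: "D = ?A - W" unfolding D_def V_def W_def by (rule energy_gain_first_law(1)[OF A cons])
  have wB: "?w * ?B = ?B * ?w" using H s r by (simp add: kron_mult[of _ d _ e] left_mult_one_mat[of _ d d])
  \<comment> \<open>The invariant state does not see conjugation by \<open>U\<close>.\<close>
  have cyc: "mtrace (?w * (adj U * X * U)) = mtrace (?w * X)" if X: "X \<in> carrier_mat ?n ?n" for X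
  proof -
    have "?w * (adj U * X * U) = adj U * (?w * X * U)"
      using invariant_commute(2) X c by (simp add: ac[symmetric]) 
    then have "mtrace (?w * (adj U * X * U)) = mtrace (adj U * (?w * X * U))" by simp
    also have "\<dots> = mtrace (?w * X * U * adj U)" using c X by (intro mtrace_comm[of _ "d*e" "d*e"]) auto
    also have "?w * X * U * adj U = ?w * X" using c X unitaryD[OF U] by (simp add: ac)
    finally show ?thesis .
  qed
  have "?S * kron (1\<^sub>m d) (H - ?h \<cdot>\<^sub>m 1\<^sub>m e) = kron (1\<^sub>m d) (\<sigma> * (H - ?h \<cdot>\<^sub>m 1\<^sub>m e))"
    using s H by (simp add: kron_mult[of _ d _ e] left_mult_one_mat[of _ d d])
  moreover have "kron (1\<^sub>m d) (H - ?h \<cdot>\<^sub>m 1\<^sub>m e) = ?B - ?h \<cdot>\<^sub>m 1\<^sub>m ?n"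
    using H by (simp add: kron_minus_right[of _ d _ e] kron_smult_right[of _ d _ e] kron_one)
  ultimately have "energy_gain d e U (\<sigma> * (H - ?h \<cdot>\<^sub>m 1\<^sub>m e)) H = ptr2 d e (?S * ((?B - ?h \<cdot>\<^sub>m 1\<^sub>m ?n) * D))"
    unfolding energy_gain_def V_def[symmetric] D_def[symmetric] using c vc by (simp add: ac[symmetric])
  then have "mtrace (\<rho> * energy_gain d e U (\<sigma> * (H - ?h \<cdot>\<^sub>m 1\<^sub>m e)) H) = mtrace (?w * ((?B - ?h \<cdot>\<^sub>m 1\<^sub>m ?n) * D))"
    using c vc by (simp add: mtrace_omega_ptr2)
  also have "?w * ((?B - ?h \<cdot>\<^sub>m 1\<^sub>m ?n) * D) = ?w * (?B * D) - ?h \<cdot>\<^sub>m (?w * D)"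
    using c vc by (simp add: dist left_mult_one_mat[of _ ?n ?n])
  also have "mtrace (?w * (?B * D) - ?h \<cdot>\<^sub>m (?w * D)) = mtrace (?w * (?B * D)) - ?h * mtrace (?w * D)"
    using c vc by (simp add: mtrace_minus[of _ ?n] mtrace_smult[of _ ?n])
  \<comment> \<open>The centring constant multiplies the mean energy gain, which vanishes in the
    invariant state.\<close>
  also have "mtrace (?w * D) = 0"
    unfolding D_def using cyc[OF c(2)] c vc(1) by (simp add: dist mtrace_minus[of _ ?n] V_def)
  also have "mtrace (?w * (?B * D)) - ?h * 0 = mtrace (?w * (?B * V)) - mtrace (?w * (?B * ?B))"
    unfolding D_def using c vc(1) by (simp add: dist mtrace_minus[of _ ?n])
  finally have lhs: "mtrace (\<rho> * energy_gain d e U (\<sigma> * (H - ?h \<cdot>\<^sub>m 1\<^sub>m e)) H)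
      = mtrace (?w * (?B * V)) - mtrace (?w * (?B * ?B))" .
  have sq: "adj U * X * U * (adj U * X * U) = adj U * (X * X) * U" if "X \<in> carrier_mat ?n ?n" for X
    using that by (simp add: ac unitary_cancel[OF U])
  have tr_sq: "mtrace (?w * ((X - Y) * (X - Y))) = mtrace (?w * (X * X)) - mtrace (?w * (X * Y)) - mtrace (?w * (Y * X)) + mtrace (?w * (Y * Y))"
    if "X \<in> carrier_mat ?n ?n" "Y \<in> carrier_mat ?n ?n" for X Y
    using that c by (simp add: dist mtrace_minus[of _ ?n] algebra_simps)
  \<comment> \<open>The two mixed terms agree because \<open>?w\<close> commutes with
    \<open>?B\<close>.\<close>
  have VB: "mtrace (?w * (V * ?B)) = mtrace (?w * (?B * V))"
  proof -
    have "mtrace (?w * (V * ?B)) = mtrace (?w * V * ?B)" using c vc by (simp add: ac)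
    also have "\<dots> = mtrace (?B * (?w * V))" using c vc by (intro mtrace_comm[of _ "d*e" "d*e"]) auto
    also have "?B * (?w * V) = ?w * (?B * V)"
      unfolding assoc_mult_mat[OF c(2,4) vc(1), symmetric] assoc_mult_mat[OF c(4,2) vc(1), symmetric] wB ..
    finally show ?thesis .
  qed
  \<comment> \<open>The square of \<open>V\<close> is the conjugate of the square of
    \<open>?B\<close>, so both have the same mean.\<close>
  have "mtrace (?w * (D * D)) = 2 * mtrace (?w * (?B * ?B)) - 2 * mtrace (?w * (?B * V))"
    unfolding D_def tr_sq[OF vc(1) c(2)] VB
    unfolding V_def sq[OF c(2)] cyc[OF mult_carrier_sq[OF c(2) c(2)]] by simp
  then have "2 * mtrace (\<rho> * energy_gain d e U (\<sigma> * (H - ?h \<cdot>\<^sub>m 1\<^sub>m e)) H) = - mtrace (?w * (D * D))"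
    unfolding lhs by (simp add: algebra_simps)
  \<comment> \<open>By energy conservation \<open>D\<close> is also \<open>?A - W\<close>; the four
    terms of this square are those of the dissipation function.\<close>
  also have "mtrace (?w * (D * D)) = mtrace (?w * (?A * ?A)) - mtrace (?w * (?A * W)) - mtrace (?w * (W * ?A)) + mtrace (?w * (W * W))"
    unfolding DA by (rule tr_sq[OF c(1) vc(2)])
  also have "mtrace (?w * (W * W)) = mtrace (\<rho> * dchan d e U \<sigma> (A * A))"
  proof -
    have "W * W = adj U * kron (A * A) (1\<^sub>m e) * U"
      unfolding W_def sq[OF c(1)] using A by (simp add: kron_mult[of _ d _ e])
    moreover have "dchan d e U \<sigma> (A * A) = ptr2 d e (?S * (adj U * kron (A * A) (1\<^sub>m e) * U))"
      unfolding dchan_def using A c by (simp add: ac)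
    ultimately show ?thesis using mtrace_omega_ptr2[OF mult_carrier_sq[OF vc(2) vc(2)]] by simp
  qed
  also have "mtrace (?w * (W * ?A)) = mtrace (\<rho> * (dchan d e U \<sigma> A * A))"
  proof -
    have "dchan d e U \<sigma> A * A = ptr2 d e (?S * (W * ?A))"
    proof -
      have "dchan d e U \<sigma> A = ptr2 d e (?S * W)" unfolding dchan_def W_def using c by (simp add: ac)
      then have "dchan d e U \<sigma> A * A = ptr2 d e (?S * W * ?A)" using c vc A by (simp add: ptr2_kron_one)
      then show ?thesis using c vc by (simp add: ac)
    qed
    then show ?thesis using mtrace_omega_ptr2[OF mult_carrier_sq[OF vc(2) c(1)]] by simp
  qed
  also have "mtrace (?w * (?A * W)) = mtrace (\<rho> * (A * dchan d e U \<sigma> A))"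
  proof -
    have SA: "?S * ?A = ?A * ?S" using kron_split[OF A s(1)] by simp
    have e1: "?A * (?S * W) = ?S * (?A * W)"
      unfolding assoc_mult_mat[OF c(1,3) vc(2), symmetric] assoc_mult_mat[OF c(3,1) vc(2), symmetric] SA ..
    have "dchan d e U \<sigma> A = ptr2 d e (?S * W)" unfolding dchan_def W_def using c by (simp add: ac)
    then have "A * dchan d e U \<sigma> A = ptr2 d e (?A * (?S * W))" using c vc A by (simp add: ptr2_kron_one)
    then show ?thesis unfolding e1 using mtrace_omega_ptr2[OF mult_carrier_sq[OF c(1) vc(2)]] by simp
  qed
  also have "mtrace (?w * (?A * ?A)) = mtrace (\<rho> * (A * A))"
  proof -
    have "?w * (?A * ?A) = kron (\<rho> * (A * A)) \<sigma>" using A s r by (simp add: kron_mult[of _ d _ e])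
    then have "mtrace (?w * (?A * ?A)) = mtrace (ptr2 d e (kron (\<rho> * (A * A)) \<sigma>))"
      using A s r by (simp add: mtrace_ptr2)
    then show ?thesis using A s r by (simp add: ptr2_kron mtrace_smult[of _ d])
  qed
  finally have fin: "2 * mtrace (\<rho> * energy_gain d e U (\<sigma> * (H - ?h \<cdot>\<^sub>m 1\<^sub>m e)) H)
     = - (mtrace (\<rho> * (A * A)) - mtrace (\<rho> * (A * dchan d e U \<sigma> A)) - mtrace (\<rho> * (dchan d e U \<sigma> A * A)) + mtrace (\<rho> * dchan d e U \<sigma> (A * A)))" .
  have "mtrace (\<rho> * (dchan d e U \<sigma> (A * A) - dchan d e U \<sigma> A * A - A * dchan d e U \<sigma> A + A * A))
    = mtrace (\<rho> * dchan d e U \<sigma> (A * A)) - mtrace (\<rho> * (dchan d e U \<sigma> A * A)) - mtrace (\<rho> * (A * dchan d e U \<sigma> A)) + mtrace (\<rho> * (A * A))"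
    using A r by (simp add: mult_add_distrib_mat[of _ d d _ d] mult_minus_distrib_mat[of _ d d _ d] mtrace_add[of _ d] mtrace_minus[of _ d])
  then show ?thesis unfolding fin by (simp add: algebra_simps)
qed

text \<open>For the bilinear form \<open>mtrace (\<rho> * X * Y)\<close> the transpose of a dual
  step is the dual step of \<open>adj U\<close>: the factor \<open>adj U\<close> is moved through
  \<open>kron \<rho> \<sigma>\<close> and then around the trace.\<close>

lemma dchan_reversed:
  assumes X: "X \<in> carrier_mat d d" and Y: "Y \<in> carrier_mat d d"
  shows "mtrace (\<rho> * dchan d e U \<sigma> X * Y) = mtrace (\<rho> * X * dchan d e (adj U) \<sigma> Y)"
proof -
  let ?n = "d*e" let ?X = "kron X (1\<^sub>m e)" let ?Y = "kron Y (1\<^sub>m e)" let ?S = "kron (1\<^sub>m d) \<sigma>" let ?w = "kron \<rho> \<sigma>"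
  have c: "?X \<in> carrier_mat ?n ?n" "?Y \<in> carrier_mat ?n ?n" "?S \<in> carrier_mat ?n ?n" "?w \<in> carrier_mat ?n ?n" using X Y s r by auto
  have "dchan d e U \<sigma> X * Y = ptr2 d e (?S * (adj U * (?X * (U * ?Y))))"
  proof -
    have "dchan d e U \<sigma> X * Y = ptr2 d e (?S * adj U * ?X * U * ?Y)" unfolding dchan_def using c Y by (simp add: ptr2_kron_one)
    then show ?thesis using c by (simp add: ac)
  qed
  then have "mtrace (\<rho> * dchan d e U \<sigma> X * Y) = mtrace (?w * (adj U * (?X * (U * ?Y))))"
    using c r Y by (simp add: assoc_mult_mat[of _ d d _ d _ d] mtrace_omega_ptr2)
  also have "?w * (adj U * (?X * (U * ?Y))) = adj U * (?w * (?X * (U * ?Y)))"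
    using invariant_commute(2) c by (simp add: ac[symmetric])
  also have "mtrace \<dots> = mtrace ((?w * (?X * (U * ?Y))) * adj U)"
    using c by (intro mtrace_comm[of _ "d*e" "d*e"]) auto
  also have "(?w * (?X * (U * ?Y))) * adj U = kron (\<rho> * X) (1\<^sub>m e) * (?S * (U * ?Y * adj U))"
  proof -
    have "?w * ?X = kron (\<rho> * X) (1\<^sub>m e) * ?S" using r X s by (simp add: kron_mult[of _ d _ e] left_mult_one_mat[of _ e e])
    then have "?w * ?X * (U * ?Y * adj U) = kron (\<rho> * X) (1\<^sub>m e) * ?S * (U * ?Y * adj U)" by simp
    then show ?thesis using c r X by (simp add: ac)
  qed
  also have "mtrace \<dots> = mtrace (\<rho> * X * dchan d e (adj U) \<sigma> Y)"
    unfolding dchan_def using c r X by (simp add: mtrace_mult_ptr2 ac)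
  finally show ?thesis .
qed

end

section \<open>Time reversal of one step\<close>

context
  fixes \<Theta> \<Theta>E :: "complex mat"
  assumes T: "antiunitary_involution d \<Theta>" and TE: "antiunitary_involution e \<Theta>E"
    and TU: "time_rev (kron \<Theta> \<Theta>E) U = adj U"
begin

private lemma Tu: "unitary d \<Theta>" "unitary e \<Theta>E" "unitary (d*e) (kron \<Theta> \<Theta>E)"
  using T TE unitary_kron by (auto simp: antiunitary_involution_def)

private lemma TUa: "time_rev (kron \<Theta> \<Theta>E) (adj U) = U"
  using time_rev_adj[OF unitaryD(1)[OF Tu(3)] Uc] TU by simp

lemma time_rev_energy_gain:
  assumes "\<sigma> \<in> carrier_mat e e" "H \<in> carrier_mat e e" "time_rev \<Theta>E \<sigma> = \<sigma>" "time_rev \<Theta>E H = H"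
  shows "time_rev \<Theta> (energy_gain d e U \<sigma> H) = energy_gain d e (adj U) \<sigma> H"
  unfolding energy_gain_def using assms unitaryD(1)[OF Tu(1)] unitaryD(1)[OF Tu(2)] unitaryD(1)[OF Tu(3)]
  by (simp add: time_rev_ptr2[OF _ Tu(2)] time_rev_mult[OF Tu(3)] time_rev_minus[of _ "d*e"] TU TUa
      time_rev_kron[of _ d _ e] time_rev_one[OF Tu(1)])

lemma time_rev_dchan:
  assumes "\<sigma> \<in> carrier_mat e e" "X \<in> carrier_mat d d" "time_rev \<Theta>E \<sigma> = \<sigma>"
  shows "dchan d e (adj U) \<sigma> X = time_rev \<Theta> (dchan d e U \<sigma> (time_rev \<Theta> X))"
  unfolding dchan_def using assms unitaryD(1)[OF Tu(1)] unitaryD(1)[OF Tu(2)] unitaryD(1)[OF Tu(3)]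
  by (simp add: time_rev_ptr2[OF _ Tu(2)] time_rev_mult[OF Tu(3)] TU TUa
      time_rev_kron[of _ d _ e] time_rev_one[OF Tu(1)] time_rev_one[OF Tu(2)] time_rev_involution[OF T])

text \<open>If the environment state is a multiple of the identity, the dual step is a multiple of
  the partial trace of \<open>adj U * kron X (1\<^sub>m e) * U\<close>, that is the step with
  \<open>U\<close> replaced by \<open>adj U\<close>, and time reversal makes exactly this
  exchange.\<close>

lemma time_rev_chan_infinite_temperature:
  assumes "X \<in> carrier_mat d d"
  shows "dchan d e U (complex_of_real c \<cdot>\<^sub>m 1\<^sub>m e) X = time_rev \<Theta> (chan d e U (complex_of_real c \<cdot>\<^sub>m 1\<^sub>m e) (time_rev \<Theta> X))"
proof -
  let ?n = "d * e" let ?X = "kron X (1\<^sub>m e)"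
  note u = unitaryD(1)[OF Tu(1)] unitaryD(1)[OF Tu(2)] unitaryD(1)[OF Tu(3)]
  have c: "?X \<in> carrier_mat ?n ?n" using assms by simp
  have "chan d e U (complex_of_real c \<cdot>\<^sub>m 1\<^sub>m e) (time_rev \<Theta> X)
     = complex_of_real c \<cdot>\<^sub>m ptr2 d e (U * kron (time_rev \<Theta> X) (1\<^sub>m e) * adj U)"
    unfolding chan_def using assms u by (simp add: kron_smult_right[of _ d _ e] dist ptr2_smult)
  then have "time_rev \<Theta> (chan d e U (complex_of_real c \<cdot>\<^sub>m 1\<^sub>m e) (time_rev \<Theta> X))
     = complex_of_real c \<cdot>\<^sub>m ptr2 d e (adj U * ?X * U)"
    using assms u by (simp add: time_rev_smult[of _ d] time_rev_ptr2[OF _ Tu(2)] time_rev_mult[OF Tu(3)] TU TUa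
      time_rev_kron[of _ d _ e] time_rev_one[OF Tu(2)] time_rev_involution[OF T])
  moreover have "dchan d e U (complex_of_real c \<cdot>\<^sub>m 1\<^sub>m e) X = complex_of_real c \<cdot>\<^sub>m ptr2 d e (adj U * ?X * U)"
    unfolding dchan_def using c
    by (simp add: kron_smult_right[of _ d _ e] kron_one dist ptr2_smult left_mult_one_mat[of _ ?n ?n])
  ultimately show ?thesis by simp
qed

end

end

section \<open>Primitive maps are mixing\<close>

lemma qf_parallelogram:
  "qf d A (\<lambda>i. u i + v i) + qf d A (\<lambda>i. u i - v i) = 2 * qf d A u + 2 * qf d A v"
  unfolding qf_def sum_distrib_left sum.distrib[symmetric]
  by (intro sum.cong refl) (simp add: algebra_simps)

text \<open>The parallelogram law with one nonnegative term dropped; the factor 2 absorbs the cross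
  terms.\<close>

lemma qf_add_le:
  assumes "psd d A" shows "Re (qf d A (\<lambda>i. u i + v i)) \<le> 2 * Re (qf d A u) + 2 * Re (qf d A v)"
  using arg_cong[OF qf_parallelogram[of d A u v], of Re] psdD(3)[OF assms, of "\<lambda>i. u i - v i"] by simp

lemma qf_scale_vec: "qf d A (\<lambda>i. c * u i) = complex_of_real ((cmod c)\<^sup>2) * qf d A u"
proof -
  have "cnj (c * u i) * A $$ (i,j) * (c * u j) = (c * cnj c) * (cnj (u i) * A $$ (i,j) * u j)" for i j
    by simp
  then show ?thesis unfolding qf_def complex_norm_square sum_distrib_left by (simp only:)
qed

lemma qf_le_msum:
  assumes "\<And>x. x \<in> set xs \<Longrightarrow> psd d (f x)" "x \<in> set xs"
  shows "Re (qf d (f x) g) \<le> Re (qf d (msum d f xs) g)"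
  using assms
proof (induction xs rule: rev_induct)
  case (snoc y ys)
  have p: "psd d (msum d f ys)" "psd d (f y)" using snoc.prems(1) by (auto intro: psd_msum)
  have e: "Re (qf d (msum d f (ys @ [y])) g) = Re (qf d (msum d f ys) g) + Re (qf d (f y) g)"
    using p by (simp add: msum_snoc qf_add psdD(2))
  show ?case
  proof (cases "x \<in> set ys")
    case True
    have "Re (qf d (f x) g) \<le> Re (qf d (msum d f ys) g)" using snoc.IH snoc.prems(1) True by simp
    then show ?thesis unfolding e using psdD(3)[OF p(2), of g] by simp
  next
    case False
    then have "x = y" using snoc.prems(2) by simp
    then show ?thesis unfolding e using psdD(3)[OF p(1), of g] by simp
  qed
qed simp

text \<open>Conjugation by a matrix unit isolates one diagonal entry of \<open>A\<close> and one
  coordinate of \<open>f\<close>. Summed over \<open>a\<close> and \<open>b\<close> this gives the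
  trace of \<open>A\<close> times the squared norm of \<open>f\<close>.\<close>

lemma qf_elementary:
  assumes A: "A \<in> carrier_mat d d" and ab: "a < d" "b < d"
  defines "E \<equiv> Matrix.mat d d (\<lambda>(i,j). if i = a \<and> j = b then 1 else 0 :: complex)"
  shows "qf d (E * A * adj E) f = A $$ (b,b) * complex_of_real ((cmod (f a))\<^sup>2)"
proof -
  have Ec: "E \<in> carrier_mat d d" by (simp add: E_def)
  have "(\<Sum>k<d. cnj (E $$ (k,i)) * f k) = (if i = b then f a else 0)" if "i < d" for i
  proof -
    have "(\<Sum>k<d. cnj (E $$ (k,i)) * f k) = (\<Sum>k<d. if k = a then (if i = b then f a else 0) else 0)"
      using that by (intro sum.cong refl) (auto simp: E_def)
    then show ?thesis using ab by (simp add: sum.delta)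
  qed
  then have "qf d (E * A * adj E) f = (\<Sum>i<d. \<Sum>j<d. if i = b then if j = b then cnj (f a) * A $$ (i,j) * f a else 0 else 0)"
    unfolding qf_conj[OF A Ec] unfolding qf_def
    by (intro sum.cong refl) auto
  also have "\<dots> = (\<Sum>i<d. if i = b then \<Sum>j<d. if j = b then cnj (f a) * A $$ (i,j) * f a else 0 else 0)"
    by (intro sum.cong refl) auto
  also have "\<dots> = A $$ (b,b) * (f a * cnj (f a))" using ab by (simp add: sum.delta mult_ac)
  finally show ?thesis unfolding complex_norm_square .
qed

lemma qf_one: "qf d (1\<^sub>m d) f = complex_of_real (\<Sum>a<d. (cmod (f a))\<^sup>2)"
proof -
  have "qf d (1\<^sub>m d) f = (\<Sum>i<d. \<Sum>j<d. if j = i then f i * cnj (f i) else 0)"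
    unfolding qf_def by (intro sum.cong refl) auto
  then show ?thesis by (simp add: sum.delta complex_norm_square del: of_real_power)
qed

text \<open>Every matrix unit is a combination of Kraus words of length \<open>n\<close>, and
  conjugation by a single word lies below \<open>L ^^ n\<close>. So conjugation by a matrix unit
  lies below a multiple of \<open>L ^^ n\<close>, and these conjugations add up to the trace times
  the identity.\<close>

lemma primitive_mixing:
  assumes L: "channel d L" and prim: "primitive d L"
  shows "mixing d L"
proof -
  from prim[unfolded primitive_def] obtain Ks where KK:
    "(\<forall>K \<in> set Ks. K \<in> carrier_mat d d) \<and>
      (\<forall>\<rho> \<in> carrier_mat d d. L \<rho> = msum d (\<lambda>K. K * \<rho> * adj K) Ks) \<and>
      (\<exists>n \<ge> 1. \<forall>X \<in> carrier_mat d d. \<exists>c :: nat list \<Rightarrow> complex.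
          X = msum d (\<lambda>w. c w \<cdot>\<^sub>m foldr (\<lambda>i A. Ks ! i * A) w (1\<^sub>m d)) (List.n_lists n [0..<length Ks]))"
    by (rule exE)
  note Ks = bspec[OF conjunct1[OF KK]]
  note LK = bspec[OF conjunct1[OF conjunct2[OF KK]]]
  from conjunct2[OF conjunct2[OF KK]] obtain n where nn: "1 \<le> n \<and> (\<forall>X \<in> carrier_mat d d. \<exists>c :: nat list \<Rightarrow> complex.
          X = msum d (\<lambda>w. c w \<cdot>\<^sub>m foldr (\<lambda>i A. Ks ! i * A) w (1\<^sub>m d)) (List.n_lists n [0..<length Ks]))"
    by (rule exE)
  note n = conjunct1[OF nn] note span = bspec[OF conjunct2[OF nn]]
  define W where "W w = foldr (\<lambda>i A. Ks ! i * A) w (1\<^sub>m d)" for w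
  have W0: "W [] = 1\<^sub>m d" and WC: "W (i # w) = Ks ! i * W w" for i w by (simp_all add: W_def)
  have Wc: "W w \<in> carrier_mat d d" if "set w \<subseteq> {0..<length Ks}" for w
    using that by (induction w) (auto simp: W0 WC Ks)
  \<comment> \<open>The image \<open>(L ^^ k) A\<close> is a sum of positive terms over all words of
    length \<open>k\<close>; the induction keeps one Kraus operator at each application of
    \<open>L\<close>.\<close>
  have word: "Re (qf d (W w * A * adj (W w)) f) \<le> Re (qf d ((L ^^ k) A) f)"
    if "length w = k" "set w \<subseteq> {0..<length Ks}" "psd d A" for w k A f
    using that
  proof (induction w arbitrary: k f)
    case Nil
    then show ?case using psdD(2)[OF Nil(3)] by (simp add: W0 left_mult_one_mat[of _ d d])
  next
    case (Cons i w)
    let ?K = "Ks ! i"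
    have K: "?K \<in> set Ks" "?K \<in> carrier_mat d d" using Cons.prems(2) Ks by auto
    have w: "W w \<in> carrier_mat d d" using Cons.prems(2) Wc by auto
    have A: "A \<in> carrier_mat d d" using psdD(2)[OF Cons.prems(3)] .
    obtain l where l: "k = Suc l" "length w = l" using Cons.prems(1) by auto
    have LA: "psd d ((L ^^ l) A)" by (rule channelD(2)[OF channel_funpow[OF L] Cons.prems(3)])
    define g where "g i = (\<Sum>k<d. cnj (?K $$ (k,i)) * f k)" for i
    have "W (i # w) * A * adj (W (i # w)) = ?K * (W w * A * adj (W w)) * adj ?K"
      unfolding WC using K(2) w A by (simp add: adj_mult[of _ d d _ d] assoc_mult_mat[of _ d d _ d _ d])
    then have "Re (qf d (W (i # w) * A * adj (W (i # w))) f) = Re (qf d (W w * A * adj (W w)) g)"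
      using w A unfolding g_def by (simp add: qf_conj[OF _ K(2)])
    also have "\<dots> \<le> Re (qf d ((L ^^ l) A) g)"
      using Cons.IH[OF l(2) _ Cons.prems(3)] Cons.prems(2) by simp
    also have "\<dots> = Re (qf d (?K * (L ^^ l) A * adj ?K) f)"
      unfolding g_def qf_conj[OF psdD(2)[OF LA] K(2)] ..
    also have "\<dots> \<le> Re (qf d (msum d (\<lambda>K. K * (L ^^ l) A * adj K) Ks) f)"
      using qf_le_msum[of Ks d "\<lambda>K. K * (L ^^ l) A * adj K" ?K f] K(1) psd_conj[OF LA Ks] by simp
    also have "msum d (\<lambda>K. K * (L ^^ l) A * adj K) Ks = (L ^^ k) A"
      unfolding l(1) using LK[OF psdD(2)[OF LA]] by simp
    finally show ?case .
  qed
  \<comment> \<open>A linear combination costs only a constant: adding a word doubles the previous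
    constant and adds twice the squared modulus of the coefficient.\<close>
  have comb: "\<exists>C\<ge>0. \<forall>A f. psd d A \<longrightarrow> Re (qf d (X * A * adj X) f) \<le> C * Re (qf d ((L ^^ n) A) f)"
    if X: "X = msum d (\<lambda>w. c w \<cdot>\<^sub>m W w) ws" and ws: "set ws \<subseteq> {w. length w = n \<and> set w \<subseteq> {0..<length Ks}}" for X c ws
    using X ws
  proof (induction ws arbitrary: X rule: rev_induct)
    case Nil
    have "qf d (X * A * adj X) f = 0" if "psd d A" for A f
      using psdD(2)[OF that] Nil(1) unfolding qf_conj[OF psdD(2)[OF that] Nil(1)[unfolded msum_Nil, THEN ssubst[of _ _ "\<lambda>X. X \<in> carrier_mat d d"], OF zero_carrier_mat]]
      by (simp add: qf_def)
    then show ?case by (intro exI[of _ 0]) auto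
  next
    case (snoc w ws)
    define Y where "Y = msum d (\<lambda>w. c w \<cdot>\<^sub>m W w) ws"
    obtain C where C: "C \<ge> 0" "\<And>A f. psd d A \<Longrightarrow> Re (qf d (Y * A * adj Y) f) \<le> C * Re (qf d ((L ^^ n) A) f)"
      using snoc.IH[OF Y_def] snoc.prems(2) by auto
    have w: "length w = n" "set w \<subseteq> {0..<length Ks}" "W w \<in> carrier_mat d d" using snoc.prems(2) Wc by auto
    have Y: "Y \<in> carrier_mat d d" unfolding Y_def using snoc.prems(2) Wc by (intro msum_carrier) auto
    have X: "X = Y + c w \<cdot>\<^sub>m W w" using snoc.prems(1) by (simp add: msum_snoc Y_def)
    have Xc: "X \<in> carrier_mat d d" unfolding X using Y w by simp
    show ?case
    proof (intro exI[of _ "2 * C + 2 * (cmod (c w))\<^sup>2"] conjI allI impI)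
      show "0 \<le> 2 * C + 2 * (cmod (c w))\<^sup>2" using C(1) by simp
      fix A f assume A: "psd d A"
      note a = psdD(2)[OF A]
      let ?u = "\<lambda>i. \<Sum>k<d. cnj (Y $$ (k,i)) * f k" and ?v = "\<lambda>i. \<Sum>k<d. cnj (W w $$ (k,i)) * f k"
      have "qf d (X * A * adj X) f = qf d A (\<lambda>i. ?u i + cnj (c w) * ?v i)"
      proof -
        have "(\<Sum>k<d. cnj (X $$ (k,i)) * f k) = ?u i + cnj (c w) * ?v i" if "i < d" for i
        proof -
          have "X $$ (k,i) = Y $$ (k,i) + c w * W w $$ (k,i)" if "k < d" for k
            unfolding X using Y w(3) \<open>i < d\<close> that by (simp add: mat_op_index[of _ d d] smult_index[of _ d d])
          then show ?thesis by (simp add: distrib_left distrib_right sum.distrib sum_distrib_left mult_ac)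
        qed
        then show ?thesis unfolding qf_conj[OF a Xc] unfolding qf_def by (intro sum.cong refl) simp
      qed
      then have "Re (qf d (X * A * adj X) f) \<le> 2 * Re (qf d A ?u) + 2 * Re (qf d A (\<lambda>i. cnj (c w) * ?v i))"
        using qf_add_le[OF A] by simp
      also have "\<dots> = 2 * Re (qf d (Y * A * adj Y) f) + 2 * (cmod (c w))\<^sup>2 * Re (qf d (W w * A * adj (W w)) f)"
        unfolding qf_scale_vec qf_conj[OF a Y] qf_conj[OF a w(3)] by simp
      also have "\<dots> \<le> 2 * (C * Re (qf d ((L ^^ n) A) f)) + 2 * (cmod (c w))\<^sup>2 * Re (qf d ((L ^^ n) A) f)"
        by (intro add_mono mult_left_mono C(2)[OF A] word[OF w(1,2) A]) auto
      finally show "Re (qf d (X * A * adj X) f) \<le> (2 * C + 2 * (cmod (c w))\<^sup>2) * Re (qf d ((L ^^ n) A) f)"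
        by (simp add: algebra_simps)
    qed
  qed
  define E where "E a b = Matrix.mat d d (\<lambda>(i,j). if i = a \<and> j = b then 1 else 0 :: complex)" for a b
  have "\<exists>C\<ge>0. \<forall>A f. psd d A \<longrightarrow> Re (qf d (E a b * A * adj (E a b)) f) \<le> C * Re (qf d ((L ^^ n) A) f)" for a b
  proof -
    obtain c where "E a b = msum d (\<lambda>w. c w \<cdot>\<^sub>m W w) (List.n_lists n [0..<length Ks])"
      using span[of "E a b"] unfolding W_def by (auto simp: E_def)
    then show ?thesis by (rule comb) (auto simp: set_n_lists)
  qed
  then obtain C where C: "\<And>a b. C a b \<ge> 0"
    "\<And>a b A f. psd d A \<Longrightarrow> Re (qf d (E a b * A * adj (E a b)) f) \<le> C a b * Re (qf d ((L ^^ n) A) f)"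
    by metis
  \<comment> \<open>The summand 1 keeps \<open>D\<close> positive, so that \<open>1 / D\<close> can
    serve as the mixing constant.\<close>
  define D where "D = 1 + (\<Sum>a<d. \<Sum>b<d. C a b)"
  have D: "D > 0" unfolding D_def using C(1) by (intro add_pos_nonneg sum_nonneg) auto
  have bound: "Re (mtrace A) * (\<Sum>a<d. (cmod (f a))\<^sup>2) \<le> D * Re (qf d ((L ^^ n) A) f)" if A: "psd d A" for A f
  proof -
    note a = psdD(2)[OF A]
    have pos: "0 \<le> Re (qf d ((L ^^ n) A) f)"
      by (rule psdD(3)[OF channelD(2)[OF channel_funpow[OF L] A]])
    have "Re (mtrace A) * (\<Sum>a<d. (cmod (f a))\<^sup>2) = (\<Sum>a<d. \<Sum>b<d. Re (qf d (E a b * A * adj (E a b)) f))"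
      unfolding mtrace_eq[OF a] E_def by (simp add: qf_elementary[OF a] sum_distrib_right sum_distrib_left)
    also have "\<dots> \<le> (\<Sum>a<d. \<Sum>b<d. C a b * Re (qf d ((L ^^ n) A) f))"
      by (intro sum_mono C(2)[OF A])
    also have "\<dots> = (\<Sum>a<d. \<Sum>b<d. C a b) * Re (qf d ((L ^^ n) A) f)"
      by (simp add: sum_distrib_right)
    also have "\<dots> \<le> D * Re (qf d ((L ^^ n) A) f)" unfolding D_def using pos by (intro mult_right_mono) auto
    finally show ?thesis .
  qed
  show ?thesis unfolding mixing_def
  proof (intro exI[of _ n] conjI n exI[of _ "1 / D"] allI impI)
    show "0 < 1 / D" using D by simp
    fix A assume A: "psd d A"
    note LA = channelD(2)[OF channel_funpow[OF L] A, of n]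
    show "psd d ((L ^^ n) A - complex_of_real (1 / D * Re (mtrace A)) \<cdot>\<^sub>m 1\<^sub>m d)"
    proof (rule psdI)
      show "herm d ((L ^^ n) A - complex_of_real (1 / D * Re (mtrace A)) \<cdot>\<^sub>m 1\<^sub>m d)"
        by (intro herm_minus psdD(1)[OF LA] herm_smult herm_one)
      fix f
      have "Re (mtrace A) * (\<Sum>a<d. (cmod (f a))\<^sup>2) / D \<le> Re (qf d ((L ^^ n) A) f)"
        using bound[OF A, of f] D by (simp add: pos_divide_le_eq mult.commute)
      then show "0 \<le> Re (qf d ((L ^^ n) A - complex_of_real (1 / D * Re (mtrace A)) \<cdot>\<^sub>m 1\<^sub>m d) f)"
        using psdD(2)[OF LA] by (simp add: qf_minus qf_smult qf_one flip: of_real_mult of_real_divide)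
    qed
  qed
qed

section \<open>Domination\<close>

text \<open>A one-sided comparison of positive maps up to a constant; it transports lower bounds
  such as mixing from \<open>K\<close> to \<open>L\<close>.\<close>

definition dominates :: "nat \<Rightarrow> (complex mat \<Rightarrow> complex mat) \<Rightarrow> (complex mat \<Rightarrow> complex mat) \<Rightarrow> bool" where
  "dominates d L K \<longleftrightarrow> (\<exists>c>0. \<forall>A. psd d A \<longrightarrow> psd d (L A - complex_of_real c \<cdot>\<^sub>m K A))"

lemma dominates_id: "dominates d (\<lambda>X. X) (\<lambda>X. X)"
  unfolding dominates_def
proof (intro exI[of _ 1] conjI allI impI)
  fix A assume A: "psd d A"
  have "A - complex_of_real 1 \<cdot>\<^sub>m A = 0\<^sub>m d d" using psdD(2)[OF A] by (simp add: minus_r_inv_mat)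
  then show "psd d (A - complex_of_real 1 \<cdot>\<^sub>m A)" by (simp only: psd_zero)
qed simp

lemma dominates_comp:
  assumes "channel d L" "channel d K" "channel d L'" "channel d K'" "dominates d L L'" "dominates d K K'"
  shows "dominates d (\<lambda>A. L (K A)) (\<lambda>A. L' (K' A))"
proof -
  obtain a where a: "a > 0" "\<And>A. psd d A \<Longrightarrow> psd d (L A - complex_of_real a \<cdot>\<^sub>m L' A)"
    using assms(5) unfolding dominates_def by blast
  obtain b where b: "b > 0" "\<And>A. psd d A \<Longrightarrow> psd d (K A - complex_of_real b \<cdot>\<^sub>m K' A)"
    using assms(6) unfolding dominates_def by blast
  show ?thesis unfolding dominates_def
  proof (intro exI[of _ "a * b"] conjI allI impI)
    show "0 < a * b" using a(1) b(1) by simp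
    fix A assume A: "psd d A"
    note c = psdD(2)[OF channelD(2)[OF assms(2) A]] psdD(2)[OF channelD(2)[OF assms(4) A]]
    note cc = linop_carrier[OF channelD(1)[OF assms(1)] c(1)] linop_carrier[OF channelD(1)[OF assms(3)] c(1)] linop_carrier[OF channelD(1)[OF assms(3)] c(2)]
    \<comment> \<open>The difference \<open>L K - a b L' K'\<close> is split as
      \<open>(L - a L') K + a L' (K - b K')\<close>, both parts being positive.\<close>
    have "psd d ((L (K A) - complex_of_real a \<cdot>\<^sub>m L' (K A)) + complex_of_real a \<cdot>\<^sub>m L' (K A - complex_of_real b \<cdot>\<^sub>m K' A))"
      using a(1) by (intro psd_add a(2) psd_smult channelD(2)[OF assms(3)] b(2) A channelD(2)[OF assms(2)]) auto
    also have "L' (K A - complex_of_real b \<cdot>\<^sub>m K' A) = L' (K A) - complex_of_real b \<cdot>\<^sub>m L' (K' A)"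
      using c by (simp add: linop_minus[OF channelD(1)[OF assms(3)]] linop_smult[OF channelD(1)[OF assms(3)]])
    also have "(L (K A) - complex_of_real a \<cdot>\<^sub>m L' (K A)) + complex_of_real a \<cdot>\<^sub>m (L' (K A) - complex_of_real b \<cdot>\<^sub>m L' (K' A))
       = L (K A) - complex_of_real (a * b) \<cdot>\<^sub>m L' (K' A)"
      by (rule matI[of _ d d]) (use cc in \<open>auto simp: mat_op_index[of _ d d] smult_index[of _ d d] algebra_simps\<close>)
    finally show "psd d (L (K A) - complex_of_real (a * b) \<cdot>\<^sub>m L' (K' A))" .
  qed
qed

lemma dominates_fold:
  assumes "\<And>x. x \<in> set xs \<Longrightarrow> channel d (f x)" "\<And>x. x \<in> set xs \<Longrightarrow> channel d (g x)"
    "\<And>x. x \<in> set xs \<Longrightarrow> dominates d (f x) (g x)"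
  shows "dominates d (fold f xs) (fold g xs)"
  using assms
proof (induction xs)
  case Nil
  show ?case unfolding fold.simps id_def by (rule dominates_id)
next
  case (Cons x xs)
  have c: "channel d (fold f xs)" "channel d (fold g xs)"
    by (rule channel_fold; use Cons.prems in auto)+
  have "dominates d (fold f xs) (fold g xs)"
    by (rule Cons.IH) (use Cons.prems in auto)
  note dominates_comp[OF c(1) Cons.prems(1)[OF list.set_intros(1)] c(2) Cons.prems(2)[OF list.set_intros(1)]
      this Cons.prems(3)[OF list.set_intros(1)]]
  then show ?case unfolding fold.simps comp_def .
qed

lemma dominates_funpow:
  assumes "channel d L" "channel d K" "dominates d L K"
  shows "dominates d (L ^^ n) (K ^^ n)"
proof (induction n)
  case 0
  show ?case unfolding funpow.simps id_def by (rule dominates_id)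
next
  case (Suc n)
  show ?case unfolding funpow.simps comp_def
    by (rule dominates_comp[OF assms(1) channel_funpow[OF assms(1)] assms(2) channel_funpow[OF assms(2)] assms(3) Suc])
qed

lemma dominates_msum:
  assumes "\<And>x. x \<in> set xs \<Longrightarrow> channel d (f x)" "\<And>x. x \<in> set xs \<Longrightarrow> channel d (g x)"
    "\<And>x. x \<in> set xs \<Longrightarrow> dominates d (f x) (g x)"
  shows "dominates d (\<lambda>A. msum d (\<lambda>x. f x A) xs) (\<lambda>A. msum d (\<lambda>x. g x A) xs)"
  using assms
proof (induction xs rule: rev_induct)
  case Nil
  have "0\<^sub>m d d - complex_of_real 1 \<cdot>\<^sub>m 0\<^sub>m d d = (0\<^sub>m d d :: complex mat)" by (rule matI[of _ d d]) auto
  then have "psd d (msum d (\<lambda>x. f x A) [] - complex_of_real 1 \<cdot>\<^sub>m msum d (\<lambda>x. g x A) [])" for A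
    by (simp only: msum_Nil psd_zero)
  moreover have "0 < (1::real)" by simp
  ultimately show ?case unfolding dominates_def by (intro exI[of _ 1] conjI allI impI)
next
  case (snoc y ys)
  obtain a where a: "a > 0" "\<And>A. psd d A \<Longrightarrow> psd d (msum d (\<lambda>x. f x A) ys - complex_of_real a \<cdot>\<^sub>m msum d (\<lambda>x. g x A) ys)"
  proof -
    have "dominates d (\<lambda>A. msum d (\<lambda>x. f x A) ys) (\<lambda>A. msum d (\<lambda>x. g x A) ys)"
      by (rule snoc.IH) (use snoc.prems in auto)
    then show ?thesis unfolding dominates_def using that by blast
  qed
  have "dominates d (f y) (g y)" by (rule snoc.prems(3)) simp
  then obtain b where b: "b > 0" "\<And>A. psd d A \<Longrightarrow> psd d (f y A - complex_of_real b \<cdot>\<^sub>m g y A)"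
    unfolding dominates_def by blast
  \<comment> \<open>The smaller constant serves both parts; the surplus \<open>a - c\<close> or
    \<open>b - c\<close> is added back as a positive term.\<close>
  define c where "c = min a b"
  show ?case unfolding dominates_def
  proof (intro exI[of _ c] conjI allI impI)
    show "0 < c" using a(1) b(1) by (simp add: c_def)
    fix A assume A: "psd d A"
    have g: "psd d (msum d (\<lambda>x. g x A) ys)" "psd d (g y A)"
      using channelD(2)[OF snoc.prems(2) A] by (auto intro!: psd_msum)
    have f: "psd d (msum d (\<lambda>x. f x A) ys)" "psd d (f y A)"
      using channelD(2)[OF snoc.prems(1) A] by (auto intro!: psd_msum)
    note cc = f[THEN psdD(2)] g[THEN psdD(2)]
    have ab: "0 \<le> a - c" "0 \<le> b - c" by (auto simp: c_def)
    have "psd d (((msum d (\<lambda>x. f x A) ys - complex_of_real a \<cdot>\<^sub>m msum d (\<lambda>x. g x A) ys) + complex_of_real (a - c) \<cdot>\<^sub>m msum d (\<lambda>x. g x A) ys)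
       + ((f y A - complex_of_real b \<cdot>\<^sub>m g y A) + complex_of_real (b - c) \<cdot>\<^sub>m g y A))"
      by (rule psd_add[OF psd_add[OF a(2)[OF A] psd_smult[OF g(1) ab(1)]] psd_add[OF b(2)[OF A] psd_smult[OF g(2) ab(2)]]])
    also have "((msum d (\<lambda>x. f x A) ys - complex_of_real a \<cdot>\<^sub>m msum d (\<lambda>x. g x A) ys) + complex_of_real (a - c) \<cdot>\<^sub>m msum d (\<lambda>x. g x A) ys)
       + ((f y A - complex_of_real b \<cdot>\<^sub>m g y A) + complex_of_real (b - c) \<cdot>\<^sub>m g y A)
       = msum d (\<lambda>x. f x A) (ys @ [y]) - complex_of_real c \<cdot>\<^sub>m msum d (\<lambda>x. g x A) (ys @ [y])"
      unfolding msum_snoc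
      by (rule matI[of _ d d]) (use cc in \<open>auto simp: mat_op_index[of _ d d] smult_index[of _ d d] algebra_simps\<close>)
    finally show "psd d (msum d (\<lambda>x. f x A) (ys @ [y]) - complex_of_real c \<cdot>\<^sub>m msum d (\<lambda>x. g x A) (ys @ [y]))" .
  qed
qed

lemma dominates_scale:
  assumes "dominates d L K" "s \<ge> 0" "linop d L" "linop d K"
  shows "dominates d (\<lambda>A. complex_of_real s \<cdot>\<^sub>m L A) (\<lambda>A. complex_of_real s \<cdot>\<^sub>m K A)"
proof -
  obtain a where a: "a > 0" "\<And>A. psd d A \<Longrightarrow> psd d (L A - complex_of_real a \<cdot>\<^sub>m K A)"
    using assms(1) unfolding dominates_def by blast
  have "psd d (complex_of_real s \<cdot>\<^sub>m L A - complex_of_real a \<cdot>\<^sub>m (complex_of_real s \<cdot>\<^sub>m K A))" if A: "psd d A" for A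
  proof -
    note c = linop_carrier[OF assms(3) psdD(2)[OF A]] linop_carrier[OF assms(4) psdD(2)[OF A]]
    have "complex_of_real s \<cdot>\<^sub>m (L A - complex_of_real a \<cdot>\<^sub>m K A) = complex_of_real s \<cdot>\<^sub>m L A - complex_of_real a \<cdot>\<^sub>m (complex_of_real s \<cdot>\<^sub>m K A)"
      by (rule matI[of _ d d]) (use c in \<open>auto simp: mat_op_index[of _ d d] smult_index[of _ d d] algebra_simps\<close>)
    then show ?thesis using psd_smult[OF a(2)[OF A] assms(2)] by simp
  qed
  then show ?thesis unfolding dominates_def using a(1) by blast
qed

text \<open>If \<open>L ^^ n\<close> lies above \<open>a\<close> times \<open>K ^^ n\<close>, the
  constant \<open>\<epsilon>\<close> of \<open>K\<close> becomes \<open>a * \<epsilon>\<close> for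
  the same power.\<close>

lemma mixing_dominates:
  assumes "channel d L" "channel d K" "dominates d L K" "mixing d K"
  shows "mixing d L"
proof -
  obtain n \<epsilon> where n: "n \<ge> 1" and e: "\<epsilon> > 0" and
    E: "\<And>A. psd d A \<Longrightarrow> psd d ((K ^^ n) A - complex_of_real (\<epsilon> * Re (mtrace A)) \<cdot>\<^sub>m 1\<^sub>m d)"
    using assms(4) unfolding mixing_def by blast
  obtain a where a: "a > 0" "\<And>A. psd d A \<Longrightarrow> psd d ((L ^^ n) A - complex_of_real a \<cdot>\<^sub>m (K ^^ n) A)"
    using dominates_funpow[OF assms(1-3), of n] unfolding dominates_def by blast
  show ?thesis unfolding mixing_def
  proof (intro exI[of _ n] conjI n exI[of _ "a * \<epsilon>"] allI impI)
    show "0 < a * \<epsilon>" using a e by simp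
    fix A assume A: "psd d A"
    note c = psdD(2)[OF channelD(2)[OF channel_funpow[OF assms(1)] A, of n]] psdD(2)[OF channelD(2)[OF channel_funpow[OF assms(2)] A, of n]]
    have "psd d (((L ^^ n) A - complex_of_real a \<cdot>\<^sub>m (K ^^ n) A) + complex_of_real a \<cdot>\<^sub>m ((K ^^ n) A - complex_of_real (\<epsilon> * Re (mtrace A)) \<cdot>\<^sub>m 1\<^sub>m d))"
      using a(1) by (intro psd_add psd_smult a(2) E A) auto
    also have "((L ^^ n) A - complex_of_real a \<cdot>\<^sub>m (K ^^ n) A) + complex_of_real a \<cdot>\<^sub>m ((K ^^ n) A - complex_of_real (\<epsilon> * Re (mtrace A)) \<cdot>\<^sub>m 1\<^sub>m d)
      = (L ^^ n) A - complex_of_real (a * \<epsilon> * Re (mtrace A)) \<cdot>\<^sub>m 1\<^sub>m d"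
      by (rule matI[of _ d d]) (use c in \<open>auto simp: mat_op_index[of _ d d] smult_index[of _ d d] algebra_simps\<close>)
    finally show "psd d ((L ^^ n) A - complex_of_real (a * \<epsilon> * Re (mtrace A)) \<cdot>\<^sub>m 1\<^sub>m d)" .
  qed
qed

text \<open>Gibbs states of one Hamiltonian share their eigenvectors and have strictly positive
  weights; the constant is the least ratio of the weights.\<close>

lemma gibbs_dominates:
  assumes "herm n H" "n > 0"
  obtains c where "c > 0" "psd n (gibbs \<beta> H - complex_of_real c \<cdot>\<^sub>m gibbs \<beta>' H)"
proof -
  obtain P l where P: "unitary n P" and H: "H = P * dg n (\<lambda>i. complex_of_real (l i)) * adj P"
    using spectral_theorem[OF assms(1)] by blast
  note p = unitaryD[OF P]
  define w where "w b a = exp (- b * l a) / (\<Sum>k<n. exp (- b * l k))" for b a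
  have w: "w b a > 0" for b a unfolding w_def using gibbs_partition_pos[OF assms(2)] by (intro divide_pos_pos) auto
  have g: "gibbs b H = P * dg n (\<lambda>i. complex_of_real (w b i)) * adj P" for b
    unfolding gibbs_sandwich[OF P H] w_def ..
  define c where "c = Min ((\<lambda>a. w \<beta> a / w \<beta>' a) ` {..<n})"
  have c: "c > 0" unfolding c_def using assms(2) w by (subst Min_gr_iff) auto
  have le: "0 \<le> w \<beta> a - c * w \<beta>' a" if "a < n" for a
  proof -
    have "c \<le> w \<beta> a / w \<beta>' a" unfolding c_def using that by (intro Min_le) auto
    then show ?thesis using w[of \<beta>' a] by (simp add: pos_le_divide_eq)
  qed
  have "gibbs \<beta> H - complex_of_real c \<cdot>\<^sub>m gibbs \<beta>' H = P * dg n (\<lambda>a. complex_of_real (w \<beta> a - c * w \<beta>' a)) * adj P"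
  proof (rule matI[of _ n n])
    fix i j assume ij: "i < n" "j < n"
    have cc: "P * dg n f * adj P \<in> carrier_mat n n" for f using p by simp
    show "(gibbs \<beta> H - complex_of_real c \<cdot>\<^sub>m gibbs \<beta>' H) $$ (i,j) = (P * dg n (\<lambda>a. complex_of_real (w \<beta> a - c * w \<beta>' a)) * adj P) $$ (i,j)"
      unfolding g mat_op_index(2)[OF cc smult_carrier_mat[OF cc] ij] smult_index[OF cc ij] sandwich_dg_index[OF p(1) ij]
      by (simp add: sum_distrib_left sum_subtractf algebra_simps)
  qed (use p g in auto)
  moreover have "psd n (P * dg n (\<lambda>a. complex_of_real (w \<beta> a - c * w \<beta>' a)) * adj P)"
    by (rule psd_conj[OF psd_dg[OF le] p(1)])
  ultimately show ?thesis using that c by simp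
qed

lemma chan_gibbs_dominates:
  assumes "unitary (d*e) U" "herm e H" "e > 0"
  shows "dominates d (chan d e U (gibbs \<beta> H)) (chan d e U (gibbs \<beta>' H))"
proof -
  obtain c where c: "c > 0" "psd e (gibbs \<beta> H - complex_of_real c \<cdot>\<^sub>m gibbs \<beta>' H)"
    using gibbs_dominates[OF assms(2,3)] by blast
  show ?thesis unfolding dominates_def
  proof (intro exI[of _ c] conjI c(1) allI impI)
    fix A assume A: "psd d A"
    note h = gibbs_carrier[OF hermD(1)[OF assms(2)]]
    show "psd d (chan d e U (gibbs \<beta> H) A - complex_of_real c \<cdot>\<^sub>m chan d e U (gibbs \<beta>' H) A)"
      using psd_chan[OF assms(1) c(2) A] unfolding chan_minus_smult[OF assms(1) h h psdD(2)[OF A]] .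
  qed
qed

section \<open>Mixing of the reversed order\<close>

text \<open>\<open>K\<close> is the trace dual of the time reversal of \<open>L\<close>.
  Infinite-temperature steps are paired with themselves, and since duality reverses compositions, a
  cycle is paired with its reversed order.\<close>

definition reversal_pair :: "nat \<Rightarrow> complex mat \<Rightarrow> (complex mat \<Rightarrow> complex mat) \<Rightarrow> (complex mat \<Rightarrow> complex mat) \<Rightarrow> bool" where
  "reversal_pair d \<Theta> K L \<longleftrightarrow> (\<forall>A\<in>carrier_mat d d. \<forall>B\<in>carrier_mat d d.
     mtrace (K A * B) = mtrace (A * time_rev \<Theta> (L (time_rev \<Theta> B))))"

lemma reversal_pair_id:
  assumes "antiunitary_involution d \<Theta>" shows "reversal_pair d \<Theta> (\<lambda>X. X) (\<lambda>X. X)"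
  using time_rev_involution[OF assms] by (simp add: reversal_pair_def)

lemma reversal_pair_comp:
  assumes "antiunitary_involution d \<Theta>" "linop d K'" "linop d L" "linop d L'" "reversal_pair d \<Theta> K L" "reversal_pair d \<Theta> K' L'"
  shows "reversal_pair d \<Theta> (\<lambda>A. K (K' A)) (\<lambda>A. L' (L A))"
  unfolding reversal_pair_def
proof (intro ballI)
  fix A B :: "complex mat" assume A: "A \<in> carrier_mat d d" and B: "B \<in> carrier_mat d d"
  have t: "\<Theta> \<in> carrier_mat d d" using assms(1) by (simp add: antiunitary_involution_def unitary_def)
  have K: "K' A \<in> carrier_mat d d" using linop_carrier[OF assms(2) A] .
  have L: "L (time_rev \<Theta> B) \<in> carrier_mat d d" using linop_carrier[OF assms(3)] t B by simp
  have "mtrace (K (K' A) * B) = mtrace (K' A * time_rev \<Theta> (L (time_rev \<Theta> B)))"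
    using assms(5) K B unfolding reversal_pair_def by blast
  also have "\<dots> = mtrace (A * time_rev \<Theta> (L' (time_rev \<Theta> (time_rev \<Theta> (L (time_rev \<Theta> B))))))"
    using assms(6) A time_rev_carrier[OF t L] unfolding reversal_pair_def by blast
  finally show "mtrace (K (K' A) * B) = mtrace (A * time_rev \<Theta> (L' (L (time_rev \<Theta> B))))"
    unfolding time_rev_involution[OF assms(1) L] .
qed

lemma reversal_pair_fold:
  assumes "antiunitary_involution d \<Theta>" "\<And>x. x \<in> set xs \<Longrightarrow> linop d (f x)" "\<And>x. x \<in> set xs \<Longrightarrow> reversal_pair d \<Theta> (f x) (f x)"
  shows "reversal_pair d \<Theta> (fold f (rev xs)) (fold f xs)"
  using assms(2,3)
proof (induction xs)
  case Nil
  show ?case unfolding rev.simps fold.simps id_def by (rule reversal_pair_id[OF assms(1)])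
next
  case (Cons x xs)
  have "reversal_pair d \<Theta> (\<lambda>A. f x (fold f (rev xs) A)) (\<lambda>A. fold f xs (f x A))"
    by (rule reversal_pair_comp[OF assms(1) linop_fold _ linop_fold _ Cons.IH]) (use Cons.prems in auto)
  then show ?case by (simp only: rev.simps fold_append fold.simps comp_def id_def)
qed

lemma reversal_pair_funpow:
  assumes "antiunitary_involution d \<Theta>" "linop d K" "linop d L" "reversal_pair d \<Theta> K L"
  shows "reversal_pair d \<Theta> (K ^^ n) (L ^^ n)"
proof (induction n)
  case 0
  show ?case unfolding funpow.simps id_def by (rule reversal_pair_id[OF assms(1)])
next
  case (Suc n)
  have "reversal_pair d \<Theta> (\<lambda>A. K ((K ^^ n) A)) (\<lambda>A. (L ^^ n) (L A))"
    by (rule reversal_pair_comp[OF assms(1) linop_funpow[OF assms(2)] assms(3) linop_funpow[OF assms(3)] assms(4) Suc])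
  then show ?case by (simp only: funpow.simps comp_def funpow_swap1)
qed

text \<open>The lower bound for \<open>(K ^^ n) A\<close> is tested against rank-one matrices
  \<open>F\<close>. Duality moves the power onto the reversed \<open>F\<close> as a power of
  \<open>L\<close>, where the mixing bound applies; \<open>A\<close> and \<open>F\<close> enter the
  result symmetrically through their traces.\<close>

lemma mixing_reversal:
  assumes T: "antiunitary_involution d \<Theta>" and K: "channel d K" and L: "channel d L"
    and rev: "reversal_pair d \<Theta> K L" and mix: "mixing d L"
  shows "mixing d K"
proof -
  obtain n \<epsilon> where n: "n \<ge> 1" and e: "\<epsilon> > 0" and
    E: "\<And>A. psd d A \<Longrightarrow> psd d ((L ^^ n) A - complex_of_real (\<epsilon> * Re (mtrace A)) \<cdot>\<^sub>m 1\<^sub>m d)"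
    using mix unfolding mixing_def by blast
  have u: "unitary d \<Theta>" using T by (simp add: antiunitary_involution_def)
  note t = unitaryD(1)[OF u]
  have rn: "mtrace ((K ^^ n) A * B) = mtrace (A * time_rev \<Theta> ((L ^^ n) (time_rev \<Theta> B)))"
    if "A \<in> carrier_mat d d" "B \<in> carrier_mat d d" for A B
    using reversal_pair_funpow[OF T channelD(1)[OF K] channelD(1)[OF L] rev, of n] that unfolding reversal_pair_def by blast
  show ?thesis unfolding mixing_def
  proof (intro exI[of _ n] conjI n exI[of _ \<epsilon>] e allI impI)
    fix A assume A: "psd d A"
    note a = psdD(2)[OF A]
    note KA = channelD(2)[OF channel_funpow[OF K] A, of n]
    show "psd d ((K ^^ n) A - complex_of_real (\<epsilon> * Re (mtrace A)) \<cdot>\<^sub>m 1\<^sub>m d)"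
    proof (rule psdI)
      show "herm d ((K ^^ n) A - complex_of_real (\<epsilon> * Re (mtrace A)) \<cdot>\<^sub>m 1\<^sub>m d)"
        by (intro herm_minus psdD(1)[OF KA] herm_smult herm_one)
      fix f :: "nat \<Rightarrow> complex"
      \<comment> \<open>The rank-one matrix that represents the quadratic form:
        \<open>qf d B f = mtrace (B * F)\<close>.\<close>
      define F where "F = Matrix.mat d d (\<lambda>(i,j). f i * cnj (f j))"
      have Fc: "F \<in> carrier_mat d d" by (simp add: F_def)
      have qF: "qf d B f = mtrace (B * F)" if "B \<in> carrier_mat d d" for B
        unfolding mtrace_mult[OF that Fc] qf_def by (intro sum.cong refl) (simp add: F_def mult_ac)
      have F: "psd d F"
      proof (rule psdI)
        show "herm d F" unfolding herm_def using Fc by (auto simp: F_def adj_def intro!: eq_matI)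
        fix g
        have "qf d F g = (\<Sum>i<d. cnj (g i) * f i) * cnj (\<Sum>i<d. cnj (g i) * f i)"
          unfolding qf_def cnj_sum sum_product by (intro sum.cong refl) (simp add: F_def mult_ac)
        also have "\<dots> = complex_of_real ((cmod (\<Sum>i<d. cnj (g i) * f i))\<^sup>2)"
          by (rule complex_norm_square[symmetric])
        finally show "0 \<le> Re (qf d F g)" by (simp only: Re_complex_of_real zero_le_power2)
      qed
      have tF: "mtrace F = complex_of_real (Re (mtrace F))" using psd_trace_nonneg(2)[OF F] by (simp add: complex_eq_iff)
      have TF: "psd d (time_rev \<Theta> F)" by (rule time_rev_psd[OF u F])
      have TFt: "Re (mtrace (time_rev \<Theta> F)) = Re (mtrace F)" by (simp add: time_rev_mtrace[OF u Fc])
      define X where "X = (L ^^ n) (time_rev \<Theta> F)"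
      have X: "X \<in> carrier_mat d d" unfolding X_def by (rule psdD(2)[OF channelD(2)[OF channel_funpow[OF L] TF]])
      have "psd d (X - complex_of_real (\<epsilon> * Re (mtrace F)) \<cdot>\<^sub>m 1\<^sub>m d)"
        using E[OF TF] unfolding TFt X_def .
      then have "psd d (time_rev \<Theta> (X - complex_of_real (\<epsilon> * Re (mtrace F)) \<cdot>\<^sub>m 1\<^sub>m d))"
        by (rule time_rev_psd[OF u])
      also have "time_rev \<Theta> (X - complex_of_real (\<epsilon> * Re (mtrace F)) \<cdot>\<^sub>m 1\<^sub>m d)
        = time_rev \<Theta> X - complex_of_real (\<epsilon> * Re (mtrace F)) \<cdot>\<^sub>m 1\<^sub>m d"
        using t X by (simp add: time_rev_minus[of _ d] time_rev_smult[of _ d] time_rev_one[OF u])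
      finally have P: "psd d (time_rev \<Theta> X - complex_of_real (\<epsilon> * Re (mtrace F)) \<cdot>\<^sub>m 1\<^sub>m d)" .
      have TX: "time_rev \<Theta> X \<in> carrier_mat d d" using t X by simp
      have "0 \<le> Re (mtrace (A * (time_rev \<Theta> X - complex_of_real (\<epsilon> * Re (mtrace F)) \<cdot>\<^sub>m 1\<^sub>m d)))"
        by (rule psd_mtrace_mult_nonneg[OF A P])
      also have "A * (time_rev \<Theta> X - complex_of_real (\<epsilon> * Re (mtrace F)) \<cdot>\<^sub>m 1\<^sub>m d)
        = A * time_rev \<Theta> X - complex_of_real (\<epsilon> * Re (mtrace F)) \<cdot>\<^sub>m A"
        using a TX by (simp add: mult_minus_distrib_mat[of _ d d _ d] mult_smult_distrib[of _ d d _ d])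
      also have "mtrace \<dots> = mtrace (A * time_rev \<Theta> X) - complex_of_real (\<epsilon> * Re (mtrace F)) * mtrace A"
        using a TX by (simp add: mtrace_minus[of _ d] mtrace_smult[of _ d])
      also have "mtrace (A * time_rev \<Theta> X) = qf d ((K ^^ n) A) f"
        unfolding qF[OF psdD(2)[OF KA]] rn[OF a Fc] X_def ..
      finally have "0 \<le> Re (qf d ((K ^^ n) A) f) - \<epsilon> * Re (mtrace F) * Re (mtrace A)" by simp
      moreover have "qf d (1\<^sub>m d) f = mtrace F"
        using qF[of "1\<^sub>m d"] Fc by (simp add: left_mult_one_mat[of _ d d])
      ultimately show "0 \<le> Re (qf d ((K ^^ n) A - complex_of_real (\<epsilon> * Re (mtrace A)) \<cdot>\<^sub>m 1\<^sub>m d) f)"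
        using psdD(2)[OF KA] by (simp add: qf_minus qf_smult mult_ac)
    qed
  qed
qed

section \<open>Linear response of invariant states\<close>

lemma mder_apply:
  assumes lin: "\<And>t. linop d (L t)" and E: "\<And>n. mder d (\<lambda>t. L t (unit_mat d n)) (D n)"
    and F: "mder d F F'" and G: "mder d (\<lambda>t. L t (F 0)) G"
  shows "mder d (\<lambda>t. L t (F t)) (G + L 0 F')"
proof (rule mderI[of _ _ _ "\<lambda>i j t. \<Sum>n<d*d. L t (unit_mat d n) $$ (i,j) * F t $$ (n div d, n mod d)"
      "\<lambda>i j. \<Sum>n<d*d. L 0 (unit_mat d n) $$ (i,j) * F' $$ (n div d, n mod d) + D n $$ (i,j) * F 0 $$ (n div d, n mod d)"])
  note Fc = mderD(1,2)[OF F]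
  show "L t (F t) \<in> carrier_mat d d" for t by (rule linop_carrier[OF lin Fc(1)])
  show "G + L 0 F' \<in> carrier_mat d d" using mderD(2)[OF G] linop_carrier[OF lin Fc(2)] by simp
  fix i j assume ij: "i < d" "j < d"
  show "((\<lambda>t. \<Sum>n<d*d. L t (unit_mat d n) $$ (i,j) * F t $$ (n div d, n mod d)) has_vector_derivative
     (\<Sum>n<d*d. L 0 (unit_mat d n) $$ (i,j) * F' $$ (n div d, n mod d) + D n $$ (i,j) * F 0 $$ (n div d, n mod d))) (at 0)"
    using div_mod_less
    by (intro has_vector_derivative_sum has_vector_derivative_mult mderD(3)[OF E ij] mderD(3)[OF F]) auto
  show "L t (F t) $$ (i,j) = (\<Sum>n<d*d. L t (unit_mat d n) $$ (i,j) * F t $$ (n div d, n mod d))" for t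
    by (rule linop_expand[OF lin Fc(1) ij])
  \<comment> \<open>Uniqueness of derivatives identifies \<open>G\<close> with the combination of
    the derivatives at matrix units.\<close>
  have "((\<lambda>t. \<Sum>n<d*d. L t (unit_mat d n) $$ (i,j) * F 0 $$ (n div d, n mod d)) has_vector_derivative
     (\<Sum>n<d*d. D n $$ (i,j) * F 0 $$ (n div d, n mod d))) (at 0)"
    by (intro has_vector_derivative_sum has_vector_derivative_mult_left mderD(3)[OF E ij])
  then have "G $$ (i,j) = (\<Sum>n<d*d. D n $$ (i,j) * F 0 $$ (n div d, n mod d))"
    using mderD(3)[OF G ij] unfolding linop_expand[OF lin Fc(1) ij] by (intro vector_derivative_unique_at)
  then show "(G + L 0 F') $$ (i,j) = (\<Sum>n<d*d. L 0 (unit_mat d n) $$ (i,j) * F' $$ (n div d, n mod d) + D n $$ (i,j) * F 0 $$ (n div d, n mod d))"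
    unfolding mat_op_index(1)[OF mderD(2)[OF G] linop_carrier[OF lin Fc(2)] ij] linop_expand[OF lin Fc(2) ij]
    by (simp add: sum.distrib)
qed

text \<open>What the two schemes and the reversed cycle share. Invariant states, their smoothness
  and linear response are treated once, in this setting.\<close>

locale channel_family =
  fixes d :: nat and L :: "'m::{finite,linorder} rvec \<Rightarrow> complex mat \<Rightarrow> complex mat"
  assumes d: "d > 0" and chn: "\<And>\<zeta>. channel d (L \<zeta>)" and mix: "\<And>\<zeta>. mixing d (L \<zeta>)"
    and smooth: "\<And>F. smat d F \<Longrightarrow> smat d (\<lambda>\<zeta>. L \<zeta> (F \<zeta>))"
begin

abbreviation "R \<zeta> \<equiv> inv_state d (L \<zeta>)"

lemma R_eq: "R \<zeta> = linop_inv d (resolvent_map d (L \<zeta>)) (max_mixed d)"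
  by (rule inv_state_eq[OF chn d mix])

lemma R_carrier [simp]: "R \<zeta> \<in> carrier_mat d d"
  by (simp add: R_eq)

lemma R_fixed: "L \<zeta> (R \<zeta>) = R \<zeta>" and R_trace: "mtrace (R \<zeta>) = 1"
  unfolding R_eq using invariant_fixed[OF chn d mix] by auto

lemma R_unique: "\<rho> \<in> carrier_mat d d \<Longrightarrow> mtrace \<rho> = 1 \<Longrightarrow> L \<zeta> \<rho> = \<rho> \<Longrightarrow> R \<zeta> = \<rho>"
  unfolding R_eq by (rule invariant_unique[OF chn d mix, symmetric])

lemma R_ex1: "\<exists>!\<rho>. state d \<rho> \<and> L \<zeta> \<rho> = \<rho>"
  by (rule invariant_ex1[OF chn d mix])

lemma smat_R: "smat d R"
proof -
  have "smat d (\<lambda>\<zeta>. linop_inv d (resolvent_map d (L \<zeta>)) (max_mixed d))"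
  proof (rule smat_linop_inv)
    fix n
    have "smat d (\<lambda>\<zeta>. unit_mat d n - L \<zeta> (unit_mat d n) + (mtrace (unit_mat d n) / of_nat d) \<cdot>\<^sub>m 1\<^sub>m d)"
      by (intro smat_add smat_minus smat_const smooth) auto
    then show "smat d (\<lambda>\<zeta>. resolvent_map d (L \<zeta>) (unit_mat d n))" unfolding resolvent_map_def .
    show "det (super_mat d (resolvent_map d (L \<zeta>))) \<noteq> 0" for \<zeta>
      by (rule super_mat_det[OF linop_resolvent[OF channelD(1)[OF chn]] resolvent_inj[OF chn d mix]])
  qed (rule smat_const[OF max_mixed(3)])
  then show ?thesis unfolding R_eq .
qed

text \<open>Differentiating the fixed-point equation gives \<open>R' = G + L 0 R'\<close> with
  traceless \<open>R'\<close>, so the response of the state is the series of the powers of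
  \<open>L 0\<close> at \<open>G\<close>. The number \<open>c\<close> is the static part, the
  derivative with the state frozen at \<open>R 0\<close>.\<close>

lemma linear_response:
  assumes P: "smat d P" and G: "mder d (\<lambda>t. L (t *\<^sub>R axis k 1) (R 0)) G"
    and c: "((\<lambda>t. mtrace (R 0 * P (t *\<^sub>R axis k 1))) has_vector_derivative c) (at 0)"
  shows "(\<lambda>n. mtrace ((L 0 ^^ n) G * P 0)) sums (pd k (\<lambda>\<zeta>. mtrace (R \<zeta> * P \<zeta>)) 0 - c)"
proof -
  define R' where "R' = Matrix.mat d d (\<lambda>(a,b). pd k (\<lambda>\<zeta>. R \<zeta> $$ (a,b)) 0)"
  define P' where "P' = Matrix.mat d d (\<lambda>(a,b). pd k (\<lambda>\<zeta>. P \<zeta> $$ (a,b)) 0)"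
  have R': "mder d (\<lambda>t. R (t *\<^sub>R axis k 1)) R'" unfolding R'_def by (rule smat_mder[OF smat_R])
  have P': "mder d (\<lambda>t. P (t *\<^sub>R axis k 1)) P'" unfolding P'_def by (rule smat_mder[OF P])
  note Gc = mderD(2)[OF G] note Rc = mderD(2)[OF R'] note Pc = smatD(1)[OF P]
  have "mder d (\<lambda>t. L (t *\<^sub>R axis k 1) (R (t *\<^sub>R axis k 1))) (G + L (0 *\<^sub>R axis k 1) R')"
  proof (rule mder_apply[OF channelD(1)[OF chn] _ R'])
    show "mder d (\<lambda>t. L (t *\<^sub>R axis k 1) (unit_mat d n)) (Matrix.mat d d (\<lambda>(a,b). pd k (\<lambda>\<zeta>. L \<zeta> (unit_mat d n) $$ (a,b)) 0))" for n
      by (rule smat_mder[OF smooth[OF smat_const[OF unit_mat_carrier]]])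
    show "mder d (\<lambda>t. L (t *\<^sub>R axis k 1) (R (0 *\<^sub>R axis k 1))) G" using G by (simp only: scaleR_zero_left)
  qed
  then have "mder d (\<lambda>t. R (t *\<^sub>R axis k 1)) (G + L 0 R')" unfolding R_fixed scaleR_zero_left .
  note stat = mder_unique[OF R' this]
  have tR: "mtrace R' = 0"
    using mder_mtrace[OF R'] unfolding R_trace by (rule vector_derivative_unique_at) (rule has_vector_derivative_const)
  have R'G: "R' = linop_inv d (resolvent_map d (L 0)) G"
    by (rule resolvent_eqI[OF chn d mix Rc Gc tR stat])
  \<comment> \<open>All channels preserve the trace, so the curve through \<open>G\<close> has
    constant trace.\<close>
  have tG: "mtrace G = 0"
  proof -
    have "((\<lambda>t. mtrace (L (t *\<^sub>R axis k 1) (R 0))) has_vector_derivative mtrace G) (at 0)" by (rule mder_mtrace[OF G])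
    then show ?thesis unfolding channelD(3)[OF chn R_carrier]
      by (rule vector_derivative_unique_at) (rule has_vector_derivative_const)
  qed
  have PR: "R 0 * P' \<in> carrier_mat d d" "R' * P 0 \<in> carrier_mat d d"
    using mderD(2)[OF P'] Rc Pc by auto
  have "((\<lambda>t. mtrace (R (t *\<^sub>R axis k 1) * P (t *\<^sub>R axis k 1))) has_vector_derivative mtrace (R 0 * P' + R' * P 0)) (at 0)"
    using mder_mtrace[OF mder_mult[OF R' P']] by (simp only: scaleR_zero_left)
  moreover have "((\<lambda>t. mtrace (R (t *\<^sub>R axis k 1) * P (t *\<^sub>R axis k 1))) has_vector_derivative pd k (\<lambda>\<zeta>. mtrace (R \<zeta> * P \<zeta>)) 0) (at 0)"
    by (rule exp_rational_line_derivative[OF exp_rational_mtrace[OF smat_mult[OF smat_R P]]])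
  ultimately have "pd k (\<lambda>\<zeta>. mtrace (R \<zeta> * P \<zeta>)) 0 = mtrace (R 0 * P' + R' * P 0)"
    by (rule vector_derivative_unique_at[rotated])
  also have "\<dots> = mtrace (R 0 * P') + mtrace (R' * P 0)" by (rule mtrace_add[OF PR])
  also have "mtrace (R 0 * P') = c"
  proof -
    have "mder d (\<lambda>t. R 0 * P (t *\<^sub>R axis k 1)) (R 0 * P' + 0\<^sub>m d d * P (0 *\<^sub>R axis k 1))"
      by (rule mder_mult[OF mder_const[OF R_carrier] P'])
    then have "mder d (\<lambda>t. R 0 * P (t *\<^sub>R axis k 1)) (R 0 * P')"
      using PR(1) left_mult_zero_mat[OF Pc] right_add_zero_mat[OF PR(1)] by (simp only: )
    from mder_mtrace[OF this] show ?thesis using c by (rule vector_derivative_unique_at)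
  qed
  finally have "pd k (\<lambda>\<zeta>. mtrace (R \<zeta> * P \<zeta>)) 0 - c = mtrace (linop_inv d (resolvent_map d (L 0)) G * P 0)"
    unfolding R'G[symmetric] by simp
  then show ?thesis using resolvent_series[OF chn d mix Gc tG Pc[of 0]] by simp
qed

end

section \<open>The collision model\<close>

lemma mder_kron_right:
  assumes "A \<in> carrier_mat d d" "mder e F F'"
  shows "mder (d*e) (\<lambda>t. kron A (F t)) (kron A F')"
proof (rule mderI[of _ _ _ "\<lambda>a b t. A $$ (a div e, b div e) * F t $$ (a mod e, b mod e)"
      "\<lambda>a b. A $$ (a div e, b div e) * F' $$ (a mod e, b mod e)"])
  note c = mderD(1,2)[OF assms(2)]
  show "kron A (F t) \<in> carrier_mat (d*e) (d*e)" for t using assms(1) c by simp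
  show "kron A F' \<in> carrier_mat (d*e) (d*e)" using assms(1) c by simp
  fix a b assume ab: "a < d * e" "b < d * e"
  then have "e > 0" by (cases e) auto
  with ab have l: "a div e < d" "b div e < d" "a mod e < e" "b mod e < e"
    by (auto simp: less_mult_imp_div_less)
  show "((\<lambda>t. A $$ (a div e, b div e) * F t $$ (a mod e, b mod e)) has_vector_derivative
      A $$ (a div e, b div e) * F' $$ (a mod e, b mod e)) (at 0)"
    by (intro has_vector_derivative_mult_right mderD(3)[OF assms(2)] l)
  show "kron A (F t) $$ (a,b) = A $$ (a div e, b div e) * F t $$ (a mod e, b mod e)" for t
    using kron_index[OF assms(1) c(1) l] by simp
  show "kron A F' $$ (a,b) = A $$ (a div e, b div e) * F' $$ (a mod e, b mod e)"
    using kron_index[OF assms(1) c(2) l] by simp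
qed

lemma mder_ptr2:
  assumes "mder (d*e) F F'" shows "mder d (\<lambda>t. ptr2 d e (F t)) (ptr2 d e F')"
proof (rule mderI[of _ _ _ "\<lambda>a b t. \<Sum>k<e. F t $$ (a*e+k, b*e+k)" "\<lambda>a b. \<Sum>k<e. F' $$ (a*e+k, b*e+k)"])
  fix a b assume "a < d" "b < d"
  then show "((\<lambda>t. \<Sum>k<e. F t $$ (a*e+k, b*e+k)) has_vector_derivative (\<Sum>k<e. F' $$ (a*e+k, b*e+k))) (at 0)"
    by (intro has_vector_derivative_sum mderD(3)[OF assms]) (auto simp: prod_index_less)
qed (auto simp: ptr2_index)

lemma linop_mult_left: "A \<in> carrier_mat n n \<Longrightarrow> linop n (\<lambda>X. A * X)"
  unfolding linop_def by (auto simp: mult_add_distrib_mat[of _ n n _ n] mult_smult_distrib[of _ n n _ n])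

lemma linop_mult_right: "B \<in> carrier_mat n n \<Longrightarrow> linop n (\<lambda>X. X * B)"
  unfolding linop_def by (auto simp: add_mult_distrib_mat[of _ n n _ _ n] mult_smult_assoc_mat[of _ n n _ n])

lemma chan_mder:
  assumes "U \<in> carrier_mat (d*e) (d*e)" "\<rho> \<in> carrier_mat d d" "mder e F F'"
  shows "mder d (\<lambda>t. chan d e U (F t) \<rho>) (chan d e U F' \<rho>)"
  unfolding chan_def
  by (intro mder_ptr2 mder_linop[OF linop_mult_right] mder_linop[OF linop_mult_left] mder_kron_right assms adj_carrier)

lemma energy_gain_mder:
  assumes "U \<in> carrier_mat (d*e) (d*e)" "H \<in> carrier_mat e e" "mder e F F'"
  shows "mder d (\<lambda>t. energy_gain d e U (F t) H) (energy_gain d e U F' H)"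
  unfolding energy_gain_def using assms(1,2)
  by (intro mder_ptr2 mder_linop[OF linop_mult_right] mder_kron_right assms(3)) auto

lemma chan_smat:
  assumes "U \<in> carrier_mat (d*e) (d*e)" "smat d F" "smat e G"
  shows "smat d (\<lambda>\<zeta>. chan d e U (G \<zeta>) (F \<zeta>))"
  unfolding chan_def using assms by (intro smat_ptr2 smat_mult smat_kron smat_const) auto

lemma dchan_smat:
  assumes "U \<in> carrier_mat (d*e) (d*e)" "smat d F" "smat e G"
  shows "smat d (\<lambda>\<zeta>. dchan d e U (G \<zeta>) (F \<zeta>))"
  unfolding dchan_def using assms by (intro smat_ptr2 smat_mult smat_kron smat_const) auto

lemma energy_gain_smat:
  assumes "U \<in> carrier_mat (d*e) (d*e)" "H \<in> carrier_mat e e" "smat e G"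
  shows "smat d (\<lambda>\<zeta>. energy_gain d e U (G \<zeta>) H)"
  unfolding energy_gain_def using assms by (intro smat_ptr2 smat_mult smat_kron smat_const) auto

locale collision_model =
  fixes S :: "('m::{finite,linorder}) qsys"
  assumes wf: "wf_sys S"
begin

abbreviation "d \<equiv> dS S"
abbreviation "e \<equiv> dE S"

lemma dims: "d > 0" "e j > 0" and herms: "herm d (HS S)" "herm (e j) (HE S j)" "herm (d * e j) (Vint S j)"
  and card_ge: "CARD('m) \<ge> 2" and bref_pos: "bref S > 0" and tau_pos: "tau S j > 0"
  using wf by (auto simp: wf_sys_def Suc_le_eq)

lemma HEc [simp]: "HE S j \<in> carrier_mat (e j) (e j)"
  using hermD(1)[OF herms(2)] .

lemma Ttot_pos: "Ttot S > 0"
  unfolding Ttot_def by (intro sum_pos tau_pos) auto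

lemma herm_Hj: "herm (d * e j) (Hj S j)"
  unfolding Hj_def by (intro herm_add herm_kron herms herm_one)

lemma unitary_U: "unitary (d * e j) (Uj S j)"
  unfolding Uj_def by (rule mexp_unitary[OF herm_Hj])

lemma Uc [simp]: "Uj S j \<in> carrier_mat (d * e j) (d * e j)"
  using unitaryD(1)[OF unitary_U] .

lemma rhoE_psd: "psd (e j) (rhoE S j z)" and rhoE_trace: "mtrace (rhoE S j z) = 1"
  and rhoE_comm: "rhoE S j z * HE S j = HE S j * rhoE S j z"
  unfolding rhoE_def using gibbs_state[OF herms(2) dims(2)] by auto

lemma rhoEc [simp]: "rhoE S j z \<in> carrier_mat (e j) (e j)"
  using psdD(2)[OF rhoE_psd] .

lemma Lch_eq: "Lch S j z = chan d (e j) (Uj S j) (rhoE S j z)"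
  by (auto simp: Lch_def chan_def)

lemma Ldual_eq: "Ldual S j z = dchan d (e j) (Uj S j) (rhoE S j z)"
  by (auto simp: Ldual_def dchan_def)

lemma Phi_eq: "Phi S j z = complex_of_real (- 1 / Ttot S) \<cdot>\<^sub>m energy_gain d (e j) (Uj S j) (rhoE S j z) (HE S j)"
  by (simp add: Phi_def energy_gain_def)

lemma Phirev_eq: "Phirev S j z = complex_of_real (1 / Ttot S) \<cdot>\<^sub>m energy_gain d (e j) (adj (Uj S j)) (rhoE S j z) (HE S j)"
  unfolding Phirev_def energy_gain_def adj_adj[OF Uc] ..

lemma Phi_carrier [simp]: "Phi S j z \<in> carrier_mat d d"
  by (simp add: Phi_def)

lemma Phirev_carrier [simp]: "Phirev S j z \<in> carrier_mat d d"
  by (simp add: Phirev_def)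

lemma channel_Lch: "channel d (Lch S j z)"
  unfolding Lch_eq by (rule channel_chan[OF unitary_U rhoE_psd rhoE_trace])

lemma linop_Ldual: "linop d (Ldual S j z)"
  unfolding Ldual_eq by (rule linop_dchan[OF unitary_U rhoEc])

lemma dual_step:
  "\<rho> \<in> carrier_mat d d \<Longrightarrow> X \<in> carrier_mat d d \<Longrightarrow> mtrace (Lch S j z \<rho> * X) = mtrace (\<rho> * Ldual S j z X)"
  unfolding Lch_eq Ldual_eq by (rule chan_duality[OF unitary_U rhoEc])

lemma rhoE_smat: "smat (e j) (\<lambda>\<zeta>::'m rvec. rhoE S j (vec_nth \<zeta> i))"
  unfolding rhoE_def by (rule gibbs_smat[OF herms(2) dims(2)])

lemma Lch_smat: "smat d F \<Longrightarrow> smat d (\<lambda>\<zeta>. Lch S j (vec_nth \<zeta> j) (F \<zeta>))"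
  unfolding Lch_eq by (rule chan_smat[OF Uc _ rhoE_smat])

lemma Ldual_smat: "smat d F \<Longrightarrow> smat d (\<lambda>\<zeta>. Ldual S j (vec_nth \<zeta> j) (F \<zeta>))"
  unfolding Ldual_eq by (rule dchan_smat[OF Uc _ rhoE_smat])

lemma Phi_smat: "smat d (\<lambda>\<zeta>. Phi S j (vec_nth \<zeta> j))"
  unfolding Phi_eq by (intro smat_smult exp_rational.const energy_gain_smat[OF Uc HEc rhoE_smat])

lemma Lch_dominates: "dominates d (Lch S j z) (Lch S j z')"
  unfolding Lch_eq rhoE_def by (rule chan_gibbs_dominates[OF unitary_U herms(2) dims(2)])

text \<open>Words of steps. The head of the list acts first on states and, in \<open>Dseq\<close>,
  last on observables, so one list denotes a map and its dual. The cycle, its segments and the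
  reversed cycle are all of this form.\<close>

definition Lseq :: "'m list \<Rightarrow> 'm rvec \<Rightarrow> complex mat \<Rightarrow> complex mat" where
  "Lseq xs \<zeta> = fold (\<lambda>j. Lch S j (vec_nth \<zeta> j)) xs"

definition Dseq :: "'m list \<Rightarrow> 'm rvec \<Rightarrow> complex mat \<Rightarrow> complex mat" where
  "Dseq xs \<zeta> = foldr (\<lambda>j. Ldual S j (vec_nth \<zeta> j)) xs"

lemma Lseq_simps [simp]: "Lseq [] \<zeta> X = X" "Lseq (x # xs) \<zeta> X = Lseq xs \<zeta> (Lch S x (vec_nth \<zeta> x) X)"
  "Lseq (xs @ ys) \<zeta> X = Lseq ys \<zeta> (Lseq xs \<zeta> X)"
  by (simp_all add: Lseq_def)

lemma Dseq_simps [simp]: "Dseq [] \<zeta> X = X" "Dseq (x # xs) \<zeta> X = Ldual S x (vec_nth \<zeta> x) (Dseq xs \<zeta> X)"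
  "Dseq (xs @ ys) \<zeta> X = Dseq xs \<zeta> (Dseq ys \<zeta> X)"
  by (simp_all add: Dseq_def)

lemma channel_Lseq: "channel d (Lseq xs \<zeta>)"
  unfolding Lseq_def by (rule channel_fold[OF channel_Lch])

lemma linop_Dseq: "linop d (Dseq xs \<zeta>)"
  unfolding Dseq_def by (rule linop_foldr[OF linop_Ldual])

lemma Lseq_carrier [simp]: "X \<in> carrier_mat d d \<Longrightarrow> Lseq xs \<zeta> X \<in> carrier_mat d d"
  by (rule linop_carrier[OF channelD(1)[OF channel_Lseq]])

lemma Dseq_carrier [simp]: "X \<in> carrier_mat d d \<Longrightarrow> Dseq xs \<zeta> X \<in> carrier_mat d d"
  by (rule linop_carrier[OF linop_Dseq])

lemma Lch_carrier [simp]: "X \<in> carrier_mat d d \<Longrightarrow> Lch S j z X \<in> carrier_mat d d"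
  by (rule linop_carrier[OF channelD(1)[OF channel_Lch]])

lemma Ldual_carrier [simp]: "X \<in> carrier_mat d d \<Longrightarrow> Ldual S j z X \<in> carrier_mat d d"
  by (rule linop_carrier[OF linop_Ldual])

lemma dual_Lseq:
  assumes "\<rho> \<in> carrier_mat d d" "X \<in> carrier_mat d d"
  shows "mtrace (Lseq xs \<zeta> \<rho> * X) = mtrace (\<rho> * Dseq xs \<zeta> X)"
  using assms(1)
proof (induction xs arbitrary: \<rho>)
  case (Cons x xs)
  then show ?case using dual_step[OF Cons.prems Dseq_carrier[OF assms(2)]] assms(2) by simp
qed simp

lemma dual_funpow:
  assumes "channel d L" "linop d D"
    "\<And>A X. A \<in> carrier_mat d d \<Longrightarrow> X \<in> carrier_mat d d \<Longrightarrow> mtrace (L A * X) = mtrace (A * D X)"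
    "\<rho> \<in> carrier_mat d d" "X \<in> carrier_mat d d"
  shows "mtrace ((L ^^ n) \<rho> * X) = mtrace (\<rho> * (D ^^ n) X)"
  using assms(5)
proof (induction n arbitrary: X)
  case (Suc n)
  have "(L ^^ n) \<rho> \<in> carrier_mat d d"
    by (rule linop_carrier[OF channelD(1)[OF channel_funpow[OF assms(1)]] assms(4)])
  from assms(3)[OF this Suc.prems]
  have "mtrace (L ((L ^^ n) \<rho>) * X) = mtrace (\<rho> * (D ^^ n) (D X))"
    unfolding Suc.IH[OF linop_carrier[OF assms(2) Suc.prems]] .
  moreover have "(D ^^ Suc n) X = (D ^^ n) (D X)" by (simp only: funpow_Suc_right comp_def)
  ultimately show ?case by (simp only: funpow.simps(2) comp_def)
qed simp

lemma Lseq_smat: "smat d F \<Longrightarrow> smat d (\<lambda>\<zeta>. Lseq xs \<zeta> (F \<zeta>))"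
proof (induction xs arbitrary: F)
  case (Cons x xs)
  show ?case using Cons.IH[OF Lch_smat[OF Cons.prems]] by simp
qed simp

lemma Dseq_smat: "smat d F \<Longrightarrow> smat d (\<lambda>\<zeta>. Dseq xs \<zeta> (F \<zeta>))"
proof (induction xs)
  case (Cons x xs)
  show ?case using Ldual_smat[OF Cons.IH[OF Cons.prems]] by simp
qed simp

lemma Lseq_dominates: "dominates d (Lseq xs \<zeta>) (Lseq xs \<zeta>')"
  unfolding Lseq_def by (rule dominates_fold[OF channel_Lch channel_Lch Lch_dominates])

lemma channel_Lra: "channel d (Lra S \<zeta>)"
proof -
  have "length (idx :: 'm list) = CARD('m)" by (simp add: idx_def)
  moreover from this have "(idx :: 'm list) \<noteq> []" using card_ge by auto
  ultimately show ?thesis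
    using channel_average[of idx d "\<lambda>j. Lch S j (vec_nth \<zeta> j)", OF channel_Lch] unfolding Lra_def[abs_def] by simp
qed

lemma Lra_dominates: "dominates d (Lra S \<zeta>) (Lra S \<zeta>')"
  unfolding Lra_def[abs_def]
  by (intro dominates_scale dominates_msum channel_Lch Lch_dominates linop_msum channelD(1)) auto

lemma Lra_smat: "smat d F \<Longrightarrow> smat d (\<lambda>\<zeta>. Lra S \<zeta> (F \<zeta>))"
  unfolding Lra_def by (intro smat_smult exp_rational.const smat_msum Lch_smat)

end

section \<open>Kinetic coefficients near equilibrium\<close>

locale equilibrium_model = collision_model S for S :: "('m::{finite,linorder}) qsys" +
  fixes rp :: "real \<Rightarrow> complex mat"
  assumes NE: "NE_map S rp"
begin

abbreviation "\<rho> \<equiv> rp 0"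

lemma rp_psd: "psd d (rp z)" and rp_trace: "mtrace (rp z) = 1"
  using NE by (auto simp: NE_map_def state_def)

lemma rpc [simp]: "rp z \<in> carrier_mat d d"
  using psdD(2)[OF rp_psd] .

lemma rp_inv: "Uj S j * kron (rp z) (rhoE S j z) * adj (Uj S j) = kron (rp z) (rhoE S j z)"
  using NE by (simp add: NE_map_def)

lemmas step_inv = unitary_U rhoEc rhoE_trace rpc HEc rhoE_comm rp_inv

lemma Lch_rp: "Lch S j z (rp z) = rp z"
  unfolding Lch_eq by (rule chan_invariant[OF step_inv])

definition rhoE' :: "'m \<Rightarrow> complex mat" where
  "rhoE' j = rhoE S j 0 * (HE S j - mtrace (rhoE S j 0 * HE S j) \<cdot>\<^sub>m 1\<^sub>m (e j))"

lemma rhoE_mder: "mder (e j) (\<lambda>t. rhoE S j t) (rhoE' j)"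
  using gibbs_mder[OF herms(2) dims(2), of j "bref S"] by (simp add: rhoE_def rhoE'_def)

lemma energy_gain_rev:
  "energy_gain d (e j) (adj (Uj S j)) (rhoE S j 0) (HE S j) = complex_of_real (Ttot S) \<cdot>\<^sub>m Phirev S j 0"
  unfolding Phirev_eq using Ttot_pos by (auto intro!: eq_matI)

definition response :: "'m \<Rightarrow> complex mat" where
  "response k = complex_of_real (Ttot S) \<cdot>\<^sub>m (Phirev S k 0 * \<rho>)"

lemma response_carrier [simp]: "response k \<in> carrier_mat d d"
  by (simp add: response_def)

lemma Lch_mder: "mder d (\<lambda>t. Lch S k t \<rho>) (response k)"
proof -
  have "chan d (e k) (Uj S k) (rhoE' k) \<rho> = response k"
    unfolding rhoE'_def chan_derivative[OF step_inv] energy_gain_rev response_def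
    by (rule mult_smult_assoc_mat[of _ d d _ d]) auto
  then show ?thesis using chan_mder[OF Uc rpc rhoE_mder, of k 0] unfolding Lch_eq by simp
qed

lemma mtrace_response:
  assumes "X \<in> carrier_mat d d"
  shows "mtrace (response k * X) = complex_of_real (Ttot S) * mtrace (\<rho> * (X * Phirev S k 0))"
proof -
  have "response k * X = complex_of_real (Ttot S) \<cdot>\<^sub>m (Phirev S k 0 * \<rho> * X)"
    unfolding response_def using assms by (intro mult_smult_assoc_mat[of _ d d _ d]) auto
  then have "mtrace (response k * X) = complex_of_real (Ttot S) * mtrace (Phirev S k 0 * \<rho> * X)"
    using assms by (simp add: mtrace_smult[of _ d])
  also have "mtrace (Phirev S k 0 * \<rho> * X) = mtrace (\<rho> * X * Phirev S k 0)"
    using assms by (intro mtrace_cyc[of _ d]) auto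
  also have "\<rho> * X * Phirev S k 0 = \<rho> * (X * Phirev S k 0)"
    using assms by (intro assoc_mult_mat[of _ d d _ d _ d]) auto
  finally show ?thesis .
qed

text \<open>At equal thermal forces (NE) provides one state that every step fixes, so every word
  fixes it.\<close>

lemma Lseq_rp: "(\<And>j. j \<in> set xs \<Longrightarrow> vec_nth \<zeta> j = z) \<Longrightarrow> Lseq xs \<zeta> (rp z) = rp z"
  by (induction xs) (auto simp: Lch_rp)

lemma axis_nth: "vec_nth (t *\<^sub>R axis k 1 :: 'm rvec) j = (if j = k then t else 0)"
  by (simp add: axis_def)

lemma Lseq_axis: "k \<notin> set xs \<Longrightarrow> Lseq xs (t *\<^sub>R axis k 1) X = Lseq xs 0 X"
proof (induction xs arbitrary: X)
  case (Cons x xs)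
  have x: "vec_nth (t *\<^sub>R axis k 1 :: 'm rvec) x = 0" unfolding axis_nth using Cons.prems by auto
  have IH: "Lseq xs (t *\<^sub>R axis k 1) Y = Lseq xs 0 Y" for Y by (rule Cons.IH) (use Cons.prems in auto)
  show ?case unfolding Lseq_simps x IH by simp
qed simp

text \<open>The steps before \<open>k\<close> leave \<open>\<rho>\<close> in place and those after
  \<open>k\<close> stay at thermal force 0. As \<open>k\<close> occurs once, a single step
  moves.\<close>

lemma Lseq_mder:
  assumes "k \<notin> set us" "k \<notin> set vs"
  shows "mder d (\<lambda>t. Lseq (us @ k # vs) (t *\<^sub>R axis k 1) \<rho>) (Lseq vs 0 (response k))"
proof -
  have us: "Lseq us (t *\<^sub>R axis k 1) \<rho> = \<rho>" for t
    using Lseq_rp[of us 0 0] unfolding Lseq_axis[OF assms(1)] by simp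
  have "mder d (\<lambda>t. Lseq vs 0 (Lch S k t \<rho>)) (Lseq vs 0 (response k))"
    by (rule mder_linop[OF channelD(1)[OF channel_Lseq] Lch_mder])
  moreover have "Lseq (us @ k # vs) (t *\<^sub>R axis k 1) \<rho> = Lseq vs 0 (Lch S k t \<rho>)" for t
    by (simp only: Lseq_simps us Lseq_axis[OF assms(2)] axis_nth if_True refl)
  ultimately show ?thesis by (simp only:)
qed

lemma Phi_mder:
  "mder d (\<lambda>t. Phi S j t) (complex_of_real (- 1 / Ttot S) \<cdot>\<^sub>m energy_gain d (e j) (Uj S j) (rhoE' j) (HE S j))"
  unfolding Phi_eq
  by (intro mder_linop[OF linop_scale[OF linop_id]] energy_gain_mder[OF Uc HEc rhoE_mder])

lemma Lra_rp: "(\<And>j. vec_nth \<zeta> j = z) \<Longrightarrow> Lra S \<zeta> (rp z) = rp z"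
proof -
  assume z: "\<And>j. vec_nth \<zeta> j = z"
  show "Lra S \<zeta> (rp z) = rp z" unfolding Lra_def z Lch_rp
  proof (rule matI[of _ d d])
    fix a b assume ab: "a < d" "b < d"
    have c: "msum d (\<lambda>j. rp z) (idx :: 'm list) \<in> carrier_mat d d" by (rule msum_carrier) simp
    have "(\<Sum>x\<leftarrow>(idx :: 'm list). rp z $$ (a,b)) = of_nat CARD('m) * rp z $$ (a,b)"
      by (simp add: sum_list_triv idx_def)
    then show "(complex_of_real (1 / real CARD('m)) \<cdot>\<^sub>m msum d (\<lambda>j. rp z) (idx :: 'm list)) $$ (a,b) = rp z $$ (a,b)"
      unfolding smult_index[OF c ab] using ab by (simp add: msum_index)
  qed (auto intro!: smult_carrier_mat msum_carrier)
qed

lemma dual_Lra: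
  assumes "A \<in> carrier_mat d d" "X \<in> carrier_mat d d"
  shows "mtrace (Lra S \<zeta> A * X) = mtrace (A * Lra_dual S \<zeta> X)"
proof -
  have L: "msum d (\<lambda>j. Lch S j (vec_nth \<zeta> j) A) xs \<in> carrier_mat d d" for xs :: "'m list"
    using assms by (intro msum_carrier) auto
  have D: "msum d (\<lambda>j. Ldual S j (vec_nth \<zeta> j) X) xs \<in> carrier_mat d d" for xs :: "'m list"
    using assms by (intro msum_carrier) auto
  have sum: "mtrace (msum d (\<lambda>j. Lch S j (vec_nth \<zeta> j) A) xs * X) = mtrace (A * msum d (\<lambda>j. Ldual S j (vec_nth \<zeta> j) X) xs)"
    for xs :: "'m list"
  proof (induction xs rule: rev_induct)
    case Nil
    show ?case using assms by (simp add: left_mult_zero_mat[of _ d d] right_mult_zero_mat[of _ d d])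
  next
    case (snoc x xs)
    have "mtrace (msum d (\<lambda>j. Lch S j (vec_nth \<zeta> j) A) (xs @ [x]) * X)
      = mtrace (msum d (\<lambda>j. Lch S j (vec_nth \<zeta> j) A) xs * X) + mtrace (Lch S x (vec_nth \<zeta> x) A * X)"
      unfolding msum_snoc add_mult_distrib_mat[OF L Lch_carrier[OF assms(1)] assms(2)]
      by (rule mtrace_add[OF mult_carrier_sq[OF L assms(2)] mult_carrier_sq[OF Lch_carrier[OF assms(1)] assms(2)]])
    also have "\<dots> = mtrace (A * msum d (\<lambda>j. Ldual S j (vec_nth \<zeta> j) X) xs) + mtrace (A * Ldual S x (vec_nth \<zeta> x) X)"
      unfolding snoc dual_step[OF assms] ..
    also have "\<dots> = mtrace (A * msum d (\<lambda>j. Ldual S j (vec_nth \<zeta> j) X) (xs @ [x]))"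
      unfolding msum_snoc mult_add_distrib_mat[OF assms(1) D Ldual_carrier[OF assms(2)]]
      by (rule mtrace_add[symmetric, OF mult_carrier_sq[OF assms(1) D] mult_carrier_sq[OF assms(1) Ldual_carrier[OF assms(2)]]])
    finally show ?case .
  qed
  show ?thesis
    unfolding Lra_def Lra_dual_def mult_smult_assoc_mat[OF L assms(2)] mult_smult_distrib[OF assms(1) D]
      mtrace_smult[OF mult_carrier_sq[OF L assms(2)]] mtrace_smult[OF mult_carrier_sq[OF assms(1) D]] sum ..
qed

lemma linop_Lra_dual: "linop d (Lra_dual S \<zeta>)"
  unfolding Lra_dual_def[abs_def] by (intro linop_scale linop_msum linop_Ldual)

lemma mder_msum:
  "(\<And>x. x \<in> set xs \<Longrightarrow> mder d (f x) (g x)) \<Longrightarrow> mder d (\<lambda>t. msum d (\<lambda>x. f x t) xs) (msum d g xs)"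
  by (induction xs rule: rev_induct) (auto simp: msum_snoc intro: mder_const mder_add)

text \<open>Only the summand \<open>k\<close> depends on the thermal force in direction
  \<open>k\<close>; averaging contributes the factor 1/M.\<close>

lemma Lra_mder: "mder d (\<lambda>t. Lra S (t *\<^sub>R axis k 1) \<rho>) (complex_of_real (1 / real CARD('m)) \<cdot>\<^sub>m response k)"
proof -
  let ?g = "\<lambda>j. if j = k then response k else 0\<^sub>m d d"
  have "mder d (\<lambda>t. Lch S j (vec_nth (t *\<^sub>R axis k 1) j) \<rho>) (?g j)" for j
    unfolding axis_nth using Lch_mder[of k] mder_const[OF rpc[of 0]] by (simp add: Lch_rp)
  then have "mder d (\<lambda>t. msum d (\<lambda>j. Lch S j (vec_nth (t *\<^sub>R axis k 1) j) \<rho>) idx) (msum d ?g idx)"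
    by (intro mder_msum)
  moreover have "msum d ?g (idx :: 'm list) = response k"
  proof (rule matI[of _ d d])
    fix a b assume ab: "a < d" "b < d"
    have "msum d ?g (idx :: 'm list) $$ (a,b) = (\<Sum>j\<leftarrow>(idx::'m list). ?g j $$ (a,b))"
      using ab by (intro msum_index) auto
    also have "\<dots> = (\<Sum>j\<in>UNIV. ?g j $$ (a,b))"
      by (subst sum_list_distinct_conv_sum_set) (auto simp: idx_def)
    also have "\<dots> = (\<Sum>j\<in>UNIV. if j = k then response k $$ (a,b) else 0)"
      using ab by (intro sum.cong refl) auto
    finally show "msum d ?g (idx :: 'm list) $$ (a,b) = response k $$ (a,b)" by (simp add: sum.delta)
  qed (auto intro!: msum_carrier)
  ultimately show ?thesis unfolding Lra_def by (intro mder_linop[OF linop_scale[OF linop_id]]) simp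
qed

section \<open>Kinetic coefficients in terms of an effective Hamiltonian\<close>

context
  fixes H' :: "complex mat"
  assumes H': "herm d H'" and eff: "mexp (complex_of_real (- bref S) \<cdot>\<^sub>m H') = \<rho>"
begin

lemma H'c: "H' \<in> carrier_mat d d"
  using hermD(1)[OF H'] .

lemma energy_conservation:
  "Uj S j * (kron H' (1\<^sub>m (e j)) + kron (1\<^sub>m d) (HE S j)) = (kron H' (1\<^sub>m (e j)) + kron (1\<^sub>m d) (HE S j)) * Uj S j"
proof (rule gibbs_product_commute[OF H' herms(2) dims(2) _ Uc])
  show "bref S \<noteq> 0" using bref_pos by simp
  show "Uj S j * kron (mexp (complex_of_real (- bref S) \<cdot>\<^sub>m H')) (gibbs (bref S) (HE S j))
    = kron (mexp (complex_of_real (- bref S) \<cdot>\<^sub>m H')) (gibbs (bref S) (HE S j)) * Uj S j"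
  proof -
    have "Uj S j * kron \<rho> (rhoE S j 0) = kron \<rho> (rhoE S j 0) * Uj S j"
      by (rule invariant_commute(1)[OF step_inv])
    then show ?thesis unfolding eff rhoE_def by (simp only: diff_zero)
  qed
qed

text \<open>The fluctuation-dissipation identity yields minus one half of the dissipation function,
  and the minus sign in the definition of the flux cancels this sign.\<close>

lemma Phi_diag_derivative:
  "((\<lambda>t. mtrace (\<rho> * Phi S j t)) has_vector_derivative (1/2) * mtrace (\<rho> * Dissip S j 0 H' H')) (at 0)"
proof -
  let ?T = "complex_of_real (Ttot S)"
  let ?EG = "energy_gain d (e j) (Uj S j) (rhoE' j) (HE S j)"
  let ?D = "Ldual S j 0 (H' * H') - Ldual S j 0 H' * H' - H' * Ldual S j 0 H' + H' * H'"
  have EG: "?EG \<in> carrier_mat d d" by (simp add: energy_gain_def)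
  have D: "?D \<in> carrier_mat d d" using H'c by simp
  have fd: "2 * mtrace (\<rho> * ?EG) = - mtrace (\<rho> * ?D)"
    unfolding rhoE'_def Ldual_eq
    by (rule fluctuation_dissipation[OF step_inv H'c energy_conservation])
  have dis: "Dissip S j 0 H' H' = complex_of_real (1 / Ttot S) \<cdot>\<^sub>m ?D"
    unfolding Dissip_def hermD(2)[OF H'] ..
  have "((\<lambda>t. mtrace (\<rho> * Phi S j t)) has_vector_derivative mtrace (\<rho> * (complex_of_real (- 1 / Ttot S) \<cdot>\<^sub>m ?EG))) (at 0)"
    by (rule mder_mtrace[OF mder_linop[OF linop_mult_left[OF rpc] Phi_mder]])
  also have "\<rho> * (complex_of_real (- 1 / Ttot S) \<cdot>\<^sub>m ?EG) = complex_of_real (- 1 / Ttot S) \<cdot>\<^sub>m (\<rho> * ?EG)"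
    by (rule mult_smult_distrib[OF rpc EG])
  also have "mtrace \<dots> = complex_of_real (- 1 / Ttot S) * mtrace (\<rho> * ?EG)"
    by (rule mtrace_smult[OF mult_carrier_sq[OF rpc EG]])
  also have "\<dots> = (1/2) * (complex_of_real (1 / Ttot S) * mtrace (\<rho> * ?D))"
  proof -
    have "mtrace (\<rho> * ?EG) = - (1/2) * mtrace (\<rho> * ?D)" using fd by (simp add: field_simps)
    then show ?thesis by simp
  qed
  also have "complex_of_real (1 / Ttot S) * mtrace (\<rho> * ?D) = mtrace (complex_of_real (1 / Ttot S) \<cdot>\<^sub>m (\<rho> * ?D))"
    by (rule mtrace_smult[OF mult_carrier_sq[OF rpc D], symmetric])
  also have "complex_of_real (1 / Ttot S) \<cdot>\<^sub>m (\<rho> * ?D) = \<rho> * Dissip S j 0 H' H'"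
    unfolding dis by (rule mult_smult_distrib[OF rpc D, symmetric])
  finally show ?thesis .
qed

text \<open>Energy conservation was derived at equilibrium but is a property of \<open>U\<close>
  alone, so the flux has this form at every temperature.\<close>

lemma Phi_first_law: "Phi S j z = complex_of_real (1 / Ttot S) \<cdot>\<^sub>m (Ldual S j z H' - H')"
proof -
  have c: "Ldual S j z H' \<in> carrier_mat d d" using H'c by simp
  have "Phi S j z = complex_of_real (- 1 / Ttot S) \<cdot>\<^sub>m (H' - Ldual S j z H')"
    unfolding Phi_eq Ldual_eq energy_gain_first_law(2)[OF step_inv H'c energy_conservation] ..
  then show ?thesis using c H'c by (auto intro!: matI[of _ d d] simp: mat_op_index[of _ d d] smult_index[of _ d d] algebra_simps)
qed

text \<open>Stated for lists of distinct steps, so that the cycle and the reversed cycle are both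
  instances. Here \<open>us\<close> and \<open>vs\<close> are the steps before and after
  \<open>k\<close>, \<open>usj\<close> those before \<open>j\<close>, and \<open>m\<close> those
  between \<open>k\<close> and \<open>j\<close> when \<open>k\<close> comes first.\<close>

lemma seq_kinetic:
  assumes fam: "channel_family d (Lseq xs)" and dist: "distinct xs"
    and k: "xs = us @ k # vs" and j: "xs = usj @ j # vsj" and m: "k \<in> set usj \<Longrightarrow> usj = us @ k # m"
  shows "(\<lambda>n. complex_of_real (Ttot S) * mtrace (\<rho> * (Dseq vs 0 ((Dseq xs 0 ^^ n) (Dseq usj 0 (Phi S j 0))) * Phirev S k 0)))
    sums (pd k (\<lambda>\<zeta>. mtrace (inv_state d (Lseq xs \<zeta>) * Dseq usj \<zeta> (Phi S j (vec_nth \<zeta> j)))) 0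
      - (if k \<in> set usj then complex_of_real (Ttot S) * mtrace (\<rho> * (Dseq m 0 (Phi S j 0) * Phirev S k 0)) else 0)
      - (if j = k then (1/2) * mtrace (\<rho> * Dissip S j 0 H' H') else 0))"
proof -
  interpret channel_family d "Lseq xs" by (rule fam)
  define P where "P \<zeta> = Dseq usj \<zeta> (Phi S j (vec_nth \<zeta> j))" for \<zeta>
  have P: "smat d P" unfolding P_def by (rule Dseq_smat[OF Phi_smat])
  have R0: "R 0 = \<rho>" by (rule R_unique[OF rpc rp_trace Lseq_rp]) simp
  have nk: "k \<notin> set us" "k \<notin> set vs" using dist k by auto
  have G: "mder d (\<lambda>t. Lseq xs (t *\<^sub>R axis k 1) (R 0)) (Lseq vs 0 (response k))"
    unfolding R0 unfolding k by (rule Lseq_mder[OF nk])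
  let ?A = "if k \<in> set usj then complex_of_real (Ttot S) * mtrace (\<rho> * (Dseq m 0 (Phi S j 0) * Phirev S k 0)) else 0"
  let ?B = "if j = k then (1/2) * mtrace (\<rho> * Dissip S j 0 H' H') else 0"
  \<comment> \<open>Duality moves the steps from the observable onto \<open>\<rho>\<close>, so the
    static part is the mean flux in the state that reaches step \<open>j\<close>.\<close>
  have tr: "mtrace (R 0 * P (t *\<^sub>R axis k 1)) = mtrace (Lseq usj (t *\<^sub>R axis k 1) \<rho> * Phi S j (if j = k then t else 0))" for t
    unfolding R0 P_def axis_nth by (rule dual_Lseq[symmetric]) auto
  have const: "Lseq usj (t *\<^sub>R axis k 1) \<rho> = \<rho>" if "k \<notin> set usj" for t
    unfolding Lseq_axis[OF that] by (rule Lseq_rp) simp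
  have "((\<lambda>t. mtrace (R 0 * P (t *\<^sub>R axis k 1))) has_vector_derivative (?A + ?B)) (at 0)"
  proof (cases "j = k")
    case True
    \<comment> \<open>No step before \<open>j\<close> is perturbed; only the flux observable itself
      moves.\<close>
    then have nu: "k \<notin> set usj" using dist j by auto
    show ?thesis unfolding tr const[OF nu] using Phi_diag_derivative[of j] nu True by simp
  next
    case jk: False
    show ?thesis
    proof (cases "k \<in> set usj")
      case True
      \<comment> \<open>A perturbation earlier in the same cycle reaches \<open>j\<close> without a
        full turn: this is the origin of the delta term.\<close>
      have nm: "k \<notin> set m" using dist j m[OF True] by auto
      have "mder d (\<lambda>t. Lseq usj (t *\<^sub>R axis k 1) \<rho> * Phi S j 0) (Lseq m 0 (response k) * Phi S j 0)"
        by (subst m[OF True]) (rule mder_linop[OF linop_mult_right[OF Phi_carrier] Lseq_mder[OF nk(1) nm]])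
      from mder_mtrace[OF this]
      have "((\<lambda>t. mtrace (R 0 * P (t *\<^sub>R axis k 1))) has_vector_derivative mtrace (Lseq m 0 (response k) * Phi S j 0)) (at 0)"
        unfolding tr using jk by simp
      also have "mtrace (Lseq m 0 (response k) * Phi S j 0) = mtrace (response k * Dseq m 0 (Phi S j 0))"
        by (rule dual_Lseq) auto
      also have "\<dots> = ?A + ?B"
        unfolding mtrace_response[OF Dseq_carrier[OF Phi_carrier]] using True jk by simp
      finally show ?thesis .
    next
      case False
      \<comment> \<open>Here \<open>k\<close> comes after \<open>j\<close>, so the state that
        reaches step \<open>j\<close> and its flux stay constant.\<close>
      show ?thesis unfolding tr const[OF False] using False jk by (simp add: has_vector_derivative_const)
    qed
  qed
  from linear_response[OF P G this]
  have "(\<lambda>n. mtrace ((Lseq xs 0 ^^ n) (Lseq vs 0 (response k)) * P 0)) sums (pd k (\<lambda>\<zeta>. mtrace (R \<zeta> * P \<zeta>)) 0 - (?A + ?B))" .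
  also have "(\<lambda>n. mtrace ((Lseq xs 0 ^^ n) (Lseq vs 0 (response k)) * P 0))
    = (\<lambda>n. complex_of_real (Ttot S) * mtrace (\<rho> * (Dseq vs 0 ((Dseq xs 0 ^^ n) (Dseq usj 0 (Phi S j 0))) * Phirev S k 0)))"
  proof
    fix n
    have P0: "P 0 = Dseq usj 0 (Phi S j 0)" by (simp add: P_def)
    have c: "(Dseq xs 0 ^^ n) (P 0) \<in> carrier_mat d d"
      unfolding P0 by (rule linop_carrier[OF linop_funpow[OF linop_Dseq]]) simp
    have "mtrace ((Lseq xs 0 ^^ n) (Lseq vs 0 (response k)) * P 0) = mtrace (Lseq vs 0 (response k) * (Dseq xs 0 ^^ n) (P 0))"
      by (rule dual_funpow[OF channel_Lseq linop_Dseq dual_Lseq]) (auto simp: P0)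
    also have "\<dots> = mtrace (response k * Dseq vs 0 ((Dseq xs 0 ^^ n) (P 0)))"
      by (rule dual_Lseq[OF response_carrier c])
    also have "\<dots> = complex_of_real (Ttot S) * mtrace (\<rho> * (Dseq vs 0 ((Dseq xs 0 ^^ n) (P 0)) * Phirev S k 0))"
      by (rule mtrace_response[OF Dseq_carrier[OF c]])
    finally show "mtrace ((Lseq xs 0 ^^ n) (Lseq vs 0 (response k)) * P 0)
      = complex_of_real (Ttot S) * mtrace (\<rho> * (Dseq vs 0 ((Dseq xs 0 ^^ n) (Dseq usj 0 (Phi S j 0))) * Phirev S k 0))"
      unfolding P0 .
  qed
  finally show ?thesis unfolding P_def by (simp only: diff_diff_eq)
qed

lemma average_kinetic:
  assumes fam: "channel_family d (Lra S)"
  shows "(\<lambda>n. complex_of_real (Ttot S / real CARD('m)) * mtrace (\<rho> * ((Lra_dual S 0 ^^ n) (Phi S j 0) * Phirev S k 0)))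
    sums (pd k (\<lambda>\<zeta>. mtrace (inv_state d (Lra S \<zeta>) * Phi S j (vec_nth \<zeta> j))) 0
      - (if j = k then (1/2) * mtrace (\<rho> * Dissip S j 0 H' H') else 0))"
proof -
  interpret channel_family d "Lra S" by (rule fam)
  let ?c = "complex_of_real (1 / real CARD('m))"
  have R0: "R 0 = \<rho>" by (rule R_unique[OF rpc rp_trace Lra_rp]) simp
  have G: "mder d (\<lambda>t. Lra S (t *\<^sub>R axis k 1) (R 0)) (?c \<cdot>\<^sub>m response k)"
    unfolding R0 by (rule Lra_mder)
  let ?B = "if j = k then (1/2) * mtrace (\<rho> * Dissip S j 0 H' H') else 0"
  have "((\<lambda>t. mtrace (R 0 * Phi S j (vec_nth (t *\<^sub>R axis k 1) j))) has_vector_derivative ?B) (at 0)"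
    unfolding R0 axis_nth using Phi_diag_derivative[of j]
    by (cases "j = k") (simp_all add: has_vector_derivative_const)
  from linear_response[OF Phi_smat G this]
  have "(\<lambda>n. mtrace ((Lra S 0 ^^ n) (?c \<cdot>\<^sub>m response k) * Phi S j 0)) sums
    (pd k (\<lambda>\<zeta>. mtrace (R \<zeta> * Phi S j (vec_nth \<zeta> j))) 0 - ?B)" by simp
  also have "(\<lambda>n. mtrace ((Lra S 0 ^^ n) (?c \<cdot>\<^sub>m response k) * Phi S j 0))
    = (\<lambda>n. complex_of_real (Ttot S / real CARD('m)) * mtrace (\<rho> * ((Lra_dual S 0 ^^ n) (Phi S j 0) * Phirev S k 0)))"
  proof
    fix n
    have c: "(Lra_dual S 0 ^^ n) (Phi S j 0) \<in> carrier_mat d d"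
      by (rule linop_carrier[OF linop_funpow[OF linop_Lra_dual]]) simp
    have "mtrace ((Lra S 0 ^^ n) (?c \<cdot>\<^sub>m response k) * Phi S j 0) = mtrace ((?c \<cdot>\<^sub>m response k) * (Lra_dual S 0 ^^ n) (Phi S j 0))"
      by (rule dual_funpow[OF channel_Lra linop_Lra_dual dual_Lra]) auto
    also have "(?c \<cdot>\<^sub>m response k) * (Lra_dual S 0 ^^ n) (Phi S j 0) = ?c \<cdot>\<^sub>m (response k * (Lra_dual S 0 ^^ n) (Phi S j 0))"
      by (rule mult_smult_assoc_mat[OF response_carrier c])
    also have "mtrace \<dots> = ?c * mtrace (response k * (Lra_dual S 0 ^^ n) (Phi S j 0))"
      by (rule mtrace_smult[OF mult_carrier_sq[OF response_carrier c]])
    also have "\<dots> = complex_of_real (Ttot S / real CARD('m)) * mtrace (\<rho> * ((Lra_dual S 0 ^^ n) (Phi S j 0) * Phirev S k 0))"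
      unfolding mtrace_response[OF c] by simp
    finally show "mtrace ((Lra S 0 ^^ n) (?c \<cdot>\<^sub>m response k) * Phi S j 0)
      = complex_of_real (Ttot S / real CARD('m)) * mtrace (\<rho> * ((Lra_dual S 0 ^^ n) (Phi S j 0) * Phirev S k 0))" .
  qed
  finally show ?thesis .
qed

end

text \<open>Faithfulness of \<open>\<rho>\<close> has to be earned: it is fixed by all powers of a
  mixing channel and has trace 1, so it lies above \<open>\<epsilon>\<close> times the identity and
  has a Hermitian logarithm.\<close>

lemma effective_hamiltonian:
  assumes L: "channel d L" and mix: "mixing d L" and stationary: "L \<rho> = \<rho>"
  defines "H' \<equiv> complex_of_real (- 1 / bref S) \<cdot>\<^sub>m mlog d \<rho>"
  shows "herm d H'" "mexp (complex_of_real (- bref S) \<cdot>\<^sub>m H') = \<rho>"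
proof -
  obtain n \<epsilon> where e: "\<epsilon> > 0" and
    E: "\<And>A. psd d A \<Longrightarrow> psd d ((L ^^ n) A - complex_of_real (\<epsilon> * Re (mtrace A)) \<cdot>\<^sub>m 1\<^sub>m d)"
    using mix unfolding mixing_def by blast
  have "(L ^^ n) \<rho> = \<rho>" by (induction n) (auto simp: stationary)
  then have "psd d (\<rho> - complex_of_real \<epsilon> \<cdot>\<^sub>m 1\<^sub>m d)"
    using E[OF rp_psd[of 0]] by (simp add: rp_trace)
  then obtain X where X: "herm d X" "mexp X = \<rho>"
    using positive_definite_log[OF psdD(1)[OF rp_psd[of 0]] _ e] by blast
  have log: "mlog d \<rho> = X" using mlog_mexp[OF X(1)] unfolding X(2) .
  show "herm d H'" unfolding H'_def log by (rule herm_smult[OF X(1)])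
  have "complex_of_real (- bref S) \<cdot>\<^sub>m H' = X"
    unfolding H'_def log using bref_pos by (auto intro!: eq_matI)
  then show "mexp (complex_of_real (- bref S) \<cdot>\<^sub>m H') = \<rho>" using X(2) by simp
qed

end

section \<open>Time reversal and reciprocity\<close>

text \<open>Both factors under the partial trace are Hermitian; the adjoint exchanges them and
  partial cyclicity restores their order.\<close>

lemma adj_energy_gain:
  assumes "U \<in> carrier_mat (d*e) (d*e)" "herm e \<sigma>" "herm e H"
  shows "adj (energy_gain d e U \<sigma> H) = energy_gain d e U \<sigma> H"
proof -
  let ?n = "d*e" let ?S = "kron (1\<^sub>m d) \<sigma>" let ?B = "kron (1\<^sub>m d) H"
  let ?D = "adj U * ?B * U - ?B"
  note s = hermD[OF assms(2)] note h = hermD[OF assms(3)]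
  have B: "herm ?n ?B" by (rule herm_kron[OF herm_one assms(3)])
  have Sc: "?S \<in> carrier_mat ?n ?n" "adj ?S = ?S" using hermD[OF herm_kron[OF herm_one assms(2)]] by auto
  have "herm ?n (adj U * ?B * adj (adj U))" by (rule herm_conj[OF B adj_carrier[OF assms(1)]])
  then have D: "herm ?n ?D" unfolding adj_adj[OF assms(1)] by (rule herm_minus[OF _ B])
  note Dc = hermD[OF D]
  have "adj (energy_gain d e U \<sigma> H) = ptr2 d e (adj (?S * ?D))"
    unfolding energy_gain_def by (rule adj_ptr2[OF mult_carrier_sq[OF Sc(1) Dc(1)]])
  also have "adj (?S * ?D) = ?D * ?S" unfolding adj_mult[OF Sc(1) Dc(1)] Sc(2) Dc(2) ..
  also have "ptr2 d e (?D * ?S) = ptr2 d e (?S * ?D)" by (rule ptr2_comm[OF s(1) Dc(1), symmetric])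
  finally show ?thesis unfolding energy_gain_def .
qed

lemma adj_dchan:
  assumes "U \<in> carrier_mat (d*e) (d*e)" "herm e \<sigma>" "X \<in> carrier_mat d d"
  shows "adj (dchan d e U \<sigma> X) = dchan d e U \<sigma> (adj X)"
proof -
  let ?n = "d*e" let ?S = "kron (1\<^sub>m d) \<sigma>" let ?X = "kron X (1\<^sub>m e)" let ?Y = "kron (adj X) (1\<^sub>m e)"
  note s = hermD[OF assms(2)]
  have c: "?S \<in> carrier_mat ?n ?n" "?X \<in> carrier_mat ?n ?n" "?Y \<in> carrier_mat ?n ?n" using s assms(3) by auto
  have Sa: "adj ?S = ?S" using hermD[OF herm_kron[OF herm_one assms(2)]] by auto
  have Xa: "adj ?X = ?Y" using adj_kron[OF assms(3) one_carrier_mat] by simp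
  have V: "adj U * ?Y * U \<in> carrier_mat ?n ?n" using c assms(1) by simp
  have "adj (dchan d e U \<sigma> X) = ptr2 d e (adj (?S * adj U * ?X * U))"
    unfolding dchan_def using c assms(1) by (intro adj_ptr2) simp
  also have "adj (?S * adj U * ?X * U) = (adj U * ?Y * U) * ?S"
    using c assms(1) by (simp add: adj_mult[of _ ?n ?n _ ?n] Sa Xa assoc_mult_mat[of _ ?n ?n _ ?n _ ?n])
  also have "ptr2 d e ((adj U * ?Y * U) * ?S) = ptr2 d e (?S * (adj U * ?Y * U))"
    by (rule ptr2_comm[OF s(1) V, symmetric])
  also have "?S * (adj U * ?Y * U) = ?S * adj U * ?Y * U"
    using c assms(1) by (simp add: assoc_mult_mat[of _ ?n ?n _ ?n _ ?n])
  finally show ?thesis unfolding dchan_def .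
qed

lemma anti_commutes_time_rev:
  assumes "unitary n \<Theta>" "A \<in> carrier_mat n n" "anti_commutes \<Theta> A"
  shows "time_rev \<Theta> A = A"
proof -
  note t = unitaryD[OF assms(1)]
  have "time_rev \<Theta> A = A * \<Theta> * adj \<Theta>"
    using assms(3) unfolding time_rev_def anti_commutes_def by (rule arg_cong)
  also have "\<dots> = A * (\<Theta> * adj \<Theta>)" by (rule assoc_mult_mat[OF assms(2) t(1) adj_carrier[OF t(1)]])
  finally show ?thesis unfolding t(3) using assms(2) by simp
qed

lemma (in collision_model) adj_Ldual: "X \<in> carrier_mat d d \<Longrightarrow> adj (Ldual S j z X) = Ldual S j z (adj X)"
  unfolding Ldual_eq by (rule adj_dchan[OF Uc psdD(1)[OF rhoE_psd]])

lemma (in collision_model) adj_Phi: "adj (Phi S j z) = Phi S j z" and adj_Phirev: "adj (Phirev S j z) = Phirev S j z"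
proof -
  have c: "energy_gain d (e j) V (rhoE S j z) (HE S j) \<in> carrier_mat d d" for V by (simp add: energy_gain_def)
  show "adj (Phi S j z) = Phi S j z"
    unfolding Phi_eq adj_smult[OF c] adj_energy_gain[OF Uc psdD(1)[OF rhoE_psd] herms(2)] by simp
  show "adj (Phirev S j z) = Phirev S j z"
    unfolding Phirev_eq adj_smult[OF c] adj_energy_gain[OF adj_carrier[OF Uc] psdD(1)[OF rhoE_psd] herms(2)] by simp
qed

locale time_reversal_model = equilibrium_model S rp for S :: "('m::{finite,linorder}) qsys" and rp +
  fixes \<Theta> :: "complex mat" and \<Theta>E :: "'m \<Rightarrow> complex mat"
  assumes T: "antiunitary_involution d \<Theta>" and THS: "anti_commutes \<Theta> (HS S)"
    and TE: "antiunitary_involution (e j) (\<Theta>E j)" and THE: "anti_commutes (\<Theta>E j) (HE S j)"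
    and TV: "anti_commutes (kron \<Theta> (\<Theta>E j)) (Vint S j)"
begin

lemma Tu: "unitary d \<Theta>" "unitary (e j) (\<Theta>E j)" "unitary (d * e j) (kron \<Theta> (\<Theta>E j))"
  using T TE[of j] unitary_kron[of d \<Theta> "e j" "\<Theta>E j"] by (auto simp: antiunitary_involution_def)

lemmas Tc = unitaryD(1)[OF Tu(1)] unitaryD(1)[OF Tu(2)] unitaryD(1)[OF Tu(3)]

lemma time_rev_HE: "time_rev (\<Theta>E j) (HE S j) = HE S j"
  by (rule anti_commutes_time_rev[OF Tu(2) HEc THE])

lemma time_rev_Hj: "time_rev (kron \<Theta> (\<Theta>E j)) (Hj S j) = Hj S j"
proof -
  note c = hermD(1)[OF herms(1)] hermD(1)[OF herms(3), of j]
  have "time_rev \<Theta> (HS S) = HS S" by (rule anti_commutes_time_rev[OF Tu(1) c(1) THS])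
  moreover have "time_rev (kron \<Theta> (\<Theta>E j)) (Vint S j) = Vint S j" by (rule anti_commutes_time_rev[OF Tu(3) c(2) TV])
  ultimately show ?thesis unfolding Hj_def using c Tc
    by (simp add: time_rev_add[of _ "d * e j"] time_rev_kron[of _ d _ "e j"] time_rev_one[OF Tu(1)] time_rev_one[OF Tu(2)] time_rev_HE)
qed

lemma time_rev_U: "time_rev (kron \<Theta> (\<Theta>E j)) (Uj S j) = adj (Uj S j)"
proof -
  let ?c = "- \<i> * complex_of_real (tau S j)"
  have "time_rev (kron \<Theta> (\<Theta>E j)) (Uj S j) = mexp (cnj ?c \<cdot>\<^sub>m time_rev (kron \<Theta> (\<Theta>E j)) (Hj S j))"
    unfolding time_rev_def Uj_def by (rule mexp_antiunitary[OF Tu(3) herm_Hj])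
  then show ?thesis unfolding time_rev_Hj Uj_def mexp_adj[OF herm_Hj] .
qed

lemma time_rev_rhoE: "time_rev (\<Theta>E j) (rhoE S j z) = rhoE S j z"
  unfolding rhoE_def time_rev_def
  by (rule gibbs_antiunitary[OF Tu(2) herms(2) time_rev_HE[unfolded time_rev_def]])

lemmas rev_step = unitary_U T TE time_rev_U

lemma time_rev_Phi: "time_rev \<Theta> (Phi S j z) = (-1) \<cdot>\<^sub>m Phirev S j z"
proof -
  have c: "energy_gain d (e j) V (rhoE S j z) (HE S j) \<in> carrier_mat d d" for V by (simp add: energy_gain_def)
  have "time_rev \<Theta> (Phi S j z) = complex_of_real (- 1 / Ttot S) \<cdot>\<^sub>m energy_gain d (e j) (adj (Uj S j)) (rhoE S j z) (HE S j)"
    unfolding Phi_eq time_rev_smult[OF Tc(1) c] complex_cnj_complex_of_real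
      time_rev_energy_gain[OF rev_step rhoEc HEc time_rev_rhoE time_rev_HE] ..
  also have "\<dots> = (-1) \<cdot>\<^sub>m Phirev S j z"
    unfolding Phirev_eq by (rule eq_matI) auto
  finally show ?thesis .
qed

lemma time_rev_Phirev: "time_rev \<Theta> (Phirev S j z) = (-1) \<cdot>\<^sub>m Phi S j z"
proof -
  have "Phi S j z = time_rev \<Theta> (time_rev \<Theta> (Phi S j z))" by (rule time_rev_involution[OF T Phi_carrier, symmetric])
  also have "\<dots> = (-1) \<cdot>\<^sub>m time_rev \<Theta> (Phirev S j z)"
    unfolding time_rev_Phi time_rev_smult[OF Tc(1) Phirev_carrier] by simp
  finally have P: "Phi S j z = (-1) \<cdot>\<^sub>m time_rev \<Theta> (Phirev S j z)" .
  show ?thesis unfolding P by (rule eq_matI) auto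
qed

text \<open>Time reversal of the invariance equation exchanges \<open>U\<close> and
  \<open>adj U\<close>. As \<open>U\<close> is unitary, the resulting equation is again invariance
  under \<open>U\<close>, now of the reversed state.\<close>

lemma Lch_time_rev_rho: "Lch S j 0 (time_rev \<Theta> \<rho>) = time_rev \<Theta> \<rho>"
proof -
  let ?n = "d * e j" let ?W = "kron \<Theta> (\<Theta>E j)" let ?s = "rhoE S j 0"
  let ?k = "kron (time_rev \<Theta> \<rho>) ?s"
  note u = unitaryD[OF unitary_U[of j]]
  have w: "kron \<rho> ?s \<in> carrier_mat ?n ?n" and k: "?k \<in> carrier_mat ?n ?n" using Tc(1) by auto
  have tw: "time_rev ?W (kron \<rho> ?s) = ?k"
    unfolding time_rev_kron[OF Tc(1) Tc(2) rpc rhoEc] time_rev_rhoE ..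
  have tua: "time_rev ?W (adj (Uj S j)) = Uj S j"
    unfolding time_rev_adj[OF Tc(3) Uc] time_rev_U by (rule adj_adj[OF Uc])
  have "time_rev ?W (Uj S j * kron \<rho> ?s * adj (Uj S j)) = adj (Uj S j) * ?k * Uj S j"
    unfolding time_rev_mult[OF Tu(3) mult_carrier_sq[OF Uc w] adj_carrier[OF Uc]] time_rev_mult[OF Tu(3) Uc w]
      tw tua time_rev_U ..
  then have inv': "adj (Uj S j) * ?k * Uj S j = ?k" unfolding rp_inv tw by simp
  have "Uj S j * ?k * adj (Uj S j) = Uj S j * (adj (Uj S j) * ?k * Uj S j) * adj (Uj S j)" unfolding inv' ..
  also have "\<dots> = ?k"
    using k u by (simp add: assoc_mult_mat[of _ ?n ?n _ ?n _ ?n] unitary_cancel[OF unitary_U])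
  finally have inv: "Uj S j * ?k * adj (Uj S j) = ?k" .
  show ?thesis unfolding Lch_eq
    by (rule chan_invariant[OF unitary_U rhoEc rhoE_trace time_rev_carrier[OF Tc(1) rpc] HEc rhoE_comm inv])
qed

text \<open>(TRI) speaks of the Hamiltonians and not of \<open>\<rho>\<close>. The reversed state is
  fixed by every step, hence by \<open>L\<close>, and a mixing channel has one invariant state. The
  hypothesis \<open>fixed\<close> lets the lemma serve both schemes.\<close>

lemma time_rev_rho:
  assumes L: "channel d L" "mixing d L" and fixed: "\<And>X. X \<in> carrier_mat d d \<Longrightarrow> (\<And>j. Lch S j 0 X = X) \<Longrightarrow> L X = X"
  shows "time_rev \<Theta> \<rho> = \<rho>"
proof -
  have c: "time_rev \<Theta> \<rho> \<in> carrier_mat d d" using Tc(1) by simp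
  have "mtrace (time_rev \<Theta> \<rho>) = 1" unfolding time_rev_mtrace[OF Tu(1) rpc] rp_trace by simp
  from invariant_unique[OF L(1) dims(1) L(2) c this fixed[OF c Lch_time_rev_rho]]
    invariant_unique[OF L(1) dims(1) L(2) rpc rp_trace fixed[OF rpc Lch_rp]]
  show ?thesis by simp
qed

text \<open>For the bilinear form \<open>mtrace (\<rho> * X * Y)\<close> the transpose of
  \<open>A\<close> is the time reversal of \<open>A'\<close>. Dual steps are their own partners, and
  composition reverses the order.\<close>

definition rev_pair :: "(complex mat \<Rightarrow> complex mat) \<Rightarrow> (complex mat \<Rightarrow> complex mat) \<Rightarrow> bool" where
  "rev_pair A A' \<longleftrightarrow> (\<forall>X\<in>carrier_mat d d. \<forall>Y\<in>carrier_mat d d.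
     mtrace (\<rho> * A X * Y) = mtrace (\<rho> * X * time_rev \<Theta> (A' (time_rev \<Theta> Y))))"

lemma rev_pairD:
  "rev_pair A A' \<Longrightarrow> X \<in> carrier_mat d d \<Longrightarrow> Y \<in> carrier_mat d d \<Longrightarrow>
     mtrace (\<rho> * A X * Y) = mtrace (\<rho> * X * time_rev \<Theta> (A' (time_rev \<Theta> Y)))"
  unfolding rev_pair_def by blast

lemma rev_pair_id: "rev_pair (\<lambda>X. X) (\<lambda>X. X)"
  unfolding rev_pair_def using time_rev_involution[OF T] by simp

lemma rev_pair_comp:
  assumes "linop d B" "linop d A'" "rev_pair A A'" "rev_pair B B'"
  shows "rev_pair (\<lambda>X. A (B X)) (\<lambda>X. B' (A' X))"
  unfolding rev_pair_def
proof (intro ballI)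
  fix X Y :: "complex mat" assume X: "X \<in> carrier_mat d d" and Y: "Y \<in> carrier_mat d d"
  have AY: "A' (time_rev \<Theta> Y) \<in> carrier_mat d d"
    by (rule linop_carrier[OF assms(2) time_rev_carrier[OF Tc(1) Y]])
  show "mtrace (\<rho> * A (B X) * Y) = mtrace (\<rho> * X * time_rev \<Theta> (B' (A' (time_rev \<Theta> Y))))"
    unfolding rev_pairD[OF assms(3) linop_carrier[OF assms(1) X] Y]
      rev_pairD[OF assms(4) X time_rev_carrier[OF Tc(1) AY]] time_rev_involution[OF T AY] ..
qed

lemma rev_pair_Ldual: "rev_pair (Ldual S j 0) (Ldual S j 0)"
  unfolding rev_pair_def Ldual_eq
proof (intro ballI)
  fix X Y :: "complex mat" assume X: "X \<in> carrier_mat d d" and Y: "Y \<in> carrier_mat d d"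
  show "mtrace (\<rho> * dchan d (e j) (Uj S j) (rhoE S j 0) X * Y)
    = mtrace (\<rho> * X * time_rev \<Theta> (dchan d (e j) (Uj S j) (rhoE S j 0) (time_rev \<Theta> Y)))"
    unfolding dchan_reversed[OF step_inv X Y] time_rev_dchan[OF rev_step rhoEc Y time_rev_rhoE] ..
qed

lemma rev_pair_Dseq: "rev_pair (Dseq xs 0) (Dseq (rev xs) 0)"
proof (induction xs)
  case Nil
  have "Dseq [] 0 = (\<lambda>X. X)" by (rule ext) simp
  then show ?case using rev_pair_id by simp
next
  case (Cons x xs)
  have "rev_pair (\<lambda>X. Ldual S x 0 (Dseq xs 0 X)) (\<lambda>X. Dseq (rev xs) 0 (Ldual S x 0 X))"
    by (rule rev_pair_comp[OF linop_Dseq linop_Ldual rev_pair_Ldual Cons])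
  moreover have "Dseq (x # xs) 0 = (\<lambda>X. Ldual S x 0 (Dseq xs 0 X))" by (rule ext) simp
  moreover have "Dseq (rev (x # xs)) 0 = (\<lambda>X. Dseq (rev xs) 0 (Ldual S x 0 X))" by (rule ext) simp
  ultimately show ?case by (simp only:)
qed

lemma rev_pair_funpow:
  assumes "linop d A" "linop d A'" "rev_pair A A'"
  shows "rev_pair (A ^^ n) (A' ^^ n)"
proof (induction n)
  case 0
  show ?case unfolding funpow.simps id_def by (rule rev_pair_id)
next
  case (Suc n)
  have "rev_pair (\<lambda>X. A ((A ^^ n) X)) (\<lambda>X. (A' ^^ n) (A' X))"
    by (rule rev_pair_comp[OF linop_funpow[OF assms(1)] assms(2) assms(3) Suc])
  moreover have "A ^^ Suc n = (\<lambda>X. A ((A ^^ n) X))" by (simp only: funpow.simps comp_def)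
  moreover have "A' ^^ Suc n = (\<lambda>X. (A' ^^ n) (A' X))" by (simp only: funpow_Suc_right comp_def)
  ultimately show ?case by (simp only:)
qed

text \<open>An average has no order to be reversed, so the random scheme is its own partner.\<close>

lemma rev_pair_Lra_dual: "rev_pair (Lra_dual S 0) (Lra_dual S 0)"
proof -
  have sum: "rev_pair (\<lambda>X. msum d (\<lambda>j. Ldual S j 0 X) xs) (\<lambda>X. msum d (\<lambda>j. Ldual S j 0 X) xs)" for xs :: "'m list"
  proof (induction xs rule: rev_induct)
    case Nil
    have "time_rev \<Theta> (0\<^sub>m d d) = 0\<^sub>m d d"
    proof -
      have "time_rev \<Theta> (0\<^sub>m d d - 0\<^sub>m d d) = time_rev \<Theta> (0\<^sub>m d d) - time_rev \<Theta> (0\<^sub>m d d)"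
        by (rule time_rev_minus[OF Tc(1)]) auto
      also have "\<dots> = 0\<^sub>m d d" by (rule minus_r_inv_mat[OF time_rev_carrier[OF Tc(1) zero_carrier_mat]])
      finally show ?thesis by (simp add: minus_r_inv_mat[of _ d d])
    qed
    then show ?case unfolding rev_pair_def msum_Nil
      by (auto simp: left_mult_zero_mat[of _ d d] right_mult_zero_mat[OF rpc] right_mult_zero_mat[OF mult_carrier_sq[OF rpc]] carrier_matD[OF rpc])
  next
    case (snoc x xs)
    show ?case unfolding rev_pair_def
    proof (intro ballI)
      fix X Y :: "complex mat" assume X: "X \<in> carrier_mat d d" and Y: "Y \<in> carrier_mat d d"
      have TY: "time_rev \<Theta> Y \<in> carrier_mat d d" using Tc(1) Y by simp
      let ?M = "\<lambda>X. msum d (\<lambda>j. Ldual S j 0 X) xs"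
      have M: "?M Z \<in> carrier_mat d d" if "Z \<in> carrier_mat d d" for Z using that by (intro msum_carrier) auto
      have L: "Ldual S x 0 Z \<in> carrier_mat d d" if "Z \<in> carrier_mat d d" for Z using that by simp
      have "\<rho> * (?M X + Ldual S x 0 X) * Y = \<rho> * ?M X * Y + \<rho> * Ldual S x 0 X * Y"
        using M[OF X] L[OF X] Y by (simp add: mult_add_distrib_mat[of _ d d _ d] add_mult_distrib_mat[of _ d d _ _ d])
      then have "mtrace (\<rho> * (?M X + Ldual S x 0 X) * Y) = mtrace (\<rho> * ?M X * Y) + mtrace (\<rho> * Ldual S x 0 X * Y)"
        using M[OF X] L[OF X] Y by (simp add: mtrace_add[of _ d])
      also have "\<dots> = mtrace (\<rho> * X * time_rev \<Theta> (?M (time_rev \<Theta> Y))) + mtrace (\<rho> * X * time_rev \<Theta> (Ldual S x 0 (time_rev \<Theta> Y)))"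
        unfolding rev_pairD[OF snoc X Y] rev_pairD[OF rev_pair_Ldual X Y] ..
      also have "\<dots> = mtrace (\<rho> * X * time_rev \<Theta> (?M (time_rev \<Theta> Y) + Ldual S x 0 (time_rev \<Theta> Y)))"
        unfolding time_rev_add[OF Tc(1) M[OF TY] L[OF TY]]
        using X M[OF TY] L[OF TY] Tc(1) by (simp add: mult_add_distrib_mat[of _ d d _ d] mtrace_add[of _ d])
      finally show "mtrace (\<rho> * msum d (\<lambda>j. Ldual S j 0 X) (xs @ [x]) * Y)
        = mtrace (\<rho> * X * time_rev \<Theta> (msum d (\<lambda>j. Ldual S j 0 (time_rev \<Theta> Y)) (xs @ [x])))"
        unfolding msum_snoc .
    qed
  qed
  show ?thesis unfolding rev_pair_def
  proof (intro ballI)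
    fix X Y :: "complex mat" assume X: "X \<in> carrier_mat d d" and Y: "Y \<in> carrier_mat d d"
    let ?c = "complex_of_real (1 / real CARD('m))"
    let ?M = "\<lambda>X. msum d (\<lambda>j. Ldual S j 0 X) (idx :: 'm list)"
    have M: "?M Z \<in> carrier_mat d d" if "Z \<in> carrier_mat d d" for Z using that by (intro msum_carrier) auto
    have TY: "time_rev \<Theta> Y \<in> carrier_mat d d" using Tc(1) Y by simp
    have "mtrace (\<rho> * (?c \<cdot>\<^sub>m ?M X) * Y) = ?c * mtrace (\<rho> * ?M X * Y)"
      unfolding mult_smult_distrib[OF rpc M[OF X]] mult_smult_assoc_mat[OF mult_carrier_sq[OF rpc M[OF X]] Y]
      by (rule mtrace_smult[OF mult_carrier_sq[OF mult_carrier_sq[OF rpc M[OF X]] Y]])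
    also have "\<dots> = ?c * mtrace (\<rho> * X * time_rev \<Theta> (?M (time_rev \<Theta> Y)))"
      unfolding rev_pairD[OF sum X Y] ..
    also have "\<dots> = mtrace (\<rho> * X * (?c \<cdot>\<^sub>m time_rev \<Theta> (?M (time_rev \<Theta> Y))))"
      unfolding mult_smult_distrib[OF mult_carrier_sq[OF rpc X] time_rev_carrier[OF Tc(1) M[OF TY]]]
      by (rule mtrace_smult[symmetric, OF mult_carrier_sq[OF mult_carrier_sq[OF rpc X] time_rev_carrier[OF Tc(1) M[OF TY]]]])
    also have "?c \<cdot>\<^sub>m time_rev \<Theta> (?M (time_rev \<Theta> Y)) = time_rev \<Theta> (?c \<cdot>\<^sub>m ?M (time_rev \<Theta> Y))"
      unfolding time_rev_smult[OF Tc(1) M[OF TY]] complex_cnj_complex_of_real ..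
    finally show "mtrace (\<rho> * Lra_dual S 0 X * Y) = mtrace (\<rho> * X * time_rev \<Theta> (Lra_dual S 0 (time_rev \<Theta> Y)))"
      unfolding Lra_dual_def zero_index .
  qed
qed

text \<open>Time reversal exchanges \<open>\<Phi>\<close> and \<open>- \<Phi>rev\<close>, and the trace with it is conjugated.\<close>
lemma reciprocity:
  assumes rho: "time_rev \<Theta> \<rho> = \<rho>" and A': "linop d A'" and pair: "rev_pair A A'"
    and A: "linop d A" and adjA: "\<And>X. X \<in> carrier_mat d d \<Longrightarrow> adj (A' X) = A' (adj X)"
  shows "mtrace (\<rho> * (A (Phi S j 0) * Phirev S k 0)) = mtrace (\<rho> * (A' (Phi S k 0) * Phirev S j 0))"
proof -
  define Y where "Y = A' (Phi S k 0)"
  have Y: "Y \<in> carrier_mat d d" "adj Y = Y"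
    unfolding Y_def using linop_carrier[OF A' Phi_carrier] adjA[OF Phi_carrier] by (auto simp: adj_Phi)
  let ?F = "Phirev S j 0"
  have F: "Phi S j 0 = (-1) \<cdot>\<^sub>m time_rev \<Theta> ?F"
    unfolding time_rev_Phirev by (rule eq_matI) auto
  have tF: "time_rev \<Theta> ?F \<in> carrier_mat d d" "time_rev \<Theta> Y \<in> carrier_mat d d" using Tc(1) Y(1) by auto
  have AP: "A (Phi S j 0) \<in> carrier_mat d d" by (rule linop_carrier[OF A Phi_carrier])
  have "mtrace (\<rho> * (A (Phi S j 0) * Phirev S k 0)) = mtrace (\<rho> * A (Phi S j 0) * Phirev S k 0)"
    unfolding assoc_mult_mat[OF rpc AP Phirev_carrier] ..
  also have "\<dots> = mtrace (\<rho> * Phi S j 0 * time_rev \<Theta> (A' (time_rev \<Theta> (Phirev S k 0))))"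
    by (rule rev_pairD[OF pair Phi_carrier Phirev_carrier])
  also have "time_rev \<Theta> (A' (time_rev \<Theta> (Phirev S k 0))) = (-1) \<cdot>\<^sub>m time_rev \<Theta> Y"
    unfolding time_rev_Phirev linop_smult[OF A' Phi_carrier] Y_def[symmetric] time_rev_smult[OF Tc(1) Y(1)] by simp
  \<comment> \<open>The two signs that come from exchanging the fluxes cancel.\<close>
  also have "\<rho> * Phi S j 0 * ((-1) \<cdot>\<^sub>m time_rev \<Theta> Y) = \<rho> * time_rev \<Theta> ?F * time_rev \<Theta> Y"
  proof -
    have "\<rho> * Phi S j 0 = (-1) \<cdot>\<^sub>m (\<rho> * time_rev \<Theta> ?F)"
      unfolding F by (rule mult_smult_distrib[OF rpc tF(1)])
    then have "\<rho> * Phi S j 0 * ((-1) \<cdot>\<^sub>m time_rev \<Theta> Y)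
      = (-1) \<cdot>\<^sub>m ((-1) \<cdot>\<^sub>m (\<rho> * time_rev \<Theta> ?F * time_rev \<Theta> Y))"
      unfolding mult_smult_distrib[OF mult_carrier_sq[OF rpc Phi_carrier] tF(2)]
      by (simp only: mult_smult_assoc_mat[OF mult_carrier_sq[OF rpc tF(1)] tF(2)])
    also have "\<dots> = \<rho> * time_rev \<Theta> ?F * time_rev \<Theta> Y" by (rule eq_matI) auto
    finally show ?thesis .
  qed
  also have "\<dots> = time_rev \<Theta> (\<rho> * ?F * Y)"
    unfolding time_rev_mult[OF Tu(1) mult_carrier_sq[OF rpc Phirev_carrier] Y(1)] time_rev_mult[OF Tu(1) rpc Phirev_carrier] rho ..
  \<comment> \<open>Antilinearity leaves a complex conjugate. Passing to the adjoint removes it and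
    reverses the product, because all three factors are Hermitian.\<close>
  also have "mtrace \<dots> = cnj (mtrace (\<rho> * ?F * Y))"
    by (rule time_rev_mtrace[OF Tu(1) mult_carrier_sq[OF mult_carrier_sq[OF rpc Phirev_carrier] Y(1)]])
  also have "\<dots> = mtrace (adj (\<rho> * ?F * Y))"
    by (rule mtrace_adj[symmetric, OF mult_carrier_sq[OF mult_carrier_sq[OF rpc Phirev_carrier] Y(1)]])
  also have "adj (\<rho> * ?F * Y) = Y * (?F * \<rho>)"
    unfolding adj_mult[OF mult_carrier_sq[OF rpc Phirev_carrier] Y(1)] adj_mult[OF rpc Phirev_carrier]
      Y(2) adj_Phirev hermD(2)[OF psdD(1)[OF rp_psd]] ..
  also have "\<dots> = Y * ?F * \<rho>" by (rule assoc_mult_mat[OF Y(1) Phirev_carrier rpc, symmetric])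
  also have "mtrace \<dots> = mtrace (\<rho> * (Y * ?F))"
    by (rule mtrace_comm[OF mult_carrier_sq[OF Y(1) Phirev_carrier] rpc])
  finally show ?thesis unfolding Y_def .
qed

lemma adj_Dseq: "X \<in> carrier_mat d d \<Longrightarrow> adj (Dseq xs \<zeta> X) = Dseq xs \<zeta> (adj X)"
  by (induction xs) (auto simp: adj_Ldual)

text \<open>At infinite temperature the dual step is the time reversal of the step, and trace
  duality turns this into a pairing.\<close>

lemma reversal_pair_step: "reversal_pair d \<Theta> (Lch S j (bref S)) (Lch S j (bref S))"
  unfolding reversal_pair_def
proof (intro ballI)
  fix A B :: "complex mat" assume A: "A \<in> carrier_mat d d" and B: "B \<in> carrier_mat d d"
  have r: "rhoE S j (bref S) = complex_of_real (1 / real (e j)) \<cdot>\<^sub>m 1\<^sub>m (e j)"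
    unfolding rhoE_def using gibbs_zero[OF herms(2)] by simp
  have "Ldual S j (bref S) B = time_rev \<Theta> (Lch S j (bref S) (time_rev \<Theta> B))"
    unfolding Ldual_eq Lch_eq r by (rule time_rev_chan_infinite_temperature[OF rev_step B])
  then show "mtrace (Lch S j (bref S) A * B) = mtrace (A * time_rev \<Theta> (Lch S j (bref S) (time_rev \<Theta> B)))"
    using dual_step[OF A B] by simp
qed

text \<open>At \<open>\<zeta> = bref\<close> the environments have infinite temperature, where every step is dual to its own
  time reversal; domination carries mixing over to all other \<open>\<zeta>\<close>.\<close>
lemma mixing_reversed_order:
  assumes "\<And>\<zeta>. mixing d (Lseq xs \<zeta>)" shows "mixing d (Lseq (rev xs) \<zeta>)"
proof -
  let ?z = "(\<chi> i. bref S) :: 'm rvec"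
  have "reversal_pair d \<Theta> (Lseq (rev xs) ?z) (Lseq xs ?z)"
    unfolding Lseq_def
    by (rule reversal_pair_fold[OF T]) (auto simp: reversal_pair_step channelD(1)[OF channel_Lch])
  from mixing_reversal[OF T channel_Lseq channel_Lseq this assms]
  have "mixing d (Lseq (rev xs) ?z)" .
  then show ?thesis by (rule mixing_dominates[OF channel_Lseq channel_Lseq Lseq_dominates])
qed

end

section \<open>Cyclic and random schemes\<close>

text \<open>In a strictly increasing list the entries below \<open>j\<close> precede it and those
  above follow it, so the filters in the definitions of the fluxes cut the cycle at
  \<open>j\<close>.\<close>

lemma sorted_split:
  fixes xs :: "'a::linorder list"
  assumes "sorted_wrt (<) xs" "j \<in> set xs"
  shows "xs = filter (\<lambda>i. i < j) xs @ j # filter (\<lambda>i. j < i) xs"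
  using assms
proof (induction xs)
  case (Cons x xs)
  show ?case
  proof (cases "x = j")
    case True
    then have "filter (\<lambda>i. i < j) xs = []" "filter (\<lambda>i. j < i) xs = xs"
      using Cons.prems by (auto simp: filter_empty_conv filter_id_conv)
    then show ?thesis using True by simp
  next
    case False
    then have "x < j" "xs = filter (\<lambda>i. i < j) xs @ j # filter (\<lambda>i. j < i) xs" using Cons by auto
    then show ?thesis by simp
  qed
qed simp

context collision_model
begin

lemma idx_props: "sorted_wrt (<) (idx :: 'm list)" "distinct (idx :: 'm list)" "set (idx :: 'm list) = UNIV"
  by (simp_all add: idx_def)

lemma idx_split: "(idx :: 'm list) = filter (\<lambda>i. i < j) idx @ j # filter (\<lambda>i. j < i) idx"
  by (rule sorted_split[OF idx_props(1)]) (simp add: idx_props)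

lemma idx_split_between:
  assumes "k < j"
  shows "filter (\<lambda>i. i < j) (idx :: 'm list) = filter (\<lambda>i. i < k) idx @ k # filter (\<lambda>i. k < i \<and> i < j) idx"
proof -
  have "sorted_wrt (<) (filter (\<lambda>i. i < j) (idx :: 'm list))" using idx_props(1) by (rule sorted_wrt_filter)
  moreover have "k \<in> set (filter (\<lambda>i. i < j) (idx :: 'm list))" using assms by (simp add: idx_props)
  ultimately have "filter (\<lambda>i. i < j) (idx :: 'm list) = filter (\<lambda>i. i < k) (filter (\<lambda>i. i < j) idx)
    @ k # filter (\<lambda>i. k < i) (filter (\<lambda>i. i < j) idx)" by (rule sorted_split)
  moreover have "filter (\<lambda>i. i < k) (filter (\<lambda>i. i < j) (idx :: 'm list)) = filter (\<lambda>i. i < k) idx"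
    unfolding filter_filter using assms by (intro filter_cong) auto
  moreover have "filter (\<lambda>i. k < i) (filter (\<lambda>i. i < j) (idx :: 'm list)) = filter (\<lambda>i. k < i \<and> i < j) idx"
    unfolding filter_filter by (intro filter_cong) auto
  ultimately show ?thesis by (simp only:)
qed

lemma idx_split_between':
  assumes "j < k"
  shows "filter (\<lambda>i. j < i) (idx :: 'm list) = filter (\<lambda>i. j < i \<and> i < k) idx @ k # filter (\<lambda>i. k < i) idx"
proof -
  have "sorted_wrt (<) (filter (\<lambda>i. j < i) (idx :: 'm list))" using idx_props(1) by (rule sorted_wrt_filter)
  moreover have "k \<in> set (filter (\<lambda>i. j < i) (idx :: 'm list))" using assms by (simp add: idx_props)
  ultimately have "filter (\<lambda>i. j < i) (idx :: 'm list) = filter (\<lambda>i. i < k) (filter (\<lambda>i. j < i) idx)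
    @ k # filter (\<lambda>i. k < i) (filter (\<lambda>i. j < i) idx)" by (rule sorted_split)
  moreover have "filter (\<lambda>i. i < k) (filter (\<lambda>i. j < i) (idx :: 'm list)) = filter (\<lambda>i. j < i \<and> i < k) idx"
    unfolding filter_filter by (intro filter_cong) auto
  moreover have "filter (\<lambda>i. k < i) (filter (\<lambda>i. j < i) (idx :: 'm list)) = filter (\<lambda>i. k < i) idx"
    unfolding filter_filter using assms by (intro filter_cong) auto
  ultimately show ?thesis by (simp only:)
qed

abbreviation "before j \<equiv> filter (\<lambda>i. i < j) (idx :: 'm list)"
abbreviation "after j \<equiv> filter (\<lambda>i. j < i) (idx :: 'm list)"

lemma Lcy_eq: "Lcy S = Lseq idx" and Lrcy_eq: "Lrcy S = Lseq (rev idx)"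
  by (auto simp: Lcy_def Lrcy_def Lseq_def fun_eq_iff)

lemma Lcy_dual_eq: "Lcy_dual S = Dseq idx"
  by (auto simp: Lcy_dual_def Dseq_def fun_eq_iff)

lemma Phicy_eq: "Phicy S \<zeta> j = Dseq (before j) \<zeta> (Phi S j (vec_nth \<zeta> j))"
  and Phircy_eq: "Phircy S \<zeta> j = Dseq (rev (after j)) \<zeta> (Phi S j (vec_nth \<zeta> j))"
  by (simp_all add: Phicy_def Phircy_def Dseq_def)

lemma Dseq_zero: "foldr (\<lambda>i. Ldual S i 0) xs = Dseq xs 0"
  by (simp add: Dseq_def)

lemma ER_family:
  assumes "ER sh S"
  shows "channel_family d (Lsh sh S)"
proof
  have ch: "channel d (Lsh sh S \<zeta>)" for \<zeta>
    by (cases sh) (simp_all add: Lsh_def Lcy_eq channel_Lseq channel_Lra)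
  have dom: "dominates d (Lsh sh S \<zeta>) (Lsh sh S \<zeta>')" for \<zeta> \<zeta>'
    by (cases sh) (simp_all add: Lsh_def Lcy_eq Lseq_dominates Lra_dominates)
  obtain \<zeta>0 where "primitive d (Lsh sh S \<zeta>0)" using assms unfolding ER_def by blast
  from primitive_mixing[OF ch this] show "mixing d (Lsh sh S \<zeta>)" for \<zeta>
    by (rule mixing_dominates[OF ch ch dom])
  show "channel d (Lsh sh S \<zeta>)" for \<zeta> by (rule ch)
  show "smat d (\<lambda>\<zeta>. Lsh sh S \<zeta> (F \<zeta>))" if "smat d F" for F
    using that by (cases sh) (simp_all add: Lsh_def Lcy_eq Lseq_smat Lra_smat)
qed (rule dims)

lemma Phicy_smat: "smat d (\<lambda>\<zeta>. Phicy S \<zeta> j)"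
  unfolding Phicy_eq by (rule Dseq_smat[OF Phi_smat])

lemma Lkin_Cy_eq: "Lkin Cy S j k = pd k (\<lambda>\<zeta>. mtrace (inv_state d (Lseq idx \<zeta>) * Dseq (before j) \<zeta> (Phi S j (vec_nth \<zeta> j)))) 0"
  by (simp add: Lkin_def rho_sh_def Lsh_def Phish_def Lcy_eq Phicy_eq)

lemma Lkin_Ra_eq: "Lkin Ra S j k = pd k (\<lambda>\<zeta>. mtrace (inv_state d (Lra S \<zeta>) * Phi S j (vec_nth \<zeta> j))) 0"
  by (simp add: Lkin_def rho_sh_def Lsh_def Phish_def)

lemma Lkin_rcy_eq: "Lkin_rcy S j k = pd k (\<lambda>\<zeta>. mtrace (inv_state d (Lseq (rev idx) \<zeta>) * Dseq (rev (after j)) \<zeta> (Phi S j (vec_nth \<zeta> j)))) 0"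
  by (simp add: Lkin_rcy_def rho_rcy_def Lrcy_eq Phircy_eq)

end

context equilibrium_model
begin

abbreviation "Heff \<equiv> complex_of_real (- 1 / bref S) \<cdot>\<^sub>m mlog d \<rho>"

lemma Lsh_rp: "Lsh sh S 0 \<rho> = \<rho>"
  by (cases sh) (simp_all add: Lsh_def Lcy_eq Lseq_rp Lra_rp)

lemma Heff:
  assumes "ER sh S"
  shows "herm d Heff" "mexp (complex_of_real (- bref S) \<cdot>\<^sub>m Heff) = \<rho>"
  using effective_hamiltonian[OF channel_family.chn[OF ER_family[OF assms]] channel_family.mix[OF ER_family[OF assms]] Lsh_rp]
  by auto

lemma Cy_family: "ER Cy S \<Longrightarrow> channel_family d (Lseq idx)"
  using ER_family[of Cy] by (simp add: Lsh_def Lcy_eq)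

lemma Ra_family: "ER Ra S \<Longrightarrow> channel_family d (Lra S)"
  using ER_family[of Ra] by (simp add: Lsh_def)

lemma kinetic_Cy:
  assumes "ER Cy S"
  shows "(\<lambda>n. complex_of_real (Ttot S) * mtrace (\<rho> * (Dseq (after k) 0 ((Dseq idx 0 ^^ n) (Dseq (before j) 0 (Phi S j 0))) * Phirev S k 0)))
    sums (Lkin Cy S j k
      - (if k < j then complex_of_real (Ttot S) * mtrace (\<rho> * (Dseq (filter (\<lambda>i. k < i \<and> i < j) idx) 0 (Phi S j 0) * Phirev S k 0)) else 0)
      - (if j = k then (1/2) * mtrace (\<rho> * Dissip S j 0 Heff Heff) else 0))"
proof -
  have mem: "k \<in> set (before j) \<longleftrightarrow> k < j" by (simp add: idx_props)
  have m: "before j = before k @ k # filter (\<lambda>i. k < i \<and> i < j) idx" if "k \<in> set (before j)"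
    using that unfolding mem by (rule idx_split_between)
  show ?thesis
    using seq_kinetic[OF Heff[OF assms] Cy_family[OF assms] idx_props(2) idx_split[of k] idx_split[of j] m]
    unfolding mem Lkin_Cy_eq .
qed

lemma kinetic_Ra:
  assumes "ER Ra S"
  shows "(\<lambda>n. complex_of_real (Ttot S / real CARD('m)) * mtrace (\<rho> * ((Lra_dual S 0 ^^ n) (Phi S j 0) * Phirev S k 0)))
    sums (Lkin Ra S j k - (if j = k then (1/2) * mtrace (\<rho> * Dissip S j 0 Heff Heff) else 0))"
  unfolding Lkin_Ra_eq by (rule average_kinetic[OF Heff[OF assms] Ra_family[OF assms]])

text \<open>Rows sum to zero because the fluxes vanish in equilibrium, columns because the effective
  energy is conserved; for two environments this forces symmetry.\<close>
lemma kinetic_Cy_two: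
  assumes "ER Cy S" "CARD('m) = 2"
  shows "Lkin Cy S j k = Lkin Cy S k j"
proof -
  interpret channel_family d "Lseq idx" by (rule Cy_family[OF assms(1)])
  define f where "f j \<zeta> = mtrace (R \<zeta> * Dseq (before j) \<zeta> (Phi S j (vec_nth \<zeta> j)))" for j and \<zeta> :: "'m rvec"
  have L: "Lkin Cy S j k = pd k (f j) 0" for j k by (simp add: Lkin_Cy_eq f_def[abs_def])
  have er: "exp_rational (f j)" for j
    unfolding f_def[abs_def] by (intro exp_rational_mtrace[of d] smat_mult smat_R Dseq_smat Phi_smat)
  have row: "(\<Sum>k\<in>UNIV. pd k (f j) 0) = 0" for j
  proof -
    have "f j (\<chi> i. t) = 0" for t
    proof -
      \<comment> \<open>At equal thermal forces the invariant state is the equilibrium state at that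
        temperature.\<close>
      have R: "R (\<chi> i. t) = rp t" by (rule R_unique[OF rpc rp_trace Lseq_rp]) simp
      have "f j (\<chi> i. t) = mtrace (Lseq (before j) (\<chi> i. t) (rp t) * Phi S j t)"
        unfolding f_def R vec_lambda_beta by (rule dual_Lseq[symmetric]) auto
      also have "Lseq (before j) (\<chi> i. t) (rp t) = rp t" by (rule Lseq_rp) simp
      also have "mtrace (rp t * Phi S j t) = complex_of_real (- 1 / Ttot S) * mtrace (rp t * energy_gain d (e j) (Uj S j) (rhoE S j t) (HE S j))"
      proof -
        have c: "energy_gain d (e j) (Uj S j) (rhoE S j t) (HE S j) \<in> carrier_mat d d" by (simp add: energy_gain_def)
        show ?thesis unfolding Phi_eq mult_smult_distrib[OF rpc c] by (rule mtrace_smult[OF mult_carrier_sq[OF rpc c]])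
      qed
      finally show ?thesis unfolding mtrace_energy_gain[OF step_inv] by simp
    qed
    then have "((\<lambda>t::real. 0) has_vector_derivative (\<Sum>k\<in>UNIV. pd k (f j) 0)) (at 0)"
      using exp_rational_diagonal_derivative[OF er, of j] by simp
    then show ?thesis by (rule vector_derivative_unique_at) (rule has_vector_derivative_const)
  qed
  obtain a b where idx: "(idx :: 'm list) = [a, b]"
  proof -
    have "length (idx :: 'm list) = 2" using assms(2) by (simp add: idx_def)
    then show ?thesis using that by (auto simp: numeral_2_eq_2 length_Suc_conv)
  qed
  have ab: "a < b" using idx_props(1) unfolding idx by simp
  have U: "(UNIV :: 'm set) = {a, b}" using idx_props(3) unfolding idx by auto
  note first_law = Phi_first_law[OF Heff[OF assms(1)]]
  note Hc = H'c[OF Heff[OF assms(1)]]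
  \<comment> \<open>Each flux is the change of mean effective energy in its step, up to 1/T; over
    one cycle in the invariant state these changes telescope to 0.\<close>
  have col0: "f a \<zeta> + f b \<zeta> = 0" for \<zeta>
  proof -
    let ?T = "complex_of_real (1 / Ttot S)"
    let ?La = "Ldual S a (vec_nth \<zeta> a)" and ?Lb = "Ldual S b (vec_nth \<zeta> b)"
    have fi: "before a = []" "before b = [a]" unfolding idx using ab by auto
    have c: "?Lb Heff \<in> carrier_mat d d" "?La Heff \<in> carrier_mat d d" "?La (?Lb Heff) \<in> carrier_mat d d" using Hc by auto
    have fa: "f a \<zeta> = ?T * (mtrace (R \<zeta> * ?La Heff) - mtrace (R \<zeta> * Heff))"
      unfolding f_def fi Dseq_simps first_law mult_smult_distrib[OF R_carrier minus_carrier[OF c(2) Hc]]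
        mtrace_smult[OF mult_carrier_sq[OF R_carrier minus_carrier[OF c(2) Hc]]]
      using c Hc by (simp add: mult_minus_distrib_mat[of _ d d _ d] mtrace_minus[of _ d])
    have "?La (?T \<cdot>\<^sub>m (?Lb Heff - Heff)) = ?T \<cdot>\<^sub>m (?La (?Lb Heff) - ?La Heff)"
      unfolding linop_smult[OF linop_Ldual minus_carrier[OF c(1) Hc]] linop_minus[OF linop_Ldual c(1) Hc] ..
    then have fb: "f b \<zeta> = ?T * (mtrace (R \<zeta> * ?La (?Lb Heff)) - mtrace (R \<zeta> * ?La Heff))"
      unfolding f_def fi Dseq_simps first_law
      using mult_smult_distrib[OF R_carrier minus_carrier[OF c(3) c(2)], of \<zeta> ?T]
        mtrace_smult[OF mult_carrier_sq[OF R_carrier minus_carrier[OF c(3) c(2)]], of ?T \<zeta>] c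
      by (simp add: mult_minus_distrib_mat[of _ d d _ d] mtrace_minus[of _ d])
    have "mtrace (R \<zeta> * Dseq idx \<zeta> Heff) = mtrace (Lseq idx \<zeta> (R \<zeta>) * Heff)"
      by (rule dual_Lseq[symmetric, OF R_carrier Hc])
    then have "mtrace (R \<zeta> * ?La (?Lb Heff)) = mtrace (R \<zeta> * Heff)"
      unfolding R_fixed by (simp add: idx)
    then show ?thesis unfolding fa fb by (simp add: algebra_simps)
  qed
  have col: "pd k (f a) 0 + pd k (f b) 0 = 0" for k
  proof -
    have "((\<lambda>t. f a (t *\<^sub>R axis k 1) + f b (t *\<^sub>R axis k 1)) has_vector_derivative (pd k (f a) 0 + pd k (f b) 0)) (at 0)"
      by (intro has_vector_derivative_add exp_rational_line_derivative er)
    then show ?thesis unfolding col0 by (rule vector_derivative_unique_at) (rule has_vector_derivative_const)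
  qed
  \<comment> \<open>The row and the column of \<open>a\<close> share the diagonal entry and both sum
    to 0, so the two off-diagonal entries agree.\<close>
  have "pd a (f a) 0 + pd b (f a) 0 = 0" using row[of a] ab unfolding U by simp
  then have "pd b (f a) 0 = pd a (f b) 0" using col[of a] by (simp add: add_eq_0_iff2)
  moreover have "j \<in> {a, b}" "k \<in> {a, b}" unfolding U[symmetric] by auto
  ultimately show ?thesis unfolding L by auto
qed

end

context time_reversal_model
begin

lemma reciprocity_Ra:
  assumes "ER Ra S" shows "Lkin Ra S j k = Lkin Ra S k j"
proof -
  interpret channel_family d "Lra S" by (rule Ra_family[OF assms])
  have rho: "time_rev \<Theta> \<rho> = \<rho>"
  proof (rule time_rev_rho[OF chn mix])
    fix X :: "complex mat" assume X: "X \<in> carrier_mat d d" "\<And>j. Lch S j 0 X = X"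
    show "Lra S 0 X = X" unfolding Lra_def zero_index X(2)
    proof (rule matI[of _ d d])
      fix a b assume ab: "a < d" "b < d"
      have c: "msum d (\<lambda>j. X) (idx :: 'm list) \<in> carrier_mat d d" by (rule msum_carrier) (rule X)
      have "(\<Sum>x\<leftarrow>(idx :: 'm list). X $$ (a,b)) = of_nat CARD('m) * X $$ (a,b)"
        by (simp add: sum_list_triv idx_def)
      then show "(complex_of_real (1 / real CARD('m)) \<cdot>\<^sub>m msum d (\<lambda>j. X) (idx :: 'm list)) $$ (a,b) = X $$ (a,b)"
        unfolding smult_index[OF c ab] using ab X(1) by (simp add: msum_index)
    qed (auto intro!: smult_carrier_mat msum_carrier X(1))
  qed
  have adjL: "adj ((Lra_dual S 0 ^^ n) X) = (Lra_dual S 0 ^^ n) (adj X)" if "X \<in> carrier_mat d d" for n X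
    using that
  proof (induction n)
    case (Suc n)
    have one: "adj (Lra_dual S 0 Y) = Lra_dual S 0 (adj Y)" if Y: "Y \<in> carrier_mat d d" for Y
    proof -
      have c: "msum d (\<lambda>j. Ldual S j 0 Y) xs \<in> carrier_mat d d" for xs :: "'m list"
        using Y by (intro msum_carrier) auto
      have "adj (msum d (\<lambda>j. Ldual S j 0 Y) xs) = msum d (\<lambda>j. Ldual S j 0 (adj Y)) xs" for xs :: "'m list"
      proof (induction xs rule: rev_induct)
        case (snoc x xs)
        show ?case unfolding msum_snoc adj_add[OF c Ldual_carrier[OF Y]] snoc adj_Ldual[OF Y] ..
      qed simp
      then show ?thesis unfolding Lra_dual_def zero_index adj_smult[OF c] by simp
    qed
    have "(Lra_dual S 0 ^^ n) X \<in> carrier_mat d d"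
      by (rule linop_carrier[OF linop_funpow[OF linop_Lra_dual] Suc.prems])
    from one[OF this] show ?case unfolding funpow.simps comp_def Suc.IH[OF Suc.prems] .
  qed simp
  note lin = linop_Lra_dual
  have trm: "mtrace (\<rho> * ((Lra_dual S 0 ^^ n) (Phi S j 0) * Phirev S k 0)) = mtrace (\<rho> * ((Lra_dual S 0 ^^ n) (Phi S k 0) * Phirev S j 0))" for n
    by (rule reciprocity[OF rho linop_funpow[OF lin] rev_pair_funpow[OF lin lin rev_pair_Lra_dual] linop_funpow[OF lin] adjL])
  have "Lkin Ra S j k - (if j = k then (1/2) * mtrace (\<rho> * Dissip S j 0 Heff Heff) else 0)
     = Lkin Ra S k j - (if k = j then (1/2) * mtrace (\<rho> * Dissip S k 0 Heff Heff) else 0)"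
    using kinetic_Ra[OF assms, of j k] unfolding trm by (rule sums_unique2) (rule kinetic_Ra[OF assms])
  then show ?thesis by (cases "j = k") auto
qed

text \<open>The word of the \<open>n\<close>-th term read backwards is the word of the
  \<open>n\<close>-th term for the reversed cycle with \<open>j\<close> and \<open>k\<close>
  exchanged. The delta terms match too, since \<open>k\<close> precedes \<open>j\<close> in the
  cycle exactly when \<open>j\<close> precedes \<open>k\<close> in the reversed one.\<close>

lemma reciprocity_Cy:
  assumes "ER Cy S" shows "Lkin Cy S j k = Lkin_rcy S k j"
proof -
  interpret channel_family d "Lseq idx" by (rule Cy_family[OF assms])
  \<comment> \<open>The reversed cycle inherits mixing by time reversal at infinite
    temperature.\<close>
  have fam: "channel_family d (Lseq (rev idx))"
    by unfold_locales (auto simp: dims channel_Lseq Lseq_smat intro: mixing_reversed_order[OF mix])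
  have rho: "time_rev \<Theta> \<rho> = \<rho>"
  proof (rule time_rev_rho[OF chn mix])
    fix X :: "complex mat" assume X: "X \<in> carrier_mat d d" "\<And>j. Lch S j 0 X = X"
    show "Lseq idx 0 X = X" for xs
    proof -
      have "Lseq xs 0 X = X" for xs by (induction xs) (auto simp: X)
      then show ?thesis .
    qed
  qed
  have recip: "mtrace (\<rho> * (Dseq w 0 (Phi S j 0) * Phirev S k 0)) = mtrace (\<rho> * (Dseq (rev w) 0 (Phi S k 0) * Phirev S j 0))" for w
    by (rule reciprocity[OF rho linop_Dseq rev_pair_Dseq linop_Dseq adj_Dseq])
  have pow: "(Dseq xs 0 ^^ n) X = Dseq (concat (replicate n xs)) 0 X" for xs n X
    by (induction n) auto
  let ?m = "filter (\<lambda>i. k < i \<and> i < j) (idx :: 'm list)"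
  have mem: "j \<in> set (rev (after k)) \<longleftrightarrow> k < j" by (simp add: idx_props)
  have rs: "rev idx = rev (after i) @ i # rev (before i)" for i :: 'm
    by (subst idx_split[of i]) simp
  \<comment> \<open>In the reversed cycle the steps between \<open>j\<close> and \<open>k\<close>
    are those of the cycle in opposite order.\<close>
  have m: "rev (after k) = rev (after j) @ j # rev ?m" if "j \<in> set (rev (after k))"
    using that unfolding mem by (subst idx_split_between'[of k j]) auto
  have "distinct (rev (idx :: 'm list))" by (simp add: idx_props)
  from seq_kinetic[OF Heff[OF assms] fam this rs[of j] rs[of k] m]
  have rcy: "(\<lambda>n. complex_of_real (Ttot S) * mtrace (\<rho> * (Dseq (rev (before j)) 0 ((Dseq (rev idx) 0 ^^ n) (Dseq (rev (after k)) 0 (Phi S k 0))) * Phirev S j 0)))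
    sums (Lkin_rcy S k j
      - (if k < j then complex_of_real (Ttot S) * mtrace (\<rho> * (Dseq (rev ?m) 0 (Phi S k 0) * Phirev S j 0)) else 0)
      - (if k = j then (1/2) * mtrace (\<rho> * Dissip S k 0 Heff Heff) else 0))"
    unfolding mem Lkin_rcy_eq .
  have rc: "rev (concat (replicate n xs)) = concat (replicate n (rev xs))" for n and xs :: "'m list"
    by (simp add: rev_concat)
  have trm: "mtrace (\<rho> * (Dseq (after k) 0 ((Dseq idx 0 ^^ n) (Dseq (before j) 0 (Phi S j 0))) * Phirev S k 0))
    = mtrace (\<rho> * (Dseq (rev (before j)) 0 ((Dseq (rev idx) 0 ^^ n) (Dseq (rev (after k)) 0 (Phi S k 0))) * Phirev S j 0))" for n
    using recip[of "after k @ concat (replicate n idx) @ before j"]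
    unfolding pow Dseq_simps(3)[symmetric] rev_append rc append_assoc .
  have "Lkin Cy S j k
      - (if k < j then complex_of_real (Ttot S) * mtrace (\<rho> * (Dseq ?m 0 (Phi S j 0) * Phirev S k 0)) else 0)
      - (if j = k then (1/2) * mtrace (\<rho> * Dissip S j 0 Heff Heff) else 0)
    = Lkin_rcy S k j
      - (if k < j then complex_of_real (Ttot S) * mtrace (\<rho> * (Dseq (rev ?m) 0 (Phi S k 0) * Phirev S j 0)) else 0)
      - (if k = j then (1/2) * mtrace (\<rho> * Dissip S k 0 Heff Heff) else 0)"
    using kinetic_Cy[OF assms, of k j] unfolding trm by (rule sums_unique2) (rule rcy)
  then show ?thesis unfolding recip[of ?m] by (cases "j = k"; cases "k < j") auto
qed

end

text \<open>The predicate \<open>sums\<close> asserts convergence of a series together with its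
  value; the delta and dissipation terms therefore stand subtracted on the right. As
  \<open>inv_state\<close> is a definite description, unique existence of the invariant state at
  every thermal force is stated first and gives \<open>rho_sh\<close> its meaning.\<close>

theorem mainTheorem1:
  fixes S :: "('m::{finite,linorder}) qsys" and sh :: scheme and rp :: "real \<Rightarrow> complex mat"
  assumes wf: "wf_sys S"
    and ER: "ER sh S"
    and NE: "NE_map S rp"
  shows
    \<comment> \<open>part 1\<close>
    "(\<forall>\<zeta>. \<exists>!\<rho>. state (dS S) \<rho> \<and> Lsh sh S \<zeta> \<rho> = \<rho>) \<and>
     smooth_mat (dS S) (rho_sh sh S) \<and>
     (\<forall>j. smooth_mat (dS S) (\<lambda>\<zeta>. Phi S j (vec_nth \<zeta> j))) \<and>
     (\<forall>j. smooth_mat (dS S) (\<lambda>\<zeta>. Phicy S \<zeta> j)) \<and>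
     \<comment> \<open>part 2\<close>
     (let \<rho>p = rp 0; T = complex_of_real (Ttot S); M = real CARD('m);
          H' = complex_of_real (- 1 / bref S) \<cdot>\<^sub>m mlog (dS S) \<rho>p;
          Dterm = (\<lambda>j k. if j = k then (1/2) * mtrace (\<rho>p * Dissip S j 0 H' H') else 0)
      in (sh = Cy \<longrightarrow> (\<forall>j k.
            (\<lambda>n. T * mtrace (\<rho>p *
                 (foldr (\<lambda>i. Ldual S i 0) (filter (\<lambda>i. k < i) idx)
                    ((Lcy_dual S 0 ^^ n) (Phicy S 0 j)) * Phirev S k 0)))
            sums (Lkin Cy S j k
                  - (if k < j then T * mtrace (\<rho>p *
                       (foldr (\<lambda>i. Ldual S i 0) (filter (\<lambda>i. k < i \<and> i < j) idx) (Phi S j 0)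
                          * Phirev S k 0)) else 0)
                  - Dterm j k))) \<and>
         (sh = Ra \<longrightarrow> (\<forall>j k.
            (\<lambda>n. complex_of_real (Ttot S / M) * mtrace (\<rho>p *
                 ((Lra_dual S 0 ^^ n) (Phi S j 0) * Phirev S k 0)))
            sums (Lkin Ra S j k - Dterm j k)))) \<and>
     \<comment> \<open>part 3\<close>
     (TRI S \<longrightarrow>
        (sh = Cy \<longrightarrow> (\<forall>j k. Lkin Cy S j k = Lkin_rcy S k j) \<and>
                     (CARD('m) = 2 \<longrightarrow> (\<forall>j k. Lkin Cy S j k = Lkin Cy S k j))) \<and>
        (sh = Ra \<longrightarrow> (\<forall>j k. Lkin Ra S j k = Lkin Ra S k j)))"
proof -
  interpret equilibrium_model S rp by unfold_locales (rule wf, rule NE)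
  interpret fam: channel_family "dS S" "Lsh sh S" by (rule ER_family[OF ER])
  have smooth: "smooth_mat (dS S) (rho_sh sh S)"
    using smat_smooth[OF fam.smat_R] by (simp add: rho_sh_def[abs_def])
  have tri: "time_reversal_model S rp \<Theta> \<Theta>E"
    if "antiunitary_involution (dS S) \<Theta> \<and> anti_commutes \<Theta> (HS S) \<and>
     (\<forall>j. antiunitary_involution (dE S j) (\<Theta>E j) \<and> anti_commutes (\<Theta>E j) (HE S j) \<and>
          anti_commutes (kron \<Theta> (\<Theta>E j)) (Vint S j))" for \<Theta> \<Theta>E
    using that by unfold_locales auto
  show ?thesis
    unfolding Let_def Dseq_zero Lcy_dual_eq Phicy_eq[of 0] zero_index
  proof (intro conjI allI impI)
    show "\<exists>!\<rho>. state (dS S) \<rho> \<and> Lsh sh S \<zeta> \<rho> = \<rho>" for \<zeta> by (rule fam.R_ex1)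
    show "smooth_mat (dS S) (rho_sh sh S)" by (rule smooth)
    show "smooth_mat (dS S) (\<lambda>\<zeta>. Phi S j (vec_nth \<zeta> j))" for j by (rule smat_smooth[OF Phi_smat])
    show "smooth_mat (dS S) (\<lambda>\<zeta>. Phicy S \<zeta> j)" for j by (rule smat_smooth[OF Phicy_smat])
  next
    fix j k assume "sh = Cy"
    then have "ER Cy S" using ER by simp
    from kinetic_Cy[OF this]
    show "(\<lambda>n. complex_of_real (Ttot S) * mtrace (rp 0 * (Dseq (filter (\<lambda>i. k < i) idx) 0 ((Dseq idx 0 ^^ n) (Dseq (filter (\<lambda>i. i < j) idx) 0 (Phi S j 0))) * Phirev S k 0)))
      sums (Lkin Cy S j k
        - (if k < j then complex_of_real (Ttot S) * mtrace (rp 0 * (Dseq (filter (\<lambda>i. k < i \<and> i < j) idx) 0 (Phi S j 0) * Phirev S k 0)) else 0)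
        - (if j = k then 1 / 2 * mtrace (rp 0 * Dissip S j 0 (complex_of_real (- 1 / bref S) \<cdot>\<^sub>m mlog (dS S) (rp 0)) (complex_of_real (- 1 / bref S) \<cdot>\<^sub>m mlog (dS S) (rp 0))) else 0))" .
  next
    fix j k assume "sh = Ra"
    then have "ER Ra S" using ER by simp
    from kinetic_Ra[OF this]
    show "(\<lambda>n. complex_of_real (Ttot S / real CARD('m)) * mtrace (rp 0 * ((Lra_dual S 0 ^^ n) (Phi S j 0) * Phirev S k 0)))
      sums (Lkin Ra S j k
        - (if j = k then 1 / 2 * mtrace (rp 0 * Dissip S j 0 (complex_of_real (- 1 / bref S) \<cdot>\<^sub>m mlog (dS S) (rp 0)) (complex_of_real (- 1 / bref S) \<cdot>\<^sub>m mlog (dS S) (rp 0))) else 0))" .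
  next
    fix j k assume "TRI S" "sh = Cy"
    then obtain \<Theta> \<Theta>E where "time_reversal_model S rp \<Theta> \<Theta>E" using tri unfolding TRI_def by blast
    then show "Lkin Cy S j k = Lkin_rcy S k j"
      by (rule time_reversal_model.reciprocity_Cy) (use ER \<open>sh = Cy\<close> in simp)
  next
    fix j k assume "sh = Cy" "CARD('m) = 2"
    then show "Lkin Cy S j k = Lkin Cy S k j" using kinetic_Cy_two ER by simp
  next
    fix j k assume "TRI S" "sh = Ra"
    then obtain \<Theta> \<Theta>E where "time_reversal_model S rp \<Theta> \<Theta>E" using tri unfolding TRI_def by blast
    then show "Lkin Ra S j k = Lkin Ra S k j"
      by (rule time_reversal_model.reciprocity_Ra) (use ER \<open>sh = Ra\<close> in simp)
  qed
qed

end
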